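(* Let $I$ be a set. The substitude for pairs $(O,L)$, where $O$ is an $I$-coloured non-symmetric operad and $L$ is a left $O$-module, is quasi-tame.
   Context: A substitude $(P,A)$ is a $\mathrm{Set}$-valued coloured symmetric operad $P$ whose colours are the objects of a small category $A$, together with an identity-on-objects functor $\eta$ from $A$ to the category of unary operations of $P$. A coloured operad, in particular a polynomial monad (equivalently a coloured operad with free symmetric group actions), is regarded as a substitude with $A$ the discrete category on the set of colours. A categorical $P$-algebra is a $P$-algebra $C$ in $\mathrm{Cat}$. An internal $(\mathcal{P}+\mathcal{A})$-algebra in $C$ consists of objects $X(a),K(a)\in C(a)$ for each $a\in A$, morphisms $p(X(a_1),\dots,X(a_n))\to X(a)$ for all $p\in P(a_1,\dots,a_n;a)$, and morphisms $\eta(u)(K(a))\to K(b)$ for all $u:a\to b$ in $A$ (no extra data when $A$ is discrete), subject to associativity, unit and equivariance conditions. The classifier $\mathcal{P}^{\mathcal{P}+\mathcal{A}}$ is the categorical $P$-algebra representing the 2-functor which sends $C$ to the category of internal $(\mathcal{P}+\mathcal{A})$-algebras in $C$; it is regarded as a category (coproduct over colours of its components). $(P,A)$ is quasi-tame if the fundamental groupoid $\Pi_1(\mathcal{P}^{\mathcal{P}+\mathcal{A}})$ (localization at all morphisms) is equivalent to a discrete groupoid, i.e. has only trivial automorphism groups. The substitude in question is the $\Sigma$-free coloured operad with discrete category of colours $PBq(I)\sqcup PBq(I)$ ($PBq(I)$ being the set of planar $I$-bouquets $(i_1,\dots,i_k;i)$, $k\ge 0$) whose algebras are exactly the pairs consisting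 of an $I$-coloured non-symmetric operad $O$ and a left $O$-module $L=\{L(i_1,\dots,i_k;i)\}$, i.e. with associative and unital actions $O(j_1,\dots,j_k;j)\otimes L(\vec{i}_1;j_1)\otimes\cdots\otimes L(\vec{i}_k;j_k)\to L(\vec{i}_1,\dots,\vec{i}_k;j)$, where $\vec{i}_m$ are finite sequences in $I$ and the sequence on the right is their concatenation. *)

theory Defs
  imports "HOL-Combinatorics.Multiset_Permutations"
begin

section \<open>Categories and the fundamental groupoid\<close>

record ('o, 'm) cat =
  Ob :: "'o set"
  Ar :: "'m set"
  Dom :: "'m \<Rightarrow> 'o"
  Cod :: "'m \<Rightarrow> 'o"
  Ide :: "'o \<Rightarrow> 'm"
  Cmp :: "'m \<Rightarrow> 'm \<Rightarrow> 'm"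

text \<open>Composition is written in applicative order: \<open>Cmp C g f\<close> is \<open>g\<close> after \<open>f\<close>.\<close>

locale category =
  fixes C :: "('o, 'm, 'z) cat_scheme"
  assumes Dom_in: "f \<in> Ar C \<Longrightarrow> Dom C f \<in> Ob C"
    and Cod_in: "f \<in> Ar C \<Longrightarrow> Cod C f \<in> Ob C"
    and Ide_in: "x \<in> Ob C \<Longrightarrow> Ide C x \<in> Ar C"
    and Dom_Ide: "x \<in> Ob C \<Longrightarrow> Dom C (Ide C x) = x"
    and Cod_Ide: "x \<in> Ob C \<Longrightarrow> Cod C (Ide C x) = x"
    and Cmp_in: "f \<in> Ar C \<Longrightarrow> g \<in> Ar C \<Longrightarrow> Cod C f = Dom C g \<Longrightarrow> Cmp C g f \<in> Ar C"
    and Dom_Cmp: "f \<in> Ar C \<Longrightarrow> g \<in> Ar C \<Longrightarrow> Cod C f = Dom C g \<Longrightarrow> Dom C (Cmp C g f) = Dom C f"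
    and Cod_Cmp: "f \<in> Ar C \<Longrightarrow> g \<in> Ar C \<Longrightarrow> Cod C f = Dom C g \<Longrightarrow> Cod C (Cmp C g f) = Cod C g"
    and Cmp_Ide: "f \<in> Ar C \<Longrightarrow> Cmp C f (Ide C (Dom C f)) = f"
    and Ide_Cmp: "f \<in> Ar C \<Longrightarrow> Cmp C (Ide C (Cod C f)) f = f"
    and Cmp_assoc: "f \<in> Ar C \<Longrightarrow> g \<in> Ar C \<Longrightarrow> h \<in> Ar C \<Longrightarrow> Cod C f = Dom C g \<Longrightarrow> Cod C g = Dom C h
        \<Longrightarrow> Cmp C h (Cmp C g f) = Cmp C (Cmp C h g) f"

definition discrete_cat :: "'o set \<Rightarrow> ('o, 'o) cat" where
  "discrete_cat A = \<lparr>Ob = A, Ar = A, Dom = id, Cod = id, Ide = id, Cmp = (\<lambda>g f. g)\<rparr>"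

datatype 'm step = Fwd 'm | Bwd 'm

inductive zigzag :: "('o, 'm, 'z) cat_scheme \<Rightarrow> 'o \<Rightarrow> 'm step list \<Rightarrow> 'o \<Rightarrow> bool" for C where
  Nil: "x \<in> Ob C \<Longrightarrow> zigzag C x [] x"
| Fwd: "f \<in> Ar C \<Longrightarrow> zigzag C (Cod C f) zs y \<Longrightarrow> zigzag C (Dom C f) (Fwd f # zs) y"
| Bwd: "f \<in> Ar C \<Longrightarrow> zigzag C (Dom C f) zs y \<Longrightarrow> zigzag C (Cod C f) (Bwd f # zs) y"

inductive zigzag_reduce :: "('o, 'm, 'z) cat_scheme \<Rightarrow> 'm step list \<Rightarrow> 'm step list \<Rightarrow> bool" for C where
  "x \<in> Ob C \<Longrightarrow> zigzag_reduce C (us @ [Fwd (Ide C x)] @ vs) (us @ vs)"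
| "f \<in> Ar C \<Longrightarrow> g \<in> Ar C \<Longrightarrow> Cod C f = Dom C g
    \<Longrightarrow> zigzag_reduce C (us @ [Fwd f, Fwd g] @ vs) (us @ [Fwd (Cmp C g f)] @ vs)"
| "f \<in> Ar C \<Longrightarrow> zigzag_reduce C (us @ [Fwd f, Bwd f] @ vs) (us @ vs)"
| "f \<in> Ar C \<Longrightarrow> zigzag_reduce C (us @ [Bwd f, Fwd f] @ vs) (us @ vs)"

definition homotopic :: "('o, 'm, 'z) cat_scheme \<Rightarrow> 'o \<Rightarrow> 'o \<Rightarrow> 'm step list \<Rightarrow> 'm step list \<Rightarrow> bool" where
  "homotopic C x y = equivclp (\<lambda>us vs. zigzag C x us y \<and> zigzag C x vs y \<and> zigzag_reduce C us vs)"

definition zclass ::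
  "('o, 'm, 'z) cat_scheme \<Rightarrow> 'o \<Rightarrow> 'm step list \<Rightarrow> 'o \<Rightarrow> 'o \<times> 'm step list set \<times> 'o" where
  "zclass C x zs y = (x, {zs'. zigzag C x zs' y \<and> homotopic C x y zs zs'}, y)"

definition Pi1 :: "('o, 'm, 'z) cat_scheme \<Rightarrow> ('o, 'o \<times> 'm step list set \<times> 'o) cat" where
  "Pi1 C = \<lparr>Ob = Ob C,
     Ar = {zclass C x zs y | x zs y. zigzag C x zs y},
     Dom = (\<lambda>(x, A, y). x),
     Cod = (\<lambda>(x, A, y). y),
     Ide = (\<lambda>x. zclass C x [] x),
     Cmp = (\<lambda>(y', B, z) (x, A, y). zclass C x ((SOME as. as \<in> A) @ (SOME bs. bs \<in> B)) z)\<rparr>"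

definition trivial_automorphisms :: "('o, 'm, 'z) cat_scheme \<Rightarrow> bool" where
  "trivial_automorphisms G \<longleftrightarrow> (\<forall>x \<in> Ob G. \<forall>f \<in> Ar G. Dom G f = x \<and> Cod G f = x \<longrightarrow> f = Ide G x)"


section \<open>Coloured symmetric operads and substitudes\<close>

text \<open>
  A permutation of \<open>{..<n}\<close> is given by its list of values \<open>s\<close>; then \<open>permuted s xs\<close> is
  \<open>[xs ! (s ! 0), \<dots>, xs ! (s ! (n - 1))]\<close>. The symmetric groups act on operations from the right:
  \<open>perm_op P p s\<close> has inputs \<open>permuted s (inputs P p)\<close>, and evaluating it on \<open>permuted s xs\<close> gives
  the value of \<open>p\<close> on \<open>xs\<close>.
\<close>

abbreviation perms :: "nat \<Rightarrow> nat list set" where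
  "perms n \<equiv> permutations_of_set {..<n}"

definition permuted :: "nat list \<Rightarrow> 'a list \<Rightarrow> 'a list" where
  "permuted s xs = map ((!) xs) s"

text \<open>
  \<open>blocks 0 [n\<^sub>1, \<dots>, n\<^sub>k]\<close> cuts \<open>[0..<n\<^sub>1 + \<dots> + n\<^sub>k]\<close> into consecutive blocks of these lengths;
  it serves to define block permutations and direct sums of permutations.
\<close>

fun blocks :: "nat \<Rightarrow> nat list \<Rightarrow> nat list list" where
  "blocks m [] = []"
| "blocks m (n # ns) = [m..<m + n] # blocks (m + n) ns"

definition block_perm :: "nat list \<Rightarrow> nat list \<Rightarrow> nat list" where
  "block_perm s ns = concat (permuted s (blocks 0 ns))"

definition sum_perm :: "nat list list \<Rightarrow> nat list \<Rightarrow> nat list" where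
  "sum_perm ss ns = concat (map2 permuted ss (blocks 0 ns))"

record ('c, 'p) operad =
  colours :: "'c set"
  ops :: "'p set"
  inputs :: "'p \<Rightarrow> 'c list"
  target :: "'p \<Rightarrow> 'c"
  unit_op :: "'c \<Rightarrow> 'p"
  comp_op :: "'p \<Rightarrow> 'p list \<Rightarrow> 'p"
  perm_op :: "'p \<Rightarrow> nat list \<Rightarrow> 'p"

text \<open>
  The set \<open>ops P\<close> is the disjoint union of all the sets \<open>P(a\<^sub>1, \<dots>, a\<^sub>n; a)\<close>, and \<open>comp_op P p qs\<close>
  is the simultaneous composite of \<open>p\<close> with the list \<open>qs\<close> of operations in all its inputs.
\<close>

definition arity :: "('c, 'p, 'z) operad_scheme \<Rightarrow> 'p \<Rightarrow> nat" where
  "arity P p = length (inputs P p)"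

definition composable :: "('c, 'p, 'z) operad_scheme \<Rightarrow> 'p \<Rightarrow> 'p list \<Rightarrow> bool" where
  "composable P p qs \<longleftrightarrow> p \<in> ops P \<and> set qs \<subseteq> ops P \<and> map (target P) qs = inputs P p"

locale coloured_operad =
  fixes P :: "('c, 'p, 'z) operad_scheme"
  assumes inputs_in: "p \<in> ops P \<Longrightarrow> set (inputs P p) \<subseteq> colours P"
    and target_in: "p \<in> ops P \<Longrightarrow> target P p \<in> colours P"
    and unit_in: "a \<in> colours P \<Longrightarrow> unit_op P a \<in> ops P"
    and inputs_unit: "a \<in> colours P \<Longrightarrow> inputs P (unit_op P a) = [a]"
    and target_unit: "a \<in> colours P \<Longrightarrow> target P (unit_op P a) = a"
    and comp_in: "composable P p qs \<Longrightarrow> comp_op P p qs \<in> ops P"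
    and inputs_comp: "composable P p qs \<Longrightarrow> inputs P (comp_op P p qs) = concat (map (inputs P) qs)"
    and target_comp: "composable P p qs \<Longrightarrow> target P (comp_op P p qs) = target P p"
    and unit_comp: "p \<in> ops P \<Longrightarrow> comp_op P (unit_op P (target P p)) [p] = p"
    and comp_unit: "p \<in> ops P \<Longrightarrow> comp_op P p (map (unit_op P) (inputs P p)) = p"
    and comp_assoc: "composable P p qs \<Longrightarrow> list_all2 (composable P) qs rss
        \<Longrightarrow> comp_op P (comp_op P p qs) (concat rss) = comp_op P p (map2 (comp_op P) qs rss)"
    and perm_in: "p \<in> ops P \<Longrightarrow> s \<in> perms (arity P p) \<Longrightarrow> perm_op P p s \<in> ops P"
    and inputs_perm: "p \<in> ops P \<Longrightarrow> s \<in> perms (arity P p)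
        \<Longrightarrow> inputs P (perm_op P p s) = permuted s (inputs P p)"
    and target_perm: "p \<in> ops P \<Longrightarrow> s \<in> perms (arity P p) \<Longrightarrow> target P (perm_op P p s) = target P p"
    and perm_id: "p \<in> ops P \<Longrightarrow> perm_op P p [0..<arity P p] = p"
    and perm_perm: "p \<in> ops P \<Longrightarrow> s \<in> perms (arity P p) \<Longrightarrow> t \<in> perms (arity P p)
        \<Longrightarrow> perm_op P (perm_op P p s) t = perm_op P p (permuted t s)"
    and comp_perm_outer: "composable P p qs \<Longrightarrow> s \<in> perms (arity P p)
        \<Longrightarrow> comp_op P (perm_op P p s) (permuted s qs)
            = perm_op P (comp_op P p qs) (block_perm s (map (arity P) qs))"
    and comp_perm_inner: "composable P p qs \<Longrightarrow> list_all2 (\<lambda>q s. s \<in> perms (arity P q)) qs ss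
        \<Longrightarrow> comp_op P p (map2 (perm_op P) qs ss)
            = perm_op P (comp_op P p qs) (sum_perm ss (map (arity P) qs))"

definition sigma_free :: "('c, 'p, 'z) operad_scheme \<Rightarrow> bool" where
  "sigma_free P \<longleftrightarrow>
    (\<forall>p \<in> ops P. \<forall>s \<in> perms (arity P p). perm_op P p s = p \<longrightarrow> s = [0..<arity P p])"

record ('c, 'p, 'u) substitude =
  opd :: "('c, 'p) operad"
  base :: "('c, 'u) cat"
  eta :: "'u \<Rightarrow> 'p"

locale substitude =
  P?: coloured_operad "opd S" + A: category "base S"
  for S :: "('c, 'p, 'u) substitude" +
  assumes Ob_base: "Ob (base S) = colours (opd S)"
    and eta_in: "u \<in> Ar (base S) \<Longrightarrow> eta S u \<in> ops (opd S)"
    and inputs_eta: "u \<in> Ar (base S) \<Longrightarrow> inputs (opd S) (eta S u) = [Dom (base S) u]"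
    and target_eta: "u \<in> Ar (base S) \<Longrightarrow> target (opd S) (eta S u) = Cod (base S) u"
    and eta_Ide: "a \<in> colours (opd S) \<Longrightarrow> eta S (Ide (base S) a) = unit_op (opd S) a"
    and eta_Cmp: "u \<in> Ar (base S) \<Longrightarrow> v \<in> Ar (base S) \<Longrightarrow> Cod (base S) u = Dom (base S) v
        \<Longrightarrow> eta S (Cmp (base S) v u) = comp_op (opd S) (eta S v) [eta S u]"

definition operad_substitude :: "('c, 'p) operad \<Rightarrow> ('c, 'p, 'c) substitude" where
  "operad_substitude P = \<lparr>opd = P, base = discrete_cat (colours P), eta = unit_op P\<rparr>"


section \<open>Categorical algebras, internal algebras and classifiers\<close>

text \<open>
  A family of categories \<open>C(a)\<close>, indexed by the colours \<open>a\<close>, is encoded as its coproduct together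
  with the colour of each object (arrows only exist between objects of the same colour).
\<close>

record ('c, 'p, 'o, 'm) cat_alg =
  total :: "('o, 'm) cat"
  colour :: "'o \<Rightarrow> 'c"
  act_ob :: "'p \<Rightarrow> 'o list \<Rightarrow> 'o"
  act_ar :: "'p \<Rightarrow> 'm list \<Rightarrow> 'm"

definition ob_args :: "('c, 'p, 'y) operad_scheme \<Rightarrow> ('c, 'p, 'o, 'm) cat_alg \<Rightarrow> 'p \<Rightarrow> 'o list \<Rightarrow> bool" where
  "ob_args P C p xs \<longleftrightarrow> set xs \<subseteq> Ob (total C) \<and> map (colour C) xs = inputs P p"

definition ar_args :: "('c, 'p, 'y) operad_scheme \<Rightarrow> ('c, 'p, 'o, 'm) cat_alg \<Rightarrow> 'p \<Rightarrow> 'm list \<Rightarrow> bool" where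
  "ar_args P C p fs \<longleftrightarrow> set fs \<subseteq> Ar (total C) \<and> map (\<lambda>f. colour C (Dom (total C) f)) fs = inputs P p"

locale categorical_algebra =
  category "total C"
  for P :: "('c, 'p) operad"
    and C :: "('c, 'p, 'o, 'm) cat_alg" +
  assumes colour_in: "x \<in> Ob (total C) \<Longrightarrow> colour C x \<in> colours P"
    and colour_Cod: "f \<in> Ar (total C) \<Longrightarrow> colour C (Cod (total C) f) = colour C (Dom (total C) f)"
    and act_ob_in: "p \<in> ops P \<Longrightarrow> ob_args P C p xs \<Longrightarrow> act_ob C p xs \<in> Ob (total C)"
    and colour_act_ob: "p \<in> ops P \<Longrightarrow> ob_args P C p xs \<Longrightarrow> colour C (act_ob C p xs) = target P p"
    and act_ar_in: "p \<in> ops P \<Longrightarrow> ar_args P C p fs \<Longrightarrow> act_ar C p fs \<in> Ar (total C)"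
    and Dom_act_ar: "p \<in> ops P \<Longrightarrow> ar_args P C p fs
        \<Longrightarrow> Dom (total C) (act_ar C p fs) = act_ob C p (map (Dom (total C)) fs)"
    and Cod_act_ar: "p \<in> ops P \<Longrightarrow> ar_args P C p fs
        \<Longrightarrow> Cod (total C) (act_ar C p fs) = act_ob C p (map (Cod (total C)) fs)"
    and act_ar_Ide: "p \<in> ops P \<Longrightarrow> ob_args P C p xs
        \<Longrightarrow> act_ar C p (map (Ide (total C)) xs) = Ide (total C) (act_ob C p xs)"
    and act_ar_Cmp: "p \<in> ops P \<Longrightarrow> ar_args P C p fs \<Longrightarrow> ar_args P C p gs
        \<Longrightarrow> map (Cod (total C)) fs = map (Dom (total C)) gs
        \<Longrightarrow> act_ar C p (map2 (Cmp (total C)) gs fs) = Cmp (total C) (act_ar C p gs) (act_ar C p fs)"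
    and act_ob_unit: "x \<in> Ob (total C) \<Longrightarrow> act_ob C (unit_op P (colour C x)) [x] = x"
    and act_ar_unit: "f \<in> Ar (total C)
        \<Longrightarrow> act_ar C (unit_op P (colour C (Dom (total C) f))) [f] = f"
    and act_ob_comp: "composable P p qs \<Longrightarrow> list_all2 (ob_args P C) qs xss
        \<Longrightarrow> act_ob C (comp_op P p qs) (concat xss) = act_ob C p (map2 (act_ob C) qs xss)"
    and act_ar_comp: "composable P p qs \<Longrightarrow> list_all2 (ar_args P C) qs fss
        \<Longrightarrow> act_ar C (comp_op P p qs) (concat fss) = act_ar C p (map2 (act_ar C) qs fss)"
    and act_ob_perm: "p \<in> ops P \<Longrightarrow> s \<in> perms (arity P p) \<Longrightarrow> ob_args P C p xs
        \<Longrightarrow> act_ob C (perm_op P p s) (permuted s xs) = act_ob C p xs"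
    and act_ar_perm: "p \<in> ops P \<Longrightarrow> s \<in> perms (arity P p) \<Longrightarrow> ar_args P C p fs
        \<Longrightarrow> act_ar C (perm_op P p s) (permuted s fs) = act_ar C p fs"

text \<open>Strict morphisms of categorical algebras, and the 2-cells between them.\<close>

locale algebra_morphism =
  fixes P :: "('c, 'p) operad"
    and B :: "('c, 'p, 'o1, 'm1) cat_alg"
    and C :: "('c, 'p, 'o2, 'm2) cat_alg"
    and F :: "'o1 \<Rightarrow> 'o2" and F' :: "'m1 \<Rightarrow> 'm2"
  assumes ob_in: "x \<in> Ob (total B) \<Longrightarrow> F x \<in> Ob (total C)"
    and colour_ob: "x \<in> Ob (total B) \<Longrightarrow> colour C (F x) = colour B x"
    and ar_in: "f \<in> Ar (total B) \<Longrightarrow> F' f \<in> Ar (total C)"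
    and Dom_ar: "f \<in> Ar (total B) \<Longrightarrow> Dom (total C) (F' f) = F (Dom (total B) f)"
    and Cod_ar: "f \<in> Ar (total B) \<Longrightarrow> Cod (total C) (F' f) = F (Cod (total B) f)"
    and ar_Ide: "x \<in> Ob (total B) \<Longrightarrow> F' (Ide (total B) x) = Ide (total C) (F x)"
    and ar_Cmp: "f \<in> Ar (total B) \<Longrightarrow> g \<in> Ar (total B) \<Longrightarrow> Cod (total B) f = Dom (total B) g
        \<Longrightarrow> F' (Cmp (total B) g f) = Cmp (total C) (F' g) (F' f)"
    and ob_act: "p \<in> ops P \<Longrightarrow> ob_args P B p xs \<Longrightarrow> F (act_ob B p xs) = act_ob C p (map F xs)"
    and ar_act: "p \<in> ops P \<Longrightarrow> ar_args P B p fs \<Longrightarrow> F' (act_ar B p fs) = act_ar C p (map F' fs)"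

locale algebra_2cell =
  fixes P :: "('c, 'p) operad"
    and B :: "('c, 'p, 'o1, 'm1) cat_alg"
    and C :: "('c, 'p, 'o2, 'm2) cat_alg"
    and F :: "'o1 \<Rightarrow> 'o2" and F' :: "'m1 \<Rightarrow> 'm2"
    and G :: "'o1 \<Rightarrow> 'o2" and G' :: "'m1 \<Rightarrow> 'm2"
    and t :: "'o1 \<Rightarrow> 'm2"
  assumes component_in: "x \<in> Ob (total B) \<Longrightarrow> t x \<in> Ar (total C)"
    and Dom_component: "x \<in> Ob (total B) \<Longrightarrow> Dom (total C) (t x) = F x"
    and Cod_component: "x \<in> Ob (total B) \<Longrightarrow> Cod (total C) (t x) = G x"
    and natural: "f \<in> Ar (total B)
        \<Longrightarrow> Cmp (total C) (t (Cod (total B) f)) (F' f) = Cmp (total C) (G' f) (t (Dom (total B) f))"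
    and component_act: "p \<in> ops P \<Longrightarrow> ob_args P B p xs \<Longrightarrow> t (act_ob B p xs) = act_ar C p (map t xs)"

record ('c, 'p, 'u, 'o, 'm) int_alg =
  X_ob :: "'c \<Rightarrow> 'o"
  K_ob :: "'c \<Rightarrow> 'o"
  X_ar :: "'p \<Rightarrow> 'm"
  K_ar :: "'u \<Rightarrow> 'm"

locale internal_algebra =
  fixes S :: "('c, 'p, 'u) substitude"
    and C :: "('c, 'p, 'o, 'm) cat_alg"
    and U :: "('c, 'p, 'u, 'o, 'm) int_alg"
  assumes X_ob_in: "a \<in> colours (opd S) \<Longrightarrow> X_ob U a \<in> Ob (total C)"
    and colour_X_ob: "a \<in> colours (opd S) \<Longrightarrow> colour C (X_ob U a) = a"
    and K_ob_in: "a \<in> colours (opd S) \<Longrightarrow> K_ob U a \<in> Ob (total C)"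
    and colour_K_ob: "a \<in> colours (opd S) \<Longrightarrow> colour C (K_ob U a) = a"
    and X_ar_in: "p \<in> ops (opd S) \<Longrightarrow> X_ar U p \<in> Ar (total C)"
    and Dom_X_ar: "p \<in> ops (opd S)
        \<Longrightarrow> Dom (total C) (X_ar U p) = act_ob C p (map (X_ob U) (inputs (opd S) p))"
    and Cod_X_ar: "p \<in> ops (opd S) \<Longrightarrow> Cod (total C) (X_ar U p) = X_ob U (target (opd S) p)"
    and X_ar_unit: "a \<in> colours (opd S)
        \<Longrightarrow> X_ar U (unit_op (opd S) a) = Ide (total C) (X_ob U a)"
    and X_ar_comp: "composable (opd S) p qs
        \<Longrightarrow> X_ar U (comp_op (opd S) p qs) = Cmp (total C) (X_ar U p) (act_ar C p (map (X_ar U) qs))"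
    and X_ar_perm: "p \<in> ops (opd S) \<Longrightarrow> s \<in> perms (arity (opd S) p)
        \<Longrightarrow> X_ar U (perm_op (opd S) p s) = X_ar U p"
    and K_ar_in: "u \<in> Ar (base S) \<Longrightarrow> K_ar U u \<in> Ar (total C)"
    and Dom_K_ar: "u \<in> Ar (base S)
        \<Longrightarrow> Dom (total C) (K_ar U u) = act_ob C (eta S u) [K_ob U (Dom (base S) u)]"
    and Cod_K_ar: "u \<in> Ar (base S) \<Longrightarrow> Cod (total C) (K_ar U u) = K_ob U (Cod (base S) u)"
    and K_ar_Ide: "a \<in> colours (opd S)
        \<Longrightarrow> K_ar U (Ide (base S) a) = Ide (total C) (K_ob U a)"
    and K_ar_Cmp: "u \<in> Ar (base S) \<Longrightarrow> v \<in> Ar (base S) \<Longrightarrow> Cod (base S) u = Dom (base S) v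
        \<Longrightarrow> K_ar U (Cmp (base S) v u) = Cmp (total C) (K_ar U v) (act_ar C (eta S v) [K_ar U u])"

locale internal_morphism =
  fixes S :: "('c, 'p, 'u) substitude"
    and C :: "('c, 'p, 'o, 'm) cat_alg"
    and U V :: "('c, 'p, 'u, 'o, 'm) int_alg"
    and phi psi :: "'c \<Rightarrow> 'm"
  assumes phi_in: "a \<in> colours (opd S) \<Longrightarrow> phi a \<in> Ar (total C)"
    and Dom_phi: "a \<in> colours (opd S) \<Longrightarrow> Dom (total C) (phi a) = X_ob U a"
    and Cod_phi: "a \<in> colours (opd S) \<Longrightarrow> Cod (total C) (phi a) = X_ob V a"
    and psi_in: "a \<in> colours (opd S) \<Longrightarrow> psi a \<in> Ar (total C)"
    and Dom_psi: "a \<in> colours (opd S) \<Longrightarrow> Dom (total C) (psi a) = K_ob U a"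
    and Cod_psi: "a \<in> colours (opd S) \<Longrightarrow> Cod (total C) (psi a) = K_ob V a"
    and phi_X: "p \<in> ops (opd S) \<Longrightarrow> Cmp (total C) (phi (target (opd S) p)) (X_ar U p)
        = Cmp (total C) (X_ar V p) (act_ar C p (map phi (inputs (opd S) p)))"
    and psi_K: "u \<in> Ar (base S) \<Longrightarrow> Cmp (total C) (psi (Cod (base S) u)) (K_ar U u)
        = Cmp (total C) (K_ar V u) (act_ar C (eta S u) [psi (Dom (base S) u)])"

definition int_image :: "('o1 \<Rightarrow> 'o2) \<Rightarrow> ('m1 \<Rightarrow> 'm2) \<Rightarrow> ('c, 'p, 'u, 'o1, 'm1) int_alg
    \<Rightarrow> ('c, 'p, 'u, 'o2, 'm2) int_alg" where
  "int_image F F' U = \<lparr>X_ob = F \<circ> X_ob U, K_ob = F \<circ> K_ob U, X_ar = F' \<circ> X_ar U, K_ar = F' \<circ> K_ar U\<rparr>"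

definition int_eq :: "('c, 'p, 'u) substitude \<Rightarrow> ('c, 'p, 'u, 'o, 'm) int_alg
    \<Rightarrow> ('c, 'p, 'u, 'o, 'm) int_alg \<Rightarrow> bool" where
  "int_eq S U V \<longleftrightarrow>
     (\<forall>a \<in> colours (opd S). X_ob U a = X_ob V a \<and> K_ob U a = K_ob V a) \<and>
     (\<forall>p \<in> ops (opd S). X_ar U p = X_ar V p) \<and> (\<forall>u \<in> Ar (base S). K_ar U u = K_ar V u)"

text \<open>
  \<open>universal_for S H U C\<close>: taking images of \<open>U\<close> is an isomorphism from the category of strict
  morphisms \<open>H \<rightarrow> C\<close> to the category of internal algebras in \<open>C\<close>. By the Yoneda lemma, a representation of
  the 2-functor of internal algebras amounts to an internal algebra \<open>U\<close> with this property for all \<open>C\<close>.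
\<close>

definition universal_for :: "('c, 'p, 'u) substitude \<Rightarrow> ('c, 'p, 'o1, 'm1) cat_alg
    \<Rightarrow> ('c, 'p, 'u, 'o1, 'm1) int_alg \<Rightarrow> ('c, 'p, 'o2, 'm2) cat_alg \<Rightarrow> bool" where
  "universal_for S H U C \<longleftrightarrow>
     (\<forall>V. internal_algebra S C V \<longrightarrow>
        (\<exists>F F'. algebra_morphism (opd S) H C F F' \<and> int_eq S (int_image F F' U) V \<and>
           (\<forall>G G'. algebra_morphism (opd S) H C G G' \<and> int_eq S (int_image G G' U) V \<longrightarrow>
              (\<forall>x \<in> Ob (total H). G x = F x) \<and> (\<forall>f \<in> Ar (total H). G' f = F' f)))) \<and>
     (\<forall>F F' G G' phi psi.
        algebra_morphism (opd S) H C F F' \<and> algebra_morphism (opd S) H C G G' \<and>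
        internal_morphism S C (int_image F F' U) (int_image G G' U) phi psi \<longrightarrow>
        (\<exists>t. algebra_2cell (opd S) H C F F' G G' t \<and>
           (\<forall>a \<in> colours (opd S). t (X_ob U a) = phi a \<and> t (K_ob U a) = psi a) \<and>
           (\<forall>t'. algebra_2cell (opd S) H C F F' G G' t' \<and>
              (\<forall>a \<in> colours (opd S). t' (X_ob U a) = phi a \<and> t' (K_ob U a) = psi a) \<longrightarrow>
              (\<forall>x \<in> Ob (total H). t' x = t x))))"

text \<open>
  HOL cannot quantify over the types of the objects and arrows of \<open>C\<close> inside a definition, so \<open>C\<close>
  ranges here over the algebras on the types underlying \<open>H\<close>. For types large enough to
  carry the actual classifier this determines \<open>H\<close> up to isomorphism. The types of terms used in
  \<open>quasi_tame\<close> are large enough: theorem \<open>term_alg_universal\<close> constructs a classifier on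
  them, with the universal property for categorical algebras on arbitrary types.
\<close>

definition classifier :: "('c, 'p, 'u) substitude \<Rightarrow> ('c, 'p, 'o, 'm) cat_alg
    \<Rightarrow> ('c, 'p, 'u, 'o, 'm) int_alg \<Rightarrow> bool" where
  "classifier S H U \<longleftrightarrow> categorical_algebra (opd S) H \<and> internal_algebra S H U \<and>
     (\<forall>C :: ('c, 'p, 'o, 'm) cat_alg. categorical_algebra (opd S) C \<longrightarrow> universal_for S H U C)"

datatype ('c, 'p) oterm = TX 'c | TK 'c | TOp 'p "('c, 'p) oterm list"

datatype ('c, 'p, 'u) aterm =
  AId "('c, 'p) oterm" | ACmp "('c, 'p, 'u) aterm" "('c, 'p, 'u) aterm"
| AOp 'p "('c, 'p, 'u) aterm list" | AX 'p | AK 'u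

type_synonym ('c, 'p, 'u) term_alg =
  "('c, 'p, ('c, 'p) oterm set, ('c, 'p, 'u) aterm set) cat_alg"

type_synonym ('c, 'p, 'u) term_int_alg =
  "('c, 'p, 'u, ('c, 'p) oterm set, ('c, 'p, 'u) aterm set) int_alg"

text \<open>
  The first conjunct holds for every substitude \<open>S\<close> (theorem \<open>term_alg_classifier\<close>); it only makes it
  explicit that the second one is not vacuous.
\<close>

definition quasi_tame :: "('c, 'p, 'u) substitude \<Rightarrow> bool" where
  "quasi_tame S \<longleftrightarrow>
     (\<exists>(H :: ('c, 'p, 'u) term_alg) U. classifier S H U) \<and>
     (\<forall>(H :: ('c, 'p, 'u) term_alg) U. classifier S H U \<longrightarrow> trivial_automorphisms (Pi1 (total H)))"


section \<open>The operad for pairs of an operad and a left module\<close>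

type_synonym 'i bouquet = "'i list \<times> 'i"

definition PBq :: "'i set \<Rightarrow> 'i bouquet set" where
  "PBq I = lists I \<times> I"

text \<open>The colour \<open>Inl b\<close> stands for \<open>O(b)\<close>, and \<open>Inr b\<close> for \<open>L(b)\<close>.\<close>

type_synonym 'i pair_colour = "'i bouquet + 'i bouquet"

definition boundary :: "'i pair_colour \<Rightarrow> 'i bouquet" where
  "boundary c = (case c of Inl b \<Rightarrow> b | Inr b \<Rightarrow> b)"

text \<open>
  An operation of the operad is a planar tree whose vertices are numbered by the inputs of the operation and
  whose leaves are numbered from left to right. The colours of its edges are determined by the bouquets
  of its vertices. There are vertices for elements of \<open>O\<close> and for elements of \<open>L\<close>: a tree with
  target \<open>Inl b\<close> only has the former; in a tree with target \<open>Inr b\<close> each path from a leaf to the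
  root meets exactly one vertex of the latter sort, namely the first one (so the elements of
  \<open>L\<close> are acted upon by a composite of elements of \<open>O\<close>). The tree without
  vertices with target \<open>Inl ([j], j)\<close> is the unit of \<open>O\<close> at \<open>j\<close>. The trees consisting of a root
  in \<open>O\<close> and one vertex on each of its inputs are the multiplication of \<open>O\<close> or the action of
  \<open>O\<close> on \<open>L\<close>, depending on the sort of the upper vertices. All trees are composites of these,
  and the associativity and unit axioms of \<open>O\<close> and \<open>L\<close> say that the value of a tree does not depend on
  how it is decomposed.
\<close>

datatype tree = Leaf nat | Node nat "tree list"

primrec leaves :: "tree \<Rightarrow> nat list" where
  "leaves (Leaf n) = [n]"
| "leaves (Node v ts) = concat (map leaves ts)"

primrec vertices :: "tree \<Rightarrow> nat list" where
  "vertices (Leaf n) = []"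
| "vertices (Node v ts) = v # concat (map vertices ts)"

inductive otree :: "'i pair_colour list \<Rightarrow> 'i list \<Rightarrow> tree \<Rightarrow> 'i \<Rightarrow> bool" for cs js where
  otree_Leaf: "n < length js \<Longrightarrow> otree cs js (Leaf n) (js ! n)"
| otree_Node: "v < length cs \<Longrightarrow> cs ! v = Inl (is, i) \<Longrightarrow> list_all2 (otree cs js) ts is
    \<Longrightarrow> otree cs js (Node v ts) i"

inductive ltree :: "'i pair_colour list \<Rightarrow> 'i list \<Rightarrow> tree \<Rightarrow> 'i \<Rightarrow> bool" for cs js where
  ltree_L: "v < length cs \<Longrightarrow> cs ! v = Inr (is, i)
    \<Longrightarrow> list_all2 (\<lambda>t k. \<exists>n < length js. t = Leaf n \<and> k = js ! n) ts is \<Longrightarrow> ltree cs js (Node v ts) i"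
| ltree_O: "v < length cs \<Longrightarrow> cs ! v = Inl (is, i) \<Longrightarrow> list_all2 (ltree cs js) ts is
    \<Longrightarrow> ltree cs js (Node v ts) i"

definition tree_of_colour :: "'i pair_colour list \<Rightarrow> 'i pair_colour \<Rightarrow> tree \<Rightarrow> bool" where
  "tree_of_colour cs c t = (case c of Inl (js, j) \<Rightarrow> otree cs js t j | Inr (js, j) \<Rightarrow> ltree cs js t j)"

primrec relabel :: "(nat \<Rightarrow> nat) \<Rightarrow> tree \<Rightarrow> tree" where
  "relabel h (Leaf n) = Leaf n"
| "relabel h (Node v ts) = Node (h v) (map (relabel h) ts)"

text \<open>\<open>graft t us\<close> glues the root of \<open>us ! n\<close> to leaf \<open>n\<close> of \<open>t\<close>.\<close>

primrec graft :: "tree \<Rightarrow> tree list \<Rightarrow> tree" where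
  "graft (Leaf n) us = us ! n"
| "graft (Node v ts) us = Node v (map (\<lambda>t. graft t us) ts)"

text \<open>\<open>insert_trees f t\<close> replaces each vertex \<open>v\<close> of \<open>t\<close> by the tree \<open>f v\<close>.\<close>

primrec insert_trees :: "(nat \<Rightarrow> tree) \<Rightarrow> tree \<Rightarrow> tree" where
  "insert_trees f (Leaf n) = Leaf n"
| "insert_trees f (Node v ts) = graft (f v) (map (insert_trees f) ts)"

type_synonym 'i pair_op = "'i pair_colour list \<times> 'i pair_colour \<times> tree"

definition inv_perm :: "nat list \<Rightarrow> nat \<Rightarrow> nat" where
  "inv_perm s = inv_into {..<length s} ((!) s)"

definition pair_operad :: "'i set \<Rightarrow> ('i pair_colour, 'i pair_op) operad" where
  "pair_operad I = \<lparr>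
     colours = PBq I <+> PBq I,
     ops = {(cs, c, t). set cs \<subseteq> PBq I <+> PBq I \<and> c \<in> PBq I <+> PBq I \<and> tree_of_colour cs c t
       \<and> leaves t = [0..<length (fst (boundary c))] \<and> vertices t \<in> perms (length cs)},
     inputs = (\<lambda>(cs, c, t). cs),
     target = (\<lambda>(cs, c, t). c),
     unit_op = (\<lambda>c. ([c], c, Node 0 (map Leaf [0..<length (fst (boundary c))]))),
     comp_op = (\<lambda>(cs, c, t) qs. (concat (map fst qs), c,
       insert_trees (\<lambda>v. relabel ((!) (blocks 0 (map (length \<circ> fst) qs) ! v)) (snd (snd (qs ! v)))) t)),
     perm_op = (\<lambda>(cs, c, t) s. (permuted s cs, c, relabel (inv_perm s) t))\<rparr>"

definition pair_substitude :: "'i set \<Rightarrow> ('i pair_colour, 'i pair_op, 'i pair_colour) substitude" where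
  "pair_substitude I = operad_substitude (pair_operad I)"


section \<open>The fundamental groupoid is a groupoid\<close>

lemma zigzag_append: "zigzag C x us y \<Longrightarrow> zigzag C y vs z \<Longrightarrow> zigzag C x (us @ vs) z"
  by (induction rule: zigzag.induct) (auto intro: zigzag.intros)

lemma zigzag_reduce_context: "zigzag_reduce C us vs \<Longrightarrow> zigzag_reduce C (as @ us @ bs) (as @ vs @ bs)"
proof (induction rule: zigzag_reduce.induct)
  case (1 x us vs)
  then show ?case using zigzag_reduce.intros(1)[of x C "as @ us" "vs @ bs"] by simp
next
  case (2 f g us vs)
  then show ?case using zigzag_reduce.intros(2)[of f C g "as @ us" "vs @ bs"] by simp
next
  case (3 f us vs)
  then show ?case using zigzag_reduce.intros(3)[of f C "as @ us" "vs @ bs"] by simp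
next
  case (4 f us vs)
  then show ?case using zigzag_reduce.intros(4)[of f C "as @ us" "vs @ bs"] by simp
qed

lemma homotopic_refl: "homotopic C x y us us"
  and homotopic_sym: "homotopic C x y us vs \<Longrightarrow> homotopic C x y vs us"
  and homotopic_trans: "homotopic C x y us vs \<Longrightarrow> homotopic C x y vs ws \<Longrightarrow> homotopic C x y us ws"
  unfolding homotopic_def by (auto intro: equivclp_sym equivclp_trans)

lemma homotopicI: "zigzag C x us y \<Longrightarrow> zigzag C x vs y \<Longrightarrow> zigzag_reduce C us vs \<Longrightarrow> homotopic C x y us vs"
  unfolding homotopic_def by blast

lemma homotopic_context:
  assumes "homotopic C x y us vs" "zigzag C w as x" "zigzag C y bs z"
  shows "homotopic C w z (as @ us @ bs) (as @ vs @ bs)"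
  using assms(1) unfolding homotopic_def
proof (induction rule: equivclp_induct)
  case (step vs ws)
  have "zigzag C w (as @ vs @ bs) z" "zigzag C w (as @ ws @ bs) z"
    using step(2) assms(2,3) by (auto intro: zigzag_append)
  moreover have "zigzag_reduce C (as @ vs @ bs) (as @ ws @ bs) \<or> zigzag_reduce C (as @ ws @ bs) (as @ vs @ bs)"
    using step(2) by (auto intro: zigzag_reduce_context)
  ultimately have "homotopic C w z (as @ vs @ bs) (as @ ws @ bs)"
    by (auto intro: homotopicI homotopic_sym)
  with step.IH show ?case unfolding homotopic_def by (rule equivclp_trans)
qed (simp add: homotopic_def[symmetric] homotopic_refl)

lemma zclass_cong: "homotopic C x y us vs \<Longrightarrow> zclass C x us y = zclass C x vs y"
  unfolding zclass_def by (auto intro: homotopic_sym homotopic_trans)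

lemma Pi1_simps [simp]: "Ob (Pi1 C) = Ob C" "Dom (Pi1 C) (zclass C x us y) = x" "Cod (Pi1 C) (zclass C x us y) = y"
  "Ide (Pi1 C) x = zclass C x [] x"
  by (simp_all add: Pi1_def zclass_def)

lemma Ar_Pi1: "f \<in> Ar (Pi1 C) \<longleftrightarrow> (\<exists>x us y. f = zclass C x us y \<and> zigzag C x us y)"
  by (auto simp: Pi1_def)

primrec flip :: "'m step \<Rightarrow> 'm step" where
  "flip (Fwd f) = Bwd f"
| "flip (Bwd f) = Fwd f"

context category
begin

lemma zigzag_ends: "zigzag C x us y \<Longrightarrow> x \<in> Ob C \<and> y \<in> Ob C"
  by (induction rule: zigzag.induct) (auto simp: Dom_in Cod_in)

lemma homotopic_append:
  assumes "homotopic C x y us us'" "homotopic C y z vs vs'"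
    and "zigzag C x us' y" "zigzag C y vs z"
  shows "homotopic C x z (us @ vs) (us' @ vs')"
proof -
  have z: "zigzag C x [] x" "zigzag C z [] z"
    using zigzag_ends[OF assms(3)] zigzag_ends[OF assms(4)] by (auto intro: zigzag.Nil)
  show ?thesis
    using homotopic_context[OF assms(1) z(1) assms(4)] homotopic_context[OF assms(2,3) z(2)]
    by (auto intro: homotopic_trans)
qed

lemma Cmp_Pi1:
  assumes "zigzag C x us y" "zigzag C y vs z"
  shows "Cmp (Pi1 C) (zclass C y vs z) (zclass C x us y) = zclass C x (us @ vs) z"
proof -
  have some: "zigzag C x (SOME as. as \<in> {as. zigzag C x as y \<and> homotopic C x y us as}) y
      \<and> homotopic C x y us (SOME as. as \<in> {as. zigzag C x as y \<and> homotopic C x y us as})"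
    if "zigzag C x us y" for x us y
    using someI[of "\<lambda>as. as \<in> {as. zigzag C x as y \<and> homotopic C x y us as}" us] that
    by (simp add: homotopic_refl)
  show ?thesis using some[OF assms(1)] some[OF assms(2)] assms
    unfolding Pi1_def zclass_def[of C y vs z] zclass_def[of C x us y]
    by (simp, intro zclass_cong homotopic_sym[OF homotopic_append]) auto
qed

lemma flip_zigzag: "zigzag C x us y \<Longrightarrow> zigzag C y (rev (map flip us)) x"
proof (induction rule: zigzag.induct)
  case (Fwd f zs y)
  have "zigzag C (Cod C f) [Bwd f] (Dom C f)" using Fwd by (auto intro!: zigzag.intros simp: Dom_in)
  with Fwd show ?case by (auto intro: zigzag_append)
next
  case (Bwd f zs y)
  have "zigzag C (Dom C f) [Fwd f] (Cod C f)" using Bwd by (auto intro!: zigzag.intros simp: Cod_in)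
  with Bwd show ?case by (auto intro: zigzag_append)
qed (auto intro: zigzag.intros)

lemma flip_homotopic: "zigzag C x us y \<Longrightarrow> homotopic C x x (us @ rev (map flip us)) []"
proof (induction rule: zigzag.induct)
  case (Nil x)
  then show ?case by (simp add: homotopic_refl)
next
  case (Fwd f zs y)
  have 1: "zigzag C (Dom C f) [Fwd f] (Cod C f)" "zigzag C (Cod C f) [Bwd f] (Dom C f)"
    "zigzag C (Dom C f) [] (Dom C f)"
    using Fwd by (auto intro!: zigzag.intros simp: Dom_in Cod_in)
  have "homotopic C (Dom C f) (Dom C f) ([Fwd f] @ (zs @ rev (map flip zs)) @ [Bwd f]) ([Fwd f] @ [] @ [Bwd f])"
    using Fwd.IH 1 by (intro homotopic_context)
  moreover have "homotopic C (Dom C f) (Dom C f) ([] @ [Fwd f, Bwd f] @ []) ([] @ [])"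
    using Fwd(1) 1 zigzag_append[OF 1(1,2)] by (intro homotopicI zigzag_reduce.intros(3)) auto
  ultimately show ?case by (auto intro: homotopic_trans)
next
  case (Bwd f zs y)
  have 1: "zigzag C (Dom C f) [Fwd f] (Cod C f)" "zigzag C (Cod C f) [Bwd f] (Dom C f)"
    "zigzag C (Cod C f) [] (Cod C f)"
    using Bwd by (auto intro!: zigzag.intros simp: Dom_in Cod_in)
  have "homotopic C (Cod C f) (Cod C f) ([Bwd f] @ (zs @ rev (map flip zs)) @ [Fwd f]) ([Bwd f] @ [] @ [Fwd f])"
    using Bwd.IH 1 by (intro homotopic_context)
  moreover have "homotopic C (Cod C f) (Cod C f) ([] @ [Bwd f, Fwd f] @ []) ([] @ [])"
    using Bwd(1) 1 zigzag_append[OF 1(2,1)] by (intro homotopicI zigzag_reduce.intros(4)) auto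
  ultimately show ?case by (auto intro: homotopic_trans)
qed

lemma flip_flip: "rev (map flip (rev (map flip us))) = us"
  by (induction us) (auto simp: rev_map, metis flip.simps step.exhaust)

theorem category_Pi1: "category (Pi1 C)"
proof
  fix f assume "f \<in> Ar (Pi1 C)"
  then obtain x us y where f: "f = zclass C x us y" "zigzag C x us y" by (auto simp: Ar_Pi1)
  note e = zigzag_ends[OF f(2)]
  show "Dom (Pi1 C) f \<in> Ob (Pi1 C)" "Cod (Pi1 C) f \<in> Ob (Pi1 C)" using e f by simp_all
  show "Cmp (Pi1 C) f (Ide (Pi1 C) (Dom (Pi1 C) f)) = f" "Cmp (Pi1 C) (Ide (Pi1 C) (Cod (Pi1 C) f)) f = f"
    using e f by (simp_all add: Cmp_Pi1 zigzag.Nil)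
  fix g assume "g \<in> Ar (Pi1 C)" and c: "Cod (Pi1 C) f = Dom (Pi1 C) g"
  then obtain z vs where g: "g = zclass C y vs z" "zigzag C y vs z" using f by (auto simp: Ar_Pi1)
  note fg = zigzag_append[OF f(2) g(2)]
  show "Cmp (Pi1 C) g f \<in> Ar (Pi1 C)" using f g fg by (auto simp: Ar_Pi1 Cmp_Pi1)
  show "Dom (Pi1 C) (Cmp (Pi1 C) g f) = Dom (Pi1 C) f" "Cod (Pi1 C) (Cmp (Pi1 C) g f) = Cod (Pi1 C) g"
    using f g by (simp_all add: Cmp_Pi1)
  fix h assume "h \<in> Ar (Pi1 C)" and c: "Cod (Pi1 C) g = Dom (Pi1 C) h"
  then obtain w ws where h: "h = zclass C z ws w" "zigzag C z ws w" using g by (auto simp: Ar_Pi1)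
  show "Cmp (Pi1 C) h (Cmp (Pi1 C) g f) = Cmp (Pi1 C) (Cmp (Pi1 C) h g) f"
    using f g h fg zigzag_append[OF g(2) h(2)] by (simp add: Cmp_Pi1)
next
  fix x assume "x \<in> Ob (Pi1 C)"
  then show "Ide (Pi1 C) x \<in> Ar (Pi1 C)" "Dom (Pi1 C) (Ide (Pi1 C) x) = x" "Cod (Pi1 C) (Ide (Pi1 C) x) = x"
    by (auto simp: Ar_Pi1 intro: zigzag.Nil)
qed

theorem Pi1_inverse:
  assumes "f \<in> Ar (Pi1 C)"
  shows "\<exists>g \<in> Ar (Pi1 C). Dom (Pi1 C) g = Cod (Pi1 C) f \<and> Cod (Pi1 C) g = Dom (Pi1 C) f \<and>
    Cmp (Pi1 C) g f = Ide (Pi1 C) (Dom (Pi1 C) f) \<and> Cmp (Pi1 C) f g = Ide (Pi1 C) (Cod (Pi1 C) f)"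
proof -
  obtain x us y where f: "f = zclass C x us y" "zigzag C x us y" using assms by (auto simp: Ar_Pi1)
  define vs where "vs = rev (map flip us)"
  have v: "zigzag C y vs x" using flip_zigzag[OF f(2)] by (simp add: vs_def)
  have "homotopic C x x (us @ vs) []" using flip_homotopic[OF f(2)] by (simp add: vs_def)
  moreover have "homotopic C y y (vs @ us) []"
    using flip_homotopic[OF v] unfolding vs_def flip_flip .
  ultimately show ?thesis using f v
    by (intro bexI[of _ "zclass C y vs x"]) (auto simp: Cmp_Pi1 Ar_Pi1 intro: zclass_cong)
qed

end


section \<open>Existence of classifiers\<close>

text \<open>
  The term classifier: terms for objects and arrows modulo the smallest congruences validating the
  axioms of a categorical algebra with an internal algebra.
\<close>

lemma permuted_map: "set s \<subseteq> {..<length xs} \<Longrightarrow> permuted s (map f xs) = map f (permuted s xs)"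
  by (induction s) (auto simp: permuted_def)

lemma perms_iff: "s \<in> perms n \<longleftrightarrow> distinct s \<and> set s = {..<n}"
  by (auto simp: permutations_of_set_def)

lemma set_permuted: "s \<in> perms (length xs) \<Longrightarrow> set (permuted s xs) = set xs"
  by (simp add: perms_iff permuted_def) (auto simp: set_conv_nth)

definition cls :: "('a \<Rightarrow> 'a \<Rightarrow> bool) \<Rightarrow> 'a \<Rightarrow> 'a set" where
  "cls R t = {t'. R t t'}"

definition rep :: "'a set \<Rightarrow> 'a" where
  "rep x = (SOME t. t \<in> x)"

lemma cls_eq: "symp R \<Longrightarrow> transp R \<Longrightarrow> R t t' \<Longrightarrow> cls R t = cls R t'"
  unfolding cls_def by (blast dest: sympD transpD)

lemma rep_cls: "R t t \<Longrightarrow> R t (rep (cls R t))"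
  unfolding rep_def cls_def by (rule someI2[of _ t]) auto

context substitude
begin

primrec tcol :: "('c, 'p) oterm \<Rightarrow> 'c" where
  "tcol (TX a) = a"
| "tcol (TK a) = a"
| "tcol (TOp p ts) = target (opd S) p"

inductive owf :: "('c, 'p) oterm \<Rightarrow> bool" where
  "a \<in> colours (opd S) \<Longrightarrow> owf (TX a)"
| "a \<in> colours (opd S) \<Longrightarrow> owf (TK a)"
| "p \<in> ops (opd S) \<Longrightarrow> (\<And>t. t \<in> set ts \<Longrightarrow> owf t) \<Longrightarrow> map tcol ts = inputs (opd S) p \<Longrightarrow> owf (TOp p ts)"

inductive oeq :: "('c, 'p) oterm \<Rightarrow> ('c, 'p) oterm \<Rightarrow> bool" where
  oeq_refl: "owf t \<Longrightarrow> oeq t t"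
| oeq_sym: "oeq t t' \<Longrightarrow> oeq t' t"
| oeq_trans: "oeq t t' \<Longrightarrow> oeq t' t'' \<Longrightarrow> oeq t t''"
| oeq_Op: "p \<in> ops (opd S) \<Longrightarrow> list_all2 oeq ts ts' \<Longrightarrow> map tcol ts = inputs (opd S) p
    \<Longrightarrow> oeq (TOp p ts) (TOp p ts')"
| oeq_unit: "owf t \<Longrightarrow> oeq (TOp (unit_op (opd S) (tcol t)) [t]) t"
| oeq_comp: "composable (opd S) p qs \<Longrightarrow> list_all2 (\<lambda>q ts. owf (TOp q ts)) qs tss
    \<Longrightarrow> oeq (TOp (comp_op (opd S) p qs) (concat tss)) (TOp p (map2 TOp qs tss))"
| oeq_perm: "owf (TOp p ts) \<Longrightarrow> s \<in> perms (arity (opd S) p)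
    \<Longrightarrow> oeq (TOp (perm_op (opd S) p s) (permuted s ts)) (TOp p ts)"

primrec adom :: "('c, 'p, 'u) aterm \<Rightarrow> ('c, 'p) oterm" where
  "adom (AId t) = t"
| "adom (ACmp g f) = adom f"
| "adom (AOp p fs) = TOp p (map adom fs)"
| "adom (AX p) = TOp p (map TX (inputs (opd S) p))"
| "adom (AK u) = TOp (eta S u) [TK (Dom (base S) u)]"

primrec acod :: "('c, 'p, 'u) aterm \<Rightarrow> ('c, 'p) oterm" where
  "acod (AId t) = t"
| "acod (ACmp g f) = acod g"
| "acod (AOp p fs) = TOp p (map acod fs)"
| "acod (AX p) = TX (target (opd S) p)"
| "acod (AK u) = TK (Cod (base S) u)"

inductive awf :: "('c, 'p, 'u) aterm \<Rightarrow> bool" where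
  "owf t \<Longrightarrow> awf (AId t)"
| "awf f \<Longrightarrow> awf g \<Longrightarrow> oeq (acod f) (adom g) \<Longrightarrow> awf (ACmp g f)"
| "p \<in> ops (opd S) \<Longrightarrow> (\<And>f. f \<in> set fs \<Longrightarrow> awf f) \<Longrightarrow> map (\<lambda>f. tcol (adom f)) fs = inputs (opd S) p
    \<Longrightarrow> awf (AOp p fs)"
| "p \<in> ops (opd S) \<Longrightarrow> awf (AX p)"
| "u \<in> Ar (base S) \<Longrightarrow> awf (AK u)"

inductive aeq :: "('c, 'p, 'u) aterm \<Rightarrow> ('c, 'p, 'u) aterm \<Rightarrow> bool" where
  aeq_refl: "awf f \<Longrightarrow> aeq f f"
| aeq_sym: "aeq f f' \<Longrightarrow> aeq f' f"
| aeq_trans: "aeq f f' \<Longrightarrow> aeq f' f'' \<Longrightarrow> aeq f f''"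
| aeq_Id: "oeq t t' \<Longrightarrow> aeq (AId t) (AId t')"
| aeq_Cmp: "aeq f f' \<Longrightarrow> aeq g g' \<Longrightarrow> oeq (acod f) (adom g) \<Longrightarrow> aeq (ACmp g f) (ACmp g' f')"
| aeq_Op: "p \<in> ops (opd S) \<Longrightarrow> list_all2 aeq fs fs' \<Longrightarrow> map (\<lambda>f. tcol (adom f)) fs = inputs (opd S) p
    \<Longrightarrow> aeq (AOp p fs) (AOp p fs')"
| aeq_Cmp_Id: "awf f \<Longrightarrow> aeq (ACmp f (AId (adom f))) f"
| aeq_Id_Cmp: "awf f \<Longrightarrow> aeq (ACmp (AId (acod f)) f) f"
| aeq_assoc: "awf f \<Longrightarrow> awf g \<Longrightarrow> awf h \<Longrightarrow> oeq (acod f) (adom g) \<Longrightarrow> oeq (acod g) (adom h)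
    \<Longrightarrow> aeq (ACmp h (ACmp g f)) (ACmp (ACmp h g) f)"
| aeq_Op_Id: "owf (TOp p ts) \<Longrightarrow> aeq (AOp p (map AId ts)) (AId (TOp p ts))"
| aeq_Op_Cmp: "awf (AOp p fs) \<Longrightarrow> awf (AOp p gs) \<Longrightarrow> list_all2 (\<lambda>f g. oeq (acod f) (adom g)) fs gs
    \<Longrightarrow> aeq (AOp p (map2 ACmp gs fs)) (ACmp (AOp p gs) (AOp p fs))"
| aeq_unit: "awf f \<Longrightarrow> aeq (AOp (unit_op (opd S) (tcol (adom f))) [f]) f"
| aeq_comp: "composable (opd S) p qs \<Longrightarrow> list_all2 (\<lambda>q fs. awf (AOp q fs)) qs fss
    \<Longrightarrow> aeq (AOp (comp_op (opd S) p qs) (concat fss)) (AOp p (map2 AOp qs fss))"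
| aeq_perm: "awf (AOp p fs) \<Longrightarrow> s \<in> perms (arity (opd S) p)
    \<Longrightarrow> aeq (AOp (perm_op (opd S) p s) (permuted s fs)) (AOp p fs)"
| aeq_X_unit: "a \<in> colours (opd S) \<Longrightarrow> aeq (AX (unit_op (opd S) a)) (AId (TX a))"
| aeq_X_comp: "composable (opd S) p qs
    \<Longrightarrow> aeq (AX (comp_op (opd S) p qs)) (ACmp (AX p) (AOp p (map AX qs)))"
| aeq_X_perm: "p \<in> ops (opd S) \<Longrightarrow> s \<in> perms (arity (opd S) p)
    \<Longrightarrow> aeq (AX (perm_op (opd S) p s)) (AX p)"
| aeq_K_Id: "a \<in> colours (opd S) \<Longrightarrow> aeq (AK (Ide (base S) a)) (AId (TK a))"
| aeq_K_Cmp: "u \<in> Ar (base S) \<Longrightarrow> v \<in> Ar (base S) \<Longrightarrow> Cod (base S) u = Dom (base S) v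
    \<Longrightarrow> aeq (AK (Cmp (base S) v u)) (ACmp (AK v) (AOp (eta S v) [AK u]))"

lemma owf_TX [simp]: "owf (TX a) \<longleftrightarrow> a \<in> colours (opd S)"
  by (auto intro: owf.intros elim: owf.cases)

lemma owf_TK [simp]: "owf (TK a) \<longleftrightarrow> a \<in> colours (opd S)"
  by (auto intro: owf.intros elim: owf.cases)

lemma owf_TOp: "owf (TOp p ts) \<longleftrightarrow>
    p \<in> ops (opd S) \<and> (\<forall>t \<in> set ts. owf t) \<and> map tcol ts = inputs (opd S) p"
  by (auto intro: owf.intros elim: owf.cases)

lemma awf_AId [simp]: "awf (AId t) \<longleftrightarrow> owf t"
  by (auto intro: awf.intros elim: awf.cases)

lemma awf_ACmp [simp]: "awf (ACmp g f) \<longleftrightarrow> awf f \<and> awf g \<and> oeq (acod f) (adom g)"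
  by (auto intro: awf.intros elim: awf.cases)

lemma awf_AOp: "awf (AOp p fs) \<longleftrightarrow>
    p \<in> ops (opd S) \<and> (\<forall>f \<in> set fs. awf f) \<and> map (\<lambda>f. tcol (adom f)) fs = inputs (opd S) p"
  by (auto intro: awf.intros elim: awf.cases)

lemma awf_AX [simp]: "awf (AX p) \<longleftrightarrow> p \<in> ops (opd S)"
  by (auto intro: awf.intros elim: awf.cases)

lemma awf_AK [simp]: "awf (AK u) \<longleftrightarrow> u \<in> Ar (base S)"
  by (auto intro: awf.intros elim: awf.cases)

lemma tcol_in: "owf t \<Longrightarrow> tcol t \<in> colours (opd S)"
  by (cases rule: owf.cases) (auto simp: target_in)

lemma length_args: "owf (TOp p ts) \<Longrightarrow> arity (opd S) p = length ts"
  unfolding owf_TOp arity_def by (metis length_map)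

lemma composable_ops: "composable (opd S) p qs \<Longrightarrow> p \<in> ops (opd S)"
  "composable (opd S) p qs \<Longrightarrow> set qs \<subseteq> ops (opd S)"
  "composable (opd S) p qs \<Longrightarrow> map (target (opd S)) qs = inputs (opd S) p"
  by (auto simp: composable_def)

lemma owf_comp:
  assumes "composable (opd S) p qs" "list_all2 (\<lambda>q ts. owf (TOp q ts)) qs tss"
  shows "owf (TOp (comp_op (opd S) p qs) (concat tss))" "owf (TOp p (map2 TOp qs tss))"
proof -
  have l: "length qs = length tss" using assms(2) by (rule list_all2_lengthD)
  have "map (map tcol) tss = map (inputs (opd S)) qs"
    using assms(2) by (induction rule: list_all2_induct) (auto simp: owf_TOp)
  moreover have "\<forall>ts \<in> set tss. \<forall>t \<in> set ts. owf t"
    using assms(2) by (induction rule: list_all2_induct) (auto simp: owf_TOp)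
  ultimately show "owf (TOp (comp_op (opd S) p qs) (concat tss))"
    using assms(1) by (auto simp: owf_TOp comp_in inputs_comp map_concat)
  have "map tcol (map2 TOp qs tss) = map (target (opd S)) qs"
    using l by (auto simp: list_eq_iff_nth_eq)
  moreover have "\<forall>t \<in> set (map2 TOp qs tss). owf t"
    using assms(2) by (induction rule: list_all2_induct) auto
  ultimately show "owf (TOp p (map2 TOp qs tss))"
    using assms(1) by (auto simp: owf_TOp composable_def)
qed

lemma owf_perm:
  assumes "owf (TOp p ts)" "s \<in> perms (arity (opd S) p)"
  shows "owf (TOp (perm_op (opd S) p s) (permuted s ts))"
proof -
  have "s \<in> perms (length ts)" using assms length_args by simp
  then have "set s = {..<length ts}" "set (permuted s ts) = set ts"
    by (simp_all add: perms_iff set_permuted)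
  moreover have "map tcol ts = inputs (opd S) p" "p \<in> ops (opd S)" "\<forall>t \<in> set ts. owf t"
    using assms(1) by (auto simp: owf_TOp)
  ultimately show ?thesis
    using assms(2) by (auto simp: owf_TOp perm_in inputs_perm permuted_map[symmetric])
qed

lemma oeq_wf: "oeq t t' \<Longrightarrow> owf t \<and> owf t' \<and> tcol t = tcol t'"
proof (induction rule: oeq.induct)
  case (oeq_Op p ts ts')
  have "(\<forall>t \<in> set ts. owf t) \<and> (\<forall>t \<in> set ts'. owf t) \<and> map tcol ts = map tcol ts'"
    using oeq_Op.IH by (induction rule: list_all2_induct) auto
  then show ?case using oeq_Op by (simp add: owf_TOp)
next
  case (oeq_unit t)
  then show ?case by (simp add: owf_TOp tcol_in unit_in inputs_unit target_unit)
next
  case (oeq_comp p qs tss)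
  then show ?case using owf_comp[of p qs tss] by (simp add: target_comp)
next
  case (oeq_perm p ts s)
  then show ?case using owf_perm[of p ts s] by (auto simp: target_perm owf_TOp)
qed auto

lemma awf_dom_cod: "awf f \<Longrightarrow> owf (adom f) \<and> owf (acod f) \<and> tcol (adom f) = tcol (acod f)"
proof (induction rule: awf.induct)
  case (2 f g)
  then show ?case using oeq_wf by auto
next
  case (3 p fs)
  then show ?case by (auto simp: owf_TOp comp_def cong: map_cong)
next
  case (4 p)
  then show ?case using inputs_in target_in by (auto simp: owf_TOp comp_def)
next
  case (5 u)
  then show ?case using A.Dom_in A.Cod_in by (auto simp: owf_TOp eta_in inputs_eta target_eta Ob_base)
qed auto

lemma awf_adom: "awf f \<Longrightarrow> owf (adom f)"
  and awf_acod: "awf f \<Longrightarrow> owf (acod f)"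
  and tcol_acod: "awf f \<Longrightarrow> tcol (acod f) = tcol (adom f)"
  using awf_dom_cod by auto

lemma awf_AOp_iff: "awf (AOp p fs) \<longleftrightarrow> (\<forall>f \<in> set fs. awf f) \<and> owf (TOp p (map adom fs))"
  by (auto simp: awf_AOp owf_TOp comp_def dest: awf_adom)

lemma awf_AOp_iff': "awf (AOp p fs) \<longleftrightarrow> (\<forall>f \<in> set fs. awf f) \<and> owf (TOp p (map acod fs))"
  by (auto simp: awf_AOp owf_TOp comp_def tcol_acod dest: awf_acod cong: map_cong)

lemma length_args_ar: "awf (AOp p fs) \<Longrightarrow> arity (opd S) p = length fs"
  unfolding awf_AOp arity_def by (metis length_map)

lemma awf_comp:
  assumes "composable (opd S) p qs" "list_all2 (\<lambda>q fs. awf (AOp q fs)) qs fss"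
  shows "awf (AOp (comp_op (opd S) p qs) (concat fss))" "awf (AOp p (map2 AOp qs fss))"
    "oeq (TOp (comp_op (opd S) p qs) (concat (map (map adom) fss))) (TOp p (map2 TOp qs (map (map adom) fss)))"
    "oeq (TOp (comp_op (opd S) p qs) (concat (map (map acod) fss))) (TOp p (map2 TOp qs (map (map acod) fss)))"
    "map adom (map2 AOp qs fss) = map2 TOp qs (map (map adom) fss)"
    "map acod (map2 AOp qs fss) = map2 TOp qs (map (map acod) fss)"
proof -
  have 1: "list_all2 (\<lambda>q ts. owf (TOp q ts)) qs (map (map adom) fss)"
    using assms(2) unfolding list_all2_map2 by (rule list_all2_mono) (simp add: awf_AOp_iff)
  have 2: "list_all2 (\<lambda>q ts. owf (TOp q ts)) qs (map (map acod) fss)"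
    using assms(2) unfolding list_all2_map2 by (rule list_all2_mono) (simp add: awf_AOp_iff')
  show 3: "map adom (map2 AOp qs fss) = map2 TOp qs (map (map adom) fss)"
    and "map acod (map2 AOp qs fss) = map2 TOp qs (map (map acod) fss)"
    using list_all2_lengthD[OF assms(2)] by (auto simp: list_eq_iff_nth_eq)
  have 4: "\<forall>fs \<in> set fss. \<forall>f \<in> set fs. awf f"
    using assms(2) by (induction rule: list_all2_induct) (auto simp: awf_AOp)
  have 5: "\<forall>f \<in> set (map2 AOp qs fss). awf f"
    using assms(2) by (induction rule: list_all2_induct) auto
  show "awf (AOp (comp_op (opd S) p qs) (concat fss))"
    using owf_comp(1)[OF assms(1) 1] 4 by (auto simp: awf_AOp_iff map_concat)
  show "awf (AOp p (map2 AOp qs fss))"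
    using owf_comp(2)[OF assms(1) 1] 5 by (simp add: awf_AOp_iff 3 del: map_map)
  show "oeq (TOp (comp_op (opd S) p qs) (concat (map (map adom) fss))) (TOp p (map2 TOp qs (map (map adom) fss)))"
    "oeq (TOp (comp_op (opd S) p qs) (concat (map (map acod) fss))) (TOp p (map2 TOp qs (map (map acod) fss)))"
    using assms(1) 1 2 by (auto intro: oeq.oeq_comp)
qed

lemma owf_X: "p \<in> ops (opd S) \<Longrightarrow> owf (TOp p (map TX (inputs (opd S) p)))"
  using inputs_in[of p] by (auto simp: owf_TOp comp_def)

lemma aeq_wf: "aeq f f' \<Longrightarrow> awf f \<and> awf f' \<and> oeq (adom f) (adom f') \<and> oeq (acod f) (acod f')"
proof (induction rule: aeq.induct)
  case (aeq_refl f)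
  then show ?case by (auto intro: oeq_refl awf_adom awf_acod)
next
  case (aeq_sym f f')
  then show ?case by (auto intro: oeq_sym)
next
  case (aeq_trans f f' f'')
  then show ?case by (auto intro: oeq_trans)
next
  case (aeq_Id t t')
  then show ?case using oeq_wf by auto
next
  case (aeq_Cmp f f' g g')
  then show ?case by (auto intro: oeq_trans oeq_sym)
next
  case (aeq_Op p fs fs')
  have 1: "(\<forall>f \<in> set fs. awf f) \<and> (\<forall>f \<in> set fs'. awf f) \<and> list_all2 oeq (map adom fs) (map adom fs')
      \<and> list_all2 oeq (map acod fs) (map acod fs')
      \<and> map (\<lambda>f. tcol (adom f)) fs = map (\<lambda>f. tcol (adom f)) fs'"
    using aeq_Op.IH by (induction rule: list_all2_induct) (auto dest: oeq_wf)
  then have 2: "awf (AOp p fs)" "awf (AOp p fs')" using aeq_Op by (auto simp: awf_AOp)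
  then have "map tcol (map adom fs) = inputs (opd S) p" "map tcol (map acod fs) = inputs (opd S) p"
    using 2(1)[unfolded awf_AOp_iff] 2(1)[unfolded awf_AOp_iff'] by (simp_all only: owf_TOp)
  then show ?case using 1 2 aeq_Op(1) by (auto intro!: oeq_Op)
next
  case (aeq_Op_Id p ts)
  then show ?case by (auto simp: awf_AOp owf_TOp comp_def intro!: oeq_refl)
next
  case (aeq_Op_Cmp p fs gs)
  have 0: "(\<forall>f \<in> set fs. awf f) \<longrightarrow> (\<forall>f \<in> set gs. awf f) \<longrightarrow> (\<forall>f \<in> set (map2 ACmp gs fs). awf f) \<and>
     map adom (map2 ACmp gs fs) = map adom fs \<and> map acod (map2 ACmp gs fs) = map acod gs \<and>
     list_all2 oeq (map acod fs) (map adom gs)"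
    using aeq_Op_Cmp(3) by (induction rule: list_all2_induct) auto
  have 1: "\<forall>f \<in> set (map2 ACmp gs fs). awf f" "map adom (map2 ACmp gs fs) = map adom fs"
    "map acod (map2 ACmp gs fs) = map acod gs" "list_all2 oeq (map acod fs) (map adom gs)"
    using 0 aeq_Op_Cmp(1,2) by (auto simp: awf_AOp)
  have 2: "awf (AOp p (map2 ACmp gs fs))"
    unfolding awf_AOp_iff using 1 aeq_Op_Cmp(1) by (auto simp: awf_AOp_iff)
  have 3: "owf (TOp p (map acod fs))" "owf (TOp p (map adom fs))" "owf (TOp p (map acod gs))"
    using aeq_Op_Cmp(1,2)[unfolded awf_AOp_iff] aeq_Op_Cmp(1,2)[unfolded awf_AOp_iff'] by simp_all
  have 4: "oeq (TOp p (map acod fs)) (TOp p (map adom gs))"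
    using 3 1 by (auto simp: owf_TOp intro!: oeq_Op)
  show ?case using 2 3 4 1(2,3) aeq_Op_Cmp(1,2) by (simp add: oeq_refl del: map_map)
next
  case (aeq_unit f)
  then have 1: "owf (adom f)" "owf (acod f)" "tcol (acod f) = tcol (adom f)" using awf_dom_cod by auto
  show ?case using 1 oeq_unit[OF 1(1)] oeq_unit[OF 1(2)] aeq_unit oeq_wf
    by (auto simp: awf_AOp_iff)
next
  case (aeq_comp p qs fss)
  then show ?case using awf_comp[OF aeq_comp] by (simp add: map_concat del: map_map)
next
  case (aeq_perm p fs s)
  have s: "set s = {..<length fs}" "set (permuted s fs) = set fs"
    using aeq_perm length_args_ar by (auto simp: perms_iff set_permuted)
  have 1: "owf (TOp p (map adom fs))" "owf (TOp p (map acod fs))" "\<forall>f \<in> set fs. awf f"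
    using aeq_perm(1)[unfolded awf_AOp_iff] aeq_perm(1)[unfolded awf_AOp_iff'] by simp_all
  show ?case using aeq_perm 1 oeq_perm[OF 1(1) aeq_perm(2)] oeq_perm[OF 1(2) aeq_perm(2)]
      owf_perm[OF 1(1) aeq_perm(2)]
    by (auto simp: awf_AOp_iff s permuted_map[symmetric])
next
  case (aeq_X_unit a)
  then show ?case using oeq_unit[of "TX a"] 
    by (auto simp: unit_in inputs_unit target_unit intro: oeq_refl)
next
  case (aeq_X_comp p qs)
  have 1: "list_all2 (\<lambda>q ts. owf (TOp q ts)) qs (map (\<lambda>q. map TX (inputs (opd S) q)) qs)"
    using composable_ops[OF aeq_X_comp] by (auto simp: list_all2_conv_all_nth subset_iff intro!: owf_X)
  have 2: "map2 TOp qs (map (\<lambda>q. map TX (inputs (opd S) q)) qs) = map (\<lambda>q. TOp q (map TX (inputs (opd S) q))) qs"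
    by (auto simp: list_eq_iff_nth_eq)
  have 3: "concat (map (\<lambda>q. map TX (inputs (opd S) q)) qs) = map TX (concat (map (inputs (opd S)) qs))"
    by (simp add: map_concat comp_def)
  have 4: "map TX (inputs (opd S) p) = map (\<lambda>q. TX (target (opd S) q)) qs"
    using composable_ops(3)[OF aeq_X_comp, symmetric] by (simp add: comp_def)
  have 5: "oeq (TOp p (map TX (inputs (opd S) p))) (TOp p (map TX (inputs (opd S) p)))"
    using composable_ops[OF aeq_X_comp] by (intro oeq_refl owf_X)
  have 6: "owf (TOp p (map (\<lambda>q. TOp q (map TX (inputs (opd S) q))) qs))"
    using owf_comp(2)[OF aeq_X_comp 1] by (simp add: 2)
  have 7: "owf (TX (target (opd S) p))"
    using composable_ops(1)[OF aeq_X_comp] by (simp add: target_in)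
  have 8: "awf (AOp p (map AX qs))"
    using 6 composable_ops(2)[OF aeq_X_comp] by (auto simp: awf_AOp_iff comp_def)
  have 9: "acod (AOp p (map AX qs)) = adom (AX p)"
    by (simp add: 4 comp_def)
  show ?case
    using oeq.oeq_comp[OF aeq_X_comp 1] composable_ops(1)[OF aeq_X_comp] comp_in[OF aeq_X_comp] 5 7 8 9
    by (simp add: 2 3 inputs_comp[OF aeq_X_comp] target_comp[OF aeq_X_comp] comp_def oeq_refl)
next
  case (aeq_X_perm p s)
  have 1: "owf (TOp p (map TX (inputs (opd S) p)))"
    using aeq_X_perm by (intro owf_X)
  have 2: "set s = {..<length (inputs (opd S) p)}"
    using aeq_X_perm by (simp add: perms_iff arity_def)
  show ?case using oeq_perm[OF 1 aeq_X_perm(2)] aeq_X_perm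
    by (auto simp: perm_in inputs_perm target_perm permuted_map 2 target_in intro: oeq_refl)
next
  case (aeq_K_Id a)
  then show ?case using oeq_unit[of "TK a"] A.Ide_in[of a]
    by (auto simp: eta_Ide Ob_base A.Dom_Ide A.Cod_Ide intro: oeq_refl)
next
  case (aeq_K_Cmp u v)
  have 1: "composable (opd S) (eta S v) [eta S u]"
    using aeq_K_Cmp by (simp add: composable_def eta_in inputs_eta target_eta)
  have 2: "list_all2 (\<lambda>q ts. owf (TOp q ts)) [eta S u] [[TK (Dom (base S) u)]]"
    using aeq_K_Cmp A.Dom_in by (simp add: owf_TOp eta_in inputs_eta Ob_base)
  have 4: "owf (TOp (eta S v) [TK (Dom (base S) v)])" "owf (TK (Cod (base S) v))"
    using aeq_K_Cmp A.Dom_in A.Cod_in by (simp_all add: owf_TOp eta_in inputs_eta Ob_base)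
  show ?case using oeq.oeq_comp[OF 1 2] owf_comp(2)[OF 1 2] aeq_K_Cmp oeq_refl[OF 4(1)] oeq_refl[OF 4(2)]
    by (auto simp: A.Cmp_in A.Dom_Cmp A.Cod_Cmp eta_Cmp awf_AOp_iff)
qed (auto intro: oeq_refl awf_adom awf_acod)

end

context substitude
begin

abbreviation "oc \<equiv> cls oeq"
abbreviation "ac \<equiv> cls aeq"

definition term_cat :: "(('c, 'p) oterm set, ('c, 'p, 'u) aterm set) cat" where
  "term_cat = \<lparr>Ob = {oc t | t. owf t}, Ar = {ac f | f. awf f},
     Dom = (\<lambda>A. oc (adom (rep A))), Cod = (\<lambda>A. oc (acod (rep A))),
     Ide = (\<lambda>x. ac (AId (rep x))), Cmp = (\<lambda>B A. ac (ACmp (rep B) (rep A)))\<rparr>"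

definition term_alg :: "('c, 'p, 'u) term_alg" where
  "term_alg = \<lparr>total = term_cat, colour = (\<lambda>x. tcol (rep x)),
     act_ob = (\<lambda>p xs. oc (TOp p (map rep xs))), act_ar = (\<lambda>p fs. ac (AOp p (map rep fs)))\<rparr>"

definition term_int_alg :: "('c, 'p, 'u) term_int_alg" where
  "term_int_alg = \<lparr>X_ob = (\<lambda>a. oc (TX a)), K_ob = (\<lambda>a. oc (TK a)),
     X_ar = (\<lambda>p. ac (AX p)), K_ar = (\<lambda>u. ac (AK u))\<rparr>"

lemma oc_eq: "oeq t t' \<Longrightarrow> oc t = oc t'"
  by (rule cls_eq) (auto intro: sympI transpI oeq_sym oeq_trans)

lemma ac_eq: "aeq f f' \<Longrightarrow> ac f = ac f'"
  by (rule cls_eq) (auto intro: sympI transpI aeq_sym aeq_trans)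

lemma oc_eqD: "oc t = oc t' \<Longrightarrow> owf t' \<Longrightarrow> oeq t t'"
  unfolding cls_def using oeq_refl by blast

lemma ac_eqD: "ac f = ac f' \<Longrightarrow> awf f' \<Longrightarrow> aeq f f'"
  unfolding cls_def using aeq_refl by blast

lemma oeq_rep: "owf t \<Longrightarrow> oeq t (rep (oc t))"
  by (simp add: oeq_refl rep_cls)

lemma aeq_rep: "awf f \<Longrightarrow> aeq f (rep (ac f))"
  by (simp add: aeq_refl rep_cls)

lemma Ob_T: "Ob term_cat = oc ` Collect owf" and Ar_T: "Ar term_cat = ac ` Collect awf"
  by (auto simp: term_cat_def)

lemma total_T [simp]: "total term_alg = term_cat"
  by (simp add: term_alg_def)

lemma Ob_TI [simp]: "owf t \<Longrightarrow> oc t \<in> Ob term_cat" and Ar_TI [simp]: "awf f \<Longrightarrow> ac f \<in> Ar term_cat"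
  by (auto simp: term_cat_def)

lemma Dom_T [simp]: "awf f \<Longrightarrow> Dom term_cat (ac f) = oc (adom f)"
  and Cod_T [simp]: "awf f \<Longrightarrow> Cod term_cat (ac f) = oc (acod f)"
  using aeq_wf[OF aeq_rep[of f]] by (auto simp: term_cat_def intro!: oc_eq intro: oeq_sym)

lemma Ide_T [simp]: "owf t \<Longrightarrow> Ide term_cat (oc t) = ac (AId t)"
  using oeq_rep[of t] by (auto simp: term_cat_def intro!: ac_eq intro: aeq_Id oeq_sym)

lemma Cmp_T [simp]: "awf f \<Longrightarrow> awf g \<Longrightarrow> oeq (acod f) (adom g) \<Longrightarrow> Cmp term_cat (ac g) (ac f) = ac (ACmp g f)"
  using aeq_rep[of f] aeq_rep[of g] unfolding term_cat_def
  by (auto intro!: ac_eq aeq_sym[OF aeq_Cmp])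

lemma colour_T [simp]: "owf t \<Longrightarrow> colour term_alg (oc t) = tcol t"
  using oeq_wf[OF oeq_rep[of t]] by (simp add: term_alg_def)

lemma act_ob_T [simp]:
  assumes "owf (TOp p ts)"
  shows "act_ob term_alg p (map oc ts) = oc (TOp p ts)"
proof -
  have "oeq (TOp p ts) (TOp p (map (\<lambda>t. rep (oc t)) ts))"
    using assms by (intro oeq_Op) (auto simp: owf_TOp list_all2_conv_all_nth oeq_rep)
  then show ?thesis by (simp add: term_alg_def comp_def oc_eq)
qed

lemma act_ar_T [simp]:
  assumes "awf (AOp p fs)"
  shows "act_ar term_alg p (map ac fs) = ac (AOp p fs)"
proof -
  have "aeq (AOp p fs) (AOp p (map (\<lambda>f. rep (ac f)) fs))"
    using assms by (intro aeq_Op) (auto simp: awf_AOp list_all2_conv_all_nth aeq_rep)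
  then show ?thesis by (simp add: term_alg_def comp_def ac_eq)
qed

lemma ob_args_T: "p \<in> ops (opd S) \<Longrightarrow> ob_args (opd S) term_alg p xs \<longleftrightarrow> (\<exists>ts. xs = map oc ts \<and> owf (TOp p ts))"
proof
  assume p: "p \<in> ops (opd S)" and *: "ob_args (opd S) term_alg p xs"
  then have "set xs \<subseteq> oc ` Collect owf" by (simp add: ob_args_def Ob_T)
  then obtain ts where ts: "xs = map oc ts" "\<forall>t \<in> set ts. owf t"
    by (induction xs) (auto simp: Cons_eq_map_conv, metis list.set_intros set_ConsD)
  with * p have "owf (TOp p ts)" by (simp add: ob_args_def owf_TOp comp_def cong: map_cong)
  then show "\<exists>ts. xs = map oc ts \<and> owf (TOp p ts)" using ts by auto
qed (auto simp: ob_args_def owf_TOp comp_def cong: map_cong)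

lemma ar_args_T: "p \<in> ops (opd S) \<Longrightarrow> ar_args (opd S) term_alg p xs \<longleftrightarrow> (\<exists>fs. xs = map ac fs \<and> awf (AOp p fs))"
proof
  assume p: "p \<in> ops (opd S)" and *: "ar_args (opd S) term_alg p xs"
  then have "set xs \<subseteq> ac ` Collect awf" by (simp add: ar_args_def Ar_T)
  then obtain fs where fs: "xs = map ac fs" "\<forall>f \<in> set fs. awf f"
    by (induction xs) (auto simp: Cons_eq_map_conv, metis list.set_intros set_ConsD)
  with * p have "awf (AOp p fs)" by (simp add: ar_args_def awf_AOp comp_def awf_adom cong: map_cong)
  then show "\<exists>fs. xs = map ac fs \<and> awf (AOp p fs)" using fs by auto
qed (auto simp: ar_args_def awf_AOp comp_def awf_adom cong: map_cong)

lemma map2_ex: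
  assumes "list_all2 (\<lambda>q xs. \<exists>ts. xs = map c ts \<and> W q ts) qs xss"
  obtains tss where "xss = map (map c) tss" "list_all2 W qs tss"
  using assms
proof (induction arbitrary: thesis rule: list_all2_induct)
  case Nil
  then show ?case by simp
next
  case (Cons q qs xs xss)
  obtain tss where "xss = map (map c) tss" "list_all2 W qs tss" using Cons by blast
  moreover obtain ts where "xs = map c ts" "W q ts" using Cons by blast
  ultimately show ?case using Cons(4)[of "ts # tss"] by simp
qed

lemma ob_args_Ts:
  assumes "set qs \<subseteq> ops (opd S)" "list_all2 (ob_args (opd S) term_alg) qs xss"
  obtains tss where "xss = map (map oc) tss" "list_all2 (\<lambda>q ts. owf (TOp q ts)) qs tss"
proof -
  have "list_all2 (\<lambda>q xs. \<exists>ts. xs = map oc ts \<and> owf (TOp q ts)) qs xss"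
    using assms by (auto simp: list_all2_conv_all_nth ob_args_T subset_iff)
  then show ?thesis by (rule map2_ex) (rule that)
qed

lemma ar_args_Ts:
  assumes "set qs \<subseteq> ops (opd S)" "list_all2 (ar_args (opd S) term_alg) qs xss"
  obtains fss where "xss = map (map ac) fss" "list_all2 (\<lambda>q fs. awf (AOp q fs)) qs fss"
proof -
  have "list_all2 (\<lambda>q xs. \<exists>fs. xs = map ac fs \<and> awf (AOp q fs)) qs xss"
    using assms by (auto simp: list_all2_conv_all_nth ar_args_T subset_iff)
  then show ?thesis by (rule map2_ex) (rule that)
qed

lemma category_T: "category term_cat"
proof
  fix f assume "f \<in> Ar term_cat"
  then obtain f' where f: "f = ac f'" "awf f'" by (auto simp: Ar_T)
  then have 1: "owf (adom f')" "owf (acod f')" by (simp_all add: awf_adom awf_acod)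
  show "Dom term_cat f \<in> Ob term_cat" "Cod term_cat f \<in> Ob term_cat" using f 1 by simp_all
  show "Cmp term_cat f (Ide term_cat (Dom term_cat f)) = f"
    using f 1 aeq_Cmp_Id[of f'] by (simp add: oeq_refl ac_eq)
  show "Cmp term_cat (Ide term_cat (Cod term_cat f)) f = f"
    using f 1 aeq_Id_Cmp[of f'] by (simp add: oeq_refl ac_eq)
  fix g assume "g \<in> Ar term_cat" and e: "Cod term_cat f = Dom term_cat g"
  then obtain g' where g: "g = ac g'" "awf g'" by (auto simp: Ar_T)
  with f e have 2: "oeq (acod f') (adom g')" by (auto dest: oc_eqD simp: awf_adom)
  show "Cmp term_cat g f \<in> Ar term_cat" "Dom term_cat (Cmp term_cat g f) = Dom term_cat f"
    "Cod term_cat (Cmp term_cat g f) = Cod term_cat g"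
    using f g 2 by simp_all
  fix h assume "h \<in> Ar term_cat" and e: "Cod term_cat g = Dom term_cat h"
  then obtain h' where h: "h = ac h'" "awf h'" by (auto simp: Ar_T)
  with g e have 3: "oeq (acod g') (adom h')" by (auto dest: oc_eqD simp: awf_adom)
  show "Cmp term_cat h (Cmp term_cat g f) = Cmp term_cat (Cmp term_cat h g) f"
    using f g h 2 3 aeq_assoc[of f' g' h'] by (simp add: ac_eq)
next
  fix x assume "x \<in> Ob term_cat"
  then obtain t where "x = oc t" "owf t" by (auto simp: Ob_T)
  then show "Ide term_cat x \<in> Ar term_cat" "Dom term_cat (Ide term_cat x) = x" "Cod term_cat (Ide term_cat x) = x"
    by simp_all
qed

lemma map2_ac: "length fs = length gs \<Longrightarrow> \<forall>f \<in> set fs. awf f \<Longrightarrow> \<forall>g \<in> set gs. awf g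
   \<Longrightarrow> list_all2 (\<lambda>f g. oeq (acod f) (adom g)) fs gs
   \<Longrightarrow> map2 (Cmp term_cat) (map ac gs) (map ac fs) = map ac (map2 ACmp gs fs)"
  by (induction fs gs rule: list_induct2) auto

lemma map2_act_ob: "list_all2 (\<lambda>q ts. owf (TOp q ts)) qs tss
   \<Longrightarrow> map2 (act_ob term_alg) qs (map (map oc) tss) = map oc (map2 TOp qs tss)"
  by (induction rule: list_all2_induct) auto

lemma map2_act_ar: "list_all2 (\<lambda>q ts. awf (AOp q ts)) qs tss
   \<Longrightarrow> map2 (act_ar term_alg) qs (map (map ac) tss) = map ac (map2 AOp qs tss)"
  by (induction rule: list_all2_induct) auto

lemma categorical_algebra_T: "categorical_algebra (opd S) term_alg"
proof (intro categorical_algebra.intro categorical_algebra_axioms.intro)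
  show "category (total term_alg)" by (simp add: category_T)
next
  fix x assume "x \<in> Ob (total term_alg)"
  then obtain t where t: "x = oc t" "owf t" by (auto simp: Ob_T)
  then show "colour term_alg x \<in> colours (opd S)" by (simp add: tcol_in)
  have "owf (TOp (unit_op (opd S) (tcol t)) [t])"
    using t by (simp add: owf_TOp tcol_in unit_in inputs_unit)
  then show "act_ob term_alg (unit_op (opd S) (colour term_alg x)) [x] = x"
    using t act_ob_T[of "unit_op (opd S) (tcol t)" "[t]"] oeq_unit[of t] by (simp add: oc_eq)
next
  fix f assume "f \<in> Ar (total term_alg)"
  then obtain f' where f: "f = ac f'" "awf f'" by (auto simp: Ar_T)
  then have 1: "owf (adom f')" "owf (acod f')" by (simp_all add: awf_adom awf_acod)
  show "colour term_alg (Cod (total term_alg) f) = colour term_alg (Dom (total term_alg) f)"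
    using f 1 by (simp add: tcol_acod)
  have "awf (AOp (unit_op (opd S) (tcol (adom f'))) [f'])"
    using f 1 by (simp add: awf_AOp tcol_in unit_in inputs_unit)
  then show "act_ar term_alg (unit_op (opd S) (colour term_alg (Dom (total term_alg) f))) [f] = f"
    using f 1 act_ar_T[of "unit_op (opd S) (tcol (adom f'))" "[f']"] aeq_unit[of f'] by (simp add: ac_eq)
next
  fix p xs assume p: "p \<in> ops (opd S)" and "ob_args (opd S) term_alg p xs"
  then obtain ts where ts: "xs = map oc ts" "owf (TOp p ts)" by (auto simp: ob_args_T)
  show "act_ob term_alg p xs \<in> Ob (total term_alg)" "colour term_alg (act_ob term_alg p xs) = target (opd S) p"
    using ts by simp_all
  have 1: "map (Ide term_cat) (map oc ts) = map ac (map AId ts)" "awf (AOp p (map AId ts))"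
    using ts by (auto simp: owf_TOp awf_AOp comp_def)
  show "act_ar term_alg p (map (Ide (total term_alg)) xs) = Ide (total term_alg) (act_ob term_alg p xs)"
    using ts 1 aeq_Op_Id[OF ts(2)] by (simp add: ac_eq del: map_map)
  fix s assume s: "s \<in> perms (arity (opd S) p)"
  have s': "set s = {..<length ts}" using ts s length_args by (simp add: perms_iff)
  show "act_ob term_alg (perm_op (opd S) p s) (permuted s xs) = act_ob term_alg p xs"
    using ts s s' by (simp add: permuted_map owf_perm oc_eq[OF oeq_perm])
next
  fix p xs assume p: "p \<in> ops (opd S)" and "ar_args (opd S) term_alg p xs"
  then obtain fs where fs: "xs = map ac fs" "awf (AOp p fs)" by (auto simp: ar_args_T)
  have fs': "\<forall>f \<in> set fs. awf f" using fs by (simp add: awf_AOp)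
  have 1: "owf (TOp p (map adom fs))" "owf (TOp p (map acod fs))"
    using fs(2)[unfolded awf_AOp_iff] fs(2)[unfolded awf_AOp_iff'] by auto
  have 2: "map (Dom term_cat) (map ac fs) = map oc (map adom fs)" "map (Cod term_cat) (map ac fs) = map oc (map acod fs)"
    using fs' by simp_all
  show "act_ar term_alg p xs \<in> Ar (total term_alg)"
    "Dom (total term_alg) (act_ar term_alg p xs) = act_ob term_alg p (map (Dom (total term_alg)) xs)"
    "Cod (total term_alg) (act_ar term_alg p xs) = act_ob term_alg p (map (Cod (total term_alg)) xs)"
    using fs 1 2 by (simp_all del: map_map)
  {
    fix s assume s: "s \<in> perms (arity (opd S) p)"
    have s': "set s = {..<length fs}" using fs s length_args_ar by (simp add: perms_iff)
    have e: "aeq (AOp (perm_op (opd S) p s) (permuted s fs)) (AOp p fs)" using fs s by (intro aeq_perm)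
    show "act_ar term_alg (perm_op (opd S) p s) (permuted s xs) = act_ar term_alg p xs"
      using fs s s' aeq_wf[OF e] by (simp add: permuted_map ac_eq[OF e])
  }
  fix ys assume "ar_args (opd S) term_alg p ys"
    and e: "map (Cod (total term_alg)) xs = map (Dom (total term_alg)) ys"
  then obtain gs where gs: "ys = map ac gs" "awf (AOp p gs)" using p by (auto simp: ar_args_T)
  have gs': "\<forall>f \<in> set gs. awf f" using gs by (simp add: awf_AOp)
  have "map (oc \<circ> acod) fs = map (oc \<circ> adom) gs" using e fs gs fs' gs' by (simp add: comp_def cong: map_cong)
  then have 3: "list_all2 (\<lambda>f g. oeq (acod f) (adom g)) fs gs"
    using gs' by (auto simp: list_eq_iff_nth_eq list_all2_conv_all_nth intro!: oc_eqD awf_adom)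
  then have e: "aeq (AOp p (map2 ACmp gs fs)) (ACmp (AOp p gs) (AOp p fs))"
    using fs gs by (intro aeq_Op_Cmp)
  show "act_ar term_alg p (map2 (Cmp (total term_alg)) ys xs)
      = Cmp (total term_alg) (act_ar term_alg p ys) (act_ar term_alg p xs)"
    using fs gs fs' gs' 3 aeq_wf[OF e] list_all2_lengthD[OF 3] by (simp add: map2_ac ac_eq[OF e] del: map_map)
next
  fix p qs xss assume c: "composable (opd S) p qs" and "list_all2 (ob_args (opd S) term_alg) qs xss"
  then obtain tss where tss: "xss = map (map oc) tss" "list_all2 (\<lambda>q ts. owf (TOp q ts)) qs tss"
    using ob_args_Ts composable_ops by metis
  show "act_ob term_alg (comp_op (opd S) p qs) (concat xss) = act_ob term_alg p (map2 (act_ob term_alg) qs xss)"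
    using owf_comp[OF c tss(2)] oeq_comp[OF c tss(2)]
    by (simp add: tss map2_act_ob map_concat[symmetric] oc_eq del: map_map)
next
  fix p qs xss assume c: "composable (opd S) p qs" and "list_all2 (ar_args (opd S) term_alg) qs xss"
  then obtain fss where fss: "xss = map (map ac) fss" "list_all2 (\<lambda>q fs. awf (AOp q fs)) qs fss"
    using ar_args_Ts composable_ops by metis
  show "act_ar term_alg (comp_op (opd S) p qs) (concat xss) = act_ar term_alg p (map2 (act_ar term_alg) qs xss)"
    using awf_comp(1,2)[OF c fss(2)] aeq_comp[OF c fss(2)]
    by (simp add: fss map2_act_ar map_concat[symmetric] ac_eq del: map_map)
qed

lemma internal_algebra_T: "internal_algebra S term_alg term_int_alg"
proof
  fix a assume a: "a \<in> colours (opd S)"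
  then show "X_ob term_int_alg a \<in> Ob (total term_alg)" "colour term_alg (X_ob term_int_alg a) = a"
    "K_ob term_int_alg a \<in> Ob (total term_alg)" "colour term_alg (K_ob term_int_alg a) = a"
    "X_ar term_int_alg (unit_op (opd S) a) = Ide (total term_alg) (X_ob term_int_alg a)"
    "K_ar term_int_alg (Ide (base S) a) = Ide (total term_alg) (K_ob term_int_alg a)"
    using ac_eq[OF aeq_X_unit[OF a]] ac_eq[OF aeq_K_Id[OF a]] by (simp_all add: term_int_alg_def)
next
  fix p assume p: "p \<in> ops (opd S)"
  have 1: "map (X_ob term_int_alg) (inputs (opd S) p) = map oc (map TX (inputs (opd S) p))"
    by (simp add: term_int_alg_def)
  show "X_ar term_int_alg p \<in> Ar (total term_alg)"
    "Dom (total term_alg) (X_ar term_int_alg p) = act_ob term_alg p (map (X_ob term_int_alg) (inputs (opd S) p))"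
    "Cod (total term_alg) (X_ar term_int_alg p) = X_ob term_int_alg (target (opd S) p)"
    using p owf_X[OF p] unfolding 1 by (simp_all add: term_int_alg_def del: map_map)
  fix s assume "s \<in> perms (arity (opd S) p)"
  then show "X_ar term_int_alg (perm_op (opd S) p s) = X_ar term_int_alg p"
    using p ac_eq[OF aeq_X_perm] by (simp add: term_int_alg_def)
next
  fix p qs assume c: "composable (opd S) p qs"
  have "aeq (AX (comp_op (opd S) p qs)) (ACmp (AX p) (AOp p (map AX qs)))" using c by (rule aeq_X_comp)
  note e = ac_eq[OF this] conjunct1[OF conjunct2[OF aeq_wf[OF this]]]
  have 1: "map (X_ar term_int_alg) qs = map ac (map AX qs)" by (simp add: term_int_alg_def)
  show "X_ar term_int_alg (comp_op (opd S) p qs) = Cmp (total term_alg) (X_ar term_int_alg p)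
      (act_ar term_alg p (map (X_ar term_int_alg) qs))"
    unfolding 1 using e by (simp add: term_int_alg_def del: map_map)
next
  fix u assume u: "u \<in> Ar (base S)"
  have 1: "owf (TOp (eta S u) [TK (Dom (base S) u)])"
    using u A.Dom_in by (simp add: owf_TOp eta_in inputs_eta Ob_base)
  show "K_ar term_int_alg u \<in> Ar (total term_alg)"
    "Dom (total term_alg) (K_ar term_int_alg u) = act_ob term_alg (eta S u) [K_ob term_int_alg (Dom (base S) u)]"
    "Cod (total term_alg) (K_ar term_int_alg u) = K_ob term_int_alg (Cod (base S) u)"
    using u act_ob_T[OF 1] by (simp_all add: term_int_alg_def)
  fix v assume v: "v \<in> Ar (base S)" "Cod (base S) u = Dom (base S) v"
  have "aeq (AK (Cmp (base S) v u)) (ACmp (AK v) (AOp (eta S v) [AK u]))" using u v by (rule aeq_K_Cmp)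
  note e = ac_eq[OF this] conjunct1[OF conjunct2[OF aeq_wf[OF this]]]
  show "K_ar term_int_alg (Cmp (base S) v u) = Cmp (total term_alg) (K_ar term_int_alg v)
      (act_ar term_alg (eta S v) [K_ar term_int_alg u])"
    using e act_ar_T[of "eta S v" "[AK u]"] by (simp add: term_int_alg_def)
qed

end

locale term_cells = substitude S + C: categorical_algebra "opd S" C +
  F: algebra_morphism "opd S" term_alg C F F' + G: algebra_morphism "opd S" term_alg C G G' +
  M: internal_morphism S C "int_image F F' term_int_alg" "int_image G G' term_int_alg" phi psi
  for S :: "('c, 'p, 'u) substitude" and C :: "('c, 'p, 'o, 'm) cat_alg" and F F' G G' phi psi
begin

primrec tO :: "('c, 'p) oterm \<Rightarrow> 'm" where
  "tO (TX a) = phi a"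
| "tO (TK a) = psi a"
| "tO (TOp p ts) = act_ar C p (map tO ts)"

lemmas int_image_simps = int_image_def term_int_alg_def

lemma ob_args_TI: "owf (TOp p ts) \<Longrightarrow> ob_args (opd S) term_alg p (map oc ts)"
  and ar_args_TI: "awf (AOp p fs) \<Longrightarrow> ar_args (opd S) term_alg p (map ac fs)"
  using ob_args_T[of p "map oc ts"] ar_args_T[of p "map ac fs"] by (auto simp: owf_TOp awf_AOp)

lemma Dom_Cod_phi:
  assumes "a \<in> colours (opd S)"
  shows "Dom (total C) (phi a) = F (oc (TX a))" "Cod (total C) (phi a) = G (oc (TX a))"
    "Dom (total C) (psi a) = F (oc (TK a))" "Cod (total C) (psi a) = G (oc (TK a))"
  using assms M.Dom_phi[of a] M.Cod_phi[of a] M.Dom_psi[of a] M.Cod_psi[of a]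
  by (simp_all add: int_image_simps)

lemma F_Op: "owf (TOp p ts) \<Longrightarrow> act_ob C p (map (\<lambda>t. F (oc t)) ts) = F (oc (TOp p ts))"
  and G_Op: "owf (TOp p ts) \<Longrightarrow> act_ob C p (map (\<lambda>t. G (oc t)) ts) = G (oc (TOp p ts))"
  using F.ob_act[OF _ ob_args_TI] G.ob_act[OF _ ob_args_TI] by (simp_all add: owf_TOp comp_def)

lemma F'_Op: "awf (AOp p fs) \<Longrightarrow> F' (ac (AOp p fs)) = act_ar C p (map (\<lambda>f. F' (ac f)) fs)"
  and G'_Op: "awf (AOp p fs) \<Longrightarrow> G' (ac (AOp p fs)) = act_ar C p (map (\<lambda>f. G' (ac f)) fs)"
  using F.ar_act[OF _ ar_args_TI] G.ar_act[OF _ ar_args_TI] by (simp_all add: awf_AOp comp_def)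

lemma F_arr:
  assumes "awf f"
  shows "F' (ac f) \<in> Ar (total C)" "Dom (total C) (F' (ac f)) = F (oc (adom f))"
    "Cod (total C) (F' (ac f)) = F (oc (acod f))" "colour C (F (oc (adom f))) = tcol (adom f)"
  using assms F.ar_in[of "ac f"] F.Dom_ar[of "ac f"] F.Cod_ar[of "ac f"] F.colour_ob[of "oc (adom f)"]
  by (auto simp: awf_adom)

lemma G_arr:
  assumes "awf f"
  shows "G' (ac f) \<in> Ar (total C)" "Dom (total C) (G' (ac f)) = G (oc (adom f))"
    "Cod (total C) (G' (ac f)) = G (oc (acod f))" "colour C (G (oc (adom f))) = tcol (adom f)"
  using assms G.ar_in[of "ac f"] G.Dom_ar[of "ac f"] G.Cod_ar[of "ac f"] G.colour_ob[of "oc (adom f)"]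
  by (auto simp: awf_adom)

lemma tO_in: "owf t \<Longrightarrow> tO t \<in> Ar (total C) \<and> Dom (total C) (tO t) = F (oc t) \<and> Cod (total C) (tO t) = G (oc t)"
proof (induction rule: owf.induct)
  case (3 p ts)
  then have w: "owf (TOp p ts)" by (simp add: owf_TOp)
  have "map (\<lambda>t. colour C (F (oc t))) ts = map tcol ts"
    using 3(2) by (intro map_cong refl) (simp add: F.colour_ob)
  moreover have "map (\<lambda>t. colour C (Dom (total C) (tO t))) ts = map (\<lambda>t. colour C (F (oc t))) ts"
    using 3 by simp
  ultimately have a: "ar_args (opd S) C p (map tO ts)"
    using 3 by (auto simp: ar_args_def comp_def)
  with 3 w show ?case
    by (simp add: C.act_ar_in C.Dom_act_ar C.Cod_act_ar F_Op[symmetric] G_Op[symmetric] comp_def cong: map_cong)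
qed (auto simp: M.phi_in M.psi_in Dom_Cod_phi)

lemma tO_args: "owf (TOp p ts) \<Longrightarrow> ar_args (opd S) C p (map tO ts)"
proof -
  assume w: "owf (TOp p ts)"
  then have "map (\<lambda>t. colour C (Dom (total C) (tO t))) ts = map tcol ts"
    by (intro map_cong refl) (simp add: tO_in F.colour_ob owf_TOp)
  moreover have "set (map tO ts) \<subseteq> Ar (total C)"
    using w tO_in by (auto simp: owf_TOp)
  ultimately show ?thesis using w unfolding ar_args_def owf_TOp map_map comp_def by simp
qed

lemma tO_cong: "oeq t t' \<Longrightarrow> tO t = tO t'"
proof (induction rule: oeq.induct)
  case (oeq_Op p ts ts')
  have "map tO ts = map tO ts'"
    using oeq_Op.IH by (induction rule: list_all2_induct) auto
  then show ?case by simp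
next
  case (oeq_unit t)
  then show ?case using C.act_ar_unit[of "tO t"] tO_in[of t] F.colour_ob[of "oc t"] by simp
next
  case (oeq_comp p qs tss)
  have "list_all2 (ar_args (opd S) C) qs (map (map tO) tss)"
    using oeq_comp(2) unfolding list_all2_map2 by (rule list_all2_mono) (simp add: tO_args)
  moreover have "map tO (map2 TOp qs tss) = map2 (act_ar C) qs (map (map tO) tss)"
    using list_all2_lengthD[OF oeq_comp(2)] by (auto simp: list_eq_iff_nth_eq)
  ultimately show ?case using C.act_ar_comp[OF oeq_comp(1)] by (simp add: map_concat del: map_map)
next
  case (oeq_perm p ts s)
  then have "set s = {..<length ts}" using length_args by (simp add: perms_iff)
  then show ?case using oeq_perm C.act_ar_perm[of p s "map tO ts"] tO_args[of p ts]
    by (simp add: permuted_map owf_TOp)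
qed auto

lemma natural_T: "awf f \<Longrightarrow> Cmp (total C) (tO (acod f)) (F' (ac f)) = Cmp (total C) (G' (ac f)) (tO (adom f))"
proof (induction rule: awf.induct)
  case (1 t)
  then have "F' (ac (AId t)) = Ide (total C) (F (oc t))" "G' (ac (AId t)) = Ide (total C) (G (oc t))"
    using F.ar_Ide[of "oc t"] G.ar_Ide[of "oc t"] by simp_all
  then show ?case using tO_in[OF 1] C.Cmp_Ide[of "tO t"] C.Ide_Cmp[of "tO t"] by simp
next
  case (2 f g)
  have e: "tO (acod f) = tO (adom g)" "oc (acod f) = oc (adom g)" using tO_cong[OF 2(3)] oc_eq[OF 2(3)] by simp_all
  have F: "F' (ac (ACmp g f)) = Cmp (total C) (F' (ac g)) (F' (ac f))"
    using F.ar_Cmp[of "ac f" "ac g"] 2 e by simp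
  have G: "G' (ac (ACmp g f)) = Cmp (total C) (G' (ac g)) (G' (ac f))"
    using G.ar_Cmp[of "ac f" "ac g"] 2 e by simp
  note t = tO_in[OF awf_adom] tO_in[OF awf_acod]
  have "Cmp (total C) (tO (acod g)) (Cmp (total C) (F' (ac g)) (F' (ac f)))
      = Cmp (total C) (Cmp (total C) (tO (acod g)) (F' (ac g))) (F' (ac f))"
    using 2 t[of f] t[of g] F_arr[of f] F_arr[of g] e by (intro C.Cmp_assoc) auto
  also have "\<dots> = Cmp (total C) (Cmp (total C) (G' (ac g)) (tO (adom g))) (F' (ac f))"
    using 2 by simp
  also have "\<dots> = Cmp (total C) (G' (ac g)) (Cmp (total C) (tO (adom g)) (F' (ac f)))"
    using 2 t[of f] t[of g] F_arr[of f] G_arr[of g] e by (intro C.Cmp_assoc[symmetric]) auto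
  also have "\<dots> = Cmp (total C) (G' (ac g)) (Cmp (total C) (G' (ac f)) (tO (adom f)))"
    using 2 e by simp
  also have "\<dots> = Cmp (total C) (Cmp (total C) (G' (ac g)) (G' (ac f))) (tO (adom f))"
    using 2 t[of f] t[of g] G_arr[of f] G_arr[of g] e by (intro C.Cmp_assoc) auto
  finally show ?case by (simp add: F G)
next
  case (3 p fs)
  then have w: "awf (AOp p fs)" by (simp add: awf_AOp)
  have 4: "owf (TOp p (map adom fs))" "owf (TOp p (map acod fs))"
    using w[unfolded awf_AOp_iff] w[unfolded awf_AOp_iff'] by auto
  have 5: "ar_args (opd S) C p (map tO (map adom fs))" "ar_args (opd S) C p (map tO (map acod fs))"
    using 4 tO_args by blast+
  have 6: "ar_args (opd S) C p (map (\<lambda>f. F' (ac f)) fs)" "ar_args (opd S) C p (map (\<lambda>f. G' (ac f)) fs)"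
    using 3 by (auto simp: ar_args_def comp_def F_arr G_arr cong: map_cong)
  have 7: "map (Cod (total C)) (map (\<lambda>f. F' (ac f)) fs) = map (Dom (total C)) (map tO (map acod fs))"
    "map (Cod (total C)) (map tO (map adom fs)) = map (Dom (total C)) (map (\<lambda>f. G' (ac f)) fs)"
    using 3 by (auto simp: F_arr G_arr tO_in awf_adom awf_acod)
  have 8: "map2 (Cmp (total C)) (map tO (map acod fs)) (map (\<lambda>f. F' (ac f)) fs)
      = map2 (Cmp (total C)) (map (\<lambda>f. G' (ac f)) fs) (map tO (map adom fs))"
    using 3 by (auto simp: list_eq_iff_nth_eq)
  show ?case
    using C.act_ar_Cmp[OF 3(1) 6(1) 5(2) 7(1)] C.act_ar_Cmp[OF 3(1) 5(1) 6(2) 7(2)] 8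
    by (simp add: F'_Op[OF w] G'_Op[OF w] del: map_map)
next
  case (4 p)
  have e: "map tO (map TX (inputs (opd S) p)) = map phi (inputs (opd S) p)" by simp
  show ?case using M.phi_X[OF 4] by (simp add: int_image_simps comp_def)
next
  case (5 u)
  show ?case using M.psi_K[OF 5] by (simp add: int_image_simps)
qed

lemma tO_rep: "owf t \<Longrightarrow> tO (rep (oc t)) = tO t"
  using tO_cong[OF oeq_rep] by simp

lemma cell_exists: "algebra_2cell (opd S) term_alg C F F' G G' (\<lambda>x. tO (rep x))"
proof
  fix x assume "x \<in> Ob (total term_alg)"
  then obtain t where t: "x = oc t" "owf t" by (auto simp: Ob_T)
  show "tO (rep x) \<in> Ar (total C)" "Dom (total C) (tO (rep x)) = F x" "Cod (total C) (tO (rep x)) = G x"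
    using t tO_in by (simp_all add: tO_rep)
next
  fix f assume "f \<in> Ar (total term_alg)"
  then obtain f' where f: "f = ac f'" "awf f'" by (auto simp: Ar_T)
  show "Cmp (total C) (tO (rep (Cod (total term_alg) f))) (F' f) =
        Cmp (total C) (G' f) (tO (rep (Dom (total term_alg) f)))"
    using f natural_T[of f'] by (simp add: tO_rep awf_adom awf_acod)
next
  fix p xs assume p: "p \<in> ops (opd S)" and "ob_args (opd S) term_alg p xs"
  then obtain ts where ts: "xs = map oc ts" "owf (TOp p ts)" by (auto simp: ob_args_T)
  then show "tO (rep (act_ob term_alg p xs)) = act_ar C p (map (\<lambda>x. tO (rep x)) xs)"
    by (simp add: tO_rep owf_TOp comp_def cong: map_cong)
qed

lemma cell_unique:
  assumes "algebra_2cell (opd S) term_alg C F F' G G' t'"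
    and *: "\<forall>a \<in> colours (opd S). t' (X_ob term_int_alg a) = phi a \<and> t' (K_ob term_int_alg a) = psi a"
  shows "owf t \<Longrightarrow> t' (oc t) = tO t"
proof (induction rule: owf.induct)
  interpret t': algebra_2cell "opd S" term_alg C F F' G G' t' by fact
  case (3 p ts)
  then have "owf (TOp p ts)" by (simp add: owf_TOp)
  then show ?case using t'.component_act[of p "map oc ts"] ob_args_T[of p "map oc ts"] 3
    by (auto simp: comp_def cong: map_cong)
qed (use * in \<open>auto simp: term_int_alg_def\<close>)

end

locale term_eval = substitude S + C: categorical_algebra "opd S" C + V: internal_algebra S C V
  for S :: "('c, 'p, 'u) substitude" and C :: "('c, 'p, 'o, 'm) cat_alg" and V
begin

primrec evO :: "('c, 'p) oterm \<Rightarrow> 'o" where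
  "evO (TX a) = X_ob V a"
| "evO (TK a) = K_ob V a"
| "evO (TOp p ts) = act_ob C p (map evO ts)"

primrec evA :: "('c, 'p, 'u) aterm \<Rightarrow> 'm" where
  "evA (AId t) = Ide (total C) (evO t)"
| "evA (ACmp g f) = Cmp (total C) (evA g) (evA f)"
| "evA (AOp p fs) = act_ar C p (map evA fs)"
| "evA (AX p) = X_ar V p"
| "evA (AK u) = K_ar V u"

lemma evO_in: "owf t \<Longrightarrow> evO t \<in> Ob (total C) \<and> colour C (evO t) = tcol t"
proof (induction rule: owf.induct)
  case (3 p ts)
  then have "ob_args (opd S) C p (map evO ts)" by (auto simp: ob_args_def comp_def cong: map_cong)
  with 3 show ?case by (simp add: C.act_ob_in C.colour_act_ob)
qed (auto simp: V.X_ob_in V.K_ob_in V.colour_X_ob V.colour_K_ob)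

lemma evO_args: "owf (TOp p ts) \<Longrightarrow> ob_args (opd S) C p (map evO ts)"
  using evO_in by (auto simp: ob_args_def owf_TOp comp_def cong: map_cong)

lemma evO_cong: "oeq t t' \<Longrightarrow> evO t = evO t'"
proof (induction rule: oeq.induct)
  case (oeq_Op p ts ts')
  have "map evO ts = map evO ts'"
    using oeq_Op.IH by (induction rule: list_all2_induct) auto
  then show ?case by simp
next
  case (oeq_unit t)
  then show ?case using C.act_ob_unit[of "evO t"] evO_in[of t] by simp
next
  case (oeq_comp p qs tss)
  have "list_all2 (ob_args (opd S) C) qs (map (map evO) tss)"
    using oeq_comp(2) unfolding list_all2_map2 by (rule list_all2_mono) (simp add: evO_args)
  moreover have "map evO (map2 TOp qs tss) = map2 (act_ob C) qs (map (map evO) tss)"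
    using list_all2_lengthD[OF oeq_comp(2)] by (auto simp: list_eq_iff_nth_eq)
  ultimately show ?case using C.act_ob_comp[OF oeq_comp(1)] by (simp add: map_concat del: map_map)
next
  case (oeq_perm p ts s)
  then have "set s = {..<length ts}" using length_args by (simp add: perms_iff)
  then show ?case using oeq_perm C.act_ob_perm[of p s "map evO ts"] evO_args[of p ts]
    by (simp add: permuted_map owf_TOp)
qed auto

lemma evA_in: "awf f \<Longrightarrow> evA f \<in> Ar (total C) \<and> Dom (total C) (evA f) = evO (adom f)
    \<and> Cod (total C) (evA f) = evO (acod f)"
proof (induction rule: awf.induct)
  case (2 f g)
  then show ?case using evO_cong[of "acod f" "adom g"] by (simp add: C.Cmp_in C.Dom_Cmp C.Cod_Cmp)
next
  case (3 p fs)
  then have "map (\<lambda>f. colour C (evO (adom f))) fs = inputs (opd S) p"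
    using evO_in awf_adom by (simp cong: map_cong)
  with 3 have "ar_args (opd S) C p (map evA fs)" by (auto simp: ar_args_def comp_def cong: map_cong)
  with 3 show ?case by (simp add: C.act_ar_in C.Dom_act_ar C.Cod_act_ar comp_def cong: map_cong)
next
  case (4 p)
  then show ?case by (simp add: V.X_ar_in V.Dom_X_ar V.Cod_X_ar comp_def)
next
  case (5 u)
  then show ?case by (simp add: V.K_ar_in V.Dom_K_ar V.Cod_K_ar)
qed (simp add: evO_in C.Ide_in C.Dom_Ide C.Cod_Ide)

lemma evA_args: "awf (AOp p fs) \<Longrightarrow> ar_args (opd S) C p (map evA fs)"
  using evA_in evO_in by (auto simp: ar_args_def awf_AOp comp_def awf_adom cong: map_cong)

lemma evA_cong: "aeq f f' \<Longrightarrow> evA f = evA f'"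
proof (induction rule: aeq.induct)
  case (aeq_Id t t')
  then show ?case using evO_cong[OF aeq_Id] by simp
next
  case (aeq_Op p fs fs')
  have "map evA fs = map evA fs'"
    using aeq_Op.IH by (induction rule: list_all2_induct) auto
  then show ?case by simp
next
  case (aeq_Cmp_Id f)
  then show ?case using C.Cmp_Ide[of "evA f"] evA_in[of f] by simp
next
  case (aeq_Id_Cmp f)
  then show ?case using C.Ide_Cmp[of "evA f"] evA_in[of f] by simp
next
  case (aeq_assoc f g h)
  then show ?case using evO_cong[OF aeq_assoc(4)] evO_cong[OF aeq_assoc(5)] evA_in[of f] evA_in[of g] evA_in[of h]
    by (simp add: C.Cmp_assoc)
next
  case (aeq_Op_Id p ts)
  then show ?case using C.act_ar_Ide[of p "map evO ts"] evO_args[of p ts] by (simp add: owf_TOp comp_def)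
next
  case (aeq_Op_Cmp p fs gs)
  have 0: "map (Cod (total C)) (map evA fs) = map (Dom (total C)) (map evA gs)"
    using aeq_Op_Cmp by (auto simp: list_eq_iff_nth_eq list_all2_conv_all_nth awf_AOp evA_in intro: evO_cong)
  have 1: "map evA (map2 ACmp gs fs) = map2 (Cmp (total C)) (map evA gs) (map evA fs)"
    by (auto simp: list_eq_iff_nth_eq)
  show ?case using aeq_Op_Cmp(1,2) 0 C.act_ar_Cmp[of p "map evA fs" "map evA gs"]
    by (simp add: 1 evA_args awf_AOp del: map_map)
next
  case (aeq_unit f)
  then show ?case using C.act_ar_unit[of "evA f"] evA_in[of f] evO_in[of "adom f"] by (simp add: awf_adom)
next
  case (aeq_comp p qs fss)
  have "list_all2 (ar_args (opd S) C) qs (map (map evA) fss)"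
    using aeq_comp(2) unfolding list_all2_map2 by (rule list_all2_mono) (simp add: evA_args)
  moreover have "map evA (map2 AOp qs fss) = map2 (act_ar C) qs (map (map evA) fss)"
    using list_all2_lengthD[OF aeq_comp(2)] by (auto simp: list_eq_iff_nth_eq)
  ultimately show ?case using C.act_ar_comp[OF aeq_comp(1)] by (simp add: map_concat del: map_map)
next
  case (aeq_perm p fs s)
  then have "set s = {..<length fs}" using length_args_ar by (simp add: perms_iff)
  then show ?case using aeq_perm C.act_ar_perm[of p s "map evA fs"] evA_args[of p fs]
    by (simp add: permuted_map awf_AOp)
next
  case (aeq_X_comp p qs)
  then show ?case by (simp add: V.X_ar_comp comp_def)
qed (auto simp: V.X_ar_unit V.X_ar_perm V.K_ar_Ide V.K_ar_Cmp)

definition "EO x = evO (rep x)"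
definition "EA f = evA (rep f)"

lemma EO [simp]: "owf t \<Longrightarrow> EO (oc t) = evO t"
  using evO_cong[OF oeq_rep] by (simp add: EO_def)

lemma EA [simp]: "awf f \<Longrightarrow> EA (ac f) = evA f"
  using evA_cong[OF aeq_rep] by (simp add: EA_def)

lemma eval_morphism: "algebra_morphism (opd S) term_alg C EO EA"
proof
  fix x assume "x \<in> Ob (total term_alg)"
  then obtain t where t: "x = oc t" "owf t" by (auto simp: Ob_T)
  then show "EO x \<in> Ob (total C)" "colour C (EO x) = colour term_alg x"
    "EA (Ide (total term_alg) x) = Ide (total C) (EO x)"
    using evO_in by simp_all
next
  fix f assume "f \<in> Ar (total term_alg)"
  then obtain f' where f: "f = ac f'" "awf f'" by (auto simp: Ar_T)
  then show "EA f \<in> Ar (total C)" "Dom (total C) (EA f) = EO (Dom (total term_alg) f)"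
    "Cod (total C) (EA f) = EO (Cod (total term_alg) f)"
    using evA_in by (simp_all add: awf_adom awf_acod)
  fix g assume "g \<in> Ar (total term_alg)" and e: "Cod (total term_alg) f = Dom (total term_alg) g"
  then obtain g' where g: "g = ac g'" "awf g'" by (auto simp: Ar_T)
  with f e have "oeq (acod f') (adom g')" by (auto dest: oc_eqD simp: awf_adom)
  with f g show "EA (Cmp (total term_alg) g f) = Cmp (total C) (EA g) (EA f)" by simp
next
  fix p xs assume p: "p \<in> ops (opd S)" and "ob_args (opd S) term_alg p xs"
  then obtain ts where ts: "xs = map oc ts" "owf (TOp p ts)" by (auto simp: ob_args_T)
  then show "EO (act_ob term_alg p xs) = act_ob C p (map EO xs)"
    by (simp add: owf_TOp comp_def cong: map_cong)
next
  fix p xs assume p: "p \<in> ops (opd S)" and "ar_args (opd S) term_alg p xs"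
  then obtain fs where fs: "xs = map ac fs" "awf (AOp p fs)" by (auto simp: ar_args_T)
  then show "EA (act_ar term_alg p xs) = act_ar C p (map EA xs)"
    by (simp add: awf_AOp comp_def cong: map_cong)
qed

lemma eval_int: "int_eq S (int_image EO EA term_int_alg) V"
  by (simp add: int_eq_def int_image_def term_int_alg_def)

lemma eval_unique:
  assumes "algebra_morphism (opd S) term_alg C G G'" and e: "int_eq S (int_image G G' term_int_alg) V"
  shows "owf t \<Longrightarrow> G (oc t) = evO t" and "awf f \<Longrightarrow> G' (ac f) = evA f"
proof -
  interpret G: algebra_morphism "opd S" term_alg C G G' by fact
  show 1: "owf t \<Longrightarrow> G (oc t) = evO t" for t
  proof (induction rule: owf.induct)
    case (3 p ts)
    then have "owf (TOp p ts)" by (simp add: owf_TOp)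
    then show ?case using G.ob_act[of p "map oc ts"] ob_args_T[of p "map oc ts"] 3
      by (auto simp: comp_def cong: map_cong)
  qed (use e in \<open>auto simp: int_eq_def int_image_def term_int_alg_def\<close>)
  show "awf f \<Longrightarrow> G' (ac f) = evA f"
  proof (induction rule: awf.induct)
    case (1 t)
    then show ?case using G.ar_Ide[of "oc t"] \<open>owf t \<Longrightarrow> G (oc t) = evO t\<close> by simp
  next
    case (2 f g)
    then show ?case using G.ar_Cmp[of "ac f" "ac g"] oc_eq[OF 2(3)] by simp
  next
    case (3 p fs)
    then have "awf (AOp p fs)" by (simp add: awf_AOp)
    then show ?case using G.ar_act[of p "map ac fs"] ar_args_T[of p "map ac fs"] 3
      by (auto simp: comp_def cong: map_cong)
  qed (use e in \<open>auto simp: int_eq_def int_image_def term_int_alg_def\<close>)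
qed

end

theorem (in substitude) term_alg_universal:
  fixes C :: "('c, 'p, 'o, 'm) cat_alg"
  assumes C: "categorical_algebra (opd S) C"
  shows "universal_for S term_alg term_int_alg C"
  unfolding universal_for_def
proof (intro conjI allI impI)
  fix V :: "('c, 'p, 'u, 'o, 'm) int_alg"
  assume V: "internal_algebra S C V"
  interpret term_eval S C V
    using C V by (intro term_eval.intro substitude_axioms)
  show "\<exists>F F'. algebra_morphism (opd S) term_alg C F F' \<and> int_eq S (int_image F F' term_int_alg) V \<and>
      (\<forall>G G'. algebra_morphism (opd S) term_alg C G G' \<and> int_eq S (int_image G G' term_int_alg) V \<longrightarrow>
         (\<forall>x \<in> Ob (total term_alg). G x = F x) \<and> (\<forall>f \<in> Ar (total term_alg). G' f = F' f))"
  proof (intro exI[of _ EO] exI[of _ EA] conjI eval_morphism eval_int allI impI ballI)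
    fix G G' x assume "algebra_morphism (opd S) term_alg C G G' \<and> int_eq S (int_image G G' term_int_alg) V"
      and "x \<in> Ob (total term_alg)"
    then show "G x = EO x" using eval_unique(1)[of G G'] by (auto simp: Ob_T)
  next
    fix G G' f assume "algebra_morphism (opd S) term_alg C G G' \<and> int_eq S (int_image G G' term_int_alg) V"
      and "f \<in> Ar (total term_alg)"
    then show "G' f = EA f" using eval_unique(2)[of G G'] by (auto simp: Ar_T)
  qed
next
  fix F F' G G' phi psi
  assume "algebra_morphism (opd S) term_alg C F F' \<and> algebra_morphism (opd S) term_alg C G G' \<and>
    internal_morphism S C (int_image F F' term_int_alg) (int_image G G' term_int_alg) phi psi"
  then interpret term_cells S C F F' G G' phi psi
    using C by (intro term_cells.intro substitude_axioms) auto
  show "\<exists>t. algebra_2cell (opd S) term_alg C F F' G G' t \<and>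
      (\<forall>a \<in> colours (opd S). t (X_ob term_int_alg a) = phi a \<and> t (K_ob term_int_alg a) = psi a) \<and>
      (\<forall>t'. algebra_2cell (opd S) term_alg C F F' G G' t' \<and>
         (\<forall>a \<in> colours (opd S). t' (X_ob term_int_alg a) = phi a \<and> t' (K_ob term_int_alg a) = psi a) \<longrightarrow>
         (\<forall>x \<in> Ob (total term_alg). t' x = t x))"
  proof (intro exI[of _ "\<lambda>x. tO (rep x)"] conjI cell_exists allI impI ballI)
    fix a assume "a \<in> colours (opd S)"
    then show "tO (rep (X_ob term_int_alg a)) = phi a" "tO (rep (K_ob term_int_alg a)) = psi a"
      by (simp_all add: term_int_alg_def tO_rep)
  next
    fix t' x
    assume "algebra_2cell (opd S) term_alg C F F' G G' t' \<and>
        (\<forall>a \<in> colours (opd S). t' (X_ob term_int_alg a) = phi a \<and> t' (K_ob term_int_alg a) = psi a)"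
      and "x \<in> Ob (total term_alg)"
    then show "t' x = tO (rep x)" using cell_unique[of t'] by (auto simp: Ob_T tO_rep)
  qed
qed

theorem (in substitude) term_alg_classifier: "classifier S term_alg term_int_alg"
  unfolding classifier_def
  using categorical_algebra_T internal_algebra_T term_alg_universal by blast


section \<open>The operad for pairs satisfies the operad axioms\<close>

lemma relabel_cong: "(\<And>v. v \<in> set (vertices t) \<Longrightarrow> h v = k v) \<Longrightarrow> relabel h t = relabel k t"
  by (induction t) auto

lemma relabel_relabel [simp]: "relabel h (relabel k t) = relabel (\<lambda>v. h (k v)) t"
  by (induction t) auto

lemma relabel_id: "(\<And>v. v \<in> set (vertices t) \<Longrightarrow> h v = v) \<Longrightarrow> relabel h t = t"
  by (induction t) (auto intro: map_idI)

lemma leaves_relabel [simp]: "leaves (relabel h t) = leaves t"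
  by (induction t) (auto intro: arg_cong[where f = concat])

lemma vertices_relabel [simp]: "vertices (relabel h t) = map h (vertices t)"
  by (induction t) (auto simp: map_concat comp_def intro: arg_cong[where f = concat])

lemma insert_cong: "(\<And>v. v \<in> set (vertices t) \<Longrightarrow> f v = g v) \<Longrightarrow> insert_trees f t = insert_trees g t"
proof (induction t)
  case (Node v ts)
  then have e: "map (insert_trees f) ts = map (insert_trees g) ts" by auto
  have "f v = g v" using Node.prems by simp
  then show ?case by (simp only: insert_trees.simps e)
qed simp

lemma insert_relabel: "insert_trees f (relabel h t) = insert_trees (\<lambda>v. f (h v)) t"
  by (induction t) (auto simp: comp_def cong: map_cong)

lemma graft_graft: "set (leaves s) \<subseteq> {..<length us}
    \<Longrightarrow> graft (graft s us) ws = graft s (map (\<lambda>u. graft u ws) us)"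
  by (induction s) (auto simp: subset_iff)

lemma relabel_graft: "set (leaves s) \<subseteq> {..<length us}
    \<Longrightarrow> relabel h (graft s us) = graft (relabel h s) (map (relabel h) us)"
  by (induction s) (auto simp: subset_iff)

lemma graft_Leaf: "set (leaves s) \<subseteq> {..<n} \<Longrightarrow> graft s (map Leaf [0..<n]) = s"
  by (induction s) (auto simp: subset_iff intro!: map_idI)

lemma leaves_graft: "leaves (graft s us) = concat (map (\<lambda>n. leaves (us ! n)) (leaves s))"
proof (induction s)
  case (Node v ts)
  then have "map (\<lambda>t. leaves (graft t us)) ts = map (\<lambda>t. concat (map (\<lambda>n. leaves (us ! n)) (leaves t))) ts"
    by auto
  then have "leaves (graft (Node v ts) us) = concat (map (\<lambda>t. concat (map (\<lambda>n. leaves (us ! n)) (leaves t))) ts)"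
    by (simp only: graft.simps leaves.simps map_map comp_def)
  also have "\<dots> = concat (map (\<lambda>n. leaves (us ! n)) (concat (map leaves ts)))"
    by (induction ts) auto
  finally show ?case by (simp only: leaves.simps)
qed simp

lemma mset_concat_map: "mset (concat (map f xs)) = (\<Sum>x\<in>#mset xs. mset (f x))"
  by (induction xs) auto

lemma vertices_graft:
  "mset (vertices (graft s us)) = mset (vertices s) + (\<Sum>n\<in>#mset (leaves s). mset (vertices (us ! n)))"
proof (induction s)
  case (Node v ts)
  then have "(\<Sum>t\<in>#mset ts. mset (vertices (graft t us)))
      = (\<Sum>t\<in>#mset ts. mset (vertices t) + (\<Sum>n\<in>#mset (leaves t). mset (vertices (us ! n))))"
    by (intro arg_cong[where f = sum_mset] image_mset_cong) simp
  also have "\<dots> = (\<Sum>t\<in>#mset ts. mset (vertices t)) + (\<Sum>n\<in>#mset (concat (map leaves ts)). mset (vertices (us ! n)))"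
    by (induction ts) (auto simp: ac_simps)
  finally show ?case by (simp add: mset_concat_map comp_def)
qed simp

text \<open>\<open>fits r t\<close>: each vertex \<open>v\<close> of \<open>t\<close> has \<open>r v\<close> children.\<close>

fun fits :: "(nat \<Rightarrow> nat) \<Rightarrow> tree \<Rightarrow> bool" where
  "fits r (Leaf n) = True"
| "fits r (Node v ts) = (length ts = r v \<and> (\<forall>t \<in> set ts. fits r t))"

lemma fits_cong: "fits r t \<Longrightarrow> (\<And>v. v \<in> set (vertices t) \<Longrightarrow> r v = r' v) \<Longrightarrow> fits r' t"
  by (induction t) auto

lemma fits_relabel: "fits r (relabel h t) = fits (\<lambda>v. r (h v)) t"
  by (induction t) auto

lemma relabel_insert:
  assumes "\<And>v. v \<in> set (vertices t) \<Longrightarrow> leaves (f v) = [0..<r v]"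
  shows "fits r t \<Longrightarrow> relabel h (insert_trees f t) = insert_trees (\<lambda>v. relabel h (f v)) t"
  using assms
proof (induction t)
  case (Node v ts)
  have fi: "\<forall>t \<in> set ts. fits r t" using Node.prems by simp
  have pr: "\<And>t w. t \<in> set ts \<Longrightarrow> w \<in> set (vertices t) \<Longrightarrow> leaves (f w) = [0..<r w]" using Node.prems by auto
  have e: "map (relabel h) (map (insert_trees f) ts) = map (insert_trees (\<lambda>v. relabel h (f v))) ts"
    unfolding map_map comp_def by (rule map_cong[OF refl], rule Node.IH) (use fi pr in blast)+
  have "set (leaves (f v)) \<subseteq> {..<length ts}" using Node(2) Node(3)[of v] by auto
  then show ?case using relabel_graft[of "f v" "map (insert_trees f) ts" h]
    by (simp only: insert_trees.simps e length_map)
qed simp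

lemma insert_graft:
  assumes "\<And>v. v \<in> set (vertices s) \<Longrightarrow> leaves (f v) = [0..<r v]"
  shows "fits r s \<Longrightarrow> set (leaves s) \<subseteq> {..<length us}
    \<Longrightarrow> insert_trees f (graft s us) = graft (insert_trees f s) (map (insert_trees f) us)"
  using assms
proof (induction s)
  case (Node v ts)
  have fi: "\<forall>t \<in> set ts. fits r t" using Node.prems by simp
  have pr: "\<And>t w. t \<in> set ts \<Longrightarrow> w \<in> set (vertices t) \<Longrightarrow> leaves (f w) = [0..<r w]" using Node.prems by auto
  have le: "\<And>t. t \<in> set ts \<Longrightarrow> set (leaves t) \<subseteq> {..<length us}" using Node.prems by auto
  have e: "map (\<lambda>t. insert_trees f (graft t us)) ts = map (\<lambda>t. graft (insert_trees f t) (map (insert_trees f) us)) ts"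
    by (rule map_cong[OF refl], rule Node.IH) (use fi pr le in blast)+
  have "set (leaves (f v)) \<subseteq> {..<length ts}" using Node(2) Node(4)[of v] by auto
  then show ?case
    using graft_graft[of "f v" "map (insert_trees f) ts" "map (insert_trees f) us"]
    by (simp only: graft.simps insert_trees.simps map_map comp_def e length_map)
qed simp

lemma insert_insert:
  assumes "\<And>v. v \<in> set (vertices t) \<Longrightarrow> leaves (f v) = [0..<r v] \<and> fits r' (f v)"
    and "\<And>v w. v \<in> set (vertices t) \<Longrightarrow> w \<in> set (vertices (f v)) \<Longrightarrow> leaves (g w) = [0..<r' w]"
  shows "fits r t \<Longrightarrow> insert_trees g (insert_trees f t) = insert_trees (\<lambda>v. insert_trees g (f v)) t"
  using assms
proof (induction t)
  case (Node v ts)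
  have fi: "\<forall>t \<in> set ts. fits r t" using Node.prems by simp
  have pr: "\<And>t w. t \<in> set ts \<Longrightarrow> w \<in> set (vertices t) \<Longrightarrow> leaves (f w) = [0..<r w] \<and> fits r' (f w)" using Node.prems by auto
  have pr': "\<And>t w x. t \<in> set ts \<Longrightarrow> w \<in> set (vertices t) \<Longrightarrow> x \<in> set (vertices (f w))
      \<Longrightarrow> leaves (g x) = [0..<r' x]"
    using Node.prems by auto
  have e: "map (insert_trees g) (map (insert_trees f) ts) = map (insert_trees (\<lambda>v. insert_trees g (f v))) ts"
    unfolding map_map comp_def by (rule map_cong[OF refl], rule Node.IH) (use fi pr pr' in blast)+
  have "set (leaves (f v)) \<subseteq> {..<length ts}" using Node(2) Node(3)[of v] by auto
  moreover have "fits r' (f v)" "\<And>w. w \<in> set (vertices (f v)) \<Longrightarrow> leaves (g w) = [0..<r' w]"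
    using Node(3)[of v] Node(4)[of v] by auto
  ultimately show ?case
    using insert_graft[of "f v" g r' "map (insert_trees f) ts"]
    by (simp only: insert_trees.simps e length_map)
qed simp

lemma leaves_insert:
  assumes "\<And>v. v \<in> set (vertices t) \<Longrightarrow> leaves (f v) = [0..<r v]"
  shows "fits r t \<Longrightarrow> leaves (insert_trees f t) = leaves t"
  using assms
proof (induction t)
  case (Node v ts)
  have fi: "\<forall>t \<in> set ts. fits r t" using Node.prems by simp
  have pr: "\<And>t w. t \<in> set ts \<Longrightarrow> w \<in> set (vertices t) \<Longrightarrow> leaves (f w) = [0..<r w]" using Node.prems by auto
  have IH: "\<And>t. t \<in> set ts \<Longrightarrow> leaves (insert_trees f t) = leaves t"
    by (rule Node.IH) (use fi pr in blast)+
  have "leaves (insert_trees f (Node v ts)) = concat (map (\<lambda>n. leaves (map (insert_trees f) ts ! n)) [0..<length ts])"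
    using Node(2) Node(3)[of v] by (simp add: leaves_graft)
  also have "map (\<lambda>n. leaves (map (insert_trees f) ts ! n)) [0..<length ts] = map leaves ts"
    by (rule nth_equalityI) (simp_all add: IH)
  finally show ?case by simp
qed simp

lemma vertices_insert:
  assumes "\<And>v. v \<in> set (vertices t) \<Longrightarrow> leaves (f v) = [0..<r v]"
  shows "fits r t \<Longrightarrow> mset (vertices (insert_trees f t)) = (\<Sum>v\<in>#mset (vertices t). mset (vertices (f v)))"
  using assms
proof (induction t)
  case (Node v ts)
  have fi: "\<forall>t \<in> set ts. fits r t" using Node.prems by simp
  have pr: "\<And>t w. t \<in> set ts \<Longrightarrow> w \<in> set (vertices t) \<Longrightarrow> leaves (f w) = [0..<r w]" using Node.prems by auto
  have IH: "\<And>t. t \<in> set ts \<Longrightarrow> mset (vertices (insert_trees f t)) = (\<Sum>v\<in>#mset (vertices t). mset (vertices (f v)))"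
    by (rule Node.IH) (use fi pr in blast)+
  have "mset (vertices (insert_trees f (Node v ts)))
      = mset (vertices (f v)) + (\<Sum>n\<in>#mset [0..<length ts]. mset (vertices (map (insert_trees f) ts ! n)))"
    using Node(2) Node(3)[of v] by (simp add: vertices_graft)
  also have "(\<Sum>n\<in>#mset [0..<length ts]. mset (vertices (map (insert_trees f) ts ! n)))
      = (\<Sum>n\<in>#mset [0..<length ts]. mset (vertices (insert_trees f (ts ! n))))"
    by (intro arg_cong[where f = sum_mset] image_mset_cong) simp
  also have "\<dots> = (\<Sum>t\<in>#mset (map ((!) ts) [0..<length ts]). mset (vertices (insert_trees f t)))"
    unfolding mset_map by (simp add: image_mset.compositionality comp_def)
  also have "\<dots> = (\<Sum>t\<in>#mset ts. mset (vertices (insert_trees f t)))"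
    by (simp only: map_nth)
  also have "\<dots> = (\<Sum>t\<in>#mset ts. (\<Sum>v\<in>#mset (vertices t). mset (vertices (f v))))"
    by (intro arg_cong[where f = sum_mset] image_mset_cong) (simp add: IH)
  also have "\<dots> = (\<Sum>v\<in>#mset (concat (map vertices ts)). mset (vertices (f v)))"
    by (induction ts) auto
  finally show ?case by simp
qed simp

abbreviation val :: "'i pair_colour \<Rightarrow> nat" where
  "val c \<equiv> length (fst (boundary c))"

lemma boundary_simps [simp]: "boundary (Inl b) = b" "boundary (Inr b) = b"
  by (simp_all add: boundary_def)

lemma otree_fits: "otree cs js t i \<Longrightarrow> fits (\<lambda>v. val (cs ! v)) t \<and> set (vertices t) \<subseteq> {..<length cs}"
proof (induction rule: otree.induct)
  case (otree_Node v "is" i ts)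
  have "\<forall>t \<in> set ts. fits (\<lambda>v. val (cs ! v)) t \<and> set (vertices t) \<subseteq> {..<length cs}"
    using otree_Node.IH by (induction rule: list_all2_induct) auto
  then show ?case using otree_Node list_all2_lengthD[OF otree_Node.IH] by auto
qed simp

lemma ltree_fits: "ltree cs js t i \<Longrightarrow> fits (\<lambda>v. val (cs ! v)) t \<and> set (vertices t) \<subseteq> {..<length cs}"
proof (induction rule: ltree.induct)
  case (ltree_L v "is" i ts)
  have "\<forall>t \<in> set ts. fits (\<lambda>v. val (cs ! v)) t \<and> set (vertices t) \<subseteq> {..<length cs}"
    using ltree_L(3) by (induction rule: list_all2_induct) auto
  then show ?case using ltree_L list_all2_lengthD[OF ltree_L(3)] by auto
next
  case (ltree_O v "is" i ts)
  have "\<forall>t \<in> set ts. fits (\<lambda>v. val (cs ! v)) t \<and> set (vertices t) \<subseteq> {..<length cs}"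
    using ltree_O.IH by (induction rule: list_all2_induct) auto
  then show ?case using ltree_O list_all2_lengthD[OF ltree_O.IH] by auto
qed

lemma tree_of_colour_fits: "tree_of_colour cs c t \<Longrightarrow> fits (\<lambda>v. val (cs ! v)) t \<and> set (vertices t) \<subseteq> {..<length cs}"
  using otree_fits ltree_fits by (fastforce simp: tree_of_colour_def split: sum.splits prod.splits)

lemma otree_relabel:
  assumes "\<And>v. v < length cs \<Longrightarrow> h v < length cs' \<and> cs' ! h v = cs ! v"
  shows "otree cs js t i \<Longrightarrow> otree cs' js (relabel h t) i"
proof (induction rule: otree.induct)
  case (otree_Node v "is" i ts)
  have "list_all2 (otree cs' js) (map (relabel h) ts) is"
    using otree_Node.IH by (induction rule: list_all2_induct) auto
  then show ?case using otree_Node assms[of v] by (auto intro: otree.otree_Node)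
qed (simp add: otree_Leaf)

lemma ltree_relabel:
  assumes "\<And>v. v < length cs \<Longrightarrow> h v < length cs' \<and> cs' ! h v = cs ! v"
  shows "ltree cs js t i \<Longrightarrow> ltree cs' js (relabel h t) i"
proof (induction rule: ltree.induct)
  case (ltree_L v "is" i ts)
  have "list_all2 (\<lambda>t k. \<exists>n < length js. t = Leaf n \<and> k = js ! n) (map (relabel h) ts) is"
    using ltree_L(3) by (induction rule: list_all2_induct) auto
  then show ?case using ltree_L assms[of v] by (auto intro: ltree.ltree_L)
next
  case (ltree_O v "is" i ts)
  have "list_all2 (ltree cs' js) (map (relabel h) ts) is"
    using ltree_O.IH by (induction rule: list_all2_induct) auto
  then show ?case using ltree_O assms[of v] by (auto intro: ltree.ltree_O)
qed

lemma tree_of_colour_relabel: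
  assumes "\<And>v. v < length cs \<Longrightarrow> h v < length cs' \<and> cs' ! h v = cs ! v"
  shows "tree_of_colour cs c t \<Longrightarrow> tree_of_colour cs' c (relabel h t)"
  using otree_relabel[OF assms] ltree_relabel[OF assms]
  by (auto simp: tree_of_colour_def split: sum.splits)

lemma otree_graft: "otree cs is t i \<Longrightarrow> list_all2 (otree cs js) us is \<Longrightarrow> otree cs js (graft t us) i"
proof (induction rule: otree.induct)
  case (otree_Node v ks k ts)
  have "list_all2 (otree cs js) (map (\<lambda>t. graft t us) ts) ks"
    using otree_Node.IH otree_Node.prems by (induction rule: list_all2_induct) auto
  then show ?case using otree_Node by (auto intro: otree.otree_Node)
qed (simp add: list_all2_conv_all_nth)

lemma otree_graft_ltree: "otree cs is t i \<Longrightarrow> list_all2 (ltree cs js) us is \<Longrightarrow> ltree cs js (graft t us) i"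
proof (induction rule: otree.induct)
  case (otree_Node v ks k ts)
  have "list_all2 (ltree cs js) (map (\<lambda>t. graft t us) ts) ks"
    using otree_Node.IH otree_Node.prems by (induction rule: list_all2_induct) auto
  then show ?case using otree_Node by (auto intro: ltree_O)
qed (simp add: list_all2_conv_all_nth)

lemma ltree_graft: "ltree cs is t i
    \<Longrightarrow> list_all2 (\<lambda>t k. \<exists>n < length js. t = Leaf n \<and> k = js ! n) us is \<Longrightarrow> ltree cs js (graft t us) i"
proof (induction rule: ltree.induct)
  case (ltree_L v ks k ts)
  have "list_all2 (\<lambda>t k. \<exists>n < length js. t = Leaf n \<and> k = js ! n) (map (\<lambda>t. graft t us) ts) ks"
  proof (rule list_all2_all_nthI)
    show l: "length (map (\<lambda>t. graft t us) ts) = length ks"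
      using ltree_L(3) by (simp add: list_all2_lengthD)
    fix i assume "i < length (map (\<lambda>t. graft t us) ts)"
    then have i: "i < length ts" by simp
    then obtain n where n: "n < length is" "ts ! i = Leaf n" "ks ! i = is ! n"
      using list_all2_nthD[OF ltree_L(3)] by blast
    then obtain n' where "n' < length js" "us ! n = Leaf n'" "is ! n = js ! n'"
      using list_all2_nthD2[OF ltree_L(4)] by blast
    then show "\<exists>n < length js. map (\<lambda>t. graft t us) ts ! i = Leaf n \<and> ks ! i = js ! n"
      using n i by auto
  qed
  then show ?case using ltree_L by (auto intro: ltree.ltree_L)
next
  case (ltree_O v ks k ts)
  have "list_all2 (ltree cs js) (map (\<lambda>t. graft t us) ts) ks"
    using ltree_O.IH ltree_O.prems by (induction rule: list_all2_induct) auto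
  then show ?case using ltree_O by (auto intro: ltree.ltree_O)
qed

lemma otree_insert:
  assumes "\<And>v. v < length cs \<Longrightarrow> tree_of_colour cs' (cs ! v) (f v)"
  shows "otree cs js t i \<Longrightarrow> otree cs' js (insert_trees f t) i"
proof (induction rule: otree.induct)
  case (otree_Node v "is" i ts)
  have "list_all2 (otree cs' js) (map (insert_trees f) ts) is"
    using otree_Node.IH by (induction rule: list_all2_induct) auto
  then show ?case using assms[of v] otree_Node by (auto simp: tree_of_colour_def intro: otree_graft)
qed (simp add: otree_Leaf)

lemma ltree_insert:
  assumes "\<And>v. v < length cs \<Longrightarrow> tree_of_colour cs' (cs ! v) (f v)"
  shows "ltree cs js t i \<Longrightarrow> ltree cs' js (insert_trees f t) i"
proof (induction rule: ltree.induct)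
  case (ltree_L v "is" i ts)
  have "list_all2 (\<lambda>t k. \<exists>n < length js. t = Leaf n \<and> k = js ! n) (map (insert_trees f) ts) is"
    using ltree_L(3) by (induction rule: list_all2_induct) auto
  then show ?case using assms[of v] ltree_L by (auto simp: tree_of_colour_def intro: ltree_graft)
next
  case (ltree_O v "is" i ts)
  have "list_all2 (ltree cs' js) (map (insert_trees f) ts) is"
    using ltree_O.IH by (induction rule: list_all2_induct) auto
  then show ?case using assms[of v] ltree_O by (auto simp: tree_of_colour_def intro: otree_graft_ltree)
qed

lemma tree_of_colour_insert:
  assumes "\<And>v. v < length cs \<Longrightarrow> tree_of_colour cs' (cs ! v) (f v)"
  shows "tree_of_colour cs c t \<Longrightarrow> tree_of_colour cs' c (insert_trees f t)"
  using otree_insert[OF assms] ltree_insert[OF assms]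
  by (auto simp: tree_of_colour_def split: sum.splits)

lemma length_blocks [simp]: "length (blocks m ns) = length ns"
  by (induction m ns rule: blocks.induct) auto

lemma nth_blocks: "v < length ns \<Longrightarrow> blocks m ns ! v = [m + sum_list (take v ns)..<m + sum_list (take v ns) + ns ! v]"
  by (induction m ns arbitrary: v rule: blocks.induct) (auto simp: nth_Cons ac_simps split: nat.splits)

lemma nth_nth_blocks: "v < length ns \<Longrightarrow> w < ns ! v \<Longrightarrow> blocks m ns ! v ! w = m + sum_list (take v ns) + w"
  by (simp add: nth_blocks)

lemma map_length_blocks: "map length (blocks m ns) = ns"
  by (induction m ns rule: blocks.induct) auto

lemma concat_blocks: "concat (blocks m ns) = [m..<m + sum_list ns]"
proof (induction m ns rule: blocks.induct)
  case (2 m n ns)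
  then show ?case using upt_add_eq_append[of m "m + n" "sum_list ns"] by (simp add: add.assoc)
qed simp

lemma sum_list_concat: "sum_list (concat xss) = sum_list (map sum_list xss)" for xss :: "nat list list"
  by (induction xss) auto

lemma concat_map_concat: "concat (map f (concat xss)) = concat (map (\<lambda>xs. concat (map f xs)) xss)"
  by (induction xss) auto

lemma sum_list_take_less: "w < length ms \<Longrightarrow> x < ms ! w \<Longrightarrow> sum_list (take w ms) + x < sum_list ms"
  for ms :: "nat list"
  by (induction ms arbitrary: w) (auto simp: nth_Cons split: nat.splits)

lemma take_concat: "v < length xss \<Longrightarrow> w \<le> length (xss ! v)
    \<Longrightarrow> take (sum_list (take v (map length xss)) + w) (concat xss) = concat (take v xss) @ take w (xss ! v)"
  by (induction xss arbitrary: v) (auto simp: nth_Cons split: nat.splits)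

lemma nth_concat_blocks:
  assumes "v < length xss" "w < length (xss ! v)"
  shows "concat xss ! (blocks 0 (map length xss) ! v ! w) = xss ! v ! w"
    and "blocks 0 (map length xss) ! v ! w < length (concat xss)"
proof -
  have e: "blocks 0 (map length xss) ! v ! w = sum_list (take v (map length xss)) + w"
    using assms by (simp add: nth_nth_blocks)
  have "concat xss ! (sum_list (take v (map length xss)) + w) = xss ! v ! w
      \<and> sum_list (take v (map length xss)) + w < length (concat xss)"
    using assms by (induction xss arbitrary: v) (auto simp: nth_Cons nth_append split: nat.splits)
  then show "concat xss ! (blocks 0 (map length xss) ! v ! w) = xss ! v ! w"
    "blocks 0 (map length xss) ! v ! w < length (concat xss)"
    unfolding e by auto
qed

lemma perms_mset: "s \<in> perms n \<longleftrightarrow> mset s = mset [0..<n]"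
proof (rule iffI)
  assume "s \<in> perms n"
  then have "distinct s" "set s = set [0..<n]" by (simp_all add: perms_iff atLeast0LessThan)
  then show "mset s = mset [0..<n]" by (rule set_eq_iff_mset_eq_distinct[THEN iffD1, OF _ distinct_upt])
next
  assume *: "mset s = mset [0..<n]"
  have "distinct s" unfolding mset_eq_imp_distinct_iff[OF *] by (rule distinct_upt)
  moreover have "set s = {..<n}" unfolding mset_eq_setD[OF *] by auto
  ultimately show "s \<in> perms n" by (simp only: perms_iff)
qed

lemma perms_length: "s \<in> perms n \<Longrightarrow> length s = n"
  using mset_eq_length[of s "[0..<n]"] by (simp add: perms_mset del: mset_upt)

lemma inv_nth: "distinct s \<Longrightarrow> k < length s \<Longrightarrow> inv_perm s (s ! k) = k"
  unfolding inv_perm_def by (rule inv_into_f_f) (auto simp: inj_on_nth)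

lemma mset_permuted:
  assumes "s \<in> perms (length xs)"
  shows "mset (permuted s xs) = mset xs"
proof -
  have "mset (permuted s xs) = image_mset ((!) xs) (mset s)" by (simp add: permuted_def)
  also have "\<dots> = mset (map ((!) xs) [0..<length xs])"
    unfolding mset_map perms_mset[THEN iffD1, OF assms] ..
  finally show ?thesis by (simp only: map_nth)
qed

lemma length_permuted [simp]: "length (permuted s xs) = length s"
  by (simp add: permuted_def)

lemma nth_permuted [simp]: "k < length s \<Longrightarrow> permuted s xs ! k = xs ! (s ! k)"
  by (simp add: permuted_def)

lemma block_perm_perms: "s \<in> perms (length ns) \<Longrightarrow> block_perm s ns \<in> perms (sum_list ns)"
proof -
  assume "s \<in> perms (length ns)"
  then have "mset (permuted s (blocks 0 ns)) = mset (blocks 0 ns)" by (simp add: mset_permuted)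
  then have "mset (concat (permuted s (blocks 0 ns))) = mset (concat (blocks 0 ns))"
    using mset_concat_map[of id "permuted s (blocks 0 ns)"] mset_concat_map[of id "blocks 0 ns"] by simp
  then show ?thesis by (simp add: perms_mset block_perm_def concat_blocks del: mset_upt)
qed

lemma sum_perm_perms: 
  assumes "list_all2 (\<lambda>s n. s \<in> perms n) ss ns"
  shows "sum_perm ss ns \<in> perms (sum_list ns)"
proof -
  have "mset (concat (map2 permuted ss (blocks m ns))) = mset (concat (blocks m ns))" for m
    using assms by (induction arbitrary: m rule: list_all2_induct) (auto simp: mset_permuted simp del: mset_upt)
  then show ?thesis by (simp add: perms_mset sum_perm_def concat_blocks del: mset_upt)
qed

context
  fixes I :: "'i set"
begin

lemma pair_sel [simp]:
  "colours (pair_operad I) = PBq I <+> PBq I"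
  "inputs (pair_operad I) (cs, c, t) = cs"
  "inputs (pair_operad I) = fst"
  "target (pair_operad I) (cs, c, t) = c"
  "unit_op (pair_operad I) c = ([c], c, Node 0 (map Leaf [0..<val c]))"
  "comp_op (pair_operad I) (cs, c, t) qs = (concat (map fst qs), c,
       insert_trees (\<lambda>v. relabel ((!) (blocks 0 (map (length \<circ> fst) qs) ! v)) (snd (snd (qs ! v)))) t)"
  "perm_op (pair_operad I) (cs, c, t) s = (permuted s cs, c, relabel (inv_perm s) t)"
  "arity (pair_operad I) = length \<circ> fst"
  by (auto simp: pair_operad_def arity_def)

lemma pair_ops: "(cs, c, t) \<in> ops (pair_operad I) \<longleftrightarrow> set cs \<subseteq> PBq I <+> PBq I \<and> c \<in> PBq I <+> PBq I \<and>
    tree_of_colour cs c t \<and> leaves t = [0..<val c] \<and> vertices t \<in> perms (length cs)"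
  by (simp add: pair_operad_def)

lemma pair_opD:
  assumes "q \<in> ops (pair_operad I)"
  shows "set (fst q) \<subseteq> PBq I <+> PBq I" "fst (snd q) \<in> PBq I <+> PBq I" "tree_of_colour (fst q) (fst (snd q)) (snd (snd q))"
    "leaves (snd (snd q)) = [0..<val (fst (snd q))]" "vertices (snd (snd q)) \<in> perms (length (fst q))"
    "set (vertices (snd (snd q))) = {..<length (fst q)}" "fits (\<lambda>v. val (fst q ! v)) (snd (snd q))"
  using assms tree_of_colour_fits by (cases q; fastforce simp: pair_ops perms_iff)+

lemma pair_composable:
  assumes "composable (pair_operad I) (cs, c, t) qs"
  shows "(cs, c, t) \<in> ops (pair_operad I)" "length qs = length cs"
    "\<And>v. v < length cs \<Longrightarrow> qs ! v \<in> ops (pair_operad I) \<and> fst (snd (qs ! v)) = cs ! v"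
proof -
  have *: "map (target (pair_operad I)) qs = cs" and 0: "set qs \<subseteq> ops (pair_operad I)"
    and 1: "(cs, c, t) \<in> ops (pair_operad I)"
    using assms by (auto simp: composable_def)
  show "(cs, c, t) \<in> ops (pair_operad I)" by fact
  show l: "length qs = length cs" using * by auto
  have "target (pair_operad I) (qs ! v) = fst (snd (qs ! v))" for v by (cases "qs ! v") simp
  then show "\<And>v. v < length cs \<Longrightarrow> qs ! v \<in> ops (pair_operad I) \<and> fst (snd (qs ! v)) = cs ! v"
    using * 0 l by (metis nth_map nth_mem subset_iff)
qed

lemma comp_tree:
  assumes "composable (pair_operad I) (cs, c, t) qs" and "ns = map (length \<circ> fst) qs" and "v < length cs"
  shows "tree_of_colour (concat (map fst qs)) (cs ! v) (relabel ((!) (blocks 0 ns ! v)) (snd (snd (qs ! v))))"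
    "leaves (snd (snd (qs ! v))) = [0..<val (cs ! v)]"
    "vertices (snd (snd (qs ! v))) \<in> perms (ns ! v)"
    "\<And>w. w < ns ! v \<Longrightarrow> concat (map fst qs) ! (blocks 0 ns ! v ! w) = fst (qs ! v) ! w"
proof -
  note q = pair_composable[OF assms(1)]
  have q': "qs ! v \<in> ops (pair_operad I)" "fst (snd (qs ! v)) = cs ! v" "v < length qs" "v < length ns"
    using q assms by auto
  have ns: "ns = map length (map fst qs)" using assms by simp
  have *: "blocks 0 ns ! v ! w < length (concat (map fst qs)) \<and>
      concat (map fst qs) ! (blocks 0 ns ! v ! w) = fst (qs ! v) ! w" if "w < length (fst (qs ! v))" for w
    using nth_concat_blocks[of v "map fst qs" w] q' that unfolding ns by simp
  show "tree_of_colour (concat (map fst qs)) (cs ! v) (relabel ((!) (blocks 0 ns ! v)) (snd (snd (qs ! v))))"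
    using pair_opD(3)[OF q'(1)] q'(2) * by (intro tree_of_colour_relabel[of "fst (qs ! v)"]) auto
  show "leaves (snd (snd (qs ! v))) = [0..<val (cs ! v)]"
    "vertices (snd (snd (qs ! v))) \<in> perms (ns ! v)"
    using pair_opD[OF q'(1)] q' by (simp_all add: ns)
  show "\<And>w. w < ns ! v \<Longrightarrow> concat (map fst qs) ! (blocks 0 ns ! v ! w) = fst (qs ! v) ! w"
    using * q' ns by simp
qed

lemma pair_comp_in:
  assumes c: "composable (pair_operad I) (cs, c, t) qs"
  shows "comp_op (pair_operad I) (cs, c, t) qs \<in> ops (pair_operad I)"
proof -
  define ns where "ns = map (length \<circ> fst) qs"
  define f where "f v = relabel ((!) (blocks 0 ns ! v)) (snd (snd (qs ! v)))" for v
  note q = pair_composable[OF c] and ct = comp_tree[OF c ns_def]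
  note p = pair_opD[OF q(1), simplified]
  have f: "leaves (f v) = [0..<val (cs ! v)]" if "v \<in> set (vertices t)" for v
    using ct[of v] that p(6) by (simp add: f_def)
  have "tree_of_colour (concat (map fst qs)) c (insert_trees f t)"
    using p(3) ct(1) unfolding f_def by (intro tree_of_colour_insert[of cs])
  moreover have "leaves (insert_trees f t) = [0..<val c]"
    using leaves_insert[of t f, OF f p(7)] p(4) by simp
  moreover have "mset (vertices (insert_trees f t)) = mset [0..<sum_list ns]"
  proof -
    have "mset (vertices (insert_trees f t)) = (\<Sum>v\<in>#mset (vertices t). mset (vertices (f v)))"
      by (rule vertices_insert[of t f, OF f p(7)])
    also have "mset (vertices t) = mset [0..<length cs]" using p(5) by (simp add: perms_mset)
    also have "(\<Sum>v\<in>#mset [0..<length cs]. mset (vertices (f v))) = (\<Sum>v\<in>#mset [0..<length cs]. mset (blocks 0 ns ! v))"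
    proof (intro arg_cong[where f = sum_mset] image_mset_cong)
      fix v assume "v \<in># mset [0..<length cs]"
      then have v: "v < length cs" by simp
      then have l: "length (blocks 0 ns ! v) = ns ! v" using q(2) by (simp add: nth_blocks ns_def)
      have "mset (vertices (f v)) = image_mset ((!) (blocks 0 ns ! v)) (mset [0..<ns ! v])"
        using ct(3)[OF v] by (simp add: f_def perms_mset)
      also have "\<dots> = mset (map ((!) (blocks 0 ns ! v)) [0..<length (blocks 0 ns ! v)])"
        unfolding mset_map l ..
      finally show "mset (vertices (f v)) = mset (blocks 0 ns ! v)" by (simp only: map_nth)
    qed
    also have "\<dots> = mset (concat (map ((!) (blocks 0 ns)) [0..<length (blocks 0 ns)]))"
      using q(2) by (simp add: mset_concat_map ns_def)
    also have "\<dots> = mset [0..<sum_list ns]" by (simp only: map_nth concat_blocks) simp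
    finally show ?thesis .
  qed
  moreover have "length (concat (map fst qs)) = sum_list ns" by (simp add: length_concat ns_def comp_def)
  moreover have "set (concat (map fst qs)) \<subseteq> PBq I <+> PBq I"
  proof
    fix x assume "x \<in> set (concat (map fst qs))"
    then obtain q where q': "q \<in> set qs" "x \<in> set (fst q)" by auto
    then have "q \<in> ops (pair_operad I)" using c by (auto simp: composable_def)
    then show "x \<in> PBq I <+> PBq I" using pair_opD(1) q' by blast
  qed
  ultimately show ?thesis using p(2) by (simp add: pair_ops perms_mset ns_def[symmetric] f_def[symmetric])
qed

lemma pair_assoc:
  assumes c: "composable (pair_operad I) (cs, c, t) qs"
    and rss: "list_all2 (composable (pair_operad I)) qs rss"
  shows "comp_op (pair_operad I) (comp_op (pair_operad I) (cs, c, t) qs) (concat rss)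
       = comp_op (pair_operad I) (cs, c, t) (map2 (comp_op (pair_operad I)) qs rss)"
proof -
  note q = pair_composable[OF c]
  note p = pair_opD[OF q(1), simplified]
  have l: "length rss = length qs" using rss by (simp add: list_all2_lengthD)
  define qt where "qt v = snd (snd (qs ! v))" for v
  define ns where "ns = map (length \<circ> fst) qs"
  define ms where "ms = map (map (length \<circ> fst)) rss"
  have c': "composable (pair_operad I) (fst (qs ! v), fst (snd (qs ! v)), qt v) (rss ! v)" if "v < length cs" for v
    using rss that q(2) by (auto simp: list_all2_conv_all_nth qt_def)
  note r = pair_composable[OF c'] and rt = comp_tree[OF c' refl] and ct = comp_tree[OF c ns_def]
  have ns: "ns = map length rss" using r(2) q(2) l by (auto simp: list_eq_iff_nth_eq ns_def)
  have nsv: "ns ! v = length (rss ! v)" "length (fst (qs ! v)) = length (rss ! v)" if "v < length cs" for v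
    using that r(2) q(2) l by (auto simp: ns)
  have qv: "set (vertices (qt v)) = {..<length (rss ! v)}" if "v < length cs" for v
    using ct(3)[OF that] nsv that by (simp add: perms_iff qt_def)
  have m2: "map2 (comp_op (pair_operad I)) qs rss ! v = comp_op (pair_operad I) (fst (qs ! v), fst (snd (qs ! v)), qt v) (rss ! v)"
    if "v < length cs" for v
    using that l q(2) by (simp add: qt_def)
  have len: "map (length \<circ> fst) (map2 (comp_op (pair_operad I)) qs rss) = map sum_list ms"
    using l m2 q(2) by (auto simp: list_eq_iff_nth_eq ms_def length_concat comp_def)
  define g where "g m = relabel ((!) (blocks 0 (map (length \<circ> fst) (concat rss)) ! m)) (snd (snd (concat rss ! m)))" for m
  define f where "f v = relabel ((!) (blocks 0 ns ! v)) (qt v)" for v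
  define h where "h v w = relabel ((!) (blocks 0 (ms ! v) ! w)) (snd (snd (rss ! v ! w)))" for v w
  have gB: "g (blocks 0 ns ! v ! w) = relabel ((!) (blocks 0 (map sum_list ms) ! v)) (h v w)"
    if v: "v < length cs" and w: "w < length (rss ! v)" for v w
  proof -
    have 1: "concat rss ! (blocks 0 ns ! v ! w) = rss ! v ! w" "blocks 0 ns ! v ! w < length (concat rss)"
      using nth_concat_blocks[of v rss w] v w l q(2) by (auto simp: ns)
    have 2: "blocks 0 ns ! v ! w = sum_list (take v (map length rss)) + w"
      using v w l q(2) by (simp add: ns nth_nth_blocks)
    have 3: "sum_list (take (blocks 0 ns ! v ! w) (map (length \<circ> fst) (concat rss)))
        = sum_list (take v (map sum_list ms)) + sum_list (take w (ms ! v))"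
      using take_concat[of v ms w] v w l q(2) unfolding 2
      by (simp add: ms_def map_concat comp_def sum_list_concat take_map)
    have "set (vertices (snd (snd (rss ! v ! w)))) = {..<ms ! v ! w}"
      using rt(3)[OF v, of w] r(2)[OF v] w v l q(2) by (simp add: perms_iff ms_def)
    moreover have "blocks 0 (map (length \<circ> fst) (concat rss)) ! (blocks 0 ns ! v ! w) ! x
        = blocks 0 (map sum_list ms) ! v ! (blocks 0 (ms ! v) ! w ! x)" if x: "x < ms ! v ! w" for x
    proof -
      have 4: "ms ! v ! w = length (fst (rss ! v ! w))" "length (ms ! v) = length (rss ! v)" "v < length ms"
        using v w l q(2) by (auto simp: ms_def)
      have 5: "blocks 0 (ms ! v) ! w ! x = sum_list (take w (ms ! v)) + x"
        using w x 4 by (simp add: nth_nth_blocks)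
      have "sum_list (take w (ms ! v)) + x < sum_list (ms ! v)"
        using w x 4 by (simp add: sum_list_take_less)
      then have "blocks 0 (map sum_list ms) ! v ! (blocks 0 (ms ! v) ! w ! x)
          = sum_list (take v (map sum_list ms)) + (sum_list (take w (ms ! v)) + x)"
        using 4 unfolding 5 by (simp add: nth_nth_blocks)
      moreover have "blocks 0 (map (length \<circ> fst) (concat rss)) ! (blocks 0 ns ! v ! w) ! x
          = sum_list (take (blocks 0 ns ! v ! w) (map (length \<circ> fst) (concat rss))) + x"
        using 1 x 4 by (simp add: nth_nth_blocks)
      ultimately show ?thesis by (simp only: 3 add.assoc)
    qed
    ultimately show ?thesis unfolding g_def h_def 1(1) by (auto intro!: relabel_cong)
  qed
  define R where "R m = val (fst (snd (concat rss ! m)))" for m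
  have "insert_trees g (insert_trees f t) = insert_trees (\<lambda>v. insert_trees g (f v)) t"
  proof (rule insert_insert[where r = "\<lambda>v. val (cs ! v)" and r' = R])
    fix v assume "v \<in> set (vertices t)"
    then have v: "v < length cs" using p(6) by simp
    have *: "R (blocks 0 ns ! v ! w) = val (fst (qs ! v) ! w)" "concat rss ! (blocks 0 ns ! v ! w) = rss ! v ! w"
      if w: "w < length (rss ! v)" for w
      using nth_concat_blocks[of v rss w] v w l q(2) r(3)[OF v, of w] nsv[OF v] by (simp_all add: R_def ns)
    have "fits (\<lambda>w. val (fst (qs ! v) ! w)) (qt v)"
      using pair_opD(7) q(3)[OF v] unfolding qt_def by blast
    then have "fits (\<lambda>w. R (blocks 0 ns ! v ! w)) (qt v)"
      by (rule fits_cong) (use *(1) qv[OF v] in simp)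
    then show "leaves (f v) = [0..<val (cs ! v)] \<and> fits R (f v)"
      using ct(2)[OF v] by (simp add: f_def qt_def fits_relabel)
    fix w assume "w \<in> set (vertices (f v))"
    then obtain x where x: "w = blocks 0 ns ! v ! x" "x < length (rss ! v)"
      using qv[OF v] by (auto simp: f_def)
    then show "leaves (g w) = [0..<R w]"
      using rt(2)[OF v, of x] nsv[OF v] *[OF x(2)] by (simp add: g_def)
  qed (use p in simp)
  also have "\<dots> = insert_trees (\<lambda>v. relabel ((!) (blocks 0 (map sum_list ms) ! v)) (insert_trees (h v) (qt v))) t"
  proof (rule insert_cong)
    fix v assume "v \<in> set (vertices t)"
    then have v: "v < length cs" using p(6) by simp
    have "insert_trees g (f v) = insert_trees (\<lambda>w. g (blocks 0 ns ! v ! w)) (qt v)"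
      by (simp add: f_def insert_relabel)
    also have "\<dots> = insert_trees (\<lambda>w. relabel ((!) (blocks 0 (map sum_list ms) ! v)) (h v w)) (qt v)"
      using gB[OF v] qv[OF v] by (intro insert_cong) simp
    also have "\<dots> = relabel ((!) (blocks 0 (map sum_list ms) ! v)) (insert_trees (h v) (qt v))"
    proof (rule relabel_insert[symmetric, where r = "\<lambda>w. val (fst (qs ! v) ! w)"])
      show "fits (\<lambda>w. val (fst (qs ! v) ! w)) (qt v)"
        using pair_opD(7) q(3)[OF v] unfolding qt_def by blast
      show "\<And>w. w \<in> set (vertices (qt v)) \<Longrightarrow> leaves (h v w) = [0..<val (fst (qs ! v) ! w)]"
        using rt(2)[OF v] qv[OF v] nsv[OF v] by (simp add: h_def)
    qed
    finally show "insert_trees g (f v) = relabel ((!) (blocks 0 (map sum_list ms) ! v)) (insert_trees (h v) (qt v))" .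
  qed
  also have "\<dots> = insert_trees (\<lambda>v. relabel ((!) (blocks 0 (map sum_list ms) ! v))
      (snd (snd (map2 (comp_op (pair_operad I)) qs rss ! v)))) t"
  proof (rule insert_cong)
    fix v assume "v \<in> set (vertices t)"
    then have v: "v < length cs" using p(6) by simp
    have "map (length \<circ> fst) (rss ! v) = ms ! v" using v l q(2) by (simp add: ms_def)
    then show "relabel ((!) (blocks 0 (map sum_list ms) ! v)) (insert_trees (h v) (qt v)) =
      relabel ((!) (blocks 0 (map sum_list ms) ! v)) (snd (snd (map2 (comp_op (pair_operad I)) qs rss ! v)))"
      unfolding m2[OF v] h_def by simp
  qed
  finally have trees: "insert_trees g (insert_trees f t) = insert_trees (\<lambda>v. relabel ((!) (blocks 0 (map sum_list ms) ! v))
      (snd (snd (map2 (comp_op (pair_operad I)) qs rss ! v)))) t" .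
  have "map fst (map2 (comp_op (pair_operad I)) qs rss) = map (concat \<circ> map fst) rss"
    using l m2 q(2) by (auto simp: list_eq_iff_nth_eq)
  then have "concat (map fst (concat rss)) = concat (map fst (map2 (comp_op (pair_operad I)) qs rss))"
    by (simp only: concat_map_concat comp_def)
  with trees show ?thesis
    by (simp add: len g_def[symmetric] f_def[symmetric] ns_def[symmetric] qt_def[symmetric] del: map_map)
qed

end

lemma pinv_less: "s \<in> perms n \<Longrightarrow> v < n \<Longrightarrow> inv_perm s v < n"
  and nth_pinv: "s \<in> perms n \<Longrightarrow> v < n \<Longrightarrow> s ! inv_perm s v = v"
proof -
  assume s: "s \<in> perms n" and v: "v < n"
  then have "v \<in> (!) s ` {..<length s}" by (auto simp: perms_iff set_conv_nth)
  then show "inv_perm s v < n" "s ! inv_perm s v = v"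
    unfolding inv_perm_def using inv_into_into[of v "(!) s" "{..<length s}"] f_inv_into_f[of v "(!) s" "{..<length s}"] perms_length[OF s]
    by simp_all
qed

lemma pinv_nth: "s \<in> perms n \<Longrightarrow> k < n \<Longrightarrow> inv_perm s (s ! k) = k"
  using inv_nth[of s k] perms_length[of s n] by (simp add: perms_iff)

lemma perms_less: "s \<in> perms n \<Longrightarrow> k < n \<Longrightarrow> s ! k < n"
  using perms_length[of s n] nth_mem[of k s] by (auto simp: perms_iff)

lemma permuted_permuted: "t \<in> perms (length s) \<Longrightarrow> permuted t (permuted s xs) = permuted (permuted t s) xs"
  by (auto simp: permuted_def perms_iff)

lemma permuted_perms: "s \<in> perms n \<Longrightarrow> t \<in> perms n \<Longrightarrow> permuted t s \<in> perms n"
  using mset_permuted[of t s] perms_length[of s n] perms_mset[of s n] perms_mset[of "permuted t s" n] by simp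

lemma permuted_upt: "permuted [0..<length xs] xs = xs"
  by (simp add: permuted_def map_nth)

lemma map_pinv_perms: 
  assumes "s \<in> perms n" "xs \<in> perms n"
  shows "map (inv_perm s) xs \<in> perms n"
proof -
  have "mset (map (inv_perm s) xs) = mset (map (inv_perm s) s)" using assms by (simp add: perms_mset del: mset_upt)
  also have "map (inv_perm s) s = [0..<n]"
    using perms_length[OF assms(1)] pinv_nth[OF assms(1)] by (simp add: list_eq_iff_nth_eq)
  finally show ?thesis by (simp add: perms_mset)
qed

lemma insert_id: "fits r t \<Longrightarrow> insert_trees (\<lambda>v. Node v (map Leaf [0..<r v])) t = t"
proof (induction t)
  case (Node v ts)
  then have e: "map (insert_trees (\<lambda>v. Node v (map Leaf [0..<r v]))) ts = ts" by (auto intro!: map_idI)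
  have "r v = length ts" using Node.prems by simp
  then show ?case unfolding insert_trees.simps e by (simp add: comp_def map_nth)
qed simp

lemma blocks_1: "v < n \<Longrightarrow> blocks 0 (replicate n 1) ! v = [v]"
  by (simp add: nth_blocks min_def sum_list_replicate)

context
  fixes I :: "'i set"
begin

lemma pair_unit_in: "c \<in> PBq I <+> PBq I \<Longrightarrow> unit_op (pair_operad I) c \<in> ops (pair_operad I)"
proof -
  assume c: "c \<in> PBq I <+> PBq I"
  obtain "is" i where b: "boundary c = (is, i)" by (cases "boundary c")
  have "tree_of_colour [c] c (Node 0 (map Leaf [0..<val c]))"
  proof (cases c)
    case (Inl a)
    have "list_all2 (otree [c] is) (map Leaf [0..<length is]) is"
      by (auto simp: list_all2_conv_all_nth intro: otree_Leaf)
    then have "otree [c] is (Node 0 (map Leaf [0..<length is])) i"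
      using b Inl by (intro otree_Node[of _ _ "is"]) auto
    then show ?thesis using b Inl by (simp add: tree_of_colour_def)
  next
    case (Inr a)
    have "ltree [c] is (Node 0 (map Leaf [0..<length is])) i"
      using b Inr by (intro ltree_L[of _ _ "is"]) (auto simp: list_all2_conv_all_nth)
    then show ?thesis using b Inr by (simp add: tree_of_colour_def)
  qed
  moreover have "concat (map (\<lambda>n. [n]) [0..<n]) = [0..<n]" for n by (induction n) auto
  moreover have "concat (map (\<lambda>n. []) xs) = []" for xs :: "nat list" by (induction xs) auto
  ultimately show ?thesis using c by (simp add: pair_ops comp_def perms_iff lessThan_Suc)
qed

lemma pair_unit_comp:
  assumes p: "(cs, c, t) \<in> ops (pair_operad I)"
  shows "comp_op (pair_operad I) (unit_op (pair_operad I) c) [(cs, c, t)] = (cs, c, t)"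
proof -
  note p' = pair_opD[OF p, simplified]
  have "relabel ((!) [0..<length cs]) t = t" by (rule relabel_id) (use p' in simp)
  moreover have "graft t (map Leaf [0..<val c]) = t" by (rule graft_Leaf) (use p' in auto)
  ultimately show ?thesis by (simp add: comp_def)
qed

lemma pair_comp_unit:
  assumes p: "(cs, c, t) \<in> ops (pair_operad I)"
  shows "comp_op (pair_operad I) (cs, c, t) (map (unit_op (pair_operad I)) cs) = (cs, c, t)"
proof -
  note p' = pair_opD[OF p, simplified]
  have ns: "map (length \<circ> fst) (map (unit_op (pair_operad I)) cs) = replicate (length cs) 1"
    by (induction cs) auto
  have "insert_trees (\<lambda>v. relabel ((!) (blocks 0 (replicate (length cs) 1) ! v))
      (snd (snd (map (unit_op (pair_operad I)) cs ! v)))) t = insert_trees (\<lambda>v. Node v (map Leaf [0..<val (cs ! v)])) t"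
  proof (rule insert_cong)
    fix v assume "v \<in> set (vertices t)"
    then have v: "v < length cs" using p'(6) by simp
    show "relabel ((!) (blocks 0 (replicate (length cs) 1) ! v)) (snd (snd (map (unit_op (pair_operad I)) cs ! v)))
        = Node v (map Leaf [0..<val (cs ! v)])"
      unfolding blocks_1[OF v] using v by (simp add: comp_def)
  qed
  also have "\<dots> = t" using p'(7) by (rule insert_id)
  finally have e: "insert_trees (\<lambda>v. relabel ((!) (blocks 0 (replicate (length cs) 1) ! v))
      (snd (snd (map (unit_op (pair_operad I)) cs ! v)))) t = t" .
  have "concat (map fst (map (unit_op (pair_operad I)) cs)) = cs" by (induction cs) auto
  then show ?thesis unfolding pair_sel(6) ns e by (simp only:)
qed

lemma pair_perm_in:
  assumes p: "(cs, c, t) \<in> ops (pair_operad I)" and s: "s \<in> perms (length cs)"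
  shows "perm_op (pair_operad I) (cs, c, t) s \<in> ops (pair_operad I)"
proof -
  note p' = pair_opD[OF p, simplified]
  have "tree_of_colour (permuted s cs) c (relabel (inv_perm s) t)"
    using p'(3) by (rule tree_of_colour_relabel[rotated])
      (simp add: pinv_less[OF s] nth_pinv[OF s] perms_length[OF s])
  moreover have "map (inv_perm s) (vertices t) \<in> perms (length cs)"
    using map_pinv_perms[OF s] p' by simp
  ultimately show ?thesis using p' set_permuted[OF s] perms_length[OF s] by (simp add: pair_ops)
qed

lemma permuted_block:
  assumes c: "composable (pair_operad I) (cs, c, t) qs" and ns: "ns = map (length \<circ> fst) qs" and v: "v < length cs"
  shows "permuted (blocks 0 ns ! v) (concat (map fst qs)) = fst (qs ! v)"
proof (rule nth_equalityI)
  have l: "length (blocks 0 ns ! v) = ns ! v" "ns ! v = length (fst (qs ! v))"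
    using v ns pair_composable(2)[OF c] by (simp_all add: nth_blocks)
  then show "length (permuted (blocks 0 ns ! v) (concat (map fst qs))) = length (fst (qs ! v))" by simp
  fix w assume "w < length (permuted (blocks 0 ns ! v) (concat (map fst qs)))"
  then show "permuted (blocks 0 ns ! v) (concat (map fst qs)) ! w = fst (qs ! v) ! w"
    using comp_tree(4)[OF c ns v] l by simp
qed

lemma pair_perm_outer:
  assumes c: "composable (pair_operad I) (cs, c, t) qs" and s: "s \<in> perms (length cs)"
  shows "comp_op (pair_operad I) (perm_op (pair_operad I) (cs, c, t) s) (permuted s qs)
    = perm_op (pair_operad I) (comp_op (pair_operad I) (cs, c, t) qs) (block_perm s (map (length \<circ> fst) qs))"
proof -
  note q = pair_composable[OF c]
  note p' = pair_opD[OF q(1), simplified]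
  define ns where "ns = map (length \<circ> fst) qs"
  note ct = comp_tree[OF c ns_def]
  define qt where "qt v = snd (snd (qs ! v))" for v
  define b where "b = block_perm s ns"
  have l: "length ns = length cs" "length s = length cs" using q(2) perms_length[OF s] by (simp_all add: ns_def)
  have b: "b \<in> perms (sum_list ns)" unfolding b_def using s l by (intro block_perm_perms) simp
  have s_len: "set s \<subseteq> {..<length qs}" using s q(2) by (simp add: perms_iff)
  have ns': "map (length \<circ> fst) (permuted s qs) = permuted s ns"
    using s_len by (simp add: ns_def permuted_map)
  have sb: "map length (permuted s (blocks 0 ns)) = permuted s ns"
    using permuted_map[of s "blocks 0 ns" length] s_len l q(2) by (simp add: map_length_blocks)
  have inv_b: "inv_perm b (blocks 0 ns ! v ! w) = blocks 0 (permuted s ns) ! inv_perm s v ! w"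
    if v: "v < length cs" and w: "w < ns ! v" for v w
  proof -
    let ?k = "inv_perm s v"
    have k: "?k < length s" "s ! ?k = v" using pinv_less[OF s v] nth_pinv[OF s v] l by simp_all
    have lv: "length (blocks 0 ns ! v) = ns ! v" using v l by (simp add: nth_blocks)
    have 1: "b ! (blocks 0 (permuted s ns) ! ?k ! w) = blocks 0 ns ! v ! w"
      "blocks 0 (permuted s ns) ! ?k ! w < length b"
      using nth_concat_blocks[of ?k "permuted s (blocks 0 ns)" w] k w lv unfolding sb
      by (simp_all add: b_def block_perm_def)
    show ?thesis using pinv_nth[OF b, of "blocks 0 (permuted s ns) ! ?k ! w"] 1 perms_length[OF b] by simp
  qed
  have qv: "set (vertices (qt v)) = {..<ns ! v}" if "v < length cs" for v
    using ct(3)[OF that] by (simp add: perms_iff qt_def)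
  have "insert_trees (\<lambda>v. relabel ((!) (blocks 0 (permuted s ns) ! v)) (snd (snd (permuted s qs ! v)))) (relabel (inv_perm s) t)
      = insert_trees (\<lambda>v. relabel ((!) (blocks 0 (permuted s ns) ! inv_perm s v)) (snd (snd (permuted s qs ! inv_perm s v)))) t"
    by (simp add: insert_relabel)
  also have "\<dots> = insert_trees (\<lambda>v. relabel (inv_perm b) (relabel ((!) (blocks 0 ns ! v)) (qt v))) t"
  proof (rule insert_cong)
    fix v assume "v \<in> set (vertices t)"
    then have v: "v < length cs" using p' by simp
    have "permuted s qs ! inv_perm s v = qs ! v" using pinv_less[OF s v] nth_pinv[OF s v] l by simp
    then show "relabel ((!) (blocks 0 (permuted s ns) ! inv_perm s v)) (snd (snd (permuted s qs ! inv_perm s v)))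
        = relabel (inv_perm b) (relabel ((!) (blocks 0 ns ! v)) (qt v))"
      using inv_b[OF v] qv[OF v] by (auto simp: qt_def[symmetric] intro!: relabel_cong)
  qed
  also have "\<dots> = relabel (inv_perm b) (insert_trees (\<lambda>v. relabel ((!) (blocks 0 ns ! v)) (qt v)) t)"
    by (rule relabel_insert[symmetric, where r = "\<lambda>v. val (cs ! v)"]) (use ct(2) p' in \<open>auto simp: qt_def\<close>)
  finally have trees: "insert_trees (\<lambda>v. relabel ((!) (blocks 0 (permuted s ns) ! v)) (snd (snd (permuted s qs ! v)))) (relabel (inv_perm s) t)
     = relabel (inv_perm b) (insert_trees (\<lambda>v. relabel ((!) (blocks 0 ns ! v)) (qt v)) t)" .
  have "permuted b (concat (map fst qs)) = concat (map (\<lambda>B. permuted B (concat (map fst qs))) (permuted s (blocks 0 ns)))"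
    by (simp add: b_def block_perm_def permuted_def map_concat)
  also have "map (\<lambda>B. permuted B (concat (map fst qs))) (permuted s (blocks 0 ns)) = map fst (permuted s qs)"
  proof (rule nth_equalityI)
    fix k assume "k < length (map (\<lambda>B. permuted B (concat (map fst qs))) (permuted s (blocks 0 ns)))"
    then have k: "k < length s" by simp
    then have sk: "s ! k < length cs" using perms_less[OF s] l by simp
    show "map (\<lambda>B. permuted B (concat (map fst qs))) (permuted s (blocks 0 ns)) ! k = map fst (permuted s qs) ! k"
      using k permuted_block[OF c ns_def sk] by simp
  qed simp
  finally have e: "permuted b (concat (map fst qs)) = concat (map fst (permuted s qs))" .
  show ?thesis unfolding pair_sel using trees e
    by (simp only: ns' ns_def[symmetric] b_def[symmetric] qt_def)
qed

lemma pair_perm_inner: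
  assumes c: "composable (pair_operad I) (cs, c, t) qs"
    and ss: "list_all2 (\<lambda>q s. s \<in> perms (length (fst q))) qs ss"
  shows "comp_op (pair_operad I) (cs, c, t) (map2 (perm_op (pair_operad I)) qs ss)
    = perm_op (pair_operad I) (comp_op (pair_operad I) (cs, c, t) qs) (sum_perm ss (map (length \<circ> fst) qs))"
proof -
  note q = pair_composable[OF c]
  note p' = pair_opD[OF q(1), simplified]
  define ns where "ns = map (length \<circ> fst) qs"
  note ct = comp_tree[OF c ns_def]
  define qt where "qt v = snd (snd (qs ! v))" for v
  define b where "b = sum_perm ss ns"
  have l: "length ns = length cs" "length ss = length cs"
    using q(2) list_all2_lengthD[OF ss] by (simp_all add: ns_def)
  have sv: "ss ! v \<in> perms (ns ! v)" if "v < length cs" for v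
    using list_all2_nthD[OF ss, of v] that q(2) by (simp add: ns_def)
  have b: "b \<in> perms (sum_list ns)" unfolding b_def
    using sv l by (intro sum_perm_perms) (simp add: list_all2_conv_all_nth)
  have m2: "map2 (perm_op (pair_operad I)) qs ss ! v = (permuted (ss ! v) (fst (qs ! v)), fst (snd (qs ! v)), relabel (inv_perm (ss ! v)) (qt v))"
    if "v < length cs" for v
    using that l q(2) by (cases "qs ! v") (simp add: qt_def)
  have ns': "map (length \<circ> fst) (map2 (perm_op (pair_operad I)) qs ss) = ns"
  proof (rule nth_equalityI)
    fix v assume "v < length (map (length \<circ> fst) (map2 (perm_op (pair_operad I)) qs ss))"
    then have v: "v < length cs" using l q(2) by simp
    then show "map (length \<circ> fst) (map2 (perm_op (pair_operad I)) qs ss) ! v = ns ! v"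
      using m2[OF v] perms_length[OF sv[OF v]] l q(2) by simp
  qed (use l q in simp)
  let ?X = "map2 permuted ss (blocks 0 ns)"
  have X: "?X ! v = permuted (ss ! v) (blocks 0 ns ! v)" if "v < length cs" for v
    using that l by simp
  have sb: "map length ?X = ns"
    using l sv by (auto simp: list_eq_iff_nth_eq perms_length)
  have inv_b: "inv_perm b (blocks 0 ns ! v ! w) = blocks 0 ns ! v ! inv_perm (ss ! v) w"
    if v: "v < length cs" and w: "w < ns ! v" for v w
  proof -
    let ?k = "inv_perm (ss ! v) w"
    have k: "?k < ns ! v" "ss ! v ! ?k = w" "length (ss ! v) = ns ! v"
      using pinv_less[OF sv[OF v] w] nth_pinv[OF sv[OF v] w] perms_length[OF sv[OF v]] by simp_all
    have 1: "b ! (blocks 0 ns ! v ! ?k) = blocks 0 ns ! v ! w" "blocks 0 ns ! v ! ?k < length b"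
      using nth_concat_blocks[of v ?X ?k] k v l X[OF v] unfolding sb by (simp_all add: b_def sum_perm_def)
    show ?thesis using pinv_nth[OF b, of "blocks 0 ns ! v ! ?k"] 1 perms_length[OF b] by simp
  qed
  have qv: "set (vertices (qt v)) = {..<ns ! v}" if "v < length cs" for v
    using ct(3)[OF that] by (simp add: perms_iff qt_def)
  have "insert_trees (\<lambda>v. relabel ((!) (blocks 0 ns ! v)) (snd (snd (map2 (perm_op (pair_operad I)) qs ss ! v)))) t
     = insert_trees (\<lambda>v. relabel (inv_perm b) (relabel ((!) (blocks 0 ns ! v)) (qt v))) t"
  proof (rule insert_cong)
    fix v assume "v \<in> set (vertices t)"
    then have v: "v < length cs" using p' by simp
    show "relabel ((!) (blocks 0 ns ! v)) (snd (snd (map2 (perm_op (pair_operad I)) qs ss ! v)))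
        = relabel (inv_perm b) (relabel ((!) (blocks 0 ns ! v)) (qt v))"
      using inv_b[OF v] qv[OF v] unfolding m2[OF v] by (auto intro!: relabel_cong)
  qed
  also have "\<dots> = relabel (inv_perm b) (insert_trees (\<lambda>v. relabel ((!) (blocks 0 ns ! v)) (qt v)) t)"
    by (rule relabel_insert[symmetric, where r = "\<lambda>v. val (cs ! v)"]) (use ct(2) p' in \<open>auto simp: qt_def\<close>)
  finally have trees: "insert_trees (\<lambda>v. relabel ((!) (blocks 0 ns ! v)) (snd (snd (map2 (perm_op (pair_operad I)) qs ss ! v)))) t
     = relabel (inv_perm b) (insert_trees (\<lambda>v. relabel ((!) (blocks 0 ns ! v)) (qt v)) t)" .
  have e: "permuted b (concat (map fst qs)) = concat (map fst (map2 (perm_op (pair_operad I)) qs ss))"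
  proof -
    have "permuted b (concat (map fst qs)) = concat (map (\<lambda>B. permuted B (concat (map fst qs))) ?X)"
      by (simp add: b_def sum_perm_def permuted_def map_concat)
    also have "map (\<lambda>B. permuted B (concat (map fst qs))) ?X = map fst (map2 (perm_op (pair_operad I)) qs ss)"
    proof (rule nth_equalityI)
      fix v assume "v < length (map (\<lambda>B. permuted B (concat (map fst qs))) ?X)"
      then have v: "v < length cs" using l by simp
      have "permuted (permuted (ss ! v) (blocks 0 ns ! v)) (concat (map fst qs)) = permuted (ss ! v) (fst (qs ! v))"
      proof -
        have "set (ss ! v) = {..<length (blocks 0 ns ! v)}"
          using sv[OF v] v l by (simp add: perms_iff nth_blocks)
        then have "permuted (permuted (ss ! v) (blocks 0 ns ! v)) (concat (map fst qs))
            = permuted (ss ! v) (permuted (blocks 0 ns ! v) (concat (map fst qs)))"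
          unfolding permuted_def[of "permuted (ss ! v) (blocks 0 ns ! v)"] permuted_def[of "blocks 0 ns ! v"]
          by (simp add: permuted_map)
        then show ?thesis by (simp only: permuted_block[OF c ns_def v])
      qed
      then show "map (\<lambda>B. permuted B (concat (map fst qs))) ?X ! v = map fst (map2 (perm_op (pair_operad I)) qs ss) ! v"
        using m2[OF v] v l q(2) by simp
    qed (use l q in simp)
    finally show ?thesis .
  qed
  show ?thesis unfolding pair_sel ns' using trees e
    by (simp only: ns_def[symmetric] b_def[symmetric] qt_def)
qed

theorem coloured_operad_pair: "coloured_operad (pair_operad I)"
proof
  fix p assume p: "p \<in> ops (pair_operad I)"
  obtain cs c t where [simp]: "p = (cs, c, t)" by (cases p)
  note p' = pair_opD[OF p, simplified]
  show "set (inputs (pair_operad I) p) \<subseteq> colours (pair_operad I)" "target (pair_operad I) p \<in> colours (pair_operad I)"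
    using p' by simp_all
  show "comp_op (pair_operad I) (unit_op (pair_operad I) (target (pair_operad I) p)) [p] = p"
    using pair_unit_comp[of cs c t] p by (simp del: pair_sel(5,6))
  show "comp_op (pair_operad I) p (map (unit_op (pair_operad I)) (inputs (pair_operad I) p)) = p"
    using pair_comp_unit[of cs c t] p by (simp del: pair_sel(5,6))
  have "relabel (inv_perm [0..<length cs]) t = t"
  proof (rule relabel_id)
    fix v assume "v \<in> set (vertices t)"
    then have "v < length cs" using p' by simp
    then show "inv_perm [0..<length cs] v = v" using pinv_nth[of "[0..<length cs]" "length cs" v] by (simp add: perms_iff atLeast0LessThan)
  qed
  then show "perm_op (pair_operad I) p [0..<arity (pair_operad I) p] = p" by (simp add: permuted_upt)
  fix s assume "s \<in> perms (arity (pair_operad I) p)"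
  then have s: "s \<in> perms (length cs)" by simp
  show "perm_op (pair_operad I) p s \<in> ops (pair_operad I)" using pair_perm_in[of cs c t s] p s by simp
  show "inputs (pair_operad I) (perm_op (pair_operad I) p s) = permuted s (inputs (pair_operad I) p)"
    "target (pair_operad I) (perm_op (pair_operad I) p s) = target (pair_operad I) p" by simp_all
  fix s' assume "s' \<in> perms (arity (pair_operad I) p)"
  then have s': "s' \<in> perms (length cs)" by simp
  have "relabel (inv_perm s') (relabel (inv_perm s) t) = relabel (inv_perm (permuted s' s)) t"
    unfolding relabel_relabel
  proof (rule relabel_cong)
    fix v assume "v \<in> set (vertices t)"
    then have v: "v < length cs" using p' by simp
    let ?k = "inv_perm s' (inv_perm s v)"
    have k: "?k < length cs" "s' ! ?k = inv_perm s v"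
      using pinv_less[OF s v] pinv_less[OF s'] nth_pinv[OF s'] by simp_all
    have "permuted s' s ! ?k = v" using k perms_length[OF s'] nth_pinv[OF s v] by simp
    then show "?k = inv_perm (permuted s' s) v"
      using pinv_nth[OF permuted_perms[OF s s'] k(1)] by simp
  qed
  moreover have "permuted s' (permuted s cs) = permuted (permuted s' s) cs"
    using s s' perms_length[OF s] by (simp add: permuted_permuted)
  ultimately show "perm_op (pair_operad I) (perm_op (pair_operad I) p s) s' = perm_op (pair_operad I) p (permuted s' s)"
    by (simp del: relabel_relabel length_permuted)
next
  fix a assume a: "a \<in> colours (pair_operad I)"
  show "unit_op (pair_operad I) a \<in> ops (pair_operad I)" using pair_unit_in a by (simp del: pair_sel(5))
  show "inputs (pair_operad I) (unit_op (pair_operad I) a) = [a]" "target (pair_operad I) (unit_op (pair_operad I) a) = a"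
    by simp_all
next
  fix p qs assume c: "composable (pair_operad I) p qs"
  obtain cs c t where p: "p = (cs, c, t)" by (cases p)
  show "comp_op (pair_operad I) p qs \<in> ops (pair_operad I)" using pair_comp_in c unfolding p .
  show "inputs (pair_operad I) (comp_op (pair_operad I) p qs) = concat (map (inputs (pair_operad I)) qs)"
    "target (pair_operad I) (comp_op (pair_operad I) p qs) = target (pair_operad I) p" by (simp_all add: p)
  show "\<And>rss. list_all2 (composable (pair_operad I)) qs rss \<Longrightarrow> comp_op (pair_operad I) (comp_op (pair_operad I) p qs) (concat rss)
      = comp_op (pair_operad I) p (map2 (comp_op (pair_operad I)) qs rss)" using pair_assoc c unfolding p .
  show "\<And>s. s \<in> perms (arity (pair_operad I) p) \<Longrightarrow> comp_op (pair_operad I) (perm_op (pair_operad I) p s) (permuted s qs)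
       = perm_op (pair_operad I) (comp_op (pair_operad I) p qs) (block_perm s (map (arity (pair_operad I)) qs))"
    using pair_perm_outer[OF c[unfolded p]] unfolding p pair_sel(8) by simp
  show "\<And>ss. list_all2 (\<lambda>q s. s \<in> perms (arity (pair_operad I) q)) qs ss \<Longrightarrow>
       comp_op (pair_operad I) p (map2 (perm_op (pair_operad I)) qs ss)
       = perm_op (pair_operad I) (comp_op (pair_operad I) p qs) (sum_perm ss (map (arity (pair_operad I)) qs))"
    using pair_perm_inner[OF c[unfolded p]] unfolding p pair_sel(8) by simp
qed

theorem sigma_free_pair: "sigma_free (pair_operad I)"
  unfolding sigma_free_def
proof (intro ballI impI)
  fix p s assume p: "p \<in> ops (pair_operad I)" and "s \<in> perms (arity (pair_operad I) p)"
    and e: "perm_op (pair_operad I) p s = p"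
  obtain cs c t where [simp]: "p = (cs, c, t)" by (cases p)
  note p' = pair_opD[OF p, simplified]
  have s: "s \<in> perms (length cs)" using \<open>s \<in> _\<close> by simp
  have "relabel (inv_perm s) t = t" using e by simp
  from arg_cong[OF this, of vertices]
  have "map (inv_perm s) (vertices t) = map (\<lambda>v. v) (vertices t)" by simp
  then have f: "\<forall>v \<in> set (vertices t). inv_perm s v = v" unfolding map_eq_conv .
  have "s = [0..<length cs]"
  proof (rule nth_equalityI)
    show "length s = length [0..<length cs]" using perms_length[OF s] by simp
    fix v assume "v < length s"
    then have v: "v < length cs" using perms_length[OF s] by simp
    then have "inv_perm s v = v" using f p'(6) by simp
    then show "s ! v = [0..<length cs] ! v" using nth_pinv[OF s v] v by simp
  qed
  then show "s = [0..<arity (pair_operad I) p]" by simp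
qed

end

lemma substitude_operad_substitude:
  assumes "coloured_operad P"
  shows "substitude (operad_substitude P)"
proof -
  interpret P: coloured_operad P by fact
  interpret A: category "discrete_cat (colours P)"
    by standard (auto simp: discrete_cat_def)
  show ?thesis
  proof (intro substitude.intro substitude_axioms.intro)
    fix u v
    assume "u \<in> Ar (base (operad_substitude P))" "v \<in> Ar (base (operad_substitude P))"
      "Cod (base (operad_substitude P)) u = Dom (base (operad_substitude P)) v"
    then show "eta (operad_substitude P) (Cmp (base (operad_substitude P)) v u)
        = comp_op (opd (operad_substitude P)) (eta (operad_substitude P) v) [eta (operad_substitude P) u]"
      using P.unit_comp[of "unit_op P u"] by (simp add: operad_substitude_def discrete_cat_def P.unit_in P.target_unit)
  qed (simp_all add: operad_substitude_def P.coloured_operad_axioms A.category_axioms,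
      simp_all add: discrete_cat_def P.unit_in P.inputs_unit P.target_unit)
qed

theorem substitude_pair: "substitude (pair_substitude I)"
  unfolding pair_substitude_def by (rule substitude_operad_substitude) (rule coloured_operad_pair)

end

theory Submission
  imports Defs
begin

text \<open>
  In the fundamental groupoid of the classifier, the action of \<open>O\<close> on \<open>L\<close> makes \<open>X\<^sub>L(i\<^sub>1, \<dots>, i\<^sub>k; j)\<close>
  isomorphic to \<open>X\<^sub>O(i\<^sub>1, \<dots>, i\<^sub>k; j)\<close> acting on the objects \<open>X\<^sub>L(i\<^sub>m; i\<^sub>m)\<close>. Together with \<open>X\<^sub>O\<close> and \<open>K\<close>,
  these composites are an internal algebra, so the universal property yields an endofunctor of the
  classifier that replaces \<open>X\<^sub>L\<close> by them, and a natural transformation from it to the identity.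
  In the image of this endofunctor the objects \<open>X\<^sub>L(i; i)\<close> are as inert as the objects \<open>K\<close>: an
  object is a planar tree of copies of \<open>X\<^sub>O\<close> and inert vertices. Contracting all maximal subtrees
  of copies of \<open>X\<^sub>O\<close> to single vertices (also the empty ones, where a unit is inserted) is natural
  with respect to all partial contractions. This gives a zigzag from each object to a normal form
  that is natural in the object, hence all loops are trivial.
\<close>

section \<open>Labelled planar trees\<close>

text \<open>The detour through the endofunctor is forced. Suppose that a copy of
  \<open>X\<^sub>O\<close> carries \<open>X\<^sub>L\<close> on all its inputs while the copy of
  \<open>X\<^sub>O\<close> below it carries a \<open>K\<^sub>L\<close> on another input. The upper
  copy can be contracted into the lower one, or become a single \<open>X\<^sub>L\<close> with what
  lies above it, and in general no further contraction brings the two results together. After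
  splitting, contractions only involve copies of \<open>X\<^sub>O\<close>, whose maximal subtrees
  are disjoint and determined by the tree. Units have to be inserted in empty places because the
  operation without inputs and with target \<open>Inl ([j], j)\<close> produces an
  \<open>X\<^sub>O\<close> from nothing; otherwise its source and its target would have different
  normal forms. Operadic associativity enters through one device: a tree whose vertices are trees
  can be flattened, or read as an outer tree with inner ones. Comparing the two readings yields the
  sources of contractions, their naturality and the morphism from the split algebra to the given
  one. All classifiers in question are retracts of the term classifier, so only the latter is
  analysed.\<close>

datatype (labs_set: 'a, lvs_set: 'b) ptree = Lf 'b | Nd 'a "('a, 'b) ptree list"
  for map: map_pt rel: rel_pt

primrec labs :: "('a, 'b) ptree \<Rightarrow> 'a list" where
  "labs (Lf x) = []"
| "labs (Nd a ss) = a # concat (map labs ss)"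

primrec lvs :: "('a, 'b) ptree \<Rightarrow> 'b list" where
  "lvs (Lf x) = [x]"
| "lvs (Nd a ss) = concat (map lvs ss)"

primrec bind :: "('b \<Rightarrow> ('a, 'c) ptree) \<Rightarrow> ('a, 'b) ptree \<Rightarrow> ('a, 'c) ptree" where
  "bind f (Lf x) = f x"
| "bind f (Nd a ss) = Nd a (map (bind f) ss)"

text \<open>Operations of the operad refer to vertices and leaves by number. Here each number is
  replaced by the datum it stands for, so that renumbering under composition and permutation becomes
  invisible.\<close>

primrec conv :: "(nat \<Rightarrow> 'a) \<Rightarrow> (nat \<Rightarrow> 'b) \<Rightarrow> tree \<Rightarrow> ('a, 'b) ptree" where
  "conv g h (Leaf n) = Lf (h n)"
| "conv g h (Node v ts) = Nd (g v) (map (conv g h) ts)"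

lemma labs_set [simp]: "labs_set s = set (labs s)"
  by (induction s) auto

lemma lvs_set [simp]: "lvs_set s = set (lvs s)"
  by (induction s) auto

lemma labs_map [simp]: "labs (map_pt f g s) = map f (labs s)"
  by (induction s) (auto simp: map_concat comp_def intro!: arg_cong[where f = concat])

lemma lvs_map [simp]: "lvs (map_pt f g s) = map g (lvs s)"
  by (induction s) (auto simp: map_concat comp_def intro!: arg_cong[where f = concat])

lemma map_map_pt [simp]: "map_pt f g (map_pt f' g' s) = map_pt (\<lambda>a. f (f' a)) (\<lambda>x. g (g' x)) s"
  by (induction s) auto

lemma map_pt_eta [simp]: "map_pt f (\<lambda>x. x) s = map_pt f id s" "map_pt (\<lambda>x. x) g s = map_pt id g s"
  by (simp_all add: id_def)

lemma map_pt_cong': "(\<And>a. a \<in> set (labs s) \<Longrightarrow> f a = f' a) \<Longrightarrow> (\<And>x. x \<in> set (lvs s) \<Longrightarrow> g x = g' x)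
    \<Longrightarrow> map_pt f g s = map_pt f' g' s"
  by (rule ptree.map_cong0) auto

lemma labs_conv [simp]: "labs (conv g h t) = map g (vertices t)"
  by (induction t) (auto simp: map_concat comp_def intro!: arg_cong[where f = concat])

lemma lvs_conv [simp]: "lvs (conv g h t) = map h (leaves t)"
  by (induction t) (auto simp: map_concat comp_def intro!: arg_cong[where f = concat])

lemma map_conv [simp]: "map_pt f f' (conv g h t) = conv (\<lambda>v. f (g v)) (\<lambda>n. f' (h n)) t"
  by (induction t) auto

lemma conv_cong: "(\<And>v. v \<in> set (vertices t) \<Longrightarrow> g v = g' v) \<Longrightarrow> (\<And>n. n \<in> set (leaves t) \<Longrightarrow> h n = h' n)
    \<Longrightarrow> conv g h t = conv g' h' t"
  by (induction t) auto

lemma conv_relabel: "conv g h (relabel k t) = conv (\<lambda>v. g (k v)) h t"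
  by (induction t) auto

lemma conv_graft: "set (leaves s) \<subseteq> {..<length us} \<Longrightarrow> conv g h (graft s us) = bind (\<lambda>n. conv g h (us ! n)) (conv g id s)"
  by (induction s) auto

lemma bind_map: "bind f (map_pt g h s) = bind (\<lambda>x. f (h x)) (map_pt g id s)"
  by (induction s) auto

lemma bind_map_id [simp]: "bind f (map_pt id h s) = bind (\<lambda>x. f (h x)) s"
  by (induction s) (auto simp: ptree.map_id)

lemma bind_conv: "bind f (conv g h s) = bind (\<lambda>n. f (h n)) (conv g id s)"
  by (induction s) auto

lemma map_bind: "map_pt g h (bind f s) = bind (\<lambda>x. map_pt g h (f x)) (map_pt g id s)"
  by (induction s) auto

lemma bind_bind [simp]: "bind f (bind g s) = bind (\<lambda>x. bind f (g x)) s"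
  by (induction s) auto

lemma bind_cong: "(\<And>x. x \<in> set (lvs s) \<Longrightarrow> f x = g x) \<Longrightarrow> bind f s = bind g s"
  by (induction s) auto

lemma bind_Lf: "bind (\<lambda>x. Lf (f x)) s = map_pt id f s"
  by (induction s) auto

lemma lvs_bind [simp]: "lvs (bind f s) = concat (map (\<lambda>x. lvs (f x)) (lvs s))"
  by (induction s) (auto simp: concat_map_concat comp_def intro!: arg_cong[where f = concat] map_cong)

lemma set_labs_bind [simp]: "set (labs (bind f s)) = set (labs s) \<union> (\<Union>x\<in>set (lvs s). set (labs (f x)))"
  by (induction s) auto

text \<open>The shape determines how many labels and leaves each child has, so the concatenated
  lists can be cut up again and the children compared one by one.\<close>

lemma ptree_eqI:
  "map_pt (\<lambda>_. ()) (\<lambda>_. ()) s = map_pt (\<lambda>_. ()) (\<lambda>_. ()) s' \<Longrightarrow> labs s = labs s' \<Longrightarrow> lvs s = lvs s' \<Longrightarrow> s = s'"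
proof (induction s arbitrary: s')
  case (Lf x)
  then show ?case by (cases s') auto
next
  case (Nd a ss)
  then obtain ss' where s': "s' = Nd a ss'" by (cases s') auto
  have m: "map (map_pt (\<lambda>_. ()) (\<lambda>_. ())) ss = map (map_pt (\<lambda>_. ()) (\<lambda>_. ())) ss'"
    using Nd.prems(1) s' by simp
  then have len: "length ss = length ss'" by (rule map_eq_imp_length_eq)
  have m': "map_pt (\<lambda>_. ()) (\<lambda>_. ()) (ss ! k) = map_pt (\<lambda>_. ()) (\<lambda>_. ()) (ss' ! k)" if "k < length ss" for k
    using m that len by (metis nth_map)
  have l: "length (labs (ss ! k)) = length (labs (ss' ! k))" "length (lvs (ss ! k)) = length (lvs (ss' ! k))"
    if "k < length ss" for k
    using m'[OF that] by (metis labs_map length_map, metis lvs_map length_map)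
  have "map labs ss = map labs ss'"
    using Nd.prems(2) s' len l by (intro concat_injective) (auto simp: in_set_zip)
  moreover have "map lvs ss = map lvs ss'"
    using Nd.prems(3) s' len l by (intro concat_injective) (auto simp: in_set_zip)
  ultimately have "ss ! k = ss' ! k" if "k < length ss" for k
    using Nd.IH[of "ss ! k" "ss' ! k"] m'[OF that] that len by (metis nth_map nth_mem)
  then have "ss = ss'" using len by (simp add: list_eq_iff_nth_eq)
  then show ?case using s' by simp
qed

lemma conv_inj: "conv id id t = conv id id t' \<Longrightarrow> t = t'"
proof (induction t arbitrary: t')
  case (Node v ts)
  then obtain ts' where t': "t' = Node v ts'" by (cases t') auto
  have m: "map (conv id id) ts = map (conv id id) ts'" using Node.prems unfolding t' conv.simps ptree.inject by blast
  have "ts = ts'"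
    by (rule list.inj_map_strong[OF _ m]) (use Node.IH in blast)
  then show ?case using t' by simp
qed (use conv.simps in \<open>metis id_apply ptree.distinct(1) ptree.inject(1) tree.exhaust\<close>)

section \<open>Canonical numbering of a labelled tree\<close>

definition numbers :: "tree \<Rightarrow> ('a, 'b) ptree \<Rightarrow> bool" where
  "numbers t s \<longleftrightarrow> conv (\<lambda>_. ()) (\<lambda>_. ()) t = map_pt (\<lambda>_. ()) (\<lambda>_. ()) s \<and>
     vertices t = [0..<length (labs s)] \<and> leaves t = [0..<length (lvs s)]"

text \<open>The offsets \<open>k\<close> and \<open>m\<close> carry the induction: each child
  continues the numbering where its left neighbour stopped.\<close>

lemma numbers_exists: "\<exists>t. conv (\<lambda>_. ()) (\<lambda>_. ()) t = map_pt (\<lambda>_. ()) (\<lambda>_. ()) s \<and>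
     vertices t = [k..<k + length (labs s)] \<and> leaves t = [m..<m + length (lvs s)]"
proof (induction s arbitrary: k m)
  case (Lf x)
  then show ?case by (intro exI[of _ "Leaf m"]) simp
next
  case (Nd a ss)
  have "\<exists>ts. map (conv (\<lambda>_. ()) (\<lambda>_. ())) ts = map (map_pt (\<lambda>_. ()) (\<lambda>_. ())) ss \<and>
     concat (map vertices ts) = [k..<k + length (concat (map labs ss))] \<and>
     concat (map leaves ts) = [m..<m + length (concat (map lvs ss))]" for k
    using Nd.IH
  proof (induction ss arbitrary: k m)
    case (Cons s ss)
    obtain t where t: "conv (\<lambda>_. ()) (\<lambda>_. ()) t = map_pt (\<lambda>_. ()) (\<lambda>_. ()) s"
      "vertices t = [k..<k + length (labs s)]" "leaves t = [m..<m + length (lvs s)]"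
      using Cons.prems[of s] by auto
    obtain ts where "map (conv (\<lambda>_. ()) (\<lambda>_. ())) ts = map (map_pt (\<lambda>_. ()) (\<lambda>_. ())) ss"
     "concat (map vertices ts) = [k + length (labs s)..<k + length (labs s) + length (concat (map labs ss))]"
     "concat (map leaves ts) = [m + length (lvs s)..<m + length (lvs s) + length (concat (map lvs ss))]"
      using Cons.IH[of "k + length (labs s)" "m + length (lvs s)"] Cons.prems by auto
    with t show ?case
      using upt_add_eq_append[of k "k + length (labs s)" "length (concat (map labs ss))"]
        upt_add_eq_append[of m "m + length (lvs s)" "length (concat (map lvs ss))"]
      by (intro exI[of _ "t # ts"]) (simp add: add.assoc)
  qed simp
  from this[of "Suc k"] obtain ts where "map (conv (\<lambda>_. ()) (\<lambda>_. ())) ts = map (map_pt (\<lambda>_. ()) (\<lambda>_. ())) ss"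
     "concat (map vertices ts) = [Suc k..<Suc k + length (concat (map labs ss))]"
     "concat (map leaves ts) = [m..<m + length (concat (map lvs ss))]" by auto
  then show ?case by (intro exI[of _ "Node k ts"]) (simp add: upt_conv_Cons del: upt_Suc)
qed

lemma numbers_unique: "numbers t s \<Longrightarrow> numbers t' s \<Longrightarrow> t = t'"
  unfolding numbers_def by (rule conv_inj, rule ptree_eqI) simp_all

text \<open>Vertices are numbered in preorder and leaves from left to right. Every orbit of the
  symmetric groups on operations contains exactly one operation numbered in this way.\<close>

definition numbering :: "('a, 'b) ptree \<Rightarrow> tree" where
  "numbering s = (THE t. numbers t s)"

lemma numbers_numbering: "numbers (numbering s) s"
proof -
  obtain t where "numbers t s" using numbers_exists[of s 0 0] by (auto simp: numbers_def)
  then show ?thesis unfolding numbering_def by (rule theI) (rule numbers_unique[OF _ \<open>numbers t s\<close>])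
qed

lemma numtI: "numbers t s \<Longrightarrow> numbering s = t"
  using numbers_unique numbers_numbering by blast

lemma vertices_numbering [simp]: "vertices (numbering s) = [0..<length (labs s)]"
  and leaves_numbering [simp]: "leaves (numbering s) = [0..<length (lvs s)]"
  using numbers_numbering[of s] by (simp_all add: numbers_def)

lemma numbering_map [simp]: "numbering (map_pt f g s) = numbering s"
  using numbers_numbering[of s] by (intro numtI) (simp add: numbers_def)

lemma conv_numbering: "conv ((!) (labs s)) ((!) (lvs s)) (numbering s) = s"
  using numbers_numbering[of s] by - (rule ptree_eqI, simp_all add: numbers_def map_nth)

lemma conv_numbering_map: "conv (\<lambda>v. f (labs s ! v)) (\<lambda>n. g (lvs s ! n)) (numbering s) = map_pt f g s"
  using arg_cong[OF conv_numbering[of s], of "map_pt f g"] by simp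

section \<open>Trees of coloured vertices and operations\<close>

text \<open>Leaves carry arbitrary data, and \<open>r\<close> supplies the colours of their edges.
  Numbers, colours and whole subtrees will all occur as leaf data.\<close>

primrec root :: "('a \<Rightarrow> 'i pair_colour) \<Rightarrow> ('b \<Rightarrow> 'i) \<Rightarrow> ('a, 'b) ptree \<Rightarrow> 'i" where
  "root col r (Lf x) = r x"
| "root col r (Nd a ss) = snd (boundary (col a))"

definition bq :: "('a \<Rightarrow> 'i pair_colour) \<Rightarrow> ('b \<Rightarrow> 'i) \<Rightarrow> ('a, 'b) ptree \<Rightarrow> 'i bouquet" where
  "bq col r s = (map r (lvs s), root col r s)"

definition colour_of :: "bool \<Rightarrow> 'i bouquet \<Rightarrow> 'i pair_colour" where
  "colour_of l b = (if l then Inr b else Inl b)"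

text \<open>The flag is set for trees with target in \<open>L\<close>, which have no leaves except above a vertex in \<open>L\<close>.\<close>

primrec wft :: "'i set \<Rightarrow> ('a \<Rightarrow> 'i pair_colour) \<Rightarrow> ('b \<Rightarrow> 'i) \<Rightarrow> bool \<Rightarrow> ('a, 'b) ptree \<Rightarrow> bool" where
  "wft I col r l (Lf x) \<longleftrightarrow> \<not> l \<and> r x \<in> I"
| "wft I col r l (Nd a ss) \<longleftrightarrow> col a \<in> PBq I <+> PBq I \<and>
     (case col a of Inl b \<Rightarrow> map (root col r) ss = fst b \<and> list_all id (map (wft I col r l) ss)
      | Inr b \<Rightarrow> l \<and> (\<exists>xs. ss = map Lf xs \<and> map r xs = fst b))"

lemma list_all_id_map [simp]: "list_all id (map P xs) \<longleftrightarrow> (\<forall>x \<in> set xs. P x)"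
  by (induction xs) auto

lemma boundary_colour_of [simp]: "boundary (colour_of l b) = b"
  by (simp add: colour_of_def)

lemma colour_of_in [simp]: "colour_of l b \<in> PBq I <+> PBq I \<longleftrightarrow> b \<in> PBq I"
  by (auto simp: colour_of_def)

lemma Inl_in [simp]: "Inl b \<in> PBq I <+> PBq I \<longleftrightarrow> b \<in> PBq I"
  and Inr_in [simp]: "Inr b \<in> PBq I <+> PBq I \<longleftrightarrow> b \<in> PBq I"
  by auto

lemma PBqD: "b \<in> PBq I \<Longrightarrow> x \<in> set (fst b) \<Longrightarrow> x \<in> I" "b \<in> PBq I \<Longrightarrow> snd b \<in> I"
  by (auto simp: PBq_def)

lemma boundary_in: "c \<in> PBq I <+> PBq I \<Longrightarrow> boundary c \<in> PBq I"
  by auto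

lemma colour_of_boundary [simp]: "colour_of (\<not> isl c) (boundary c) = c"
  by (cases c) (simp_all add: colour_of_def)

lemma isl_colour_of [simp]: "isl (colour_of l b) \<longleftrightarrow> \<not> l"
  by (simp add: colour_of_def)

lemma colour_of_simps [simp]: "colour_of False b = Inl b" "colour_of True b = Inr b"
  by (simp_all add: colour_of_def)

lemma root_map [simp]: "root col r (map_pt f g s) = root (\<lambda>a. col (f a)) (\<lambda>x. r (g x)) s"
  by (cases s) auto

lemma bq_map [simp]: "bq col r (map_pt f g s) = bq (\<lambda>a. col (f a)) (\<lambda>x. r (g x)) s"
  by (simp add: bq_def comp_def)

lemma wft_map [simp]: "wft I col r l (map_pt f g s) = wft I (\<lambda>a. col (f a)) (\<lambda>x. r (g x)) l s"
proof (induction s)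
  case (Nd a ss)
  have e: "map (map_pt f g) ss = map Lf xs \<longleftrightarrow> (\<exists>ys. ss = map Lf ys \<and> xs = map g ys)" for xs
  proof
    assume *: "map (map_pt f g) ss = map Lf xs"
    have "\<exists>y. s = Lf y" if s: "s \<in> set ss" for s
    proof -
      have "map_pt f g s \<in> set (map Lf xs)" using s unfolding *[symmetric] by simp
      then show ?thesis by (cases s) auto
    qed
    then obtain y where y: "\<And>s. s \<in> set ss \<Longrightarrow> s = Lf (y s)" by metis
    have 1: "ss = map Lf (map y ss)" using y by (auto intro!: nth_equalityI)
    have "map Lf xs = map (map_pt f g) (map Lf (map y ss))" using 1 * by metis
    from arg_cong[OF this, of "\<lambda>z. concat (map lvs z)"] have "xs = map g (map y ss)" by (simp add: comp_def)
    with 1 show "\<exists>ys. ss = map Lf ys \<and> xs = map g ys" by blast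
  qed auto
  have "(\<exists>xs. map (map_pt f g) ss = map Lf xs \<and> map r xs = js) = (\<exists>xs. ss = map Lf xs \<and> map (\<lambda>x. r (g x)) xs = js)" for js
    unfolding e by (auto simp: comp_def)
  moreover have "list_all id (map (wft I col r l) (map (map_pt f g) ss)) = list_all id (map (wft I (\<lambda>a. col (f a)) (\<lambda>x. r (g x)) l) ss)"
    using Nd.IH by simp
  moreover have "map (root col r) (map (map_pt f g) ss) = map (root (\<lambda>a. col (f a)) (\<lambda>x. r (g x))) ss"
    by simp
  ultimately show ?case by (simp only: ptree.map wft.simps)
qed auto

lemma root_cong: "(\<And>a. a \<in> set (labs s) \<Longrightarrow> col a = col' a) \<Longrightarrow> (\<And>x. x \<in> set (lvs s) \<Longrightarrow> r x = r' x)
    \<Longrightarrow> root col r s = root col' r' s"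
  by (cases s) auto

lemma bq_cong: "(\<And>a. a \<in> set (labs s) \<Longrightarrow> col a = col' a) \<Longrightarrow> (\<And>x. x \<in> set (lvs s) \<Longrightarrow> r x = r' x)
    \<Longrightarrow> bq col r s = bq col' r' s"
  using root_cong[of s col col' r r'] by (auto simp: bq_def)

lemma wft_cong: "(\<And>a. a \<in> set (labs s) \<Longrightarrow> col a = col' a) \<Longrightarrow> (\<And>x. x \<in> set (lvs s) \<Longrightarrow> r x = r' x)
    \<Longrightarrow> wft I col r l s = wft I col' r' l s"
proof (induction s)
  case (Nd a ss)
  have [simp]: "map (root col r) ss = map (root col' r') ss"
    using Nd.prems by (auto intro!: root_cong)
  have [simp]: "(\<exists>xs. ss = map Lf xs \<and> map r xs = fst b) = (\<exists>xs. ss = map Lf xs \<and> map r' xs = fst b)" for b :: "'c list \<times> 'c"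
  proof -
    have "map r xs = map r' xs" if "ss = map Lf xs" for xs using Nd.prems(2) that by auto
    then show ?thesis by metis
  qed
  have [simp]: "(\<forall>s \<in> set ss. wft I col r l s) = (\<forall>s \<in> set ss. wft I col' r' l s)"
    by (intro ball_cong refl Nd.IH) (use Nd.prems in auto)
  show ?case using Nd.prems(1)[of a] by (simp split: sum.split)
qed auto

lemma wft_bq: "wft I col r l s \<Longrightarrow> bq col r s \<in> PBq I"
proof -
  assume v: "wft I col r l s"
  have "set (map r (lvs s)) \<subseteq> I" using v
  proof (induction s)
    case (Nd a ss)
    show ?case
    proof (cases "col a")
      case (Inr b)
      then obtain xs where "ss = map Lf xs" "map r xs = fst b" "b \<in> PBq I" using Nd.prems by auto
      then show ?thesis by (auto simp: PBq_def comp_def simp flip: set_map)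
    qed (use Nd in \<open>auto simp: image_subset_iff\<close>)
  qed auto
  moreover have "root col r s \<in> I" using v by (cases s) (auto simp: PBq_def dest!: boundary_in)
  ultimately show ?thesis by (auto simp: bq_def PBq_def)
qed

lemma wft_tree:
  assumes "wft I col r l (conv g h t)"
    and "\<And>v. v \<in> set (vertices t) \<Longrightarrow> v < length cs \<and> cs ! v = col (g v)"
    and "\<And>n. n \<in> set (leaves t) \<Longrightarrow> n < length js \<and> js ! n = r (h n)"
  shows "(if l then ltree else otree) cs js t (root col r (conv g h t))"
  using assms
proof (induction t)
  case (Leaf n)
  then show ?case using otree_Leaf[of n js cs] by auto
next
  case (Node v ts)
  have IH: "(if l then ltree else otree) cs js t (root col r (conv g h t))" if t: "t \<in> set ts" and v: "wft I col r l (conv g h t)" for t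
    by (rule Node.IH[OF t v]) (use t Node.prems(2,3) in auto)
  have v: "v < length cs" "cs ! v = col (g v)" using Node.prems(2)[of v] by auto
  show ?case
  proof (cases "col (g v)")
    case (Inl b)
    then have "list_all2 ((if l then ltree else otree) cs js) ts (fst b)"
    proof (intro list_all2_all_nthI)
      have e: "map (root col r) (map (conv g h) ts) = fst b" and a: "\<forall>t \<in> set ts. wft I col r l (conv g h t)"
        using Node.prems(1) Inl by simp_all
      show "length ts = length (fst b)" using arg_cong[OF e, of length] by simp
      fix k assume k: "k < length ts"
      then have "fst b ! k = root col r (conv g h (ts ! k))" using e by (metis length_map nth_map)
      then show "(if l then ltree else otree) cs js (ts ! k) (fst b ! k)" using IH[of "ts ! k"] a k by simp
    qed
    then show ?thesis using v Inl otree_Node[of v cs "fst b" "snd b" js ts] ltree_O[of v cs "fst b" "snd b" js ts]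
      by auto
  next
    case (Inr b)
    then obtain xs where x: "l" "map (conv g h) ts = map Lf xs" "map r xs = fst b" using Node.prems(1) by auto
    have "list_all2 (\<lambda>t k. \<exists>n < length js. t = Leaf n \<and> k = js ! n) ts (fst b)"
    proof (rule list_all2_all_nthI)
      show len: "length ts = length (fst b)" using arg_cong[OF x(2), of length] arg_cong[OF x(3), of length] by simp
      fix k assume k: "k < length ts"
      then have "conv g h (ts ! k) = Lf (xs ! k)" using x(2,3) len by (metis length_map nth_map)
      then obtain n where n: "ts ! k = Leaf n" "h n = xs ! k" by (cases "ts ! k") auto
      have "n \<in> set (leaves (Node v ts))" using n k nth_mem[OF k] by (auto intro!: bexI[of _ "ts ! k"])
      with Node.prems(3) have "n < length js" "js ! n = r (h n)" by blast+
      moreover have "r (xs ! k) = fst b ! k" using x(3) k len by (metis length_map nth_map)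
      ultimately show "\<exists>n < length js. ts ! k = Leaf n \<and> fst b ! k = js ! n" using n by auto
    qed
    then show ?thesis using v Inr x ltree_L[of v cs "fst b" "snd b" js ts] by auto
  qed
qed

text \<open>Together with \<open>ops_wft\<close> this makes well-formed labelled trees and
  operations interchangeable, up to the order of the inputs.\<close>

lemma wft_ops:
  assumes "wft I col r l s"
  shows "(map col (labs s), colour_of l (bq col r s), numbering s) \<in> ops (pair_operad I)"
proof -
  have "(if l then ltree else otree) (map col (labs s)) (map r (lvs s)) (numbering s)
      (root col r (conv ((!) (labs s)) ((!) (lvs s)) (numbering s)))"
    by (rule wft_tree) (use assms in \<open>auto simp: conv_numbering\<close>)
  then have "tree_of_colour (map col (labs s)) (colour_of l (bq col r s)) (numbering s)"
    by (auto simp: tree_of_colour_def conv_numbering colour_of_def bq_def split: if_splits)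
  moreover have "set (map col (labs s)) \<subseteq> PBq I <+> PBq I"
    using assms by (induction s) (auto split: sum.splits)
  ultimately show ?thesis using wft_bq[OF assms] by (simp add: pair_ops perms_mset bq_def)
qed

lemma otree_wft:
  assumes "\<And>v. v < length cs \<Longrightarrow> col (g v) = cs ! v" "\<And>n. n < length js \<Longrightarrow> r (h n) = js ! n"
    and "set cs \<subseteq> PBq I <+> PBq I" "set js \<subseteq> I"
  shows "otree cs js t i \<Longrightarrow> wft I col r False (conv g h t) \<and> root col r (conv g h t) = i"
proof (induction rule: otree.induct)
  case (otree_Node v "is" i ts)
  have "col (g v) \<in> PBq I <+> PBq I" using assms(1)[OF otree_Node(1)] otree_Node(1) assms(3) by auto
  moreover have "map (root col r) (map (conv g h) ts) = is" "\<forall>t \<in> set ts. wft I col r False (conv g h t)"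
    using otree_Node.IH by (induction rule: list_all2_induct) auto
  ultimately show ?case using assms(1)[OF otree_Node(1)] otree_Node(2) by simp
qed (use assms in \<open>auto simp: subset_iff\<close>)

lemma ltree_wft:
  assumes "\<And>v. v < length cs \<Longrightarrow> col (g v) = cs ! v" "\<And>n. n < length js \<Longrightarrow> r (h n) = js ! n"
    and "set cs \<subseteq> PBq I <+> PBq I" "set js \<subseteq> I"
  shows "ltree cs js t i \<Longrightarrow> wft I col r True (conv g h t) \<and> root col r (conv g h t) = i"
proof (induction rule: ltree.induct)
  case (ltree_L v "is" i ts)
  have "col (g v) \<in> PBq I <+> PBq I" using assms(1)[OF ltree_L(1)] ltree_L(1) assms(3) by auto
  moreover have "\<exists>xs. map (conv g h) ts = map Lf xs \<and> map r xs = is"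
    using ltree_L(3)
  proof (induction rule: list_all2_induct)
    case (Cons t ts k ks)
    then obtain xs n where "map (conv g h) ts = map Lf xs" "map r xs = ks" "t = Leaf n" "n < length js" "k = js ! n"
      by auto
    then show ?case using assms(2) by (intro exI[of _ "h n # xs"]) simp
  qed simp
  ultimately show ?case using assms(1)[OF ltree_L(1)] ltree_L(2) by simp
next
  case (ltree_O v "is" i ts)
  have "col (g v) \<in> PBq I <+> PBq I" using assms(1)[OF ltree_O(1)] ltree_O(1) assms(3) by auto
  moreover have "map (root col r) (map (conv g h) ts) = is" "\<forall>t \<in> set ts. wft I col r True (conv g h t)"
    using ltree_O.IH by (induction rule: list_all2_induct) auto
  ultimately show ?case using assms(1)[OF ltree_O(1)] ltree_O(2) by simp
qed

lemma ops_wft: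
  assumes p: "(cs, c, t) \<in> ops (pair_operad I)"
    and g: "\<And>v. v < length cs \<Longrightarrow> col (g v) = cs ! v" and h: "\<And>n. n < val c \<Longrightarrow> r (h n) = fst (boundary c) ! n"
  shows "wft I col r (\<not> isl c) (conv g h t)" "colour_of (\<not> isl c) (bq col r (conv g h t)) = c"
    "bq col r (conv g h t) = boundary c"
proof -
  note p' = pair_opD[OF p, simplified]
  obtain js j where b: "boundary c = (js, j)" by (cases "boundary c")
  have js: "set js \<subseteq> I" using boundary_in[OF p'(2)] b by (auto simp: PBq_def)
  have h': "r (h n) = js ! n" if "n < length js" for n using h that b by simp
  have *: "wft I col r (\<not> isl c) (conv g h t) \<and> root col r (conv g h t) = j"
  proof (cases c)
    case (Inl a)
    then have "otree cs js t j" using p'(3) b by (simp add: tree_of_colour_def)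
    from otree_wft[of cs col g js r h, OF g h' p'(1) js this] show ?thesis using Inl by simp
  next
    case (Inr a)
    then have "ltree cs js t j" using p'(3) b by (simp add: tree_of_colour_def)
    from ltree_wft[of cs col g js r h, OF g h' p'(1) js this] show ?thesis using Inr by simp
  qed
  then show "wft I col r (\<not> isl c) (conv g h t)" by simp
  have "map r (lvs (conv g h t)) = js"
    using p'(4) b h' by (auto intro!: nth_equalityI)
  with * b show "bq col r (conv g h t) = boundary c" by (simp add: bq_def)
  then show "colour_of (\<not> isl c) (bq col r (conv g h t)) = c" by simp
qed

section \<open>Nested trees\<close>

text \<open>The vertices of a nested tree are themselves trees, whose leaves carry the subtrees above the vertex.\<close>

datatype ('a, 'b) nest = NL 'b | NN bool "('a, ('a, 'b) nest) ptree"

primrec nroot :: "('a \<Rightarrow> 'i pair_colour) \<Rightarrow> ('b \<Rightarrow> 'i) \<Rightarrow> ('a, 'b) nest \<Rightarrow> 'i" where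
  "nroot col r (NL x) = r x"
| "nroot col r (NN l q) = root col id (map_pt id (nroot col r) q)"

primrec flat :: "('a, 'b) nest \<Rightarrow> ('a, 'b) ptree" where
  "flat (NL x) = Lf x"
| "flat (NN l q) = bind id (map_pt id flat q)"

text \<open>A vertex keeps its whole inner tree as label, with the nested trees in the leaves,
  because evaluating the label requires the colours of their roots. The recursion passes through
  \<open>map_pt\<close> in order to be primitive; \<open>skel_NN\<close> is the equation in
  use.\<close>

primrec skel :: "('a, 'b) nest \<Rightarrow> (bool \<times> ('a, ('a, 'b) nest) ptree, 'b) ptree" where
  "skel (NL x) = Lf x"
| "skel (NN l q) = Nd (l, q) (lvs (map_pt id skel q))"

text \<open>The conditions are those of \<open>wft\<close> with an inner tree in the role of a
  vertex: above an inner tree with target in \<open>L\<close> there are only bare leaves.\<close>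

primrec wfn :: "'i set \<Rightarrow> ('a \<Rightarrow> 'i pair_colour) \<Rightarrow> ('b \<Rightarrow> 'i) \<Rightarrow> bool \<Rightarrow> ('a, 'b) nest \<Rightarrow> bool" where
  "wfn I col r l (NL x) \<longleftrightarrow> \<not> l \<and> r x \<in> I"
| "wfn I col r l (NN l' q) \<longleftrightarrow> wft I col (nroot col r) l' q \<and>
     (if l' then l \<and> (\<exists>xs. lvs q = map NL xs) else list_all id (lvs (map_pt id (wfn I col r l) q)))"

definition ncol :: "('a \<Rightarrow> 'i pair_colour) \<Rightarrow> ('b \<Rightarrow> 'i) \<Rightarrow> bool \<times> ('a, ('a, 'b) nest) ptree \<Rightarrow> 'i pair_colour" where
  "ncol col r = (\<lambda>(l, q). colour_of l (bq col (nroot col r) q))"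

definition nlabs :: "('a, 'b) nest \<Rightarrow> 'a list" where
  "nlabs n = concat (map (\<lambda>(l, q). labs q) (labs (skel n)))"

lemma ncol_simp [simp]: "ncol col r (l, q) = colour_of l (bq col (nroot col r) q)"
  by (simp add: ncol_def)

lemma nroot_NN [simp]: "nroot col r (NN l q) = root col (nroot col r) q"
  by simp

lemma flat_NN [simp]: "flat (NN l q) = bind flat q"
  by simp

lemma skel_NN [simp]: "skel (NN l q) = Nd (l, q) (map skel (lvs q))"
  by simp

lemma wfn_NN [simp]: "wfn I col r l (NN l' q) \<longleftrightarrow> wft I col (nroot col r) l' q \<and>
     (if l' then l \<and> (\<exists>xs. lvs q = map NL xs) else (\<forall>n \<in> set (lvs q). wfn I col r l n))"
  by simp

declare nroot.simps(2) [simp del] flat.simps(2) [simp del] skel.simps(2) [simp del] wfn.simps(2) [simp del]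

lemma root_bind: "root col r (bind f q) = root col (\<lambda>x. root col r (f x)) q"
  by (cases q) auto

lemma root_flat [simp]: "root col r (flat n) = nroot col r n"
proof (induction n)
  case (NN l q)
  then show ?case by (auto simp: root_bind intro!: root_cong)
qed simp

lemma root_skel [simp]: "root (ncol col r) r (skel n) = nroot col r n"
  by (cases n) (simp_all add: bq_def)

lemma lvs_skel: "lvs (skel n) = lvs (flat n)"
proof (induction n)
  case (NN l q)
  then have "map (\<lambda>n. lvs (skel n)) (lvs q) = map (\<lambda>n. lvs (flat n)) (lvs q)" by auto
  then show ?case by (simp add: comp_def cong: map_cong)
qed simp

lemma bq_skel [simp]: "bq (ncol col r) r (skel n) = bq col r (flat n)"
  by (simp add: bq_def lvs_skel)

lemma skel_wft: "wfn I col r l n \<Longrightarrow> wft I (ncol col r) r l (skel n)"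
proof (induction n)
  case (NN l' q)
  have b: "bq col (nroot col r) q \<in> PBq I" using NN.prems by (auto intro: wft_bq)
  show ?case
  proof (cases l')
    case True
    then obtain xs where x: "lvs q = map NL xs" "l" using NN.prems by auto
    have "map skel (lvs q) = map Lf xs" "map (nroot col r) (lvs q) = map r xs" unfolding x by simp_all
    then show ?thesis using b True x(2) by (auto simp: bq_def)
  next
    case False
    then show ?thesis using b NN by (auto simp: bq_def)
  qed
qed simp

lemma skel_labs_wft: "wfn I col r l n \<Longrightarrow> (l', q) \<in> set (labs (skel n)) \<Longrightarrow> wft I col (nroot col r) l' q"
proof (induction n)
  case (NN l'' q')
  then show ?case by (auto split: if_splits)
qed simp

lemma wft_map_leaf: "wft I col r l (map_pt id h s) = wft I col (\<lambda>x. r (h x)) l s"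
  by simp

text \<open>Only a tree with target in \<open>O\<close> may be grafted upon, since nothing but
  leaves lies above a vertex in \<open>L\<close>. The sort of the result is that of the grafted
  trees.\<close>

lemma wft_bind:
  "wft I col (\<lambda>x. root col r (f x)) False q \<Longrightarrow> (\<And>x. x \<in> set (lvs q) \<Longrightarrow> wft I col r l (f x)) \<Longrightarrow> wft I col r l (bind f q)"
proof (induction q)
  case (Nd a ss)
  have "wft I col r l (bind f s)" if "s \<in> set ss" "wft I col (\<lambda>x. root col r (f x)) False s" for s
    by (rule Nd.IH[OF that]) (use that(1) Nd.prems(2) in auto)
  moreover have "map (root col r) (map (bind f) ss) = map (root col (\<lambda>x. root col r (f x))) ss"
    by (simp add: root_bind)
  ultimately show ?case using Nd.prems(1) by (auto simp del: map_map split: sum.splits)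
qed simp

lemma wft_flat: "wfn I col r l n \<Longrightarrow> wft I col r l (flat n)"
proof (induction n)
  case (NN l' q)
  show ?case
  proof (cases l')
    case True
    then obtain xs where x: "lvs q = map NL xs" "l" using NN.prems by auto
    then have "\<forall>n \<in> set (lvs q). \<exists>x. n = NL x" by auto
    \<comment> \<open>All leaves of an inner tree in \<open>L\<close> are of the form
      \<open>NL\<close>, so that flattening merely renames them.\<close>
    then obtain u where u: "\<And>n. n \<in> set (lvs q) \<Longrightarrow> n = NL (u n)" by metis
    have 1: "bind flat q = bind (\<lambda>n. Lf (u n)) q" by (rule bind_cong) (use u in \<open>metis flat.simps(1)\<close>)
    have "wft I col (nroot col r) True q = wft I col (\<lambda>n. r (u n)) True q"
      by (rule wft_cong) (use u in \<open>auto, metis nroot.simps(1)\<close>)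
    then show ?thesis using NN.prems True x(2) unfolding flat_NN 1 bind_Lf wft_map_leaf by simp
  next
    case False
    then show ?thesis using NN unfolding flat_NN by (intro wft_bind) auto
  qed
qed simp

lemma nlabs_NL [simp]: "nlabs (NL x) = []"
  by (simp add: nlabs_def)

lemma set_nlabs_NN [simp]: "set (nlabs (NN l q)) = set (labs q) \<union> (\<Union>n\<in>set (lvs q). set (nlabs n))"
  by (auto simp: nlabs_def)

lemma labs_flat: "set (labs (flat n)) = set (nlabs n)"
proof (induction n)
  case (NN l q)
  then show ?case by auto
qed simp

text \<open>This is where composition in the operad meets \<open>flat\<close>: grafting at numbered
  leaves becomes \<open>bind\<close>, provided that each inserted tree numbers its leaves like the
  children of the vertex it replaces.\<close>

lemma conv_insert:
  assumes "conv g h t = skel n"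
    and "\<And>v. v \<in> set (vertices t) \<Longrightarrow> leaves (f v) = [0..<length (lvs (snd (g v)))] \<and>
      conv k ((!) (lvs (snd (g v)))) (f v) = snd (g v)"
  shows "conv k h (insert_trees f t) = flat n"
  using assms
proof (induction t arbitrary: n)
  case (Leaf m)
  then show ?case by (cases n) auto
next
  case (Node v ts)
  obtain l q where n: "n = NN l q" "g v = (l, q)" "map (conv g h) ts = map skel (lvs q)"
    using Node.prems(1) by (cases n) auto
  have len: "length ts = length (lvs q)" using arg_cong[OF n(3), of length] by simp
  have f: "leaves (f v) = [0..<length ts]" "conv k ((!) (lvs q)) (f v) = q"
    using Node.prems(2)[of v] n(2) len by auto
  have IH: "conv k h (insert_trees f (ts ! m)) = flat (lvs q ! m)" if m: "m < length ts" for m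
  proof (rule Node.IH)
    show "ts ! m \<in> set ts" using m by simp
    show "conv g h (ts ! m) = skel (lvs q ! m)" using n(3) m len by (metis nth_map)
    fix w assume "w \<in> set (vertices (ts ! m))"
    then have "w \<in> set (vertices (Node v ts))" using m by auto
    then show "leaves (f w) = [0..<length (lvs (snd (g w)))] \<and> conv k ((!) (lvs (snd (g w)))) (f w) = snd (g w)"
      by (rule Node.prems(2))
  qed
  have "conv k h (insert_trees f (Node v ts)) = bind (\<lambda>m. conv k h (map (insert_trees f) ts ! m)) (conv k id (f v))"
    using conv_graft[of "f v" "map (insert_trees f) ts" k h] f(1) by (simp add: atLeast0LessThan)
  also have "\<dots> = bind (\<lambda>m. flat (lvs q ! m)) (conv k id (f v))"
    by (rule bind_cong) (use f(1) IH in auto)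
  also have "\<dots> = bind flat (conv k ((!) (lvs q)) (f v))" unfolding bind_conv[of flat] ..
  finally show ?case using f(2) n(1) by simp
qed

text \<open>A nested tree is an instance of operadic composition: the operation \<open>nest_op\<close> on the vertices of its
  skeleton is composed with the operations \<open>nest_ops\<close> on these vertices.\<close>

definition tree_op :: "('a \<Rightarrow> 'i pair_colour) \<Rightarrow> ('b \<Rightarrow> 'i) \<Rightarrow> bool \<Rightarrow> ('a, 'b) ptree \<Rightarrow> 'i pair_op" where
  "tree_op col r l s = (map col (labs s), colour_of l (bq col r s), numbering s)"

definition nest_op :: "('a \<Rightarrow> 'i pair_colour) \<Rightarrow> ('b \<Rightarrow> 'i) \<Rightarrow> bool \<Rightarrow> ('a, 'b) nest \<Rightarrow> 'i pair_op" where
  "nest_op col r l n = tree_op (ncol col r) r l (skel n)"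

definition nest_ops :: "('a \<Rightarrow> 'i pair_colour) \<Rightarrow> ('b \<Rightarrow> 'i) \<Rightarrow> ('a, 'b) nest \<Rightarrow> 'i pair_op list" where
  "nest_ops col r n = map (\<lambda>(l, q). tree_op col (nroot col r) l q) (labs (skel n))"

lemma tree_op_sel [simp]: "fst (tree_op col r l s) = map col (labs s)" "fst (snd (tree_op col r l s)) = colour_of l (bq col r s)"
  by (simp_all add: tree_op_def)

lemma tree_op_ops: "wft I col r l s \<Longrightarrow> tree_op col r l s \<in> ops (pair_operad I)"
  unfolding tree_op_def by (rule wft_ops)

lemma nest_composable:
  assumes "wfn I col r l n"
  shows "composable (pair_operad I) (nest_op col r l n) (nest_ops col r n)"
proof -
  have "nest_op col r l n \<in> ops (pair_operad I)" unfolding nest_op_def by (rule tree_op_ops[OF skel_wft[OF assms]])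
  moreover have "set (nest_ops col r n) \<subseteq> ops (pair_operad I)"
    using skel_labs_wft[OF assms] tree_op_ops by (fastforce simp: nest_ops_def)
  moreover have "map (target (pair_operad I)) (nest_ops col r n) = inputs (pair_operad I) (nest_op col r l n)"
    by (auto simp: nest_ops_def nest_op_def tree_op_def)
  ultimately show ?thesis by (simp only: composable_def)
qed

text \<open>Operadic composition numbers the vertices block by block, in the order of
  \<open>nlabs\<close>, which is in general not the preorder of the flattened tree. Hence some tree
  \<open>t\<close> appears instead of the canonical numbering, and it is pinned down through
  \<open>conv\<close>.\<close>

lemma nest_comp:
  assumes "wfn I col r l n"
  obtains t where "comp_op (pair_operad I) (nest_op col r l n) (nest_ops col r n) = (map col (nlabs n), colour_of l (bq col r (flat n)), t)"
    and "conv ((!) (nlabs n)) ((!) (lvs (flat n))) t = flat n"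
proof -
  let ?Q = "labs (skel n)"
  let ?ns = "map (length \<circ> fst) (nest_ops col r n)"
  let ?f = "\<lambda>v. relabel ((!) (blocks 0 ?ns ! v)) (snd (snd (nest_ops col r n ! v)))"
  let ?t = "insert_trees ?f (numbering (skel n))"
  have ns: "?ns = map length (map (\<lambda>(l, q). labs q) ?Q)" by (auto simp: nest_ops_def tree_op_def)
  have "conv ((!) (nlabs n)) ((!) (lvs (skel n))) ?t = flat n"
  proof (rule conv_insert[OF conv_numbering])
    fix v assume "v \<in> set (vertices (numbering (skel n)))"
    then have v: "v < length ?Q" by simp
    obtain l' q where lq: "?Q ! v = (l', q)" by (cases "?Q ! v")
    have f: "?f v = relabel ((!) (blocks 0 ?ns ! v)) (numbering q)" using v lq by (simp add: nest_ops_def tree_op_def)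
    have *: "nlabs n ! (blocks 0 ?ns ! v ! w) = labs q ! w" if "w < length (labs q)" for w
      unfolding ns nlabs_def using nth_concat_blocks(1)[of v "map (\<lambda>(l, q). labs q) ?Q" w] v lq that by simp
    have "conv ((!) (nlabs n)) ((!) (lvs q)) (?f v) = conv ((!) (labs q)) ((!) (lvs q)) (numbering q)"
      unfolding f conv_relabel by (rule conv_cong) (use * in auto)
    then show "leaves (?f v) = [0..<length (lvs (snd (?Q ! v)))] \<and>
        conv ((!) (nlabs n)) ((!) (lvs (snd (?Q ! v)))) (?f v) = snd (?Q ! v)"
      using lq f conv_numbering[of q] by simp
  qed
  moreover have "concat (map fst (nest_ops col r n)) = map col (nlabs n)"
    by (auto simp: nest_ops_def nlabs_def map_concat tree_op_def comp_def intro!: arg_cong[where f = concat])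
  ultimately show ?thesis
    by (intro that[of ?t]) (simp_all add: nest_op_def tree_op_def lvs_skel)
qed

text \<open>The right permutation is \<open>vertices t\<close> itself, the list of vertex numbers in
  preorder: its inverse sends each number to its preorder position.\<close>

lemma perm_tree_op:
  assumes p: "(cs, c, t) \<in> ops (pair_operad I)" and g: "\<And>v. v < length cs \<Longrightarrow> col (g v) = cs ! v"
    and h: "\<And>n. n < val c \<Longrightarrow> r (h n) = fst (boundary c) ! n"
  shows "perm_op (pair_operad I) (cs, c, t) (vertices t) = tree_op col r (\<not> isl c) (conv g h t)"
proof -
  note p' = pair_opD[OF p, simplified]
  have "map (inv_perm (vertices t)) (vertices t) = [0..<length (vertices t)]"
    using perms_length[OF p'(5)] pinv_nth[OF p'(5)] by (auto intro!: nth_equalityI)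
  then have "numbering (conv g h t) = relabel (inv_perm (vertices t)) t"
    using p'(4) by (intro numtI) (simp add: numbers_def conv_relabel)
  moreover have "colour_of (\<not> isl c) (bq col r (conv g h t)) = c"
    by (rule ops_wft(2)[OF p]) (simp_all add: g h)
  moreover have "map col (labs (conv g h t)) = permuted (vertices t) cs"
    using p'(6) g by (simp add: permuted_def)
  ultimately show ?thesis by (simp add: tree_op_def)
qed

lemma tree_op_map [simp]: "tree_op col r l (map_pt f g s) = tree_op (\<lambda>a. col (f a)) (\<lambda>x. r (g x)) l s"
  by (simp add: tree_op_def comp_def)

lemma tree_op_cong: "(\<And>a. a \<in> set (labs s) \<Longrightarrow> col a = col' a) \<Longrightarrow> (\<And>x. x \<in> set (lvs s) \<Longrightarrow> r x = r' x)
    \<Longrightarrow> tree_op col r l s = tree_op col' r' l s"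
  using bq_cong[of s col col' r r'] by (simp add: tree_op_def)

section \<open>Evaluation of labelled trees in an algebra\<close>

text \<open>An algebra in sets, separated from the category structure so that it can be instantiated
  twice, by the objects and by the arrows of a categorical algebra.\<close>

locale pair_algebra =
  fixes I :: "'i set" and A :: "'x set" and col :: "'x \<Rightarrow> 'i pair_colour" and act :: "'i pair_op \<Rightarrow> 'x list \<Rightarrow> 'x"
  assumes col_in: "x \<in> A \<Longrightarrow> col x \<in> PBq I <+> PBq I"
    and act_in: "p \<in> ops (pair_operad I) \<Longrightarrow> set xs \<subseteq> A \<Longrightarrow> map col xs = fst p \<Longrightarrow> act p xs \<in> A"
    and col_act: "p \<in> ops (pair_operad I) \<Longrightarrow> set xs \<subseteq> A \<Longrightarrow> map col xs = fst p \<Longrightarrow> col (act p xs) = fst (snd p)"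
    and act_unit: "x \<in> A \<Longrightarrow> act (unit_op (pair_operad I) (col x)) [x] = x"
    and act_comp: "composable (pair_operad I) p qs \<Longrightarrow> list_all2 (\<lambda>q xs. set xs \<subseteq> A \<and> map col xs = fst q) qs xss
      \<Longrightarrow> act (comp_op (pair_operad I) p qs) (concat xss) = act p (map2 act qs xss)"
    and act_perm: "p \<in> ops (pair_operad I) \<Longrightarrow> s \<in> perms (length (fst p)) \<Longrightarrow> set xs \<subseteq> A \<Longrightarrow> map col xs = fst p
      \<Longrightarrow> act (perm_op (pair_operad I) p s) (permuted s xs) = act p xs"
begin

definition eval :: "('b \<Rightarrow> 'i) \<Rightarrow> bool \<Rightarrow> ('x, 'b) ptree \<Rightarrow> 'x" where
  "eval r l s = act (tree_op col r l s) (labs s)"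

lemma eval_in: "wft I col r l s \<Longrightarrow> set (labs s) \<subseteq> A \<Longrightarrow> eval r l s \<in> A"
  and col_eval: "wft I col r l s \<Longrightarrow> set (labs s) \<subseteq> A \<Longrightarrow> col (eval r l s) = colour_of l (bq col r s)"
  using act_in[OF tree_op_ops, of col r l s "labs s"] col_act[OF tree_op_ops, of col r l s "labs s"]
  by (simp_all add: eval_def tree_op_def)

lemma eval_map_leaf [simp]: "eval r l (map_pt id h s) = eval (\<lambda>x. r (h x)) l s"
  by (simp add: eval_def tree_op_def)

lemma eval_cong: "(\<And>x. x \<in> set (lvs s) \<Longrightarrow> r x = r' x) \<Longrightarrow> eval r l s = eval r' l s"
  using bq_cong[of s col col r r'] by (simp add: eval_def tree_op_def)

text \<open>Equivariance reduces an arbitrary numbering of the vertices to the canonical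
  one.\<close>

lemma act_eval:
  assumes p: "(cs, c, t) \<in> ops (pair_operad I)" and xs: "set xs \<subseteq> A" "map col xs = cs"
    and h: "\<And>n. n < val c \<Longrightarrow> r (h n) = fst (boundary c) ! n"
  shows "act (cs, c, t) xs = eval r (\<not> isl c) (conv ((!) xs) h t)"
proof -
  have v: "vertices t \<in> perms (length cs)" using pair_opD(5)[OF p] by simp
  have "perm_op (pair_operad I) (cs, c, t) (vertices t) = tree_op col r (\<not> isl c) (conv ((!) xs) h t)"
    using xs(2) h by (intro perm_tree_op[OF p]) auto
  then show ?thesis using act_perm[OF p, of "vertices t" xs] v xs by (simp add: eval_def permuted_def)
qed

lemma eval_unit:
  fixes xs :: "'b list"
  assumes x: "x \<in> A" and r: "map r xs = fst (boundary (col x))"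
  shows "eval r (\<not> isl (col x)) (Nd x (map Lf xs)) = x"
proof -
  have len: "length xs = val (col x)" using r by (metis length_map)
  have u: "unit_op (pair_operad I) (col x) \<in> ops (pair_operad I)" by (rule pair_unit_in[OF col_in[OF x]])
  have "map (\<lambda>n. Lf (xs ! n)) [0..<val (col x)] = (map Lf xs :: ('x, 'b) ptree list)"
    using len by (auto intro!: nth_equalityI)
  moreover have "r (xs ! n) = fst (boundary (col x)) ! n" if "n < val (col x)" for n
    using r len that by (metis nth_map)
  ultimately show ?thesis
    using act_eval[OF u[unfolded pair_sel], of "[x]" r "(!) xs"] act_unit[OF x] x by (simp add: comp_def)
qed

text \<open>The axiom \<open>act_comp\<close> freed of numberings: the inner trees may be evaluated
  first. The blockwise numbering of the composite and the numbering of the skeleton are both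
  absorbed by \<open>act_eval\<close>.\<close>

lemma eval_flat:
  assumes n: "wfn I col r l n" and A: "set (nlabs n) \<subseteq> A"
  shows "eval r l (flat n) = eval r l (map_pt (\<lambda>(l', q). eval (nroot col r) l' q) id (skel n))"
proof -
  let ?Q = "labs (skel n)"
  let ?xss = "map (\<lambda>(l, q). labs q) ?Q" and ?f = "\<lambda>(l', q). eval (nroot col r) l' q"
  have Q: "wft I col (nroot col r) l' q" "set (labs q) \<subseteq> A" if "(l', q) \<in> set ?Q" for l' q
    using skel_labs_wft[OF n that] A that by (auto simp: nlabs_def)
  have c: "composable (pair_operad I) (nest_op col r l n) (nest_ops col r n)" by (rule nest_composable[OF n])
  obtain t where t: "comp_op (pair_operad I) (nest_op col r l n) (nest_ops col r n) = (map col (nlabs n), colour_of l (bq col r (flat n)), t)"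
    "conv ((!) (nlabs n)) ((!) (lvs (flat n))) t = flat n" using nest_comp[OF n] .
  have op: "(map col (nlabs n), colour_of l (bq col r (flat n)), t) \<in> ops (pair_operad I)"
    unfolding t(1)[symmetric] using c by (cases "nest_op col r l n") (simp only: pair_comp_in)
  have p: "nest_op col r l n \<in> ops (pair_operad I)" using c by (simp add: composable_def)
  have "eval r l (flat n) = act (map col (nlabs n), colour_of l (bq col r (flat n)), t) (nlabs n)"
    using act_eval[OF op A refl, of r "(!) (lvs (flat n))"] t(2) by (simp add: bq_def)
  also have "\<dots> = act (comp_op (pair_operad I) (nest_op col r l n) (nest_ops col r n)) (concat ?xss)"
    by (simp add: t(1) nlabs_def)
  also have "\<dots> = act (nest_op col r l n) (map2 act (nest_ops col r n) ?xss)"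
  proof (rule act_comp[OF c], rule list_all2_all_nthI)
    fix v assume "v < length (nest_ops col r n)"
    then have v: "v < length ?Q" by (simp add: nest_ops_def)
    obtain l' q where lq: "?Q ! v = (l', q)" by (cases "?Q ! v")
    have "set (labs q) \<subseteq> A" using Q(2)[of l' q] nth_mem[OF v] lq by simp
    then show "set (?xss ! v) \<subseteq> A \<and> map col (?xss ! v) = fst (nest_ops col r n ! v)"
      using v lq by (simp add: nest_ops_def tree_op_def)
  qed (simp add: nest_ops_def)
  also have "map2 act (nest_ops col r n) ?xss = map ?f ?Q"
    by (auto simp: nest_ops_def eval_def list_eq_iff_nth_eq split: prod.split)
  also have "act (nest_op col r l n) (map ?f ?Q) = eval r l (conv ((!) (map ?f ?Q)) ((!) (lvs (skel n))) (numbering (skel n)))"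
  proof -
    have "eval (nroot col r) l' q \<in> A \<and> col (eval (nroot col r) l' q) = colour_of l' (bq col (nroot col r) q)"
      if "(l', q) \<in> set ?Q" for l' q
      using eval_in[OF Q(1)[OF that] Q(2)[OF that]] col_eval[OF Q(1)[OF that] Q(2)[OF that]] by blast
    then have "set (map ?f ?Q) \<subseteq> A" "map col (map ?f ?Q) = fst (nest_op col r l n)"
      by (auto simp: nest_op_def tree_op_def)
    then show ?thesis
      using act_eval[of "fst (nest_op col r l n)" "fst (snd (nest_op col r l n))" "snd (snd (nest_op col r l n))" "map ?f ?Q" r "(!) (lvs (skel n))"] p
      by (auto simp: nest_op_def tree_op_def bq_def lvs_skel)
  qed
  also have "conv ((!) (map ?f ?Q)) ((!) (lvs (skel n))) (numbering (skel n)) = map_pt ?f id (skel n)"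
    unfolding conv_numbering_map[of ?f "skel n" id, symmetric] by (rule conv_cong) auto
  finally show ?thesis .
qed

lemma outer_wft:
  assumes "wfn I col r l n" "set (nlabs n) \<subseteq> A"
  shows "wft I col r l (map_pt (\<lambda>(l', q). eval (nroot col r) l' q) id (skel n))"
proof -
  have "col (eval (nroot col r) l' q) = colour_of l' (bq col (nroot col r) q)" if q: "(l', q) \<in> set (labs (skel n))" for l' q
    by (rule col_eval[OF skel_labs_wft[OF assms(1) q]]) (use assms(2) q in \<open>auto simp: nlabs_def\<close>)
  then have "wft I (\<lambda>x. col (case x of (l', q) \<Rightarrow> eval (nroot col r) l' q)) r l (skel n) = wft I (ncol col r) r l (skel n)"
    by (intro wft_cong) auto
  then show ?thesis using skel_wft[OF assms(1)] by simp
qed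

end

lemma pair_substitude_simps [simp]: "opd (pair_substitude I) = pair_operad I"
  "base (pair_substitude I) = discrete_cat (PBq I <+> PBq I)"
  "eta (pair_substitude I) = unit_op (pair_operad I)"
  by (simp_all add: pair_substitude_def operad_substitude_def)

section \<open>Evaluation of labelled trees in a categorical algebra\<close>

locale pair_cat = categorical_algebra "pair_operad I" C
  for I :: "'i set" and C :: "('i pair_colour, 'i pair_op, 'o, 'm) cat_alg"
begin

text \<open>An arrow is assigned the colour of its domain; by \<open>colour_Cod\<close> this is also
  the colour of its codomain.\<close>

abbreviation acol :: "'m \<Rightarrow> 'i pair_colour" where
  "acol f \<equiv> colour C (Dom (total C) f)"

sublocale ob: pair_algebra I "Ob (total C)" "colour C" "act_ob C"
proof
  show "\<And>x. x \<in> Ob (total C) \<Longrightarrow> colour C x \<in> PBq I <+> PBq I" using colour_in by simp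
  show "\<And>p qs xss. composable (pair_operad I) p qs \<Longrightarrow>
       list_all2 (\<lambda>q xs. set xs \<subseteq> Ob (total C) \<and> map (colour C) xs = fst q) qs xss \<Longrightarrow>
       act_ob C (comp_op (pair_operad I) p qs) (concat xss) = act_ob C p (map2 (act_ob C) qs xss)"
    by (rule act_ob_comp) (auto simp: ob_args_def elim: list_all2_mono)
  fix p assume p: "p \<in> ops (pair_operad I)"
  show "\<And>xs. set xs \<subseteq> Ob (total C) \<Longrightarrow> map (colour C) xs = fst p \<Longrightarrow> act_ob C p xs \<in> Ob (total C)"
    using act_ob_in[OF p] by (simp add: ob_args_def)
  show "\<And>xs. set xs \<subseteq> Ob (total C) \<Longrightarrow> map (colour C) xs = fst p \<Longrightarrow> colour C (act_ob C p xs) = fst (snd p)"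
    using colour_act_ob[OF p] by (cases p) (simp add: ob_args_def)
  show "\<And>s xs. s \<in> perms (length (fst p)) \<Longrightarrow> set xs \<subseteq> Ob (total C) \<Longrightarrow> map (colour C) xs = fst p \<Longrightarrow>
       act_ob C (perm_op (pair_operad I) p s) (permuted s xs) = act_ob C p xs"
    using act_ob_perm[OF p] by (simp add: ob_args_def)
qed (rule act_ob_unit)

sublocale ar: pair_algebra I "Ar (total C)" acol "act_ar C"
proof
  show "\<And>x. x \<in> Ar (total C) \<Longrightarrow> acol x \<in> PBq I <+> PBq I" using colour_in[OF Dom_in] by simp
  show "\<And>p qs xss. composable (pair_operad I) p qs \<Longrightarrow>
       list_all2 (\<lambda>q xs. set xs \<subseteq> Ar (total C) \<and> map acol xs = fst q) qs xss \<Longrightarrow>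
       act_ar C (comp_op (pair_operad I) p qs) (concat xss) = act_ar C p (map2 (act_ar C) qs xss)"
    by (rule act_ar_comp) (auto simp: ar_args_def elim: list_all2_mono)
  fix p assume p: "p \<in> ops (pair_operad I)"
  show "\<And>xs. set xs \<subseteq> Ar (total C) \<Longrightarrow> map acol xs = fst p \<Longrightarrow> act_ar C p xs \<in> Ar (total C)"
    using act_ar_in[OF p] by (simp add: ar_args_def)
  show "\<And>xs. set xs \<subseteq> Ar (total C) \<Longrightarrow> map acol xs = fst p \<Longrightarrow> acol (act_ar C p xs) = fst (snd p)"
  proof -
    fix xs assume "set xs \<subseteq> Ar (total C)" "map acol xs = fst p"
    then show "acol (act_ar C p xs) = fst (snd p)"
      using Dom_act_ar[OF p, of xs] colour_act_ob[OF p, of "map (Dom (total C)) xs"] Dom_in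
      by (cases p) (auto simp: ar_args_def ob_args_def comp_def)
  qed
  show "\<And>s xs. s \<in> perms (length (fst p)) \<Longrightarrow> set xs \<subseteq> Ar (total C) \<Longrightarrow> map acol xs = fst p \<Longrightarrow>
       act_ar C (perm_op (pair_operad I) p s) (permuted s xs) = act_ar C p xs"
    using act_ar_perm[OF p] by (simp add: ar_args_def)
qed (rule act_ar_unit)

lemma Dom_eval: "wft I acol r l s \<Longrightarrow> set (labs s) \<subseteq> Ar (total C)
    \<Longrightarrow> Dom (total C) (ar.eval r l s) = ob.eval r l (map_pt (Dom (total C)) id s)"
  using Dom_act_ar[of "tree_op acol r l s" "labs s"] tree_op_ops[of I acol r l s]
  by (simp add: ar.eval_def ob.eval_def ar_args_def)

lemma Cod_eval:
  assumes "wft I acol r l s" "set (labs s) \<subseteq> Ar (total C)"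
  shows "Cod (total C) (ar.eval r l s) = ob.eval r l (map_pt (Cod (total C)) id s)"
proof -
  have "tree_op (\<lambda>f. colour C (Cod (total C) f)) r l s = tree_op acol r l s"
    using assms(2) colour_Cod by (intro tree_op_cong) auto
  then show ?thesis
    using Cod_act_ar[of "tree_op acol r l s" "labs s"] tree_op_ops[OF assms(1)] assms(2)
    by (simp add: ar.eval_def ob.eval_def ar_args_def)
qed

lemma eval_Ide:
  assumes "wft I (colour C) r l s" "set (labs s) \<subseteq> Ob (total C)"
  shows "ar.eval r l (map_pt (Ide (total C)) id s) = Ide (total C) (ob.eval r l s)"
proof -
  have "tree_op (\<lambda>x. acol (Ide (total C) x)) r l s = tree_op (colour C) r l s"
    using assms(2) Dom_Ide by (intro tree_op_cong) auto
  then show ?thesis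
    using act_ar_Ide[of "tree_op (colour C) r l s" "labs s"] tree_op_ops[OF assms(1)] assms(2)
    by (simp add: ar.eval_def ob.eval_def ob_args_def)
qed

text \<open>Functoriality of the action. The pairs are stored in the order of \<open>Cmp\<close>,
  the later arrow first.\<close>

lemma eval_Cmp:
  assumes v: "wft I (\<lambda>z. acol (snd z)) r l z"
    and z: "\<And>g f. (g, f) \<in> set (labs z) \<Longrightarrow> f \<in> Ar (total C) \<and> g \<in> Ar (total C) \<and> Cod (total C) f = Dom (total C) g"
  shows "ar.eval r l (map_pt (\<lambda>(g, f). Cmp (total C) g f) id z)
    = Cmp (total C) (ar.eval r l (map_pt fst id z)) (ar.eval r l (map_pt snd id z))"
proof -
  let ?p = "tree_op (\<lambda>z. acol (snd z)) r l z"
  have z': "snd y \<in> Ar (total C)" "fst y \<in> Ar (total C)" "Cod (total C) (snd y) = Dom (total C) (fst y)"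
    if "y \<in> set (labs z)" for y
    using z[of "fst y" "snd y"] that by simp_all
  have a: "acol (fst y) = acol (snd y)" if "y \<in> set (labs z)" for y
    using colour_Cod[OF z'(1)[OF that]] z'(3)[OF that] by simp
  have c: "acol (case y of (g, f) \<Rightarrow> Cmp (total C) g f) = acol (snd y)" if "y \<in> set (labs z)" for y
    using Dom_Cmp[OF z'(1)[OF that] z'(2)[OF that] z'(3)[OF that]] by (simp add: case_prod_beta)
  have "tree_op (\<lambda>z. acol (fst z)) r l z = ?p" by (rule tree_op_cong) (use a in auto)
  moreover have "tree_op (\<lambda>z. acol (case z of (g, f) \<Rightarrow> Cmp (total C) g f)) r l z = ?p" by (rule tree_op_cong) (use c in auto)
  moreover have "act_ar C ?p (map2 (Cmp (total C)) (map fst (labs z)) (map snd (labs z)))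
      = Cmp (total C) (act_ar C ?p (map fst (labs z))) (act_ar C ?p (map snd (labs z)))"
  proof (rule act_ar_Cmp)
    show "?p \<in> ops (pair_operad I)" by (rule tree_op_ops[OF v])
    show "ar_args (pair_operad I) C ?p (map snd (labs z))" "ar_args (pair_operad I) C ?p (map fst (labs z))"
      using z' a by (auto simp: ar_args_def)
    show "map (Cod (total C)) (map snd (labs z)) = map (Dom (total C)) (map fst (labs z))"
      using z' by simp
  qed
  moreover have "map2 (Cmp (total C)) (map fst (labs z)) (map snd (labs z)) = map (\<lambda>(g, f). Cmp (total C) g f) (labs z)"
    by (simp add: zip_map_fst_snd)
  ultimately show ?thesis by (simp add: ar.eval_def)
qed

text \<open>Two trees of arrows that compose vertex by vertex, and their composite. The hidden tree
  of pairs is what \<open>eval_Cmp\<close> needs, while \<open>tri_Nd\<close> and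
  \<open>tri_Lf\<close> allow proofs by recursion on trees.\<close>

definition tri :: "('m, 'b) ptree \<Rightarrow> ('m, 'b) ptree \<Rightarrow> ('m, 'b) ptree \<Rightarrow> bool" where
  "tri t1 t2 t3 \<longleftrightarrow> (\<exists>z. t1 = map_pt fst id z \<and> t2 = map_pt snd id z \<and> t3 = map_pt (\<lambda>(g, f). Cmp (total C) g f) id z \<and>
     (\<forall>(g, f) \<in> set (labs z). f \<in> Ar (total C) \<and> g \<in> Ar (total C) \<and> Cod (total C) f = Dom (total C) g))"

definition tris :: "('m, 'b) ptree list \<Rightarrow> ('m, 'b) ptree list \<Rightarrow> ('m, 'b) ptree list \<Rightarrow> bool" where
  "tris ts1 ts2 ts3 \<longleftrightarrow> length ts1 = length ts2 \<and> length ts2 = length ts3 \<and>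
     (\<forall>k < length ts1. tri (ts1 ! k) (ts2 ! k) (ts3 ! k))"

lemma tri_Lf: "tri (Lf x) (Lf x) (Lf x)"
  unfolding tri_def by (rule exI[of _ "Lf x"]) simp

lemma tri_Nd:
  assumes "tris ts1 ts2 ts3" "f \<in> Ar (total C)" "g \<in> Ar (total C)" "Cod (total C) f = Dom (total C) g"
  shows "tri (Nd g ts1) (Nd f ts2) (Nd (Cmp (total C) g f) ts3)"
proof -
  have "\<exists>y. ts1 ! k = map_pt fst id y \<and> ts2 ! k = map_pt snd id y \<and>
      ts3 ! k = map_pt (\<lambda>(g, f). Cmp (total C) g f) id y \<and>
      (\<forall>(g, f) \<in> set (labs y). f \<in> Ar (total C) \<and> g \<in> Ar (total C) \<and> Cod (total C) f = Dom (total C) g)"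
    if "k < length ts1" for k
    using assms(1) that unfolding tris_def tri_def by blast
  then obtain z where z: "\<And>k. k < length ts1 \<Longrightarrow> ts1 ! k = map_pt fst id (z k) \<and> ts2 ! k = map_pt snd id (z k) \<and>
      ts3 ! k = map_pt (\<lambda>(g, f). Cmp (total C) g f) id (z k) \<and>
      (\<forall>(g, f) \<in> set (labs (z k)). f \<in> Ar (total C) \<and> g \<in> Ar (total C) \<and> Cod (total C) f = Dom (total C) g)"
    by (rule that[OF someI_ex])
  define n where "n = length ts1"
  have "ts1 = map (\<lambda>k. map_pt fst id (z k)) [0..<n]" "ts2 = map (\<lambda>k. map_pt snd id (z k)) [0..<n]"
    "ts3 = map (\<lambda>k. map_pt (\<lambda>(g, f). Cmp (total C) g f) id (z k)) [0..<n]"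
    using z assms(1) by (auto simp: tris_def n_def intro!: nth_equalityI)
  moreover have "\<forall>k < n. \<forall>(g, f) \<in> set (labs (z k)). f \<in> Ar (total C) \<and> g \<in> Ar (total C) \<and> Cod (total C) f = Dom (total C) g"
    using z by (simp add: n_def)
  ultimately show ?thesis unfolding tri_def
    by (intro exI[of _ "Nd (g, f) (map z [0..<n])"]) (use assms(2-4) in \<open>auto simp: comp_def\<close>)
qed

lemma tris_map: "(\<And>s. s \<in> set ss \<Longrightarrow> tri (f1 s) (f2 s) (f3 s)) \<Longrightarrow> tris (map f1 ss) (map f2 ss) (map f3 ss)"
  by (simp add: tris_def)

lemma tris_append: "tris as bs cs \<Longrightarrow> tris as' bs' cs' \<Longrightarrow> tris (as @ as') (bs @ bs') (cs @ cs')"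
  by (auto simp: tris_def nth_append)

lemma tris_concat: "(\<And>s. s \<in> set ss \<Longrightarrow> tris (f1 s) (f2 s) (f3 s))
    \<Longrightarrow> tris (concat (map f1 ss)) (concat (map f2 ss)) (concat (map f3 ss))"
  by (induction ss) (auto intro: tris_append simp: tris_def[of "[]"])

lemma tri_eval:
  assumes "tri t1 t2 t3" "wft I acol r l t2"
  shows "ar.eval r l t3 = Cmp (total C) (ar.eval r l t1) (ar.eval r l t2)"
  using assms eval_Cmp[of r l] unfolding tri_def by fastforce

end

locale pair_int = pair_cat I C + internal_algebra "pair_substitude I" C U
  for I :: "'i set" and C :: "('i pair_colour, 'i pair_op, 'o, 'm) cat_alg" and U
begin

definition X_tree :: "('b \<Rightarrow> 'i) \<Rightarrow> bool \<Rightarrow> ('i pair_colour, 'b) ptree \<Rightarrow> 'm" where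
  "X_tree r l q = X_ar U (tree_op (\<lambda>c. c) r l q)"

lemma X_tree_map_leaf: "X_tree r l (map_pt f h q) = X_tree (\<lambda>x. r (h x)) l (map_pt f id q)"
  by (simp add: X_tree_def)

lemma X_tree_cong: "(\<And>x. x \<in> set (lvs q) \<Longrightarrow> r x = r' x) \<Longrightarrow> X_tree r l q = X_tree r' l q"
  using tree_op_cong[of q "\<lambda>c. c" "\<lambda>c. c" r r' l] by (simp add: X_tree_def)

lemma wft_labs: "wft I col r l s \<Longrightarrow> a \<in> set (labs s) \<Longrightarrow> col a \<in> PBq I <+> PBq I"
  by (induction s) (auto split: sum.splits)

lemma X_tree_in: "wft I (\<lambda>c. c) r l q \<Longrightarrow> X_tree r l q \<in> Ar (total C)"
  and Cod_X_tree: "wft I (\<lambda>c. c) r l q \<Longrightarrow> Cod (total C) (X_tree r l q) = X_ob U (colour_of l (bq (\<lambda>c. c) r q))"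
  using X_ar_in[of "tree_op (\<lambda>c. c) r l q"] Cod_X_ar[of "tree_op (\<lambda>c. c) r l q"] tree_op_ops[of I "\<lambda>c. c" r l q]
  by (cases "tree_op (\<lambda>c. c) r l q", simp_all add: X_tree_def tree_op_def)+

lemma Dom_X_tree:
  assumes "wft I (\<lambda>c. c) r l q"
  shows "Dom (total C) (X_tree r l q) = ob.eval r l (map_pt (X_ob U) id q)"
proof -
  have "tree_op (\<lambda>c. colour C (X_ob U c)) r l q = tree_op (\<lambda>c. c) r l q"
    using wft_labs[OF assms] colour_X_ob by (intro tree_op_cong) auto
  then show ?thesis using Dom_X_ar[of "tree_op (\<lambda>c. c) r l q"] tree_op_ops[OF assms]
    by (simp add: X_tree_def ob.eval_def)
qed

lemma acol_X_tree: "wft I (\<lambda>c. c) r l q \<Longrightarrow> acol (X_tree r l q) = colour_of l (bq (\<lambda>c. c) r q)"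
  using colour_Cod[OF X_tree_in, of r l q] Cod_X_tree[of r l q] colour_X_ob wft_bq[of I "\<lambda>c. c" r l q] by simp

text \<open>By \<open>X_ar_perm\<close> the structure map at an operation depends only on its tree
  of colours, so that all later work can be done with \<open>X_tree\<close>.\<close>

lemma X_ar_conv:
  assumes "(cs, c, t) \<in> ops (pair_operad I)" "\<And>n. n < val c \<Longrightarrow> r (h n) = fst (boundary c) ! n"
  shows "X_ar U (cs, c, t) = X_tree r (\<not> isl c) (conv ((!) cs) h t)"
  using perm_tree_op[OF assms(1), of "\<lambda>c. c" "(!) cs" r h] assms X_ar_perm[of "(cs, c, t)" "vertices t"]
    pair_opD(5)[OF assms(1)] by (simp add: X_tree_def)

lemma X_tree_unit:
  fixes xs :: "'b list"
  assumes "c \<in> PBq I <+> PBq I" "map r xs = fst (boundary c)"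
  shows "X_tree r (\<not> isl c) (Nd c (map Lf xs)) = Ide (total C) (X_ob U c)"
proof -
  have len: "length xs = val c" using assms(2) by (metis length_map)
  have "map (\<lambda>n. Lf (xs ! n)) [0..<val c] = (map Lf xs :: ('i pair_colour, 'b) ptree list)"
    using len by (auto intro!: nth_equalityI)
  moreover have "r (xs ! n) = fst (boundary c) ! n" if "n < val c" for n
    using assms(2) len that by (metis nth_map)
  ultimately show ?thesis
    using X_ar_conv[OF pair_unit_in[OF assms(1), unfolded pair_sel], of r "(!) xs"] X_ar_unit[of c] assms(1)
    by (simp add: comp_def)
qed

text \<open>The axiom \<open>X_ar_comp\<close> for nested trees: first contract the inner trees,
  then the skeleton that is left.\<close>

lemma X_tree_flat:
  assumes n: "wfn I (\<lambda>c. c) r l n"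
  shows "X_tree r l (flat n) = Cmp (total C) (X_tree r l (map_pt (ncol (\<lambda>c. c) r) id (skel n)))
    (ar.eval r l (map_pt (\<lambda>(l', q). X_tree (nroot (\<lambda>c. c) r) l' q) id (skel n)))"
proof -
  let ?col = "\<lambda>c. c" and ?Q = "labs (skel n)"
  let ?p = "nest_op ?col r l n" and ?qs = "nest_ops ?col r n"
  have c: "composable (pair_operad I) ?p ?qs" by (rule nest_composable[OF n])
  obtain t where t: "comp_op (pair_operad I) ?p ?qs = (map ?col (nlabs n), colour_of l (bq ?col r (flat n)), t)"
    "conv ((!) (nlabs n)) ((!) (lvs (flat n))) t = flat n" using nest_comp[OF n] .
  have op: "(nlabs n, colour_of l (bq ?col r (flat n)), t) \<in> ops (pair_operad I)"
    unfolding t(1)[simplified, symmetric] using c by (cases ?p) (simp only: pair_comp_in)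
  have "X_tree r l (flat n) = X_ar U (nlabs n, colour_of l (bq ?col r (flat n)), t)"
    using X_ar_conv[OF op, of r "(!) (lvs (flat n))"] t(2) by (simp add: bq_def)
  also have "\<dots> = Cmp (total C) (X_ar U ?p) (act_ar C ?p (map (X_ar U) ?qs))"
    using X_ar_comp[of ?p ?qs] c t(1) by simp
  also have "X_ar U ?p = X_tree r l (map_pt (ncol ?col r) id (skel n))"
    by (simp add: X_tree_def nest_op_def)
  also have "act_ar C ?p (map (X_ar U) ?qs) = ar.eval r l (map_pt (\<lambda>(l', q). X_tree (nroot ?col r) l' q) id (skel n))"
  proof -
    have "tree_op (\<lambda>y. acol (case y of (l', q) \<Rightarrow> X_tree (nroot ?col r) l' q)) r l (skel n) = ?p"
      unfolding nest_op_def using acol_X_tree[OF skel_labs_wft[OF n]] by (intro tree_op_cong) auto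
    then show ?thesis by (simp add: ar.eval_def nest_ops_def X_tree_def split_def comp_def)
  qed
  finally show ?thesis .
qed

lemma X_tree_skel_in:
  assumes n: "wfn I (\<lambda>c. c) r l n"
  defines "t \<equiv> map_pt (\<lambda>(l', q). X_tree (nroot (\<lambda>c. c) r) l' q) id (skel n)"
  shows "wft I acol r l t" "set (labs t) \<subseteq> Ar (total C)"
    "Cod (total C) (ar.eval r l t) = Dom (total C) (X_tree r l (map_pt (ncol (\<lambda>c. c) r) id (skel n)))"
proof -
  note q = skel_labs_wft[OF n]
  have "wft I (\<lambda>x. acol (case x of (l', q) \<Rightarrow> X_tree (nroot (\<lambda>c. c) r) l' q)) r l (skel n) = wft I (ncol (\<lambda>c. c) r) r l (skel n)"
    using acol_X_tree[OF q] by (intro wft_cong) auto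
  then show t: "wft I acol r l t" using skel_wft[OF n] by (simp add: t_def)
  show t': "set (labs t) \<subseteq> Ar (total C)" using X_tree_in[OF q] by (auto simp: t_def)
  have "map_pt (Cod (total C)) id t = map_pt (\<lambda>y. X_ob U (ncol (\<lambda>c. c) r y)) id (skel n)"
    unfolding t_def map_map_pt using Cod_X_tree[OF q] by (intro map_pt_cong') auto
  then show "Cod (total C) (ar.eval r l t) = Dom (total C) (X_tree r l (map_pt (ncol (\<lambda>c. c) r) id (skel n)))"
    using Cod_eval[OF t t'] Dom_X_tree[of r l "map_pt (ncol (\<lambda>c. c) r) id (skel n)"] skel_wft[OF n] by simp
qed

end

section \<open>Contractions\<close>

text \<open>
  \<open>VX b\<close> stands for \<open>X\<^sub>O(b)\<close>, and \<open>VI e c\<close> for an inert vertex: \<open>K(c)\<close>, or \<open>X(c)\<close> if \<open>e\<close> is set, which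
  only happens for \<open>c = Inr ([i], i)\<close>. A term of type \<open>ctr\<close> is a partial contraction:
  for each \<open>BX q\<close>, the tree \<open>q\<close> of copies of \<open>X\<^sub>O\<close>, whose leaves carry what lies above it, is
  contracted to one vertex.
\<close>

datatype 'i vert = VX "'i bouquet" | VI bool "'i pair_colour"

datatype ('i, 'b) ctr = BL 'b | BI bool "'i pair_colour" "('i, 'b) ctr list" | BX "('i bouquet, ('i, 'b) ctr) ptree"

primrec vcol :: "'i vert \<Rightarrow> 'i pair_colour" where
  "vcol (VX b) = Inl b"
| "vcol (VI e c) = c"

primrec broot :: "('b \<Rightarrow> 'i) \<Rightarrow> ('i, 'b) ctr \<Rightarrow> 'i" where
  "broot r (BL x) = r x"
| "broot r (BI e c ss) = snd (boundary c)"
| "broot r (BX q) = root Inl id (map_pt id (broot r) q)"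

primrec src :: "('i, 'b) ctr \<Rightarrow> ('i vert, 'b) ptree" where
  "src (BL x) = Lf x"
| "src (BI e c ss) = Nd (VI e c) (map src ss)"
| "src (BX q) = bind id (map_pt VX src q)"

primrec tgt :: "('b \<Rightarrow> 'i) \<Rightarrow> ('i, 'b) ctr \<Rightarrow> ('i vert, 'b) ptree" where
  "tgt r (BL x) = Lf x"
| "tgt r (BI e c ss) = Nd (VI e c) (map (tgt r) ss)"
| "tgt r (BX q) = Nd (VX (bq Inl (broot r) q)) (lvs (map_pt id (tgt r) q))"

primrec wfc :: "'i set \<Rightarrow> ('b \<Rightarrow> 'i) \<Rightarrow> bool \<Rightarrow> ('i, 'b) ctr \<Rightarrow> bool" where
  "wfc I r l (BL x) \<longleftrightarrow> \<not> l \<and> r x \<in> I"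
| "wfc I r l (BI e c ss) \<longleftrightarrow> c \<in> PBq I <+> PBq I \<and>
     (if isl c then map (broot r) ss = fst (boundary c) \<and> list_all id (map (wfc I r l) ss)
      else l \<and> (\<exists>xs. ss = map BL xs \<and> map r xs = fst (boundary c)))"
| "wfc I r l (BX q) \<longleftrightarrow> wft I Inl (broot r) False q \<and> list_all id (lvs (map_pt id (wfc I r l) q))"

text \<open>Above an inert vertex in \<open>O\<close> a contracted vertex is placed even if
  \<open>q\<close> is a bare leaf. Above one in \<open>L\<close> only leaves are allowed; there
  \<open>q\<close> has the form \<open>Lf (BL x)\<close>, and \<open>hd\<close> returns the leaf
  \<open>BL x\<close> without inserting a unit.\<close>

definition under :: "'i pair_colour \<Rightarrow> ('i bouquet, ('i, 'b) ctr) ptree \<Rightarrow> ('i, 'b) ctr" where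
  "under c q = (if isl c then BX q else hd (lvs q))"

text \<open>The maximal subtree of copies of \<open>X\<^sub>O\<close> at the root; its leaves carry the contractions of what lies above it.\<close>

primrec top_comp :: "('i vert, 'b) ptree \<Rightarrow> ('i bouquet, ('i, 'b) ctr) ptree" where
  "top_comp (Lf x) = Lf (BL x)"
| "top_comp (Nd a ss) = (case a of VX b \<Rightarrow> Nd b (map top_comp ss) | VI e c \<Rightarrow> Lf (BI e c (map (\<lambda>s. under c (top_comp s)) ss)))"

definition contract :: "('i vert, 'b) ptree \<Rightarrow> ('i, 'b) ctr" where
  "contract d = BX (top_comp d)"

lemma broot_BX [simp]: "broot r (BX q) = root Inl (broot r) q"
  by simp

lemma src_BX [simp]: "src (BX q) = bind src (map_pt VX id q)"
  by (simp add: bind_map[of _ _ src])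

lemma tgt_BX [simp]: "tgt r (BX q) = Nd (VX (bq Inl (broot r) q)) (map (tgt r) (lvs q))"
  by simp

lemma wfc_BI [simp]: "wfc I r l (BI e c ss) \<longleftrightarrow> c \<in> PBq I <+> PBq I \<and>
     (if isl c then map (broot r) ss = fst (boundary c) \<and> (\<forall>s \<in> set ss. wfc I r l s)
      else l \<and> (\<exists>xs. ss = map BL xs \<and> map r xs = fst (boundary c)))"
  by simp

lemma wfc_BX [simp]: "wfc I r l (BX q) \<longleftrightarrow> wft I Inl (broot r) False q \<and> (\<forall>s \<in> set (lvs q). wfc I r l s)"
  by simp

declare broot.simps(3) [simp del] src.simps(3) [simp del] tgt.simps(3) [simp del] wfc.simps(2,3) [simp del]

text \<open>Inert vertices of the two sorts behave differently: one in \<open>O\<close> may carry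
  arbitrary contractions, one in \<open>L\<close> only bare leaves. The same case split recurs in
  \<open>wft_induct\<close> and \<open>wft_vcol_induct\<close>.\<close>

lemma wfc_induct [consumes 1, case_names BL BIl BIr BX]:
  assumes "wfc I r l s"
    and "\<And>x. \<not> l \<Longrightarrow> r x \<in> I \<Longrightarrow> P (BL x)"
    and "\<And>e b ss. b \<in> PBq I \<Longrightarrow> map (broot r) ss = fst b \<Longrightarrow> (\<And>s. s \<in> set ss \<Longrightarrow> wfc I r l s) \<Longrightarrow> (\<And>s. s \<in> set ss \<Longrightarrow> P s)
      \<Longrightarrow> P (BI e (Inl b) ss)"
    and "\<And>e b xs. b \<in> PBq I \<Longrightarrow> map r xs = fst b \<Longrightarrow> l \<Longrightarrow> P (BI e (Inr b) (map BL xs))"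
    and "\<And>q. wft I Inl (broot r) False q \<Longrightarrow> (\<And>s. s \<in> set (lvs q) \<Longrightarrow> wfc I r l s) \<Longrightarrow> (\<And>s. s \<in> set (lvs q) \<Longrightarrow> P s) \<Longrightarrow> P (BX q)"
  shows "P s"
  using assms(1)
proof (induction s)
  case (BI e c ss)
  then show ?case using assms(3,4) by (cases c) auto
next
  case (BX q)
  then show ?case using assms(5) by simp
qed (use assms(2) in simp)

lemma wft_induct [consumes 1, case_names Lf Inl Inr]:
  assumes "wft I col r l s"
    and "\<And>x. \<not> l \<Longrightarrow> r x \<in> I \<Longrightarrow> P (Lf x)"
    and "\<And>a b ss. col a = Inl b \<Longrightarrow> b \<in> PBq I \<Longrightarrow> map (root col r) ss = fst b \<Longrightarrow> (\<And>s. s \<in> set ss \<Longrightarrow> wft I col r l s)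
      \<Longrightarrow> (\<And>s. s \<in> set ss \<Longrightarrow> P s) \<Longrightarrow> P (Nd a ss)"
    and "\<And>a b xs. col a = Inr b \<Longrightarrow> b \<in> PBq I \<Longrightarrow> map r xs = fst b \<Longrightarrow> l \<Longrightarrow> P (Nd a (map Lf xs))"
  shows "P s"
  using assms(1)
proof (induction s)
  case (Nd a ss)
  then show ?case using assms(3,4) by (cases "col a") auto
qed (use assms(2) in simp)

text \<open>A tree of copies of \<open>X\<^sub>O\<close> at the root lies in the maximal one, which
  continues into whatever is grafted on top.\<close>

lemma top_comp_bind: "top_comp (bind f (map_pt VX id q)) = bind (\<lambda>x. top_comp (f x)) q"
  by (induction q) auto

lemma top_comp_simps [simp]: "top_comp (Nd (VX b) ss) = Nd b (map top_comp ss)"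
  "top_comp (Nd (VI e (Inl b)) ss) = Lf (BI e (Inl b) (map contract ss))"
  by (auto simp: contract_def under_def)

lemma top_comp_Inr [simp]: "top_comp (Nd (VI e (Inr b)) (map Lf xs)) = Lf (BI e (Inr b) (map BL xs))"
  by (simp add: under_def comp_def)

declare top_comp.simps(2) [simp del]

lemma wft_vcol_induct [consumes 1, case_names Lf VX VIl VIr]:
  assumes "wft I vcol r l s"
    and "\<And>x. \<not> l \<Longrightarrow> r x \<in> I \<Longrightarrow> P (Lf x)"
    and "\<And>b ss. b \<in> PBq I \<Longrightarrow> map (root vcol r) ss = fst b \<Longrightarrow> (\<And>s. s \<in> set ss \<Longrightarrow> wft I vcol r l s)
      \<Longrightarrow> (\<And>s. s \<in> set ss \<Longrightarrow> P s) \<Longrightarrow> P (Nd (VX b) ss)"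
    and "\<And>e b ss. b \<in> PBq I \<Longrightarrow> map (root vcol r) ss = fst b \<Longrightarrow> (\<And>s. s \<in> set ss \<Longrightarrow> wft I vcol r l s)
      \<Longrightarrow> (\<And>s. s \<in> set ss \<Longrightarrow> P s) \<Longrightarrow> P (Nd (VI e (Inl b)) ss)"
    and "\<And>e b xs. b \<in> PBq I \<Longrightarrow> map r xs = fst b \<Longrightarrow> l \<Longrightarrow> P (Nd (VI e (Inr b)) (map Lf xs))"
  shows "P s"
  using assms(1)
proof (induction rule: wft_induct)
  case (Inl a b ss)
  then show ?case using assms(3,4) by (cases a) auto
next
  case (Inr a b xs)
  then show ?case using assms(5) by (cases a) auto
qed (use assms(2) in simp)

lemma top_comp_props:
  assumes "wft I vcol r l d"
  shows "src (contract d) = d \<and> root Inl (broot r) (top_comp d) = root vcol r d \<and> wfc I r l (contract d)"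
  using assms
proof (induction rule: wft_vcol_induct)
  case (VX b ss)
  have "map (bind src) (map (map_pt VX id) (map top_comp ss)) = ss"
    using VX(4) by (auto simp: contract_def intro!: map_idI)
  moreover have "map (root Inl (broot r)) (map top_comp ss) = fst b" using VX(2,4) by (auto simp flip: VX(2))
  ultimately show ?case using VX by (auto simp: contract_def simp del: map_map)
next
  case (VIl e b ss)
  have "map src (map contract ss) = ss"
    using VIl(4) by (auto intro!: map_idI)
  moreover have "map (broot r) (map contract ss) = fst b" using VIl(2,4) by (auto simp: contract_def simp flip: VIl(2))
  ultimately show ?case using VIl by (auto simp: contract_def[of "Nd _ _"] PBq_def simp del: map_map)
next
  case (VIr e b xs)
  then show ?case by (auto simp: contract_def comp_def PBq_def)
qed (auto simp: contract_def)

lemma src_contract: "wft I vcol r l d \<Longrightarrow> src (contract d) = d"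
  and wfc_contract: "wft I vcol r l d \<Longrightarrow> wfc I r l (contract d)"
  using top_comp_props by blast+

lemma roots_aux:
  assumes "wfc I r l s"
  shows "root vcol r (src s) = broot r s \<and> root vcol r (tgt r s) = broot r s \<and>
    root Inl (broot r) (top_comp (src s)) = broot r s \<and> root Inl (broot r) (top_comp (tgt r s)) = broot r s"
  using assms
proof (induction rule: wfc_induct)
  case (BX q)
  then show ?case by (auto simp: top_comp_bind root_bind bq_def intro!: root_cong)
qed (simp_all add: comp_def)

lemma roots:
  assumes "wfc I r l s"
  shows "root vcol r (src s) = broot r s" "root vcol r (tgt r s) = broot r s"
    "root Inl (broot r) (top_comp (src s)) = broot r s" "root Inl (broot r) (top_comp (tgt r s)) = broot r s"
  using roots_aux[OF assms] by blast+

lemma lvs_tgt: "wfc I r l s \<Longrightarrow> lvs (src s) = lvs (tgt r s)"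
proof (induction rule: wfc_induct)
  case (BX q)
  then have "map (\<lambda>x. lvs (src x)) (lvs q) = map (\<lambda>x. lvs (tgt r x)) (lvs q)" by simp
  then show ?case by (simp add: comp_def cong: map_cong)
qed (auto intro!: arg_cong[where f = concat])

lemma wft_src: "wfc I r l s \<Longrightarrow> wft I vcol r l (src s)"
proof (induction rule: wfc_induct)
  case (BIl e b ss)
  then have "map (root vcol r) (map src ss) = fst b" by (auto simp: roots(1)[OF BIl(3)] simp flip: BIl(2))
  then show ?case using BIl by (auto simp del: map_map)
next
  case (BX q)
  have "wft I (\<lambda>a. vcol (VX a)) (\<lambda>x. root vcol r (src x)) False q = wft I Inl (broot r) False q"
    using roots(1)[OF BX(2)] by (intro wft_cong) auto
  then show ?case using BX by (auto intro!: wft_bind)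
qed (auto simp: comp_def)

lemma wft_tgt: "wfc I r l s \<Longrightarrow> wft I vcol r l (tgt r s)"
proof (induction rule: wfc_induct)
  case (BIl e b ss)
  then have "map (root vcol r) (map (tgt r) ss) = fst b" by (auto simp: roots(2)[OF BIl(3)] simp flip: BIl(2))
  then show ?case using BIl by (auto simp del: map_map)
next
  case (BX q)
  have "map (root vcol r) (map (tgt r) (lvs q)) = map (broot r) (lvs q)" using BX by (auto simp: roots(2)[OF BX(2)])
  then show ?case using BX wft_bq[OF BX(1)] by (auto simp: bq_def simp del: map_map)
qed (auto simp: comp_def)

section \<open>Normal forms and their invariance under contraction\<close>

definition nform :: "('b \<Rightarrow> 'i) \<Rightarrow> ('i vert, 'b) ptree \<Rightarrow> ('i vert, 'b) ptree" where
  "nform r d = tgt r (contract d)"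

text \<open>A partial contraction changes nothing but trees of copies of \<open>X\<^sub>O\<close>.
  Above the maximal subtree at the root, source and target thus have the same inert vertices and
  leaves in the same order, and induction gives equal normal forms above them.\<close>

lemma nform_src_tgt_aux:
  assumes "wfc I r l s"
  shows "map (\<lambda>x. (broot r x, tgt r x)) (lvs (top_comp (src s))) = map (\<lambda>x. (broot r x, tgt r x)) (lvs (top_comp (tgt r s)))"
  using assms
proof (induction rule: wfc_induct)
  case (BIl e b ss)
  \<comment> \<open>Each subtree above an inert vertex in \<open>O\<close> is contracted separately.
    The list equality determines both the bouquet of its new root vertex and the children of that
    vertex.\<close>
  have "tgt r (contract (src s)) = tgt r (contract (tgt r s))" if s: "s \<in> set ss" for s
  proof -
    have e: "map (\<lambda>x. (broot r x, tgt r x)) (lvs (top_comp (src s))) = map (\<lambda>x. (broot r x, tgt r x)) (lvs (top_comp (tgt r s)))"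
      by (rule BIl(4)[OF s])
    have "map (broot r) (lvs (top_comp (src s))) = map (broot r) (lvs (top_comp (tgt r s)))"
      "map (tgt r) (lvs (top_comp (src s))) = map (tgt r) (lvs (top_comp (tgt r s)))"
      using arg_cong[OF e, of "map fst"] arg_cong[OF e, of "map snd"] by (simp_all add: comp_def)
    then show ?thesis using roots[OF BIl(3)[OF s]] by (simp add: contract_def bq_def)
  qed
  then show ?case by simp
next
  case (BX q)
  have e: "map (\<lambda>s. map (\<lambda>x. (broot r x, tgt r x)) (lvs (top_comp (src s)))) (lvs q)
      = map (\<lambda>s. map (\<lambda>x. (broot r x, tgt r x)) (lvs (top_comp (tgt r s)))) (lvs q)" using BX(3) by simp
  show ?case using arg_cong[OF e, of concat] by (simp add: top_comp_bind map_concat comp_def)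
qed (simp_all add: comp_def)

lemma nform_src_tgt:
  assumes "wfc I r l s"
  shows "nform r (src s) = nform r (tgt r s)"
proof -
  have "map (broot r) (lvs (top_comp (src s))) = map (broot r) (lvs (top_comp (tgt r s)))"
    "map (tgt r) (lvs (top_comp (src s))) = map (tgt r) (lvs (top_comp (tgt r s)))"
    using arg_cong[OF nform_src_tgt_aux[OF assms], of "map fst"] arg_cong[OF nform_src_tgt_aux[OF assms], of "map snd"]
    by (simp_all add: comp_def)
  then show ?thesis using roots[OF assms] by (simp add: nform_def contract_def bq_def)
qed

section \<open>Contractions as arrows of a categorical algebra\<close>

context pair_int
begin

primrec vob :: "'i vert \<Rightarrow> 'o" where
  "vob (VX b) = X_ob U (Inl b)"
| "vob (VI e c) = (if e then X_ob U c else K_ob U c)"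

lemma vob_in: "vcol v \<in> PBq I <+> PBq I \<Longrightarrow> vob v \<in> Ob (total C) \<and> colour C (vob v) = vcol v"
  using X_ob_in K_ob_in colour_X_ob colour_K_ob by (cases v) auto

text \<open>A contraction is given by one arrow for each vertex of its target: an identity at an
  inert vertex, a structure map at a contracted tree. Its codomain can be read off vertexwise,
  whereas its domain is a tree of trees that has to be flattened.\<close>

primrec arr_tree :: "('b \<Rightarrow> 'i) \<Rightarrow> ('i, 'b) ctr \<Rightarrow> ('m, 'b) ptree" where
  "arr_tree r (BL x) = Lf x"
| "arr_tree r (BI e c ss) = Nd (Ide (total C) (vob (VI e c))) (map (arr_tree r) ss)"
| "arr_tree r (BX q) = Nd (X_tree (broot r) False (map_pt Inl id q)) (lvs (map_pt id (arr_tree r) q))"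

lemma arr_tree_BX [simp]: "arr_tree r (BX q) = Nd (X_tree (broot r) False (map_pt Inl id q)) (map (arr_tree r) (lvs q))"
  by simp

declare arr_tree.simps(3) [simp del]

definition obj :: "('b \<Rightarrow> 'i) \<Rightarrow> bool \<Rightarrow> ('i vert, 'b) ptree \<Rightarrow> 'o" where
  "obj r l d = ob.eval r l (map_pt vob id d)"

definition arr :: "('b \<Rightarrow> 'i) \<Rightarrow> bool \<Rightarrow> ('i, 'b) ctr \<Rightarrow> 'm" where
  "arr r l s = ar.eval r l (arr_tree r s)"

lemma wft_vob:
  assumes "wft I vcol r l d"
  shows "wft I (colour C) r l (map_pt vob id d)" "set (labs (map_pt vob id d)) \<subseteq> Ob (total C)"
proof -
  have v: "vob a \<in> Ob (total C) \<and> colour C (vob a) = vcol a" if "a \<in> set (labs d)" for a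
    using vob_in[OF wft_labs[OF assms that]] .
  then show "set (labs (map_pt vob id d)) \<subseteq> Ob (total C)" by auto
  have "wft I (\<lambda>a. colour C (vob a)) r l d = wft I vcol r l d" using v by (intro wft_cong) auto
  then show "wft I (colour C) r l (map_pt vob id d)" using assms by simp
qed

lemma obj_in: "wft I vcol r l d \<Longrightarrow> obj r l d \<in> Ob (total C)"
  unfolding obj_def by (intro ob.eval_in wft_vob)

lemma colour_obj:
  assumes "wft I vcol r l d"
  shows "colour C (obj r l d) = colour_of l (bq vcol r d)"
proof -
  have "bq (\<lambda>a. colour C (vob a)) r d = bq vcol r d"
    using vob_in[OF wft_labs[OF assms]] by (intro bq_cong) auto
  then show ?thesis unfolding obj_def using ob.col_eval[OF wft_vob[OF assms]] by simp
qed

lemma wft_Inl: "wft I Inl r False q \<Longrightarrow> wft I (\<lambda>c. c) r False (map_pt Inl id q)"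
  by simp

lemma acol_Ide_vob: "vcol v \<in> PBq I <+> PBq I \<Longrightarrow> acol (Ide (total C) (vob v)) = vcol v"
  using vob_in[of v] Dom_Ide by simp

lemma acol_X_tree_Inl: "wft I Inl (broot r) False q \<Longrightarrow> acol (X_tree (broot r) False (map_pt Inl id q)) = Inl (bq Inl (broot r) q)"
  using acol_X_tree[OF wft_Inl, of "broot r" q] by simp

lemma arr_tree_wf:
  assumes "wfc I r l s"
  shows "wft I acol r l (arr_tree r s) \<and> set (labs (arr_tree r s)) \<subseteq> Ar (total C) \<and> root acol r (arr_tree r s) = broot r s"
  using assms
proof (induction rule: wfc_induct)
  case (BIl e b ss)
  have "map (root acol r) (map (arr_tree r) ss) = fst b" using BIl by (auto simp flip: BIl(2))
  moreover have "acol (Ide (total C) (vob (VI e (Inl b)))) = Inl b"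
    using acol_Ide_vob[of "VI e (Inl b)"] BIl(1) by auto
  moreover have "Ide (total C) (vob (VI e (Inl b))) \<in> Ar (total C)"
    using vob_in[of "VI e (Inl b)"] Ide_in BIl(1) by auto
  ultimately show ?case using BIl by (auto simp del: map_map vob.simps)
next
  case (BIr e b xs)
  moreover have "acol (Ide (total C) (vob (VI e (Inr b)))) = Inr b"
    using acol_Ide_vob[of "VI e (Inr b)"] BIr(1) by auto
  moreover have "Ide (total C) (vob (VI e (Inr b))) \<in> Ar (total C)"
    using vob_in[of "VI e (Inr b)"] Ide_in BIr(1) by auto
  ultimately show ?case by (auto simp: comp_def simp del: vob.simps)
next
  case (BX q)
  have "map (root acol r) (map (arr_tree r) (lvs q)) = map (broot r) (lvs q)" using BX by auto
  moreover have "X_tree (broot r) False (map_pt Inl id q) \<in> Ar (total C)" by (rule X_tree_in[OF wft_Inl[OF BX(1)]])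
  ultimately show ?case using BX(3) acol_X_tree_Inl[OF BX(1)] wft_bq[OF BX(1)]
    by (auto simp: bq_def simp del: map_map)
qed auto

lemma Cod_arr:
  assumes "wfc I r l s"
  shows "Cod (total C) (arr r l s) = obj r l (tgt r s)"
proof -
  have "map_pt (Cod (total C)) id (arr_tree r s) = map_pt vob id (tgt r s)"
    using assms
  proof (induction rule: wfc_induct)
    case (BIl e b ss)
    then show ?case using Cod_Ide vob_in[of "VI e (Inl b)"] by auto
  next
    case (BIr e b xs)
    then show ?case using Cod_Ide vob_in[of "VI e (Inr b)"] by auto
  next
    case (BX q)
    then show ?case using Cod_X_tree[OF wft_Inl[OF BX(1)]] by simp
  qed simp
  then show ?thesis using Cod_eval[of r l "arr_tree r s"] arr_tree_wf[OF assms] by (simp add: arr_def obj_def)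
qed

lemma arr_in: "wfc I r l s \<Longrightarrow> arr r l s \<in> Ar (total C)"
  using ar.eval_in[of r l "arr_tree r s"] arr_tree_wf[of r l s] by (simp add: arr_def)

text \<open>Each vertex of the target is replaced by the tree it came from, a corolla in the case of
  an inert vertex. Flattening gives the source, and evaluating the inner trees gives the domains of
  the arrows in \<open>arr_tree\<close>; thus \<open>eval_flat\<close> yields
  \<open>Dom_arr\<close>.\<close>

primrec obj_nest :: "('i, 'b) ctr \<Rightarrow> ('o, 'b) nest" where
  "obj_nest (BL x) = NL x"
| "obj_nest (BI e c ss) = NN (\<not> isl c) (Nd (vob (VI e c)) (map (\<lambda>s. Lf (obj_nest s)) ss))"
| "obj_nest (BX q) = NN False (map_pt (\<lambda>b. vob (VX b)) obj_nest q)"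

lemma obj_nest_wf:
  assumes "wfc I r l s"
  shows "wfn I (colour C) r l (obj_nest s) \<and> nroot (colour C) r (obj_nest s) = broot r s \<and> set (nlabs (obj_nest s)) \<subseteq> Ob (total C)
    \<and> flat (obj_nest s) = map_pt vob id (src s)
    \<and> map_pt (\<lambda>(l', q). ob.eval (nroot (colour C) r) l' q) id (skel (obj_nest s)) = map_pt (Dom (total C)) id (arr_tree r s)"
  using assms
proof (induction rule: wfc_induct)
  case (BIl e b ss)
  have v: "vob (VI e (Inl b)) \<in> Ob (total C)" "colour C (vob (VI e (Inl b))) = Inl b"
    using vob_in[of "VI e (Inl b)"] BIl(1) by auto
  have r: "map (nroot (colour C) r) (map obj_nest ss) = fst b" using BIl by (auto simp flip: BIl(2))
  have "ob.eval (nroot (colour C) r) False (Nd (vob (VI e (Inl b))) (map Lf (map obj_nest ss))) = vob (VI e (Inl b))"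
    using ob.eval_unit[OF v(1), of "nroot (colour C) r" "map obj_nest ss"] v(2) r by simp
  moreover have "\<forall>s \<in> set ss. broot r s \<in> I" using PBqD(1)[OF BIl(1)] by (auto simp flip: BIl(2))
  ultimately show ?case using BIl v r Dom_Ide[OF v(1)]
    by (auto simp: comp_def simp del: vob.simps)
next
  case (BIr e b xs)
  have v: "vob (VI e (Inr b)) \<in> Ob (total C)" "colour C (vob (VI e (Inr b))) = Inr b"
    using vob_in[of "VI e (Inr b)"] BIr(1) by auto
  have "ob.eval (nroot (colour C) r) True (Nd (vob (VI e (Inr b))) (map Lf (map NL xs))) = vob (VI e (Inr b))"
    using ob.eval_unit[OF v(1), of "nroot (colour C) r" "map NL xs"] v(2) BIr(2) by (simp add: comp_def)
  then show ?case using BIr v Dom_Ide[OF v(1)]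
    by (auto simp: comp_def simp del: vob.simps intro!: exI[of _ "map NL xs"])
next
  case (BX q)
  have v: "vob (VX b) \<in> Ob (total C) \<and> colour C (vob (VX b)) = Inl b" if "b \<in> set (labs q)" for b
    using vob_in[of "VX b"] wft_labs[OF BX(1) that] by simp
  have e: "wft I (\<lambda>b. colour C (vob (VX b))) (\<lambda>s. nroot (colour C) r (obj_nest s)) False q = wft I Inl (broot r) False q"
    using v BX(3) by (intro wft_cong) auto
  have e2: "root (\<lambda>b. colour C (vob (VX b))) (\<lambda>s. nroot (colour C) r (obj_nest s)) q = root Inl (broot r) q"
    using v BX(3) by (intro root_cong) auto
  have e3: "map_pt vob id (bind src (map_pt VX id q)) = bind flat (map_pt (\<lambda>b. vob (VX b)) obj_nest q)"
    unfolding map_bind bind_map[of flat _ obj_nest] map_map_pt using BX(3) by (auto intro!: bind_cong)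
  have e4: "ob.eval (nroot (colour C) r) False (map_pt (\<lambda>b. vob (VX b)) obj_nest q) = Dom (total C) (X_tree (broot r) False (map_pt Inl id q))"
  proof -
    have "ob.eval (nroot (colour C) r) False (map_pt (\<lambda>b. vob (VX b)) obj_nest q)
        = ob.eval (\<lambda>s. nroot (colour C) r (obj_nest s)) False (map_pt (\<lambda>b. vob (VX b)) id q)"
      using ob.eval_map_leaf[of "nroot (colour C) r" False obj_nest "map_pt (\<lambda>b. vob (VX b)) id q"] by simp
    also have "\<dots> = ob.eval (broot r) False (map_pt (\<lambda>b. vob (VX b)) id q)"
      by (rule ob.eval_cong) (use BX(3) in auto)
    finally show ?thesis using Dom_X_tree[OF wft_Inl[OF BX(1)]] by simp
  qed
  have "set (nlabs (NN False (map_pt (\<lambda>b. vob (VX b)) obj_nest q))) \<subseteq> Ob (total C)"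
    using v BX(3) by auto
  then show ?case using BX e e2 e3 e4 by (auto simp del: vob.simps)
qed simp

lemma Dom_arr:
  assumes "wfc I r l s"
  shows "Dom (total C) (arr r l s) = obj r l (src s)"
  using ob.eval_flat[of r l "obj_nest s"] obj_nest_wf[OF assms] Dom_eval[of r l "arr_tree r s"] arr_tree_wf[OF assms]
  by (simp add: arr_def obj_def)

section \<open>Naturality of the total contraction\<close>

definition nest_under :: "'i pair_colour \<Rightarrow> ('m, ('m, 'b) nest) ptree \<Rightarrow> ('m, 'b) nest" where
  "nest_under c q = (if isl c then NN False q else hd (lvs q))"

text \<open>The arrows in \<open>arr_tree r s\<close>, sorted by the maximal subtrees of
  \<open>tgt r s\<close>. The result has the shape of \<open>top_comp (tgt r s)\<close>, with arrows
  as labels, and its leaves carry what lies above as nested trees.\<close>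

primrec regroup :: "('b \<Rightarrow> 'i) \<Rightarrow> ('i, 'b) ctr \<Rightarrow> ('m, ('m, 'b) nest) ptree" where
  "regroup r (BL x) = Lf (NL x)"
| "regroup r (BI e c ss) = Lf (NN (\<not> isl c) (Nd (Ide (total C) (vob (VI e c))) (map (\<lambda>s. Lf (nest_under c (regroup r s))) ss)))"
| "regroup r (BX q) = Nd (X_tree (broot r) False (map_pt Inl id q)) (lvs (map_pt id (regroup r) q))"

lemma regroup_BX [simp]: "regroup r (BX q) = Nd (X_tree (broot r) False (map_pt Inl id q)) (map (regroup r) (lvs q))"
  by simp

lemma regroup_Inl [simp]: "regroup r (BI e (Inl b) ss)
    = Lf (NN False (Nd (Ide (total C) (vob (VI e (Inl b)))) (map (\<lambda>s. Lf (NN False (regroup r s))) ss)))"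
  by (simp add: nest_under_def)

lemma regroup_Inr [simp]: "regroup r (BI e (Inr b) (map BL xs))
    = Lf (NN True (Nd (Ide (total C) (vob (VI e (Inr b)))) (map Lf (map NL xs))))"
  by (simp add: nest_under_def comp_def)

declare regroup.simps(2,3) [simp del]

lemma Ide_vob_in: "c \<in> PBq I <+> PBq I \<Longrightarrow> Ide (total C) (vob (VI e c)) \<in> Ar (total C)"
  and acol_Ide: "c \<in> PBq I <+> PBq I \<Longrightarrow> acol (Ide (total C) (vob (VI e c))) = c"
  using vob_in[of "VI e c"] Ide_in Dom_Ide by auto

lemma regroup_wf:
  assumes "wfc I r l s"
  shows "bind flat (regroup r s) = arr_tree r s \<and> wft I acol (nroot acol r) False (regroup r s) \<and> set (labs (regroup r s)) \<subseteq> Ar (total C)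
    \<and> root acol (nroot acol r) (regroup r s) = broot r s \<and> (\<forall>n \<in> set (lvs (regroup r s)). wfn I acol r l n \<and> set (nlabs n) \<subseteq> Ar (total C))"
  using assms
proof (induction rule: wfc_induct)
  case (BIl e b ss)
  have "\<forall>s \<in> set ss. broot r s \<in> I" using PBqD(1)[OF BIl(1)] by (auto simp flip: BIl(2))
  moreover have "map (\<lambda>s. nroot acol r (NN False (regroup r s))) ss = fst b" using BIl(4) by (auto simp flip: BIl(2))
  moreover have "x \<in> Ar (total C)" if "s \<in> set ss" "x \<in> set (labs (regroup r s))" for s x using BIl(4) that by blast
  moreover have "x \<in> Ar (total C)" if "s \<in> set ss" "n \<in> set (lvs (regroup r s))" "x \<in> set (nlabs n)" for s n x
    using BIl(4) that by blast
  ultimately show ?case using BIl Ide_vob_in[of "Inl b" e] acol_Ide[of "Inl b" e] PBqD(2)[OF BIl(1)]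
    by (auto simp: comp_def simp del: vob.simps)
next
  case (BIr e b xs)
  then show ?case using Ide_vob_in[of "Inr b" e] acol_Ide[of "Inr b" e] PBqD(2)[OF BIr(1)]
    by (auto simp: comp_def simp del: vob.simps intro!: exI[of _ "map NL xs"])
next
  case (BX q)
  have "map (root acol (nroot acol r)) (map (regroup r) (lvs q)) = map (broot r) (lvs q)" using BX by auto
  moreover have "map (bind flat) (map (regroup r) (lvs q)) = map (arr_tree r) (lvs q)" using BX by auto
  moreover have "X_tree (broot r) False (map_pt Inl id q) \<in> Ar (total C)" by (rule X_tree_in[OF wft_Inl[OF BX(1)]])
  ultimately show ?case using BX(3) acol_X_tree_Inl[OF BX(1)] wft_bq[OF BX(1)]
    by (auto simp: bq_def simp del: map_map)
qed auto

text \<open>The maximal subtree at the root of the source, cut into the pieces that \<open>s\<close>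
  contracts to single vertices. Of everything above it only the colour of the root edge is
  kept.\<close>

primrec colour_nest :: "('b \<Rightarrow> 'i) \<Rightarrow> ('i, 'b) ctr \<Rightarrow> ('i pair_colour, 'i) nest" where
  "colour_nest r (BL x) = NL (r x)"
| "colour_nest r (BI e c ss) = NL (snd (boundary c))"
| "colour_nest r (BX q) = NN False (map_pt Inl (colour_nest r) q)"

lemma colour_nest_wf:
  assumes "wfc I r l s"
  shows "wfn I (\<lambda>c. c) (\<lambda>i. i) False (colour_nest r s) \<and> nroot (\<lambda>c. c) (\<lambda>i. i) (colour_nest r s) = broot r s
    \<and> flat (colour_nest r s) = map_pt Inl (broot r) (top_comp (src s))
    \<and> map_pt (ncol (\<lambda>c. c) (\<lambda>i. i)) id (skel (colour_nest r s)) = map_pt Inl (broot r) (top_comp (tgt r s))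
    \<and> map_pt (\<lambda>(l', q). X_tree (nroot (\<lambda>c. c) (\<lambda>i. i)) l' q) id (skel (colour_nest r s)) = map_pt id (nroot acol r) (regroup r s)"
  using assms
proof (induction rule: wfc_induct)
  case (BIl e b ss)
  then show ?case using PBqD(2)[OF BIl(1)] acol_Ide[of "Inl b" e] by (simp del: vob.simps)
next
  case (BIr e b xs)
  then show ?case using PBqD(2)[OF BIr(1)] acol_Ide[of "Inr b" e] by (simp add: comp_def del: vob.simps)
next
  case (BX q)
  have 1: "wft I Inl (\<lambda>s. nroot (\<lambda>c. c) (\<lambda>i. i) (colour_nest r s)) False q = wft I Inl (broot r) False q"
    using BX(3) by (intro wft_cong) auto
  have 2: "bq Inl (\<lambda>s. nroot (\<lambda>c. c) (\<lambda>i. i) (colour_nest r s)) q = bq Inl (broot r) q"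
    using BX(3) by (intro bq_cong) auto
  have 3: "bind flat (map_pt Inl (colour_nest r) q) = map_pt Inl (broot r) (bind (\<lambda>s. top_comp (src s)) q)"
    using BX(3) by (auto simp: bind_map[of _ _ "colour_nest r"] map_bind intro!: bind_cong)
  have 4: "X_tree (nroot (\<lambda>c. c) (\<lambda>i. i)) False (map_pt Inl (colour_nest r) q) = X_tree (broot r) False (map_pt Inl id q)"
    unfolding X_tree_map_leaf[of _ _ _ "colour_nest r"] using BX(3) by (intro X_tree_cong) auto
  show ?case using BX 1 2 3 4 root_bind[of Inl]
    by (auto simp: bq_def top_comp_bind intro!: map_cong)
qed simp_all

text \<open>The composition axiom at the root: contracting the pieces by \<open>f\<close> and the
  remaining copies of \<open>X\<^sub>O\<close> by \<open>g\<close> amounts to contracting everything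
  at once. The nested tree \<open>colour_nest r s\<close> is made so that \<open>X_tree_flat\<close>
  says exactly this.\<close>

lemma X_tree_top_comp:
  assumes "wfc I r l s"
  defines "g \<equiv> X_tree (broot r) False (map_pt Inl id (top_comp (tgt r s)))" and "f \<equiv> ar.eval (nroot acol r) False (regroup r s)"
  shows "X_tree (broot r) False (map_pt Inl id (top_comp (src s))) = Cmp (total C) g f"
    "f \<in> Ar (total C)" "g \<in> Ar (total C)" "Cod (total C) f = Dom (total C) g"
proof -
  let ?n = "colour_nest r s"
  note n = colour_nest_wf[OF assms(1)]
  have n': "wfn I (\<lambda>c. c) (\<lambda>i. i) False ?n" using n by blast
  have g: "X_tree (\<lambda>i. i) False (map_pt (ncol (\<lambda>c. c) (\<lambda>i. i)) id (skel ?n)) = g"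
    using n X_tree_map_leaf[of "\<lambda>i. i" False Inl "broot r" "top_comp (tgt r s)"] by (simp add: g_def)
  have f: "ar.eval (\<lambda>i. i) False (map_pt (\<lambda>(l', q). X_tree (nroot (\<lambda>c. c) (\<lambda>i. i)) l' q) id (skel ?n)) = f"
    using n by (simp add: f_def)
  have "X_tree (\<lambda>i. i) False (flat ?n) = X_tree (broot r) False (map_pt Inl id (top_comp (src s)))"
    using n X_tree_map_leaf[of "\<lambda>i. i" False Inl "broot r" "top_comp (src s)"] by simp
  then show "X_tree (broot r) False (map_pt Inl id (top_comp (src s))) = Cmp (total C) g f"
    using X_tree_flat[OF n'] f g by simp
  show "Cod (total C) f = Dom (total C) g" using X_tree_skel_in(3)[OF n'] f g by simp
  show "f \<in> Ar (total C)" using ar.eval_in[OF X_tree_skel_in(1,2)[OF n']] f by simp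
  have "wft I (\<lambda>c. c) (\<lambda>i. i) False (map_pt (ncol (\<lambda>c. c) (\<lambda>i. i)) id (skel ?n))" using skel_wft[OF n'] by simp
  then show "g \<in> Ar (total C)" using X_tree_in g by blast
qed

abbreviation outer :: "('b \<Rightarrow> 'i) \<Rightarrow> ('m, 'b) nest \<Rightarrow> ('m, 'b) ptree" where
  "outer r n \<equiv> map_pt (\<lambda>(l', q). ar.eval (nroot acol r) l' q) id (skel n)"

lemma tri_contract_aux:
  assumes "wfc I r l s"
    and "tris (map (arr_tree r) (lvs (top_comp (tgt r s)))) (map (outer r) (lvs (regroup r s))) (map (arr_tree r) (lvs (top_comp (src s))))"
  shows "tri (arr_tree r (contract (tgt r s))) (outer r (NN False (regroup r s))) (arr_tree r (contract (src s)))"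
  using tri_Nd[OF assms(2) X_tree_top_comp(2-4)[OF assms(1)]] X_tree_top_comp(1)[OF assms(1)]
  by (simp add: contract_def comp_def)

text \<open>This is \<open>contract_natural\<close>, vertex by vertex, for everything above the
  maximal subtree at the root. At an inert vertex it only says that an identity is the composite of
  two identities.\<close>

lemma tris_top_comp:
  assumes "wfc I r l s"
  shows "tris (map (arr_tree r) (lvs (top_comp (tgt r s)))) (map (outer r) (lvs (regroup r s))) (map (arr_tree r) (lvs (top_comp (src s))))"
  using assms
proof (induction rule: wfc_induct)
  case (BL x)
  then show ?case by (simp add: tris_def tri_Lf)
next
  case (BIl e b ss)
  let ?i = "Ide (total C) (vob (VI e (Inl b)))"
  have i: "?i \<in> Ar (total C)" "acol ?i = Inl b" using Ide_vob_in[of "Inl b" e] acol_Ide[of "Inl b" e] BIl(1) by auto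
  have o: "vob (VI e (Inl b)) \<in> Ob (total C)" using vob_in[of "VI e (Inl b)"] BIl(1) by simp
  have "map (nroot acol r) (map (\<lambda>s. NN False (regroup r s)) ss) = fst b"
    using BIl(3) regroup_wf by (fastforce simp flip: BIl(2))
  \<comment> \<open>The inner tree at an inert vertex is a corolla and evaluates to its
    label.\<close>
  then have E: "ar.eval (nroot acol r) False (Nd ?i (map Lf (map (\<lambda>s. NN False (regroup r s)) ss))) = ?i"
    using ar.eval_unit[OF i(1), of "nroot acol r" "map (\<lambda>s. NN False (regroup r s)) ss"] i(2) by simp
  have "tris (map (\<lambda>s. arr_tree r (contract (tgt r s))) ss) (map (\<lambda>s. outer r (NN False (regroup r s))) ss) (map (\<lambda>s. arr_tree r (contract (src s))) ss)"
    by (rule tris_map, rule tri_contract_aux) (use BIl in auto)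
  then have "tri (Nd ?i (map (\<lambda>s. arr_tree r (contract (tgt r s))) ss)) (Nd ?i (map (\<lambda>s. outer r (NN False (regroup r s))) ss))
      (Nd (Cmp (total C) ?i ?i) (map (\<lambda>s. arr_tree r (contract (src s))) ss))"
    by (rule tri_Nd) (use i Dom_Ide[OF o] Cod_Ide[OF o] in auto)
  moreover have "Cmp (total C) ?i ?i = ?i" using Ide_Cmp[OF i(1)] Cod_Ide[OF o] by simp
  ultimately show ?case using E by (simp add: tris_def comp_def del: vob.simps)
next
  case (BIr e b xs)
  let ?i = "Ide (total C) (vob (VI e (Inr b)))"
  have i: "?i \<in> Ar (total C)" "acol ?i = Inr b" using Ide_vob_in[of "Inr b" e] acol_Ide[of "Inr b" e] BIr(1) by auto
  have o: "vob (VI e (Inr b)) \<in> Ob (total C)" using vob_in[of "VI e (Inr b)"] BIr(1) by simp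
  have "map (nroot acol r) (map NL xs) = fst b" using BIr(2) by (simp add: comp_def)
  then have E: "ar.eval (nroot acol r) True (Nd ?i (map Lf (map NL xs))) = ?i"
    using ar.eval_unit[OF i(1), of "nroot acol r" "map NL xs"] i(2) by simp
  have "tri (Nd ?i (map Lf xs)) (Nd ?i (map Lf xs)) (Nd (Cmp (total C) ?i ?i) (map Lf xs))"
    by (rule tri_Nd) (use i Dom_Ide[OF o] Cod_Ide[OF o] in \<open>auto simp: tris_def tri_Lf\<close>)
  moreover have "Cmp (total C) ?i ?i = ?i" using Ide_Cmp[OF i(1)] Cod_Ide[OF o] by simp
  ultimately show ?case using E by (simp add: tris_def comp_def del: vob.simps)
next
  case (BX q)
  then show ?case
    using tris_concat[of "lvs q" "\<lambda>s. map (arr_tree r) (lvs (top_comp (tgt r s)))" "\<lambda>s. map (outer r) (lvs (regroup r s))"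
      "\<lambda>s. map (arr_tree r) (lvs (top_comp (src s)))"]
    by (simp add: top_comp_bind map_concat comp_def)
qed

text \<open>Regrouping the arrows of \<open>s\<close> does not change their value, by associativity
  of the action. Once regrouped they have the shape of the contraction of the target and compose
  with it vertexwise.\<close>

theorem contract_natural:
  assumes s: "wfc I r l s"
  shows "arr r l (contract (src s)) = Cmp (total C) (arr r l (contract (tgt r s))) (arr r l s)"
proof -
  let ?n = "NN False (regroup r s)"
  have n: "wfn I acol r l ?n" "set (nlabs ?n) \<subseteq> Ar (total C)" "flat ?n = arr_tree r s"
    using regroup_wf[OF s] by auto
  have "tri (arr_tree r (contract (tgt r s))) (outer r ?n) (arr_tree r (contract (src s)))"
    by (rule tri_contract_aux[OF s tris_top_comp[OF s]])
  from tri_eval[OF this ar.outer_wft[OF n(1,2)]] show ?thesis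
    unfolding arr_def ar.eval_flat[OF n(1,2), symmetric] n(3) .
qed

end

section \<open>Insertion of trees into operations\<close>

abbreviation inp :: "'i pair_colour \<Rightarrow> nat \<Rightarrow> 'i" where
  "inp c \<equiv> (!) (fst (boundary c))"

text \<open>The condition for a tree to be insertable at a vertex of colour \<open>c\<close>: its
  leaf \<open>n\<close> takes the place of the input \<open>n\<close> of the vertex.\<close>

definition typed :: "'i set \<Rightarrow> ('a \<Rightarrow> 'i pair_colour) \<Rightarrow> 'i pair_colour \<Rightarrow> ('a, nat) ptree \<Rightarrow> bool" where
  "typed I col c s \<longleftrightarrow> wft I col (inp c) (\<not> isl c) s \<and> root col (inp c) s = snd (boundary c) \<and> lvs s = [0..<val c]"

lemma typed_bq: "typed I col c s \<Longrightarrow> bq col (inp c) s = boundary c"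
  by (simp add: typed_def bq_def map_nth)

text \<open>A common induction for operations with target in \<open>O\<close> and in
  \<open>L\<close>. The predicate sees the colour of the root edge of a subtree; the sort is that of
  \<open>c\<close> throughout.\<close>

lemma op_induct [consumes 1, case_names Leaf Inl Inr]:
  assumes p: "(cs, c, t) \<in> ops (pair_operad I)"
    and L: "\<And>n. isl c \<Longrightarrow> n < val c \<Longrightarrow> P (Leaf n) (inp c n)"
    and O: "\<And>v b ts. v < length cs \<Longrightarrow> cs ! v = Inl b \<Longrightarrow> length ts = length (fst b)
      \<Longrightarrow> (\<And>n. n < length ts \<Longrightarrow> P (ts ! n) (fst b ! n)) \<Longrightarrow> P (Node v ts) (snd b)"
    and M: "\<And>v b ns. v < length cs \<Longrightarrow> cs ! v = Inr b \<Longrightarrow> \<not> isl c \<Longrightarrow> map (inp c) ns = fst b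
      \<Longrightarrow> (\<And>n. n \<in> set ns \<Longrightarrow> n < val c) \<Longrightarrow> P (Node v (map Leaf ns)) (snd b)"
  shows "P t (snd (boundary c))"
proof (cases c)
  case (Inl b)
  obtain js j where b: "b = (js, j)" by (cases b)
  have "otree cs js t j" using pair_opD(3)[OF p] Inl b by (simp add: tree_of_colour_def)
  then have "P t j"
  proof (induction rule: otree.induct)
    case (otree_Leaf n)
    then show ?case using L[of n] Inl b by simp
  next
    case (otree_Node v "is" i ts)
    show ?case using O[OF otree_Node(1,2)] otree_Node.IH by (simp add: list_all2_conv_all_nth)
  qed
  then show ?thesis using Inl b by simp
next
  case (Inr b)
  obtain js j where b: "b = (js, j)" by (cases b)
  have "ltree cs js t j" using pair_opD(3)[OF p] Inr b by (simp add: tree_of_colour_def)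
  then have "P t j"
  proof (induction rule: ltree.induct)
    case (ltree_L v "is" i ts)
    from ltree_L(3) have "\<exists>ns. ts = map Leaf ns \<and> map ((!) js) ns = is \<and> (\<forall>n \<in> set ns. n < length js)"
    proof (induction rule: list_all2_induct)
      case (Cons t ts k ks)
      then obtain n ns where "t = Leaf n" "k = js ! n" "n < length js" "ts = map Leaf ns" "map ((!) js) ns = ks"
        "\<forall>n \<in> set ns. n < length js" by auto
      then show ?case by (intro exI[of _ "n # ns"]) simp
    qed simp
    then show ?case using M[OF ltree_L(1,2)] Inr b by auto
  next
    case (ltree_O v "is" i ts)
    show ?case using O[OF ltree_O(1,2)] ltree_O.IH by (simp add: list_all2_conv_all_nth)
  qed
  then show ?thesis using Inr b by simp
qed

primrec plug :: "(nat \<Rightarrow> ('a, nat) ptree) \<Rightarrow> tree \<Rightarrow> ('a, nat) ptree" where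
  "plug f (Leaf n) = Lf n"
| "plug f (Node v ts) = bind (\<lambda>n. map (plug f) ts ! n) (f v)"

text \<open>The nested tree behind \<open>plug\<close>, with skeleton \<open>t\<close> and inner
  trees \<open>f v\<close>. Through it the results on nested trees apply to operations that act on
  labelled trees.\<close>

primrec plug_nest :: "'i pair_colour list \<Rightarrow> (nat \<Rightarrow> ('a, nat) ptree) \<Rightarrow> tree \<Rightarrow> ('a, nat) nest" where
  "plug_nest cs f (Leaf n) = NL n"
| "plug_nest cs f (Node v ts) = NN (\<not> isl (cs ! v)) (map_pt id (\<lambda>n. map (plug_nest cs f) ts ! n) (f v))"

text \<open>The label of the skeleton at \<open>v\<close> is not a function of \<open>v\<close>, as
  it also contains the subtrees above the vertex. The relation says that it is \<open>f v\<close> up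
  to a change \<open>h\<close> of the leaf data that respects colours.\<close>

definition slot :: "'i set \<Rightarrow> ('a \<Rightarrow> 'i pair_colour) \<Rightarrow> 'i pair_colour list \<Rightarrow> (nat \<Rightarrow> 'i) \<Rightarrow> (nat \<Rightarrow> ('a, nat) ptree)
    \<Rightarrow> bool \<times> ('a, ('a, nat) nest) ptree \<Rightarrow> nat \<Rightarrow> bool" where
  "slot I col cs r f = (\<lambda>(l, q) v. v < length cs \<and> l = (\<not> isl (cs ! v)) \<and>
     (\<exists>h. q = map_pt id h (f v) \<and> (\<forall>x \<in> set (lvs (f v)). nroot col r (h x) = inp (cs ! v) x)))"

lemma plug_nest_slot:
  assumes p: "(cs, c, t) \<in> ops (pair_operad I)" and f: "\<And>v. v < length cs \<Longrightarrow> typed I col (cs ! v) (f v)"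
  shows "wfn I col (inp c) (\<not> isl c) (plug_nest cs f t) \<and> nroot col (inp c) (plug_nest cs f t) = snd (boundary c)
    \<and> flat (plug_nest cs f t) = plug f t \<and> rel_pt (slot I col cs (inp c) f) (=) (skel (plug_nest cs f t)) (conv (\<lambda>v. v) (\<lambda>n. n) t)"
  using p
proof (induction rule: op_induct)
  case (Leaf n)
  have "inp c n \<in> I" using Leaf PBqD(1)[OF boundary_in[OF pair_opD(2)[OF p]]] by simp
  then show ?case using Leaf by simp
next
  case (Inl v b ts)
  let ?u = "\<lambda>n. map (plug_nest cs f) ts ! n"
  have v: "wft I col ((!) (fst b)) False (f v)" "root col ((!) (fst b)) (f v) = snd b" "lvs (f v) = [0..<length ts]"
    using f[OF Inl(1)] Inl(2,3) by (simp_all add: typed_def)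
  have u: "nroot col (inp c) (?u n) = fst b ! n" "flat (?u n) = map (plug f) ts ! n" if "n < length ts" for n
    using Inl(4)[OF that] that by simp_all
  have 1: "wft I col (\<lambda>n. nroot col (inp c) (?u n)) False (f v) = wft I col ((!) (fst b)) False (f v)"
    using v(3) u by (intro wft_cong) auto
  have 2: "root col (\<lambda>n. nroot col (inp c) (?u n)) (f v) = root col ((!) (fst b)) (f v)"
    using v(3) u by (intro root_cong) auto
  have 3: "bind (\<lambda>n. flat (?u n)) (f v) = bind (\<lambda>n. map (plug f) ts ! n) (f v)"
    using v(3) u by (intro bind_cong) auto
  have "slot I col cs (inp c) f (False, map_pt id ?u (f v)) v"
    unfolding slot_def using Inl(1,2) u v(3) by auto
  moreover have "list_all2 (rel_pt (slot I col cs (inp c) f) (=)) (map (\<lambda>n. skel (?u n)) [0..<length ts]) (map (conv (\<lambda>v. v) (\<lambda>n. n)) ts)"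
    using Inl(4) by (simp add: list_all2_conv_all_nth)
  ultimately show ?case using Inl v 1 2 3 by (auto simp: comp_def)
next
  case (Inr v b ns)
  let ?u = "\<lambda>n. map (plug_nest cs f) (map tree.Leaf ns) ! n"
  have len: "length (fst b) = length ns" using Inr(4) by (metis length_map)
  have v: "wft I col ((!) (fst b)) True (f v)" "root col ((!) (fst b)) (f v) = snd b" "lvs (f v) = [0..<length ns]"
    using f[OF Inr(1)] Inr(2) len by (simp_all add: typed_def)
  have u: "?u n = NL (ns ! n)" "nroot col (inp c) (?u n) = fst b ! n" "flat (?u n) = map (plug f) (map tree.Leaf ns) ! n"
    if "n < length ns" for n
    using that Inr(4) nth_map[of n ns "inp c"] by simp_all
  have 1: "wft I col (\<lambda>n. nroot col (inp c) (?u n)) True (f v) = wft I col ((!) (fst b)) True (f v)"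
    using v(3) u(2) by (intro wft_cong) auto
  have 2: "root col (\<lambda>n. nroot col (inp c) (?u n)) (f v) = root col ((!) (fst b)) (f v)"
    using v(3) u(2) by (intro root_cong) auto
  have 3: "bind (\<lambda>n. flat (?u n)) (f v) = bind (\<lambda>n. map (plug f) (map tree.Leaf ns) ! n) (f v)"
    using v(3) u(3) by (intro bind_cong) auto
  have 4: "map ?u [0..<length ns] = map NL ns" using u(1) by (auto intro!: nth_equalityI)
  have 5: "slot I col cs (inp c) f (True, map_pt id ?u (f v)) v"
    unfolding slot_def using Inr(1,2) u(2) v(3) by auto
  have 6: "list_all2 (rel_pt (slot I col cs (inp c) f) (=)) (map skel (map ?u [0..<length ns])) (map (conv (\<lambda>v. v) (\<lambda>n. n)) (map tree.Leaf ns))"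
    unfolding 4 by (simp add: list_all2_conv_all_nth)
  have "lvs (map_pt id ?u (f v)) = map NL ns" using 4 v(3) by simp
  then have "wfn I col (inp c) (\<not> isl c) (plug_nest cs f (Node v (map tree.Leaf ns)))"
    using Inr(2,3) v(1) 1 by auto
  moreover have "rel_pt (slot I col cs (inp c) f) (=) (skel (plug_nest cs f (Node v (map tree.Leaf ns)))) (conv (\<lambda>v. v) (\<lambda>n. n) (Node v (map tree.Leaf ns)))"
    using 5 6 v(3) Inr(2) by simp
  moreover have "nroot col (inp c) (plug_nest cs f (Node v (map tree.Leaf ns))) = snd b" using 2 v(2) by simp
  moreover have "flat (plug_nest cs f (Node v (map tree.Leaf ns))) = plug f (Node v (map tree.Leaf ns))" using 3 by simp
  ultimately show ?case by blast
qed

lemma map_rel_pt: "rel_pt R (=) s s' \<Longrightarrow> (\<And>a b. R a b \<Longrightarrow> F a = G b) \<Longrightarrow> map_pt F id s = map_pt G id s'"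
proof (induction rule: ptree.rel_induct)
  case (Nd a ss b ss')
  have "map (map_pt F id) ss = map (map_pt G id) ss'"
    using Nd(2) Nd.prems by (induction rule: list_all2_induct) auto
  then show ?case using Nd by simp
qed simp

lemma plug_nest_map:
  assumes p: "(cs, c, t) \<in> ops (pair_operad I)" and f: "\<And>v. v < length cs \<Longrightarrow> typed I col (cs ! v) (f v)"
    and F: "\<And>v h. v < length cs \<Longrightarrow> (\<And>x. x \<in> set (lvs (f v)) \<Longrightarrow> nroot col (inp c) (h x) = inp (cs ! v) x)
      \<Longrightarrow> F (\<not> isl (cs ! v), map_pt id h (f v)) = G v"
  shows "map_pt F id (skel (plug_nest cs f t)) = conv G (\<lambda>n. n) t"
proof -
  have "rel_pt (slot I col cs (inp c) f) (=) (skel (plug_nest cs f t)) (conv (\<lambda>v. v) (\<lambda>n. n) t)"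
    using plug_nest_slot[OF p, of col f] f by blast
  then have "map_pt F id (skel (plug_nest cs f t)) = map_pt G id (conv (\<lambda>v. v) (\<lambda>n. n) t)"
    by (rule map_rel_pt) (use F in \<open>auto simp: slot_def\<close>)
  then show ?thesis by simp
qed

lemma plug_nest_labs:
  assumes "(cs, c, t) \<in> ops (pair_operad I)" "\<And>v. v < length cs \<Longrightarrow> typed I col (cs ! v) (f v)"
  shows "set (nlabs (plug_nest cs f t)) = (\<Union>v<length cs. set (labs (f v)))"
proof -
  have "map_pt (\<lambda>(l, q). set (labs q)) id (skel (plug_nest cs f t)) = conv (\<lambda>v. set (labs (f v))) (\<lambda>n. n) t"
    by (rule plug_nest_map[OF assms(1), where col = col and f = f]) (use assms(2) in auto)
  from arg_cong[OF this, of "\<lambda>s. \<Union> (set (labs s))"]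
  show ?thesis using pair_opD(6)[OF assms(1)] by (simp add: nlabs_def split_def)
qed

lemma typed_plug:
  assumes p: "(cs, c, t) \<in> ops (pair_operad I)" and f: "\<And>v. v < length cs \<Longrightarrow> typed I col (cs ! v) (f v)"
  shows "typed I col c (plug f t)"
proof -
  have n: "wfn I col (inp c) (\<not> isl c) (plug_nest cs f t)" "nroot col (inp c) (plug_nest cs f t) = snd (boundary c)"
    "flat (plug_nest cs f t) = plug f t"
    using plug_nest_slot[OF p, of col f] f by blast+
  \<comment> \<open>With the labels forgotten, \<open>plug_nest_map\<close> identifies the skeleton
    with \<open>t\<close>, whose leaves are known.\<close>
  have "lvs (skel (plug_nest cs f t)) = lvs (map_pt (\<lambda>_. ()) id (skel (plug_nest cs f t)))" by simp
  also have "map_pt (\<lambda>_. ()) id (skel (plug_nest cs f t)) = conv (\<lambda>_. ()) (\<lambda>n. n) t"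
    by (rule plug_nest_map[OF p, where col = col and f = f]) (use f in auto)
  also have "lvs \<dots> = [0..<val c]" using pair_opD(4)[OF p] by simp
  finally show ?thesis using wft_flat[OF n(1)] root_flat[of col "inp c" "plug_nest cs f t"] n(2,3)
    by (simp add: typed_def lvs_skel)
qed

lemma map_plug:
  assumes p: "(cs, c, t) \<in> ops (pair_operad I)" and f: "\<And>v. v < length cs \<Longrightarrow> typed I col (cs ! v) (f v)"
  shows "map_pt F id (plug f t) = plug (\<lambda>v. map_pt F id (f v)) t"
  using p
proof (induction rule: op_induct)
  case (Inl v b ts)
  have "lvs (f v) = [0..<length ts]" using f[OF Inl(1)] Inl(2,3) by (simp add: typed_def)
  then show ?case using Inl(4) unfolding plug.simps map_bind by (auto intro!: bind_cong)
next
  case (Inr v b ns)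
  have "length (fst b) = length ns" using Inr(4) by (metis length_map)
  then have "lvs (f v) = [0..<length ns]" using f[OF Inr(1)] Inr(2) by (simp add: typed_def)
  then show ?case unfolding plug.simps map_bind by (auto intro!: bind_cong)
qed simp

context pair_algebra
begin

lemma eval_typed: "typed I col c s \<Longrightarrow> set (labs s) \<subseteq> A \<Longrightarrow> eval (inp c) (\<not> isl c) s \<in> A \<and> col (eval (inp c) (\<not> isl c) s) = c"
  using eval_in[of "inp c" "\<not> isl c" s] col_eval[of "inp c" "\<not> isl c" s] typed_bq[of I col c s] by (simp add: typed_def)

text \<open>Inserting trees into an operation corresponds to letting it act on their values. Applied
  to objects and to arrows, this makes \<open>obj\<close> and \<open>arr\<close> compatible with the
  action.\<close>

lemma act_plug:
  assumes p: "(cs, c, t) \<in> ops (pair_operad I)" and f: "\<And>v. v < length cs \<Longrightarrow> typed I col (cs ! v) (f v)"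
    and A: "\<And>v. v < length cs \<Longrightarrow> set (labs (f v)) \<subseteq> A"
  shows "act (cs, c, t) (map (\<lambda>v. eval (inp (cs ! v)) (\<not> isl (cs ! v)) (f v)) [0..<length cs]) = eval (inp c) (\<not> isl c) (plug f t)"
proof -
  let ?xs = "map (\<lambda>v. eval (inp (cs ! v)) (\<not> isl (cs ! v)) (f v)) [0..<length cs]" and ?n = "plug_nest cs f t"
  have n: "wfn I col (inp c) (\<not> isl c) ?n" "flat ?n = plug f t"
    using plug_nest_slot[OF p, of col f] f by blast+
  have "set ?xs \<subseteq> A" "map col ?xs = cs" using eval_typed[OF f A] by (auto intro!: nth_equalityI)
  then have "act (cs, c, t) ?xs = eval (inp c) (\<not> isl c) (conv ((!) ?xs) (\<lambda>n. n) t)"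
    by (rule act_eval[OF p]) simp
  also have "conv ((!) ?xs) (\<lambda>n. n) t = conv (\<lambda>v. eval (inp (cs ! v)) (\<not> isl (cs ! v)) (f v)) (\<lambda>n. n) t"
    using pair_opD(6)[OF p] by (intro conv_cong) auto
  also have "\<dots> = map_pt (\<lambda>(l', q). eval (nroot col (inp c)) l' q) id (skel ?n)"
    by (rule plug_nest_map[OF p, where col = col and f = f, symmetric]) (use f in \<open>auto intro!: eval_cong\<close>)
  also have "eval (inp c) (\<not> isl c) \<dots> = eval (inp c) (\<not> isl c) (plug f t)"
  proof -
    have "set (nlabs ?n) \<subseteq> A" using plug_nest_labs[OF p, of col f] f A by auto
    from eval_flat[OF n(1) this] show ?thesis using n(2) by simp
  qed
  finally show ?thesis .
qed

end

section \<open>Insertion of contractions into operations\<close>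

primrec bind_ctr :: "('b \<Rightarrow> ('i, 'c) ctr) \<Rightarrow> ('i, 'b) ctr \<Rightarrow> ('i, 'c) ctr" where
  "bind_ctr f (BL x) = f x"
| "bind_ctr f (BI e c ss) = BI e c (map (bind_ctr f) ss)"
| "bind_ctr f (BX q) = BX (map_pt id (bind_ctr f) q)"

primrec plug_ctr :: "(nat \<Rightarrow> ('i, nat) ctr) \<Rightarrow> tree \<Rightarrow> ('i, nat) ctr" where
  "plug_ctr f (Leaf n) = BL n"
| "plug_ctr f (Node v ts) = bind_ctr (\<lambda>n. map (plug_ctr f) ts ! n) (f v)"

lemma broot_bind_ctr: "broot r (bind_ctr f s) = broot (\<lambda>x. broot r (f x)) s"
proof (induction s)
  case (BX q)
  then show ?case by (auto intro!: root_cong)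
qed simp_all

lemma src_bind_ctr: "src (bind_ctr f s) = bind (\<lambda>x. src (f x)) (src s)"
proof (induction s)
  case (BX q)
  have "bind src (map_pt VX id (map_pt id (bind_ctr f) q)) = bind (\<lambda>s. src (bind_ctr f s)) (map_pt VX id q)"
    by (simp add: bind_map[of src _ "bind_ctr f"])
  then show ?case using BX by (auto intro!: bind_cong)
qed simp_all

lemma tgt_bind_ctr: "tgt r (bind_ctr f s) = bind (\<lambda>x. tgt r (f x)) (tgt (\<lambda>x. broot r (f x)) s)"
proof (induction s)
  case (BX q)
  have "bq Inl (\<lambda>s. broot r (bind_ctr f s)) q = bq Inl (broot (\<lambda>x. broot r (f x))) q"
    by (rule bq_cong) (simp_all add: broot_bind_ctr)
  then show ?case using BX by (auto simp: comp_def)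
qed simp_all

lemma bind_ctr_cong: "(\<And>x. x \<in> set (lvs (src s)) \<Longrightarrow> f x = g x) \<Longrightarrow> bind_ctr f s = bind_ctr g s"
proof (induction s)
  case (BI e c ss)
  have "bind_ctr f s = bind_ctr g s" if "s \<in> set ss" for s
    by (rule BI.IH[OF that]) (use that BI.prems in auto)
  then show ?case by simp
next
  case (BX q)
  have "map_pt id (bind_ctr f) q = map_pt id (bind_ctr g) q" using BX by (intro map_pt_cong') auto
  then show ?case by simp
qed simp_all

lemma wfc_bind_ctr: "wfc I (\<lambda>x. broot r (f x)) False s \<Longrightarrow> (\<And>x. x \<in> set (lvs (src s)) \<Longrightarrow> wfc I r l (f x)) \<Longrightarrow> wfc I r l (bind_ctr f s)"
proof (induction s)
  case (BI e c ss)
  have "wfc I r l (bind_ctr f s)" if "s \<in> set ss" "wfc I (\<lambda>x. broot r (f x)) False s" for s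
    by (rule BI.IH[OF that]) (use that BI.prems in auto)
  then show ?case using BI.prems(1) by (auto simp: broot_bind_ctr comp_def split: if_splits)
next
  case (BX q)
  have "wft I Inl (\<lambda>s. broot r (bind_ctr f s)) False q = wft I Inl (broot (\<lambda>x. broot r (f x))) False q"
    by (rule wft_cong) (simp_all add: broot_bind_ctr)
  then show ?case using BX by auto
qed simp

text \<open>The companion of \<open>wfc_bind_ctr\<close> for contractions with target in
  \<open>L\<close>, above which only leaves can be substituted for leaves.\<close>

lemma wfc_bind_ctr_BL: "wfc I (\<lambda>x. r (f x)) l s \<Longrightarrow> wfc I r l (bind_ctr (\<lambda>x. BL (f x)) s)"
proof (induction rule: wfc_induct)
  case (BIl e b ss)
  then show ?case by (auto simp: broot_bind_ctr comp_def)
next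
  case (BIr e b xs)
  then show ?case by (auto simp: comp_def intro!: exI[of _ "map f xs"])
next
  case (BX q)
  have "wft I Inl (\<lambda>s. broot r (bind_ctr (\<lambda>x. BL (f x)) s)) False q = wft I Inl (broot (\<lambda>x. r (f x))) False q"
    by (rule wft_cong) (simp_all add: broot_bind_ctr)
  then show ?case using BX by auto
qed simp

lemma b_cong:
  assumes "\<And>x. x \<in> set (lvs (src s)) \<Longrightarrow> r x = r' x"
  shows "broot r s = broot r' s \<and> tgt r s = tgt r' s"
  using assms
proof (induction s)
  case (BI e c ss)
  have "tgt r s = tgt r' s" if "s \<in> set ss" for s
    using BI.IH[OF that] that BI.prems by auto
  then show ?case by simp
next
  case (BX q)
  have "\<forall>s \<in> set (lvs q). broot r s = broot r' s \<and> tgt r s = tgt r' s" using BX by auto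
  moreover from this have "bq Inl (broot r) q = bq Inl (broot r') q" by (intro bq_cong) auto
  ultimately show ?case by (auto simp: bq_def)
qed simp_all

lemma wfc_cong:
  assumes "wfc I r l s" "\<And>x. x \<in> set (lvs (src s)) \<Longrightarrow> r x = r' x"
  shows "wfc I r' l s"
  using assms
proof (induction rule: wfc_induct)
  case (BIl e b ss)
  have "broot r s = broot r' s" if "s \<in> set ss" for s
    by (rule b_cong[THEN conjunct1]) (use BIl.prems that in auto)
  then have "map (broot r') ss = fst b" by (auto simp flip: BIl(2))
  then show ?case using BIl by auto
next
  case (BIr e b xs)
  then have "map r' xs = fst b" by (auto simp flip: BIr(2))
  then show ?case using BIr by auto
next
  case (BX q)
  have "broot r s = broot r' s" if "s \<in> set (lvs q)" for s
    by (rule b_cong[THEN conjunct1]) (use BX.prems that in auto)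
  then have "wft I Inl (broot r') False q = wft I Inl (broot r) False q" by (intro wft_cong) auto
  then show ?case using BX by auto
qed auto

definition ctyped :: "'i set \<Rightarrow> 'i pair_colour \<Rightarrow> ('i, nat) ctr \<Rightarrow> bool" where
  "ctyped I c s \<longleftrightarrow> wfc I (inp c) (\<not> isl c) s \<and> broot (inp c) s = snd (boundary c) \<and> lvs (src s) = [0..<val c]"

lemma ctyped_tgt: "ctyped I c s \<Longrightarrow> typed I vcol c (tgt (inp c) s)"
  using wft_tgt[of I "inp c" "\<not> isl c" s] roots[of I "inp c" "\<not> isl c" s]
    lvs_tgt[of I "inp c" "\<not> isl c" s]
  by (simp add: ctyped_def typed_def)

lemma ctyped_contract: "typed I vcol c d \<Longrightarrow> ctyped I c (contract d)"
  using top_comp_props[of I "inp c" "\<not> isl c" d] by (simp add: ctyped_def typed_def contract_def[of d])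

context pair_int
begin

lemma X_tree_plug:
  assumes p: "(cs, c, t) \<in> ops (pair_operad I)" and f: "\<And>v. v < length cs \<Longrightarrow> typed I (\<lambda>c. c) (cs ! v) (f v)"
  shows "X_tree (inp c) (\<not> isl c) (plug f t) = Cmp (total C) (X_ar U (cs, c, t))
    (act_ar C (cs, c, t) (map (\<lambda>v. X_tree (inp (cs ! v)) (\<not> isl (cs ! v)) (f v)) [0..<length cs]))"
proof -
  let ?n = "plug_nest cs f t" and ?a = "\<lambda>v. X_tree (inp (cs ! v)) (\<not> isl (cs ! v)) (f v)"
  let ?fs = "map ?a [0..<length cs]"
  have n: "wfn I (\<lambda>c. c) (inp c) (\<not> isl c) ?n" "flat ?n = plug f t"
    using plug_nest_slot[OF p, of "\<lambda>c. c" f] f by blast+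
  have g: "map_pt (ncol (\<lambda>c. c) (inp c)) id (skel ?n) = conv ((!) cs) (\<lambda>n. n) t"
  proof (rule plug_nest_map[OF p, where col = "\<lambda>c. c" and f = f, OF f])
    fix v h assume v: "v < length cs" and h: "\<And>x. x \<in> set (lvs (f v)) \<Longrightarrow> nroot (\<lambda>c. c) (inp c) (h x) = inp (cs ! v) x"
    have "bq (\<lambda>c. c) (\<lambda>x. nroot (\<lambda>c. c) (inp c) (h x)) (f v) = bq (\<lambda>c. c) (inp (cs ! v)) (f v)"
      using h by (intro bq_cong) auto
    then show "ncol (\<lambda>c. c) (inp c) (\<not> isl (cs ! v), map_pt id h (f v)) = cs ! v"
      using typed_bq[OF f[OF v]] by simp
  qed simp
  have a: "map_pt (\<lambda>(l', q). X_tree (nroot (\<lambda>c. c) (inp c)) l' q) id (skel ?n) = conv ?a (\<lambda>n. n) t"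
  proof (rule plug_nest_map[OF p, where col = "\<lambda>c. c" and f = f, OF f])
    fix v h assume v: "v < length cs" and h: "\<And>x. x \<in> set (lvs (f v)) \<Longrightarrow> nroot (\<lambda>c. c) (inp c) (h x) = inp (cs ! v) x"
    show "(case (\<not> isl (cs ! v), map_pt id h (f v)) of (l', q) \<Rightarrow> X_tree (nroot (\<lambda>c. c) (inp c)) l' q) = ?a v"
      unfolding prod.case X_tree_map_leaf[of _ _ id h] using h by (auto simp: ptree.map_id intro!: X_tree_cong)
  qed simp
  have fs: "set ?fs \<subseteq> Ar (total C)" "map acol ?fs = cs"
    using f X_tree_in acol_X_tree typed_bq[OF f] by (fastforce simp: typed_def intro!: nth_equalityI)+
  have "act_ar C (cs, c, t) ?fs = ar.eval (inp c) (\<not> isl c) (conv ((!) ?fs) (\<lambda>n. n) t)"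
    by (rule ar.act_eval[OF p fs]) simp
  also have "conv ((!) ?fs) (\<lambda>n. n) t = conv ?a (\<lambda>n. n) t"
    using pair_opD(6)[OF p] by (intro conv_cong) auto
  finally have "act_ar C (cs, c, t) ?fs = ar.eval (inp c) (\<not> isl c) (conv ?a (\<lambda>n. n) t)" .
  moreover have "X_ar U (cs, c, t) = X_tree (inp c) (\<not> isl c) (conv ((!) cs) (\<lambda>n. n) t)"
    by (rule X_ar_conv[OF p]) simp
  ultimately show ?thesis using X_tree_flat[OF n(1)] n(2) g a by simp
qed

lemma obj_plug:
  assumes p: "(cs, c, t) \<in> ops (pair_operad I)" and d: "\<And>v. v < length cs \<Longrightarrow> typed I vcol (cs ! v) (d v)"
  shows "act_ob C (cs, c, t) (map (\<lambda>v. obj (inp (cs ! v)) (\<not> isl (cs ! v)) (d v)) [0..<length cs])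
    = obj (inp c) (\<not> isl c) (plug d t)"
proof -
  have t: "typed I (colour C) (cs ! v) (map_pt vob id (d v))" "set (labs (map_pt vob id (d v))) \<subseteq> Ob (total C)"
    if v: "v < length cs" for v
  proof -
    have d': "wft I vcol (inp (cs ! v)) (\<not> isl (cs ! v)) (d v)" using d[OF v] by (simp add: typed_def)
    have "root (\<lambda>a. colour C (vob a)) (inp (cs ! v)) (d v) = root vcol (inp (cs ! v)) (d v)"
      using vob_in[OF wft_labs[OF d']] by (intro root_cong) auto
    then show "typed I (colour C) (cs ! v) (map_pt vob id (d v))" using wft_vob(1)[OF d'] d[OF v] by (simp add: typed_def)
    show "set (labs (map_pt vob id (d v))) \<subseteq> Ob (total C)" by (rule wft_vob(2)[OF d'])
  qed
  show ?thesis
  proof -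
    have "map_pt vob id (plug d t) = plug (\<lambda>v. map_pt vob id (d v)) t"
      by (rule map_plug[OF p]) (rule d)
    moreover have "act_ob C (cs, c, t) (map (\<lambda>v. ob.eval (inp (cs ! v)) (\<not> isl (cs ! v)) (map_pt vob id (d v))) [0..<length cs])
        = ob.eval (inp c) (\<not> isl c) (plug (\<lambda>v. map_pt vob id (d v)) t)"
      by (rule ob.act_plug[OF p]) (use t in auto)
    ultimately show ?thesis by (simp add: obj_def)
  qed
qed

lemma lvs_arr_tree: "wfc I r l s \<Longrightarrow> lvs (arr_tree r s) = lvs (src s)"
proof (induction rule: wfc_induct)
  case (BX q)
  then have "map (\<lambda>x. lvs (arr_tree r x)) (lvs q) = map (\<lambda>x. lvs (src x)) (lvs q)" by simp
  then show ?case by (simp add: comp_def cong: map_cong)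
qed (auto intro!: arg_cong[where f = concat])

lemma arr_tree_bind_ctr: "arr_tree r (bind_ctr f s) = bind (\<lambda>x. arr_tree r (f x)) (arr_tree (\<lambda>x. broot r (f x)) s)"
proof (induction s)
  case (BX q)
  have "X_tree (broot r) False (map_pt Inl (bind_ctr f) q) = X_tree (broot (\<lambda>x. broot r (f x))) False (map_pt Inl id q)"
    unfolding X_tree_map_leaf[of _ _ _ "bind_ctr f"] by (rule X_tree_cong) (simp add: broot_bind_ctr)
  then show ?case using BX by (auto simp: comp_def)
qed simp_all

lemma arr_tree_cong: "(\<And>x. x \<in> set (lvs (src s)) \<Longrightarrow> r x = r' x) \<Longrightarrow> arr_tree r s = arr_tree r' s"
proof (induction s)
  case (BI e c ss)
  have "arr_tree r s = arr_tree r' s" if "s \<in> set ss" for s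
    by (rule BI.IH[OF that]) (use that BI.prems in auto)
  then show ?case by simp
next
  case (BX q)
  have "\<forall>s \<in> set (lvs q). arr_tree r s = arr_tree r' s" using BX by auto
  moreover have "X_tree (broot r) False (map_pt Inl id q) = X_tree (broot r') False (map_pt Inl id q)"
  proof (rule X_tree_cong)
    fix s assume "s \<in> set (lvs (map_pt Inl id q))"
    then show "broot r s = broot r' s" by (intro b_cong[THEN conjunct1]) (use BX.prems in auto)
  qed
  ultimately show ?case by auto
qed simp_all

text \<open>The five claims share one induction: the colours of the leaves of \<open>f v\<close>
  have to be exchanged for the roots of the inserted children, and these are known from the
  induction hypothesis.\<close>

lemma ctyped_plug_ctr:
  assumes p: "(cs, c, t) \<in> ops (pair_operad I)" and f: "\<And>v. v < length cs \<Longrightarrow> ctyped I (cs ! v) (f v)"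
  shows "wfc I (inp c) (\<not> isl c) (plug_ctr f t) \<and> broot (inp c) (plug_ctr f t) = snd (boundary c)
    \<and> src (plug_ctr f t) = plug (\<lambda>v. src (f v)) t \<and> tgt (inp c) (plug_ctr f t) = plug (\<lambda>v. tgt (inp (cs ! v)) (f v)) t
    \<and> arr_tree (inp c) (plug_ctr f t) = plug (\<lambda>v. arr_tree (inp (cs ! v)) (f v)) t"
  using p
proof (induction rule: op_induct)
  case (Leaf n)
  have "inp c n \<in> I" using Leaf PBqD(1)[OF boundary_in[OF pair_opD(2)[OF p]]] by simp
  then show ?case using Leaf by simp
next
  case (Inl v b ts)
  let ?u = "\<lambda>n. map (plug_ctr f) ts ! n"
  have v: "wfc I ((!) (fst b)) False (f v)" "broot ((!) (fst b)) (f v) = snd b" "lvs (src (f v)) = [0..<length ts]"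
    using f[OF Inl(1)] Inl(2,3) by (simp_all add: ctyped_def)
  have u: "broot (inp c) (?u n) = fst b ! n" "wfc I (inp c) (\<not> isl c) (?u n)" "src (?u n) = plug (\<lambda>v. src (f v)) (ts ! n)"
    "tgt (inp c) (?u n) = plug (\<lambda>v. tgt (inp (cs ! v)) (f v)) (ts ! n)"
    "arr_tree (inp c) (?u n) = plug (\<lambda>v. arr_tree (inp (cs ! v)) (f v)) (ts ! n)" if "n < length ts" for n
    using Inl(4)[OF that] that by simp_all
  \<comment> \<open>The input colours of the vertex agree with the roots of the inserted children,
    which is the form of the leaf colouring in the equations for \<open>bind_ctr\<close>.\<close>
  have c: "x \<in> set (lvs (src (f v))) \<Longrightarrow> (!) (fst b) x = broot (inp c) (?u x)" for x using u(1) v(3) by simp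
  have "wfc I (\<lambda>x. broot (inp c) (?u x)) False (f v)" by (rule wfc_cong[OF v(1)], rule c)
  then have "wfc I (inp c) (\<not> isl c) (bind_ctr ?u (f v))" by (rule wfc_bind_ctr) (use u v(3) in auto)
  moreover have e: "broot ((!) (fst b)) (f v) = broot (\<lambda>x. broot (inp c) (?u x)) (f v) \<and>
      tgt ((!) (fst b)) (f v) = tgt (\<lambda>x. broot (inp c) (?u x)) (f v)" by (rule b_cong[of "f v" "(!) (fst b)" "\<lambda>x. broot (inp c) (?u x)", OF c])
  moreover have "bind (\<lambda>x. src (?u x)) (src (f v)) = bind (\<lambda>n. map (plug (\<lambda>v. src (f v))) ts ! n) (src (f v))"
    by (rule bind_cong) (use u v(3) in auto)
  moreover have "bind (\<lambda>x. tgt (inp c) (?u x)) (tgt ((!) (fst b)) (f v))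
      = bind (\<lambda>n. map (plug (\<lambda>v. tgt (inp (cs ! v)) (f v))) ts ! n) (tgt ((!) (fst b)) (f v))"
    by (rule bind_cong) (use u v(3) lvs_tgt[OF v(1)] in auto)
  moreover have "arr_tree ((!) (fst b)) (f v) = arr_tree (\<lambda>x. broot (inp c) (?u x)) (f v)"
    by (rule arr_tree_cong[of "f v" "(!) (fst b)" "\<lambda>x. broot (inp c) (?u x)", OF c])
  moreover have "bind (\<lambda>x. arr_tree (inp c) (?u x)) (arr_tree ((!) (fst b)) (f v))
      = bind (\<lambda>n. map (plug (\<lambda>v. arr_tree (inp (cs ! v)) (f v))) ts ! n) (arr_tree ((!) (fst b)) (f v))"
    by (rule bind_cong) (use u v(3) lvs_arr_tree[OF v(1)] in auto)
  ultimately show ?case using v Inl(2) by (simp add: broot_bind_ctr src_bind_ctr tgt_bind_ctr arr_tree_bind_ctr)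
next
  case (Inr v b ns)
  let ?ts = "map tree.Leaf ns"
  let ?u = "\<lambda>n. map (plug_ctr f) ?ts ! n"
  have len: "length (fst b) = length ns" using Inr(4) by (metis length_map)
  have v: "wfc I ((!) (fst b)) True (f v)" "broot ((!) (fst b)) (f v) = snd b" "lvs (src (f v)) = [0..<length ns]"
    using f[OF Inr(1)] Inr(2) len by (simp_all add: ctyped_def)
  have u: "?u n = BL (ns ! n)" "broot (inp c) (?u n) = fst b ! n" if "n < length ns" for n
    using that Inr(4) nth_map[of n ns "inp c"] by simp_all
  have c: "x \<in> set (lvs (src (f v))) \<Longrightarrow> (!) (fst b) x = broot (inp c) (?u x)" for x using u(2) v(3) by simp
  have "wfc I (\<lambda>x. inp c (ns ! x)) True (f v)"
    by (rule wfc_cong[OF v(1)]) (use u v(3) in auto)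
  then have "wfc I (inp c) True (bind_ctr (\<lambda>x. BL (ns ! x)) (f v))" by (rule wfc_bind_ctr_BL)
  moreover have "bind_ctr (\<lambda>x. BL (ns ! x)) (f v) = bind_ctr ?u (f v)"
    using v(3) u(1) by (intro bind_ctr_cong) auto
  moreover have e: "broot ((!) (fst b)) (f v) = broot (\<lambda>x. broot (inp c) (?u x)) (f v) \<and>
      tgt ((!) (fst b)) (f v) = tgt (\<lambda>x. broot (inp c) (?u x)) (f v)" by (rule b_cong[of "f v" "(!) (fst b)" "\<lambda>x. broot (inp c) (?u x)", OF c])
  moreover have "bind (\<lambda>x. src (?u x)) (src (f v)) = bind (\<lambda>n. map (plug (\<lambda>v. src (f v))) ?ts ! n) (src (f v))"
    by (rule bind_cong) (use u v(3) in auto)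
  moreover have "bind (\<lambda>x. tgt (inp c) (?u x)) (tgt ((!) (fst b)) (f v))
      = bind (\<lambda>n. map (plug (\<lambda>v. tgt (inp (cs ! v)) (f v))) ?ts ! n) (tgt ((!) (fst b)) (f v))"
    by (rule bind_cong) (use u v(3) lvs_tgt[OF v(1)] in auto)
  moreover have "arr_tree ((!) (fst b)) (f v) = arr_tree (\<lambda>x. broot (inp c) (?u x)) (f v)"
    by (rule arr_tree_cong[of "f v" "(!) (fst b)" "\<lambda>x. broot (inp c) (?u x)", OF c])
  moreover have "bind (\<lambda>x. arr_tree (inp c) (?u x)) (arr_tree ((!) (fst b)) (f v))
      = bind (\<lambda>n. map (plug (\<lambda>v. arr_tree (inp (cs ! v)) (f v))) ?ts ! n) (arr_tree ((!) (fst b)) (f v))"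
    by (rule bind_cong) (use u v(3) lvs_arr_tree[OF v(1)] in auto)
  ultimately show ?case using v Inr(2,3) by (simp add: broot_bind_ctr src_bind_ctr tgt_bind_ctr arr_tree_bind_ctr)
qed

lemma arr_plug_ctr:
  assumes p: "(cs, c, t) \<in> ops (pair_operad I)" and f: "\<And>v. v < length cs \<Longrightarrow> ctyped I (cs ! v) (f v)"
  shows "act_ar C (cs, c, t) (map (\<lambda>v. arr (inp (cs ! v)) (\<not> isl (cs ! v)) (f v)) [0..<length cs])
    = arr (inp c) (\<not> isl c) (plug_ctr f t)"
proof -
  have t: "typed I acol (cs ! v) (arr_tree (inp (cs ! v)) (f v))" "set (labs (arr_tree (inp (cs ! v)) (f v))) \<subseteq> Ar (total C)"
    if v: "v < length cs" for v
  proof -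
    have b: "wfc I (inp (cs ! v)) (\<not> isl (cs ! v)) (f v)" using f[OF v] by (simp add: ctyped_def)
    show "typed I acol (cs ! v) (arr_tree (inp (cs ! v)) (f v))" "set (labs (arr_tree (inp (cs ! v)) (f v))) \<subseteq> Ar (total C)"
      using arr_tree_wf[OF b] lvs_arr_tree[OF b] f[OF v] by (simp_all add: typed_def ctyped_def)
  qed
  have e: "arr_tree (inp c) (plug_ctr f t) = plug (\<lambda>v. arr_tree (inp (cs ! v)) (f v)) t" using ctyped_plug_ctr[OF p, of f] f by simp
  show ?thesis unfolding arr_def e by (rule ar.act_plug[OF p]) (use t in auto)
qed

end

section \<open>Splitting the elements of the left module\<close>

lemma plug_cong: "(\<And>v. v \<in> set (vertices t) \<Longrightarrow> f v = g v) \<Longrightarrow> plug f t = plug g t"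
proof (induction t)
  case (Node v ts)
  have e: "map (plug f) ts = map (plug g) ts" using Node by auto
  show ?case unfolding plug.simps e using Node.prems by simp
qed simp

lemma plug_relabel: "plug f (relabel h t) = plug (\<lambda>v. f (h v)) t"
proof (induction t)
  case (Node v ts)
  then have e: "map (plug f) (map (relabel h) ts) = map (plug (\<lambda>v. f (h v))) ts" by simp
  show ?case unfolding relabel.simps plug.simps e ..
qed simp

lemma plug_graft: "set (leaves s) \<subseteq> {..<length us} \<Longrightarrow> fits (\<lambda>v. length (lvs (f v))) s \<Longrightarrow>
    (\<And>v. v \<in> set (vertices s) \<Longrightarrow> lvs (f v) = [0..<length (lvs (f v))]) \<Longrightarrow>
    plug f (graft s us) = bind (\<lambda>n. plug f (us ! n)) (plug f s)"
proof (induction s)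
  case (Node v ts)
  have IH: "plug f (graft (ts ! n) us) = bind (\<lambda>n. plug f (us ! n)) (plug f (ts ! n))" if "n < length ts" for n
  proof (rule Node.IH)
    show m: "ts ! n \<in> set ts" using that by simp
    show "set (leaves (ts ! n)) \<subseteq> {..<length us}" using Node.prems(1) m by auto
    show "fits (\<lambda>v. length (lvs (f v))) (ts ! n)" using Node.prems(2) m by simp
    show "lvs (f w) = [0..<length (lvs (f w))]" if "w \<in> set (vertices (ts ! n))" for w
      by (rule Node.prems(3)) (use that m in auto)
  qed
  have l: "lvs (f v) = [0..<length ts]" using Node.prems(2) Node.prems(3)[of v] by simp
  show ?case unfolding graft.simps plug.simps bind_bind
    by (rule bind_cong) (use l IH in simp)
qed simp

text \<open>Insertion in two stages agrees with insertion at once. With \<open>plug_unit\<close>,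
  \<open>plug_comp\<close> and \<open>plug_perm\<close>, which follow, labelled trees satisfy the
  axioms of an algebra over the operad.\<close>

lemma plug_insert:
  assumes "fits r t" and "\<And>v. v \<in> set (vertices t) \<Longrightarrow> leaves (f v) = [0..<r v]"
    and "\<And>v. v \<in> set (vertices t) \<Longrightarrow> fits (\<lambda>w. length (lvs (g w))) (f v)"
    and "\<And>v. v \<in> set (vertices t) \<Longrightarrow> lvs (plug g (f v)) = [0..<r v]"
    and "\<And>v w. v \<in> set (vertices t) \<Longrightarrow> w \<in> set (vertices (f v)) \<Longrightarrow> lvs (g w) = [0..<length (lvs (g w))]"
  shows "plug g (insert_trees f t) = plug (\<lambda>v. plug g (f v)) t"
  using assms
proof (induction t)
  case (Node v ts)
  have IH: "plug g (insert_trees f (ts ! n)) = plug (\<lambda>v. plug g (f v)) (ts ! n)" if n: "n < length ts" for n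
  proof (rule Node.IH)
    show "ts ! n \<in> set ts" "fits r (ts ! n)" using n Node.prems(1) by auto
    fix w assume w: "w \<in> set (vertices (ts ! n))"
    then have w': "w \<in> set (vertices (Node v ts))" using n by auto
    show "leaves (f w) = [0..<r w]" "fits (\<lambda>w. length (lvs (g w))) (f w)" "lvs (plug g (f w)) = [0..<r w]"
      "\<And>x. x \<in> set (vertices (f w)) \<Longrightarrow> lvs (g x) = [0..<length (lvs (g x))]"
      using Node.prems(2-5) w' by blast+
  qed
  have v: "r v = length ts" "leaves (f v) = [0..<length ts]" "lvs (plug g (f v)) = [0..<length ts]"
    using Node.prems(1) Node.prems(2,4)[of v] by simp_all
  have "plug g (graft (f v) (map (insert_trees f) ts)) = bind (\<lambda>n. plug g (map (insert_trees f) ts ! n)) (plug g (f v))"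
    by (rule plug_graft) (use v Node.prems(3)[of v] Node.prems(5)[of v] in \<open>simp_all add: atLeast0LessThan\<close>)
  also have "\<dots> = bind (\<lambda>n. map (plug (\<lambda>v. plug g (f v))) ts ! n) (plug g (f v))"
    by (rule bind_cong) (use v IH in simp)
  finally show ?case by simp
qed simp

lemma plug_unit: "lvs d = [0..<n] \<Longrightarrow> f 0 = d \<Longrightarrow> plug f (Node 0 (map Leaf [0..<n])) = d"
proof -
  assume l: "lvs d = [0..<n]" and f: "f 0 = d"
  have "bind (\<lambda>k. map (plug f) (map Leaf [0..<n]) ! k) d = bind (\<lambda>k. Lf k) d"
    by (rule bind_cong) (use l in simp)
  then show ?thesis using f by (simp add: bind_Lf ptree.map_id del: map_map)
qed

lemma plug_comp:
  assumes c: "composable (pair_operad I) (cs, c, t) qs"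
    and g: "\<And>w. w < length (concat (map fst qs)) \<Longrightarrow> typed I col (concat (map fst qs) ! w) (g w)"
  shows "plug g (snd (snd (comp_op (pair_operad I) (cs, c, t) qs)))
    = plug (\<lambda>v. plug (\<lambda>w. g (blocks 0 (map (length \<circ> fst) qs) ! v ! w)) (snd (snd (qs ! v)))) t"
proof -
  define ns where "ns = map (length \<circ> fst) qs"
  define f where "f v = relabel ((!) (blocks 0 ns ! v)) (snd (snd (qs ! v)))" for v
  note q = pair_composable[OF c] and ct = comp_tree[OF c ns_def]
  note p' = pair_opD[OF q(1), simplified]
  have f: "plug g (f v) = plug (\<lambda>w. g (blocks 0 ns ! v ! w)) (snd (snd (qs ! v)))" for v
    by (simp add: f_def plug_relabel)
  have gb: "typed I col (fst (qs ! v) ! w) (g (blocks 0 ns ! v ! w))"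
    if v: "v < length cs" and w: "w < length (fst (qs ! v))" for v w
  proof -
    have w': "w < ns ! v" using v w q(2) by (simp add: ns_def)
    have "blocks 0 ns ! v ! w < length (concat (map fst qs))"
      using nth_concat_blocks(2)[of v "map fst qs" w] v w q(2) by (simp add: ns_def)
    from g[OF this] show ?thesis using ct(4)[OF v w'] by simp
  qed
  have qop: "(fst (qs ! v), cs ! v, snd (snd (qs ! v))) \<in> ops (pair_operad I)" if "v < length cs" for v
    using q(3)[OF that] by (cases "qs ! v") auto
  have "plug g (insert_trees f t) = plug (\<lambda>v. plug g (f v)) t"
  proof (rule plug_insert[OF p'(7)])
    fix v assume "v \<in> set (vertices t)"
    then have v: "v < length cs" using p'(6) by simp
    show "leaves (f v) = [0..<val (cs ! v)]" using ct(2)[OF v] by (simp add: f_def)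
    have vs: "set (vertices (snd (snd (qs ! v)))) = {..<length (fst (qs ! v))}" using pair_opD(6)[OF qop[OF v]] by simp
    have "fits (\<lambda>w. val (fst (qs ! v) ! w)) (snd (snd (qs ! v)))" using pair_opD(7)[OF qop[OF v]] by simp
    then show "fits (\<lambda>w. length (lvs (g w))) (f v)" unfolding f_def fits_relabel
      by (rule fits_cong) (use gb[OF v] vs in \<open>simp add: typed_def\<close>)
    show "lvs (plug g (f v)) = [0..<val (cs ! v)]"
      using typed_plug[OF qop[OF v], of col "\<lambda>w. g (blocks 0 ns ! v ! w)"] gb[OF v] by (simp add: f typed_def)
    fix w assume "w \<in> set (vertices (f v))"
    then obtain w' where "w = blocks 0 ns ! v ! w'" "w' < length (fst (qs ! v))" using vs by (auto simp: f_def)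
    then show "lvs (g w) = [0..<length (lvs (g w))]" using gb[OF v, of w'] by (simp add: typed_def)
  qed
  then show ?thesis by (simp add: f ns_def[symmetric] f_def[symmetric])
qed

lemma plug_perm:
  assumes p: "(cs, c, t) \<in> ops (pair_operad I)" and s: "s \<in> perms (length cs)"
    and g: "\<And>k. k < length cs \<Longrightarrow> g k = f (s ! k)"
  shows "plug g (relabel (inv_perm s) t) = plug f t"
  unfolding plug_relabel
  by (rule plug_cong) (use pair_opD(6)[OF p] g pinv_less[OF s] nth_pinv[OF s] in simp)

text \<open>What the split object has on its input \<open>n\<close>: a bare leaf for a colour of
  \<open>O\<close>, an inert copy of \<open>X\<^sub>L(i; i)\<close> for a colour of
  \<open>L\<close>. It is given as a contraction, since it will appear among the leaves of
  \<open>top_comp\<close>.\<close>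

definition atom :: "'i pair_colour \<Rightarrow> nat \<Rightarrow> ('i, nat) ctr" where
  "atom c n = (if isl c then BL n else BI True (Inr ([inp c n], inp c n)) [BL n])"

text \<open>The tree that will replace the object \<open>X(c)\<close>. For a colour of
  \<open>O\<close> it is a corolla, so that nothing changes there.\<close>

definition X_pt :: "'i pair_colour \<Rightarrow> ('i vert, nat) ptree" where
  "X_pt c = Nd (VX (boundary c)) (map (\<lambda>n. src (atom c n)) [0..<val c])"

definition K_pt :: "'i pair_colour \<Rightarrow> ('i vert, nat) ptree" where
  "K_pt c = Nd (VI False c) (map Lf [0..<val c])"

lemma concat_sing: "concat (map (\<lambda>n. [n]) xs) = xs"
  by (induction xs) auto

lemma lvs_atom [simp]: "lvs (src (atom c n)) = [n]"
  by (simp add: atom_def)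

lemma typed_X_pt:
  assumes "c \<in> PBq I <+> PBq I"
  shows "typed I vcol c (X_pt c)"
proof -
  have r: "inp c n \<in> I" if "n < val c" for n
    using PBqD(1)[OF boundary_in[OF assms]] that by simp
  have "map (root vcol (inp c)) (map (\<lambda>n. src (atom c n)) [0..<val c]) = fst (boundary c)"
    by (auto simp: atom_def intro!: nth_equalityI)
  moreover have "wft I vcol (inp c) (\<not> isl c) (src (atom c n))" if "n < val c" for n
    using r[OF that] by (auto simp: atom_def PBq_def intro!: exI[of _ "[n]"])
  moreover have "concat (map (\<lambda>n. lvs (src (atom c n))) [0..<val c]) = [0..<val c]"
    by (simp add: concat_sing)
  ultimately show ?thesis using boundary_in[OF assms] by (simp add: typed_def X_pt_def comp_def)
qed

lemma typed_K_pt: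
  assumes "c \<in> PBq I <+> PBq I"
  shows "typed I vcol c (K_pt c)"
proof -
  have r: "inp c n \<in> I" if "n < val c" for n
    using PBqD(1)[OF boundary_in[OF assms]] that by simp
  have "map (inp c) [0..<val c] = fst (boundary c)" by (simp add: map_nth)
  then show ?thesis using assms r
    by (cases c) (auto simp: typed_def K_pt_def concat_sing comp_def intro!: exI[of _ "[0..<val c]"])
qed

definition X_plug :: "'i pair_op \<Rightarrow> ('i vert, nat) ptree" where
  "X_plug = (\<lambda>(cs, c, t). plug (\<lambda>v. X_pt (cs ! v)) t)"

lemma X_plug_simp [simp]: "X_plug (cs, c, t) = plug (\<lambda>v. X_pt (cs ! v)) t"
  by (simp add: X_plug_def)

lemma op_colours:
  assumes "(cs, c, t) \<in> ops (pair_operad I)"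
  shows "v < length cs \<Longrightarrow> cs ! v \<in> PBq I <+> PBq I" "c \<in> PBq I <+> PBq I"
  using pair_opD(1,2)[OF assms] nth_mem[of v cs] by auto

lemma typed_X_plug: "(cs, c, t) \<in> ops (pair_operad I) \<Longrightarrow> typed I vcol c (X_plug (cs, c, t))"
  unfolding X_plug_simp by (rule typed_plug) (auto intro: typed_X_pt op_colours)

text \<open>In a tree with target in \<open>L\<close> every vertex in \<open>L\<close> has only
  leaves above it. After splitting, the copies of \<open>X\<^sub>L(i; i)\<close> therefore sit
  directly below the leaves, and all copies of \<open>X\<^sub>O\<close> form one connected tree of
  the shape of \<open>t\<close>.\<close>

lemma top_comp_X_plug:
  assumes p: "(cs, c, t) \<in> ops (pair_operad I)"
  shows "top_comp (X_plug (cs, c, t)) = conv (\<lambda>v. boundary (cs ! v)) (atom c) t"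
  unfolding X_plug_simp using p
proof (induction rule: op_induct)
  case (Leaf n)
  then show ?case by (simp add: atom_def)
next
  case (Inl v b ts)
  have "map (bind (\<lambda>n. map (plug (\<lambda>v. X_pt (cs ! v))) ts ! n)) (map (\<lambda>n. src (atom (cs ! v) n)) [0..<length ts])
      = map (plug (\<lambda>v. X_pt (cs ! v))) ts"
    using Inl(2) by (auto simp: atom_def intro!: nth_equalityI)
  then have "plug (\<lambda>v. X_pt (cs ! v)) (Node v ts) = Nd (VX b) (map (plug (\<lambda>v. X_pt (cs ! v))) ts)"
    using Inl(2,3) by (simp add: X_pt_def del: map_map)
  moreover have "map (\<lambda>t. top_comp (plug (\<lambda>v. X_pt (cs ! v)) t)) ts = map (conv (\<lambda>v. boundary (cs ! v)) (atom c)) ts"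
    using Inl(4) by (auto simp: in_set_conv_nth)
  ultimately show ?case using Inl(2) by (simp add: comp_def del: plug.simps)
next
  case (Inr v b ns)
  have len: "length (fst b) = length ns" using Inr(4) by (metis length_map)
  have b: "fst b ! n = inp c (ns ! n)" if "n < length ns" for n
    using Inr(4) that nth_map[of n ns "inp c"] by simp
  have "map (bind (\<lambda>n. map (plug (\<lambda>v. X_pt (cs ! v))) (map tree.Leaf ns) ! n)) (map (\<lambda>n. src (atom (cs ! v) n)) [0..<length ns])
      = map (\<lambda>n. Nd (VI True (Inr ([inp c n], inp c n))) (map Lf [n])) ns"
    using Inr(2) b by (auto simp: atom_def intro!: nth_equalityI)
  then have "plug (\<lambda>v. X_pt (cs ! v)) (Node v (map tree.Leaf ns)) = Nd (VX b) (map (\<lambda>n. Nd (VI True (Inr ([inp c n], inp c n))) (map Lf [n])) ns)"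
    using Inr(2) len by (simp add: X_pt_def del: map_map)
  moreover have "top_comp (Nd (VI True (Inr ([inp c n], inp c n))) (map Lf [n])) = Lf (atom c n)" for n
    using Inr(3) unfolding top_comp_Inr by (simp add: atom_def)
  ultimately show ?case using Inr(2) by (simp add: comp_def)
qed

lemma nform_X_plug:
  assumes p: "(cs, c, t) \<in> ops (pair_operad I)"
  shows "nform (inp c) (X_plug (cs, c, t)) = X_pt c"
proof -
  have "root Inl (broot (inp c)) (top_comp (X_plug (cs, c, t))) = snd (boundary c)"
    using top_comp_props[of I "inp c" "\<not> isl c" "X_plug (cs, c, t)"] typed_X_plug[OF p] by (simp add: typed_def)
  moreover have "map (broot (inp c)) (lvs (top_comp (X_plug (cs, c, t)))) = fst (boundary c)"
    using pair_opD(4)[OF p] unfolding top_comp_X_plug[OF p] by (auto simp: atom_def intro!: nth_equalityI)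
  ultimately have "bq Inl (broot (inp c)) (top_comp (X_plug (cs, c, t))) = boundary c" by (simp add: bq_def)
  moreover have "tgt (inp c) (atom c n) = src (atom c n)" for n by (simp add: atom_def)
  moreover have "lvs (top_comp (X_plug (cs, c, t))) = map (atom c) [0..<val c]"
    using pair_opD(4)[OF p] unfolding top_comp_X_plug[OF p] by simp
  ultimately show ?thesis unfolding nform_def contract_def tgt_BX X_pt_def[of c] by simp
qed

lemma X_plug_unit: "c \<in> PBq I <+> PBq I \<Longrightarrow> X_plug (unit_op (pair_operad I) c) = X_pt c"
  using plug_unit[of "X_pt c" "val c" "\<lambda>v. X_pt ([c] ! v)"] typed_X_pt[of c I] by (simp add: typed_def)

lemma labs_plug:
  assumes "(cs, c, t) \<in> ops (pair_operad I)" "\<And>v. v < length cs \<Longrightarrow> typed I col (cs ! v) (f v)"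
  shows "set (labs (plug f t)) = (\<Union>v<length cs. set (labs (f v)))"
  using plug_nest_slot[OF assms(1), of col f] plug_nest_labs[OF assms(1), of col f] assms(2) labs_flat[of "plug_nest cs f t"] by simp

context pair_int
begin

abbreviation obj_at :: "'i pair_colour \<Rightarrow> ('i vert, nat) ptree \<Rightarrow> 'o" where
  "obj_at c \<equiv> obj (inp c) (\<not> isl c)"

abbreviation arr_at :: "'i pair_colour \<Rightarrow> ('i, nat) ctr \<Rightarrow> 'm" where
  "arr_at c \<equiv> arr (inp c) (\<not> isl c)"

lemma obj_at_in: "typed I vcol c d \<Longrightarrow> obj_at c d \<in> Ob (total C) \<and> colour C (obj_at c d) = c"
  using obj_in[of "inp c" "\<not> isl c" d] colour_obj[of "inp c" "\<not> isl c" d] typed_bq[of I vcol c d]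
  by (simp add: typed_def)

lemma arr_at_in: "ctyped I c s \<Longrightarrow> arr_at c s \<in> Ar (total C) \<and> Dom (total C) (arr_at c s) = obj_at c (src s)
    \<and> Cod (total C) (arr_at c s) = obj_at c (tgt (inp c) s)"
  using arr_in[of "inp c" "\<not> isl c" s] Dom_arr[of "inp c" "\<not> isl c" s] Cod_arr[of "inp c" "\<not> isl c" s]
  by (simp add: ctyped_def)

lemma contract_in: "typed I vcol c d \<Longrightarrow> arr_at c (contract d) \<in> Ar (total C) \<and> Dom (total C) (arr_at c (contract d)) = obj_at c d
    \<and> Cod (total C) (arr_at c (contract d)) = obj_at c (nform (inp c) d)"
  using arr_at_in[OF ctyped_contract] src_contract[of I "inp c" "\<not> isl c" d] by (simp add: nform_def typed_def)

text \<open>Contracting the operands and then the rest is the same as contracting everything. This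
  is \<open>contract_natural\<close> for the partial contraction \<open>s\<close>, which treats the
  operands separately.\<close>

lemma plug_contract:
  assumes p: "(cs, c, t) \<in> ops (pair_operad I)" and d0: "\<forall>v < length cs. typed I vcol (cs ! v) (d v)"
  defines "s \<equiv> plug_ctr (\<lambda>v. contract (d v)) t"
  shows "ctyped I c s" "src s = plug d t" "tgt (inp c) s = plug (\<lambda>v. nform (inp (cs ! v)) (d v)) t"
    "arr_at c s = act_ar C (cs, c, t) (map (\<lambda>v. arr_at (cs ! v) (contract (d v))) [0..<length cs])"
    "arr_at c (contract (plug d t)) = Cmp (total C) (arr_at c (contract (tgt (inp c) s))) (arr_at c s)"
    "nform (inp c) (plug d t) = nform (inp c) (tgt (inp c) s)"
proof -
  have d: "typed I vcol (cs ! v) (d v)" if "v < length cs" for v using d0 that by blast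
  have f: "\<And>v. v < length cs \<Longrightarrow> ctyped I (cs ! v) (contract (d v))" by (rule ctyped_contract[OF d])
  have b: "wfc I (inp c) (\<not> isl c) s" "broot (inp c) s = snd (boundary c)"
    "src s = plug (\<lambda>v. src (contract (d v))) t" "tgt (inp c) s = plug (\<lambda>v. tgt (inp (cs ! v)) (contract (d v))) t"
    using ctyped_plug_ctr[OF p, of "\<lambda>v. contract (d v)"] f by (simp_all add: s_def)
  have "src (contract (d v)) = d v" if "v < length cs" for v
    using src_contract[of I "inp (cs ! v)" "\<not> isl (cs ! v)" "d v"] d[OF that] by (simp add: typed_def)
  then have "plug (\<lambda>v. src (contract (d v))) t = plug d t" using pair_opD(6)[OF p] by (intro plug_cong) simp
  with b(3) show src: "src s = plug d t" by simp
  show "tgt (inp c) s = plug (\<lambda>v. nform (inp (cs ! v)) (d v)) t" using b(4) by (simp add: nform_def)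
  have "typed I vcol c (plug d t)" using typed_plug[OF p, of vcol d] d by simp
  then show "ctyped I c s" using b(1,2) src by (simp add: ctyped_def typed_def)
  show "arr_at c s = act_ar C (cs, c, t) (map (\<lambda>v. arr_at (cs ! v) (contract (d v))) [0..<length cs])"
    using arr_plug_ctr[OF p, of "\<lambda>v. contract (d v)"] f by (simp add: s_def)
  show "arr_at c (contract (plug d t)) = Cmp (total C) (arr_at c (contract (tgt (inp c) s))) (arr_at c s)"
    using contract_natural[OF b(1)] src by simp
  show "nform (inp c) (plug d t) = nform (inp c) (tgt (inp c) s)"
    using nform_src_tgt[OF b(1)] src by simp
qed

text \<open>The maximal subtree of copies of \<open>X\<^sub>O\<close> consists of a single vertex,
  so its structure map belongs to a unit operation.\<close>

lemma contract_X_pt: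
  assumes c: "c \<in> PBq I <+> PBq I"
  shows "arr_at c (contract (X_pt c)) = Ide (total C) (obj_at c (X_pt c))"
proof -
  have u: "unit_op (pair_operad I) c \<in> ops (pair_operad I)" by (rule pair_unit_in[OF c])
  have e: "contract (X_pt c) = BX (Nd (boundary c) (map Lf (map (atom c) [0..<val c])))"
    using top_comp_X_plug[OF u[unfolded pair_sel]] X_plug_unit[OF c] by (simp add: contract_def comp_def)
  have b: "boundary c \<in> PBq I" by (rule boundary_in[OF c])
  have "map (broot (inp c)) (map (atom c) [0..<val c]) = fst (boundary c)"
    by (auto simp: atom_def intro!: nth_equalityI)
  then have "X_tree (broot (inp c)) False (Nd (Inl (boundary c)) (map Lf (map (atom c) [0..<val c]))) = Ide (total C) (X_ob U (Inl (boundary c)))"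
    using X_tree_unit[of "Inl (boundary c)" "broot (inp c)" "map (atom c) [0..<val c]"] b by simp
  then have "arr_tree (inp c) (contract (X_pt c)) = map_pt (Ide (total C)) id (map_pt vob id (X_pt c))"
    unfolding e by (auto simp: X_pt_def atom_def comp_def)
  moreover have t: "wft I vcol (inp c) (\<not> isl c) (X_pt c)" using typed_X_pt[OF c] by (simp add: typed_def)
  ultimately show ?thesis using eval_Ide[OF wft_vob[OF t]] by (simp add: arr_def obj_def)
qed

text \<open>Here \<open>X\<^sub>L(is; j)\<close> is replaced by \<open>X\<^sub>O(is; j)\<close> acting on the objects \<open>X\<^sub>L(i; i)\<close>.\<close>

definition split_alg :: "('i pair_colour, 'i pair_op, 'i pair_colour, 'o, 'm) int_alg" where
  "split_alg = \<lparr>X_ob = (\<lambda>c. obj_at c (X_pt c)), K_ob = K_ob U,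
     X_ar = (\<lambda>p. arr_at (fst (snd p)) (contract (X_plug p))), K_ar = K_ar U\<rparr>"

lemma split_simps [simp]: "X_ob split_alg c = obj_at c (X_pt c)" "K_ob split_alg = K_ob U"
  "X_ar split_alg (cs, c, t) = arr_at c (contract (X_plug (cs, c, t)))" "K_ar split_alg = K_ar U"
  by (simp_all add: split_alg_def)

lemma map_upt_nth: "map (\<lambda>v. F (cs ! v)) [0..<length cs] = map F cs"
  by (auto intro!: nth_equalityI)

text \<open>The composition axiom is \<open>plug_contract\<close> for the operands
  \<open>X_plug (qs ! v)\<close>. Their normal forms are the trees \<open>X_pt (cs ! v)\<close>, so
  the contraction that remains is exactly the new structure map at \<open>p\<close>.\<close>

lemma internal_split: "internal_algebra (pair_substitude I) C split_alg"
proof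
  fix a assume a: "a \<in> colours (opd (pair_substitude I))"
  then have a': "a \<in> PBq I <+> PBq I" by simp
  show "X_ob split_alg a \<in> Ob (total C)" "colour C (X_ob split_alg a) = a" using obj_at_in[OF typed_X_pt[OF a']] by simp_all
  show "K_ob split_alg a \<in> Ob (total C)" "colour C (K_ob split_alg a) = a" using K_ob_in[OF a] colour_K_ob[OF a] by simp_all
  show "X_ar split_alg (unit_op (opd (pair_substitude I)) a) = Ide (total C) (X_ob split_alg a)"
    using contract_X_pt[OF a'] X_plug_unit[OF a'] by (simp add: split_alg_def del: X_plug_simp)
  show "K_ar split_alg (Ide (base (pair_substitude I)) a) = Ide (total C) (K_ob split_alg a)"
    using K_ar_Ide[OF a] by simp
next
  fix p assume p: "p \<in> ops (opd (pair_substitude I))"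
  obtain cs c t where pe: "p = (cs, c, t)" by (cases p)
  have p': "(cs, c, t) \<in> ops (pair_operad I)" using p pe by simp
  have x: "typed I vcol (cs ! v) (X_pt (cs ! v))" if "v < length cs" for v
    by (rule typed_X_pt[OF op_colours(1)[OF p' that]])
  note d = contract_in[OF typed_X_plug[OF p']]
  show "X_ar split_alg p \<in> Ar (total C)" using d pe by (simp del: X_plug_simp)
  show "Dom (total C) (X_ar split_alg p) = act_ob C p (map (X_ob split_alg) (inputs (opd (pair_substitude I)) p))"
    using d obj_plug[OF p', of "\<lambda>v. X_pt (cs ! v)"] x map_upt_nth[of "\<lambda>c. obj_at c (X_pt c)" cs] pe by (simp add: split_alg_def)
  show "Cod (total C) (X_ar split_alg p) = X_ob split_alg (target (opd (pair_substitude I)) p)"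
    using d nform_X_plug[OF p'] pe by (simp del: X_plug_simp)
  fix s assume "s \<in> perms (arity (opd (pair_substitude I)) p)"
  then have s: "s \<in> perms (length cs)" using pe by simp
  have "X_plug (permuted s cs, c, relabel (inv_perm s) t) = X_plug (cs, c, t)"
    unfolding X_plug_simp by (rule plug_perm[OF p' s]) (use perms_length[OF s] in simp)
  then show "X_ar split_alg (perm_op (opd (pair_substitude I)) p s) = X_ar split_alg p"
    using pe by (simp del: X_plug_simp)
next
  fix p qs assume "composable (opd (pair_substitude I)) p qs"
  obtain cs c t where pe: "p = (cs, c, t)" by (cases p)
  have co: "composable (pair_operad I) (cs, c, t) qs" using \<open>composable _ p qs\<close> pe by simp
  note q = pair_composable[OF co]
  have qop: "(fst (qs ! v), cs ! v, snd (snd (qs ! v))) \<in> ops (pair_operad I)" if "v < length cs" for v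
    using q(3)[OF that] by (cases "qs ! v") auto
  have q3: "qs ! v = (fst (qs ! v), cs ! v, snd (snd (qs ! v)))" if "v < length cs" for v
    using q(3)[OF that] by (cases "qs ! v") auto
  let ?d = "\<lambda>v. X_plug (qs ! v)"
  have d: "typed I vcol (cs ! v) (?d v)" "nform (inp (cs ! v)) (?d v) = X_pt (cs ! v)" if "v < length cs" for v
    using typed_X_plug[OF qop[OF that]] nform_X_plug[OF qop[OF that]] q3[OF that] by simp_all
  let ?s = "plug_ctr (\<lambda>v. contract (?d v)) t"
  note i = plug_contract[OF q(1), of ?d]
  have "tgt (inp c) ?s = X_plug (cs, c, t)"
    using i(3) d pair_opD(6)[OF q(1)] by (auto intro!: plug_cong)
  moreover have "arr_at c ?s = act_ar C p (map (X_ar split_alg) qs)"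
  proof -
    have "map (\<lambda>v. arr_at (cs ! v) (contract (?d v))) [0..<length cs] = map (X_ar split_alg) qs"
    proof (rule nth_equalityI)
      fix v assume "v < length (map (\<lambda>v. arr_at (cs ! v) (contract (?d v))) [0..<length cs])"
      then have v: "v < length cs" by simp
      have "X_ar split_alg (qs ! v) = arr_at (cs ! v) (contract (?d v))"
        by (subst q3[OF v], simp only: split_simps, subst q3[OF v, symmetric], rule refl)
      then show "map (\<lambda>v. arr_at (cs ! v) (contract (?d v))) [0..<length cs] ! v = map (X_ar split_alg) qs ! v"
        using v q(2) by simp
    qed (use q(2) in simp)
    then show ?thesis using i(4) d pe by simp
  qed
  moreover have "plug ?d t = X_plug (comp_op (pair_operad I) (cs, c, t) qs)"
  proof -
    let ?ds = "concat (map fst qs)" and ?ns = "map (length \<circ> fst) qs"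
    have ct: "?ds ! (blocks 0 ?ns ! v ! w) = fst (qs ! v) ! w" if "v < length cs" "w < length (fst (qs ! v))" for v w
      using comp_tree(4)[OF co refl that(1), of w] that q(2) by simp
    have "(?ds, c, snd (snd (comp_op (pair_operad I) (cs, c, t) qs))) \<in> ops (pair_operad I)"
      using pair_comp_in[OF co] by simp
    from plug_comp[OF co, of vcol "\<lambda>w. X_pt (?ds ! w)", OF typed_X_pt[OF op_colours(1)[OF this]]]
    have "X_plug (comp_op (pair_operad I) (cs, c, t) qs)
        = plug (\<lambda>v. plug (\<lambda>w. X_pt (?ds ! (blocks 0 ?ns ! v ! w))) (snd (snd (qs ! v)))) t"
      by simp
    also have "\<dots> = plug ?d t"
    proof (rule plug_cong)
      fix v assume "v \<in> set (vertices t)"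
      then have v: "v < length cs" using pair_opD(6)[OF q(1)] by simp
      have "plug (\<lambda>w. X_pt (?ds ! (blocks 0 ?ns ! v ! w))) (snd (snd (qs ! v))) = plug (\<lambda>w. X_pt (fst (qs ! v) ! w)) (snd (snd (qs ! v)))"
        by (rule plug_cong) (use ct[OF v] pair_opD(6)[OF qop[OF v]] in simp)
      then show "plug (\<lambda>w. X_pt (?ds ! (blocks 0 ?ns ! v ! w))) (snd (snd (qs ! v))) = ?d v"
        by (subst q3[OF v]) simp
    qed
    finally show ?thesis by simp
  qed
  ultimately show "X_ar split_alg (comp_op (opd (pair_substitude I)) p qs)
      = Cmp (total C) (X_ar split_alg p) (act_ar C p (map (X_ar split_alg) qs))"
    using i(5) d(1) pe by (simp add: split_alg_def del: X_plug_simp)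
qed (use K_ar_in Dom_K_ar Cod_K_ar K_ar_Cmp in simp_all)

section \<open>The morphism from the split algebra to the given one\<close>

primrec merge_nest :: "('i, 'b) ctr \<Rightarrow> ('i pair_colour, 'b) nest" where
  "merge_nest (BL x) = NL x"
| "merge_nest (BI e c ss) = NN (\<not> isl c) (Nd c (map (\<lambda>s. Lf (merge_nest s)) ss))"
| "merge_nest (BX q) = NN False (map_pt Inl merge_nest q)"

text \<open>If every inert vertex is a copy of \<open>X\<close>, then the whole source is a tree of
  copies of \<open>X\<close>. The contraction can then be read as a composition of operations in
  which inert vertices contribute units.\<close>

lemma merge_nest_wf:
  assumes "wfc I r l s" "\<And>e c. VI e c \<in> set (labs (src s)) \<Longrightarrow> e"
  shows "wfn I (\<lambda>c. c) r l (merge_nest s) \<and> nroot (\<lambda>c. c) r (merge_nest s) = broot r s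
    \<and> flat (merge_nest s) = map_pt vcol id (src s) \<and> map_pt (ncol (\<lambda>c. c) r) id (skel (merge_nest s)) = map_pt vcol id (tgt r s)
    \<and> map_pt (\<lambda>(l', q). X_tree (nroot (\<lambda>c. c) r) l' q) id (skel (merge_nest s)) = arr_tree r s"
  using assms
proof (induction rule: wfc_induct)
  case (BIl e b ss)
  have e: "e" using BIl.prems[of e "Inl b"] by simp
  have IH: "wfn I (\<lambda>c. c) r l (merge_nest s) \<and> nroot (\<lambda>c. c) r (merge_nest s) = broot r s
    \<and> flat (merge_nest s) = map_pt vcol id (src s) \<and> map_pt (ncol (\<lambda>c. c) r) id (skel (merge_nest s)) = map_pt vcol id (tgt r s)
    \<and> map_pt (\<lambda>(l', q). X_tree (nroot (\<lambda>c. c) r) l' q) id (skel (merge_nest s)) = arr_tree r s" if s: "s \<in> set ss" for s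
    by (rule BIl.IH[OF s]) (use BIl.prems s in auto)
  have r: "map (nroot (\<lambda>c. c) r) (map merge_nest ss) = fst b" using IH by (auto simp flip: BIl(2))
  have "X_tree (nroot (\<lambda>c. c) r) False (Nd (Inl b) (map Lf (map merge_nest ss))) = Ide (total C) (X_ob U (Inl b))"
    using X_tree_unit[of "Inl b" "nroot (\<lambda>c. c) r" "map merge_nest ss"] r BIl(1) by simp
  moreover have "\<forall>s \<in> set ss. broot r s \<in> I" using PBqD(1)[OF BIl(1)] by (auto simp flip: BIl(2))
  ultimately show ?case using e BIl(1) r IH by (auto simp: comp_def bq_def)
next
  case (BIr e b xs)
  have e: "e" using BIr.prems[of e "Inr b"] by simp
  have "X_tree (nroot (\<lambda>c. c) r) True (Nd (Inr b) (map Lf (map NL xs))) = Ide (total C) (X_ob U (Inr b))"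
    using X_tree_unit[of "Inr b" "nroot (\<lambda>c. c) r" "map NL xs"] BIr(1,2) by (simp add: comp_def)
  then show ?case using e BIr(1-3) by (auto simp: comp_def bq_def concat_sing intro!: exI[of _ "map NL xs"])
next
  case (BX q)
  have IH: "wfn I (\<lambda>c. c) r l (merge_nest s) \<and> nroot (\<lambda>c. c) r (merge_nest s) = broot r s
    \<and> flat (merge_nest s) = map_pt vcol id (src s) \<and> map_pt (ncol (\<lambda>c. c) r) id (skel (merge_nest s)) = map_pt vcol id (tgt r s)
    \<and> map_pt (\<lambda>(l', q). X_tree (nroot (\<lambda>c. c) r) l' q) id (skel (merge_nest s)) = arr_tree r s" if s: "s \<in> set (lvs q)" for s
    by (rule BX.IH[OF s]) (use BX.prems s in auto)
  have 1: "wft I Inl (\<lambda>s. nroot (\<lambda>c. c) r (merge_nest s)) False q = wft I Inl (broot r) False q"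
    using IH by (intro wft_cong) auto
  have 2: "bq Inl (\<lambda>s. nroot (\<lambda>c. c) r (merge_nest s)) q = bq Inl (broot r) q"
    using IH by (intro bq_cong) auto
  have 3: "bind flat (map_pt Inl merge_nest q) = map_pt vcol id (bind src (map_pt VX id q))"
    unfolding map_bind bind_map[of flat _ merge_nest] map_map_pt using IH by (auto intro!: bind_cong)
  have 4: "X_tree (nroot (\<lambda>c. c) r) False (map_pt Inl merge_nest q) = X_tree (broot r) False (map_pt Inl id q)"
    unfolding X_tree_map_leaf[of _ _ _ merge_nest] using IH by (intro X_tree_cong) auto
  show ?case using BX(1) IH 1 2 3 4 by (auto simp: bq_def)
qed simp

text \<open>Both sides compose the whole source to a single copy of \<open>X\<close>: at once on the
  left, and by way of the contraction on the right.\<close>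

lemma X_tree_src:
  assumes "wfc I r l s" "\<And>e c. VI e c \<in> set (labs (src s)) \<Longrightarrow> e"
  shows "X_tree r l (map_pt vcol id (src s)) = Cmp (total C) (X_tree r l (map_pt vcol id (tgt r s))) (arr r l s)"
  using X_tree_flat[of r l "merge_nest s"] merge_nest_wf[OF assms] by (simp add: arr_def)

text \<open>For a colour of \<open>L\<close> this is the action of \<open>X\<^sub>O\<close> on the
  copies of \<open>X\<^sub>L(i; i)\<close>; for a colour of \<open>O\<close> it is an
  identity.\<close>

definition merge :: "'i pair_colour \<Rightarrow> 'm" where
  "merge c = X_tree (inp c) (\<not> isl c) (map_pt vcol id (X_pt c))"

lemma X_pt_labs: "VI e c' \<in> set (labs (X_pt c)) \<Longrightarrow> e"
  by (auto simp: X_pt_def atom_def split: if_splits)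

lemma typed_vcol: "typed I vcol c d \<Longrightarrow> typed I (\<lambda>c. c) c (map_pt vcol id d)"
  by (simp add: typed_def)

text \<open>Both sides of the square for \<open>p\<close> are the structure map of \<open>U\<close>
  at the tree \<open>X_plug p\<close>, decomposed in two ways: contract and then merge, or merge
  each operand and then apply \<open>p\<close>.\<close>

lemma internal_merge: "internal_morphism (pair_substitude I) C split_alg U merge (\<lambda>c. Ide (total C) (K_ob U c))"
proof
  fix a assume a: "a \<in> colours (opd (pair_substitude I))"
  then have a': "a \<in> PBq I <+> PBq I" by simp
  have x: "typed I (\<lambda>c. c) a (map_pt vcol id (X_pt a))" by (rule typed_vcol[OF typed_X_pt[OF a']])
  then have v: "wft I (\<lambda>c. c) (inp a) (\<not> isl a) (map_pt vcol id (X_pt a))" by (simp add: typed_def)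
  show "merge a \<in> Ar (total C)" unfolding merge_def by (rule X_tree_in[OF v])
  have "map_pt (\<lambda>b. X_ob U (vcol b)) id (X_pt a) = map_pt vob id (X_pt a)"
  proof (rule map_pt_cong')
    fix b assume b: "b \<in> set (labs (X_pt a))"
    show "X_ob U (vcol b) = vob b"
    proof (cases b)
      case (VI e c)
      then have e using b X_pt_labs[of e c a] by simp
      then show ?thesis using VI by simp
    qed simp
  qed simp
  then show "Dom (total C) (merge a) = X_ob split_alg a" using Dom_X_tree[OF v] by (simp add: merge_def obj_def)
  show "Cod (total C) (merge a) = X_ob U a" using Cod_X_tree[OF v] typed_bq[OF x] by (simp add: merge_def)
  show "Ide (total C) (K_ob U a) \<in> Ar (total C)" "Dom (total C) (Ide (total C) (K_ob U a)) = K_ob split_alg a"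
    "Cod (total C) (Ide (total C) (K_ob U a)) = K_ob U a"
    using K_ob_in[OF a] Ide_in Dom_Ide Cod_Ide by simp_all
next
  fix p assume p: "p \<in> ops (opd (pair_substitude I))"
  obtain cs c t where pe: "p = (cs, c, t)" by (cases p)
  have p': "(cs, c, t) \<in> ops (pair_operad I)" using p pe by simp
  have x: "typed I vcol (cs ! v) (X_pt (cs ! v))" if "v < length cs" for v
    by (rule typed_X_pt[OF op_colours(1)[OF p' that]])
  let ?s = "contract (X_plug (cs, c, t))"
  have d: "wft I vcol (inp c) (\<not> isl c) (X_plug (cs, c, t))" using typed_X_plug[OF p'] by (simp add: typed_def)
  have s: "src ?s = X_plug (cs, c, t)" "wfc I (inp c) (\<not> isl c) ?s" "tgt (inp c) ?s = X_pt c"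
    using src_contract[OF d] wfc_contract[OF d] nform_X_plug[OF p'] by (simp_all add: nform_def)
  \<comment> \<open>No vertex of the source is a copy of \<open>K\<close>.\<close>
  have "e" if "VI e c' \<in> set (labs (src ?s))" for e c'
    using that s(1) X_pt_labs labs_plug[OF p', of vcol "\<lambda>v. X_pt (cs ! v)"] x by auto
  from X_tree_src[OF s(2) this] have "X_tree (inp c) (\<not> isl c) (map_pt vcol id (X_plug (cs, c, t))) = Cmp (total C) (merge c) (X_ar split_alg p)"
    using s pe by (simp add: merge_def)
  moreover have "map_pt vcol id (X_plug (cs, c, t)) = plug (\<lambda>v. map_pt vcol id (X_pt (cs ! v))) t"
    unfolding X_plug_simp by (rule map_plug[OF p']) (rule x)
  moreover have "X_tree (inp c) (\<not> isl c) (plug (\<lambda>v. map_pt vcol id (X_pt (cs ! v))) t)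
      = Cmp (total C) (X_ar U p) (act_ar C p (map merge cs))"
    using X_tree_plug[OF p', of "\<lambda>v. map_pt vcol id (X_pt (cs ! v))"] typed_vcol[OF x] map_upt_nth[of merge cs] pe
    by (simp add: merge_def)
  ultimately show "Cmp (total C) (merge (target (opd (pair_substitude I)) p)) (X_ar split_alg p)
      = Cmp (total C) (X_ar U p) (act_ar C p (map merge (inputs (opd (pair_substitude I)) p)))"
    using pe by simp
next
  fix u assume "u \<in> Ar (base (pair_substitude I))"
  then have u: "u \<in> colours (opd (pair_substitude I))" by (simp add: discrete_cat_def)
  have K: "K_ob U u \<in> Ob (total C)" "colour C (K_ob U u) = u" using K_ob_in[OF u] colour_K_ob[OF u] by simp_all
  have k: "K_ar U u = Ide (total C) (K_ob U u)" using K_ar_Ide[OF u] by (simp add: discrete_cat_def)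
  have "act_ar C (unit_op (pair_operad I) u) [Ide (total C) (K_ob U u)] = Ide (total C) (K_ob U u)"
    using act_ar_unit[OF Ide_in[OF K(1)]] Dom_Ide[OF K(1)] K(2) by simp
  then show "Cmp (total C) (Ide (total C) (K_ob U (Cod (base (pair_substitude I)) u))) (K_ar split_alg u)
    = Cmp (total C) (K_ar U u) (act_ar C (eta (pair_substitude I) u) [Ide (total C) (K_ob U (Dom (base (pair_substitude I)) u))])"
    using k by (simp add: discrete_cat_def)
qed

end

section \<open>Groupoids without automorphisms\<close>

context category
begin

lemma homotopic_cancel:
  assumes "zigzag C x us y" "zigzag C x vs y" "zigzag C y ws z" "homotopic C x z (us @ ws) (vs @ ws)"
  shows "homotopic C x y us vs"
proof -
  let ?i = "rev (map flip ws)"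
  have i: "zigzag C z ?i y" by (rule flip_zigzag[OF assms(3)])
  have h: "homotopic C y y (ws @ ?i) []" by (rule flip_homotopic[OF assms(3)])
  have y: "zigzag C y [] y" using zigzag_ends[OF assms(1)] by (auto intro: zigzag.Nil)
  have c: "homotopic C x y (as @ ws @ ?i) as" if "zigzag C x as y" for as
    using homotopic_context[OF h that y] by simp
  have "homotopic C x y ((us @ ws) @ ?i) ((vs @ ws) @ ?i)"
    using homotopic_context[OF assms(4) _ i, of x "[]"] zigzag_ends[OF assms(1)] by (auto intro: zigzag.Nil)
  then show ?thesis using c[OF assms(1)] c[OF assms(2)] by (auto intro: homotopic_trans homotopic_sym)
qed

lemma zigzag_single: "f \<in> Ar C \<Longrightarrow> zigzag C (Dom C f) [Fwd f] (Cod C f)" "f \<in> Ar C \<Longrightarrow> zigzag C (Cod C f) [Bwd f] (Dom C f)"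
  by (auto intro!: zigzag.intros simp: Dom_in Cod_in)

text \<open>Naturality along the steps of a loop \<open>zs\<close> at \<open>x\<close> shows that
  \<open>zs @ h x\<close> is homotopic to \<open>h x\<close>. Cancelling \<open>h x\<close> leaves
  the empty zigzag.\<close>

lemma trivial_automorphismsI:
  assumes h: "\<And>x. x \<in> Ob C \<Longrightarrow> zigzag C x (h x) (n x)"
    and n: "\<And>f. f \<in> Ar C \<Longrightarrow> n (Dom C f) = n (Cod C f)"
    and nat: "\<And>f. f \<in> Ar C \<Longrightarrow> homotopic C (Dom C f) (n (Dom C f)) (Fwd f # h (Cod C f)) (h (Dom C f))"
  shows "trivial_automorphisms (Pi1 C)"
proof -
  have *: "n x = n y \<and> homotopic C x (n x) (zs @ h y) (h x)" if "zigzag C x zs y" for x zs y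
    using that
  proof (induction rule: zigzag.induct)
    case (Nil x)
    then show ?case by (simp add: homotopic_refl)
  next
    case (Fwd f zs y)
    have z: "zigzag C (n (Dom C f)) [] (n (Dom C f))" using zigzag_ends[OF h[OF Dom_in[OF Fwd(1)]]] by (auto intro: zigzag.Nil)
    have "homotopic C (Dom C f) (n (Dom C f)) ([Fwd f] @ (zs @ h y) @ []) ([Fwd f] @ h (Cod C f) @ [])"
      by (rule homotopic_context) (use Fwd n zigzag_single z in auto)
    then show ?case using nat[OF Fwd(1)] n[OF Fwd(1)] Fwd(3) by (auto intro: homotopic_trans)
  next
    case (Bwd f zs y)
    have z: "zigzag C (n (Dom C f)) [] (n (Dom C f))" using zigzag_ends[OF h[OF Dom_in[OF Bwd(1)]]] by (auto intro: zigzag.Nil)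
    have a: "homotopic C (Cod C f) (n (Dom C f)) ([Bwd f] @ (zs @ h y) @ []) ([Bwd f] @ h (Dom C f) @ [])"
      by (rule homotopic_context) (use Bwd n zigzag_single z in auto)
    \<comment> \<open>A backward step is put in front of the naturality condition of
      \<open>f\<close>, where it cancels against the forward step \<open>f\<close>.\<close>
    have b: "homotopic C (Cod C f) (n (Dom C f)) ([Bwd f] @ (Fwd f # h (Cod C f)) @ []) ([Bwd f] @ h (Dom C f) @ [])"
      by (rule homotopic_context[OF nat]) (use Bwd zigzag_single z in auto)
    have c: "homotopic C (Cod C f) (n (Dom C f)) ([] @ [Bwd f, Fwd f] @ h (Cod C f)) ([] @ [] @ h (Cod C f))"
    proof (rule homotopic_context[where x = "Cod C f" and y = "Cod C f"])
      show "homotopic C (Cod C f) (Cod C f) [Bwd f, Fwd f] []"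
        using zigzag_append[OF zigzag_single(2)[OF Bwd(1)] zigzag_single(1)[OF Bwd(1)]] zigzag_reduce.intros(4)[OF Bwd(1), of "[]" "[]"] Cod_in[OF Bwd(1)]
        by (intro homotopicI) (auto intro: zigzag.Nil)
    qed (use h[OF Cod_in[OF Bwd(1)]] n[OF Bwd(1)] Cod_in[OF Bwd(1)] in \<open>auto intro: zigzag.Nil\<close>)
    have "homotopic C (Cod C f) (n (Dom C f)) (Bwd f # zs @ h y) (h (Cod C f))"
      using homotopic_trans[OF homotopic_trans[OF a homotopic_sym[OF b]]] c by simp
    then show ?case using Bwd(3) n[OF Bwd(1)] by simp
  qed
  show ?thesis unfolding trivial_automorphisms_def
  proof (intro ballI impI)
    fix x f assume x: "x \<in> Ob (Pi1 C)" and f: "f \<in> Ar (Pi1 C)" and "Dom (Pi1 C) f = x \<and> Cod (Pi1 C) f = x"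
    then obtain zs where zs: "f = zclass C x zs x" "zigzag C x zs x" by (auto simp: Ar_Pi1)
    have x': "x \<in> Ob C" using x by simp
    have "homotopic C x x zs []"
      by (rule homotopic_cancel[OF zs(2) _ h[OF x']]) (use *[OF zs(2)] x' in \<open>auto intro: zigzag.Nil\<close>)
    then show "f = Ide (Pi1 C) x" using zs(1) zclass_cong by simp
  qed
qed

end

section \<open>Zigzags under functors and retracts\<close>

lemma zigzag_functor:
  assumes "\<And>x. x \<in> Ob B \<Longrightarrow> F x \<in> Ob C" "\<And>f. f \<in> Ar B \<Longrightarrow> F' f \<in> Ar C \<and> Dom C (F' f) = F (Dom B f) \<and> Cod C (F' f) = F (Cod B f)"
  shows "zigzag B x zs y \<Longrightarrow> zigzag C (F x) (map (map_step F') zs) (F y)"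
proof (induction rule: zigzag.induct)
  case (Fwd f zs y)
  then show ?case using zigzag.Fwd[of "F' f" C] assms(2)[OF Fwd(1)] by simp
next
  case (Bwd f zs y)
  then show ?case using zigzag.Bwd[of "F' f" C] assms(2)[OF Bwd(1)] by simp
qed (use assms(1) in \<open>auto intro: zigzag.Nil\<close>)

lemma homotopic_functor:
  assumes F: "\<And>x. x \<in> Ob B \<Longrightarrow> F x \<in> Ob C \<and> F' (Ide B x) = Ide C (F x)"
    and F': "\<And>f. f \<in> Ar B \<Longrightarrow> F' f \<in> Ar C \<and> Dom C (F' f) = F (Dom B f) \<and> Cod C (F' f) = F (Cod B f)"
    and cmp: "\<And>f g. f \<in> Ar B \<Longrightarrow> g \<in> Ar B \<Longrightarrow> Cod B f = Dom B g \<Longrightarrow> F' (Cmp B g f) = Cmp C (F' g) (F' f)"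
    and h: "homotopic B x y us vs"
  shows "homotopic C (F x) (F y) (map (map_step F') us) (map (map_step F') vs)"
proof -
  have red: "zigzag_reduce C (map (map_step F') us) (map (map_step F') vs)" if "zigzag_reduce B us vs" for us vs
    using that
  proof (induction rule: zigzag_reduce.induct)
    case (1 x us vs)
    then show ?case using F[OF 1] zigzag_reduce.intros(1)[of "F x" C "map (map_step F') us" "map (map_step F') vs"] by simp
  next
    case (2 f g us vs)
    then show ?case using F'[OF 2(1)] F'[OF 2(2)] cmp[OF 2]
      zigzag_reduce.intros(2)[of "F' f" C "F' g" "map (map_step F') us" "map (map_step F') vs"] by simp
  next
    case (3 f us vs)
    then show ?case using F'[OF 3] zigzag_reduce.intros(3)[of "F' f" C "map (map_step F') us" "map (map_step F') vs"] by simp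
  next
    case (4 f us vs)
    then show ?case using F'[OF 4] zigzag_reduce.intros(4)[of "F' f" C "map (map_step F') us" "map (map_step F') vs"] by simp
  qed
  note zz = zigzag_functor[of B F C F', OF conjunct1[OF F] F']
  show ?thesis using h unfolding homotopic_def
  proof (induction rule: equivclp_induct)
    case (step vs ws)
    from step(2) have "homotopic C (F x) (F y) (map (map_step F') vs) (map (map_step F') ws)"
      using zz[of x vs y] zz[of x ws y] red[of vs ws] red[of ws vs]
      by (metis homotopicI homotopic_sym)
    with step.IH show ?case unfolding homotopic_def by (rule equivclp_trans)
  qed simp
qed

text \<open>A loop is pushed forward to \<open>C\<close> along \<open>F\<close> and is trivial
  there. The homotopy is carried back along the functor \<open>G\<close>, which undoes
  \<open>F\<close>.\<close>

lemma trivial_automorphisms_retract: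
  assumes "category B" "category C"
    and F: "\<And>x. x \<in> Ob B \<Longrightarrow> F x \<in> Ob C" "\<And>f. f \<in> Ar B \<Longrightarrow> F' f \<in> Ar C \<and> Dom C (F' f) = F (Dom B f) \<and> Cod C (F' f) = F (Cod B f)"
    and G: "\<And>x. x \<in> Ob C \<Longrightarrow> G x \<in> Ob B \<and> G' (Ide C x) = Ide B (G x)"
      "\<And>f. f \<in> Ar C \<Longrightarrow> G' f \<in> Ar B \<and> Dom B (G' f) = G (Dom C f) \<and> Cod B (G' f) = G (Cod C f)"
      "\<And>f g. f \<in> Ar C \<Longrightarrow> g \<in> Ar C \<Longrightarrow> Cod C f = Dom C g \<Longrightarrow> G' (Cmp C g f) = Cmp B (G' g) (G' f)"
    and GF: "\<And>x. x \<in> Ob B \<Longrightarrow> G (F x) = x" "\<And>f. f \<in> Ar B \<Longrightarrow> G' (F' f) = f"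
    and C: "trivial_automorphisms (Pi1 C)"
  shows "trivial_automorphisms (Pi1 B)"
  unfolding trivial_automorphisms_def
proof (intro ballI impI)
  interpret B: category B by fact
  interpret C: category C by fact
  fix x f assume x: "x \<in> Ob (Pi1 B)" and f: "f \<in> Ar (Pi1 B)" and "Dom (Pi1 B) f = x \<and> Cod (Pi1 B) f = x"
  then obtain zs where zs: "f = zclass B x zs x" "zigzag B x zs x" by (auto simp: Ar_Pi1)
  have x': "x \<in> Ob B" using x by simp
  have z: "zigzag C (F x) (map (map_step F') zs) (F x)" by (rule zigzag_functor[OF F zs(2)])
  have "zclass C (F x) (map (map_step F') zs) (F x) = zclass C (F x) [] (F x)"
    using C[unfolded trivial_automorphisms_def, rule_format, of "F x" "zclass C (F x) (map (map_step F') zs) (F x)"]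
      F(1)[OF x'] z Ar_Pi1[of "zclass C (F x) (map (map_step F') zs) (F x)" C] by auto
  moreover have "map (map_step F') zs \<in> fst (snd (zclass C (F x) (map (map_step F') zs) (F x)))"
    using z by (simp add: zclass_def homotopic_refl)
  ultimately have "homotopic C (F x) (F x) [] (map (map_step F') zs)" by (simp add: zclass_def)
  then have "homotopic B (G (F x)) (G (F x)) (map (map_step G') []) (map (map_step G') (map (map_step F') zs))"
    by (rule homotopic_functor[of C G B G', rotated 3]) (use G in auto)
  then have "homotopic B x x [] (map (map_step G') (map (map_step F') zs))" using GF(1)[OF x'] by simp
  moreover have "map (map_step G') (map (map_step F') zs) = zs"
    using zs(2) by (induction rule: zigzag.induct) (simp_all add: GF(2))
  ultimately have "zclass B x zs x = zclass B x [] x" by (auto intro: zclass_cong homotopic_sym)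
  then show "f = Ide (Pi1 B) x" using zs(1) by simp
qed

section \<open>Uniqueness of classifiers\<close>

lemma algebra_morphism_id: "algebra_morphism P C C (\<lambda>x. x) (\<lambda>f. f)"
  by standard simp_all

lemma algebra_morphism_comp:
  assumes "category (total A)" "algebra_morphism P A B F F'" "algebra_morphism P B C G G'"
  shows "algebra_morphism P A C (\<lambda>x. G (F x)) (\<lambda>f. G' (F' f))"
proof -
  interpret A: category "total A" by fact
  interpret F: algebra_morphism P A B F F' by fact
  interpret G: algebra_morphism P B C G G' by fact
  have "ob_args P B p (map F xs)" if "ob_args P A p xs" for p xs
  proof -
    have e: "map (\<lambda>x. colour B (F x)) xs = map (colour A) xs" using that F.colour_ob by (intro map_cong) (auto simp: ob_args_def)
    show ?thesis unfolding ob_args_def map_map comp_def e using that F.ob_in by (auto simp: ob_args_def)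
  qed
  moreover have "ar_args P B p (map F' fs)" if "ar_args P A p fs" for p fs
  proof -
    have e: "map (\<lambda>f. colour B (Dom (total B) (F' f))) fs = map (\<lambda>f. colour A (Dom (total A) f)) fs"
      using that F.colour_ob F.Dom_ar A.Dom_in by (intro map_cong) (auto simp: ar_args_def)
    show ?thesis unfolding ar_args_def map_map comp_def e using that F.ar_in by (auto simp: ar_args_def)
  qed
  ultimately show ?thesis
    by unfold_locales (simp_all add: F.ob_in G.ob_in F.colour_ob G.colour_ob F.ar_in G.ar_in F.Dom_ar G.Dom_ar
      F.Cod_ar G.Cod_ar F.ar_Ide G.ar_Ide F.ar_Cmp G.ar_Cmp F.ob_act G.ob_act F.ar_act G.ar_act comp_def)
qed

lemma int_eq_comp: "int_eq S (int_image F F' U) V \<Longrightarrow> int_eq S (int_image G G' V) W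
    \<Longrightarrow> int_eq S (int_image (\<lambda>x. G (F x)) (\<lambda>f. G' (F' f)) U) W"
  by (simp add: int_eq_def int_image_def)

lemma internal_morphism_cong:
  assumes "int_eq S U U'" "int_eq S V V'" "internal_morphism S C U V phi psi" "substitude S"
  shows "internal_morphism S C U' V' phi psi"
proof -
  interpret M: internal_morphism S C U V phi psi by fact
  interpret S: substitude S by fact
  show ?thesis
    using assms(1,2) M.phi_in M.Dom_phi M.Cod_phi M.psi_in M.Dom_psi M.Cod_psi M.phi_X M.psi_K
    by unfold_locales (simp_all add: int_eq_def)
qed

lemma universal_for_morphism:
  assumes u: "universal_for S H U C" and V: "internal_algebra S C V"
  obtains F F' where "algebra_morphism (opd S) H C F F'" "int_eq S (int_image F F' U) V"
    "\<And>G G'. algebra_morphism (opd S) H C G G' \<Longrightarrow> int_eq S (int_image G G' U) V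
      \<Longrightarrow> (\<forall>x \<in> Ob (total H). G x = F x) \<and> (\<forall>f \<in> Ar (total H). G' f = F' f)"
proof -
  from u[unfolded universal_for_def, THEN conjunct1, rule_format, OF V] that show ?thesis
    by (elim exE conjE) metis
qed

lemma universal_for_2cell:
  assumes u: "universal_for S H U C" and F: "algebra_morphism (opd S) H C F F'" "algebra_morphism (opd S) H C G G'"
    and m: "internal_morphism S C (int_image F F' U) (int_image G G' U) phi psi"
  obtains t where "algebra_2cell (opd S) H C F F' G G' t"
  using u[unfolded universal_for_def, THEN conjunct2, rule_format, OF conjI[OF F(1) conjI[OF F(2) m]]] that
  by (elim exE conjE)

context substitude
begin

text \<open>The universal properties give morphisms \<open>F\<close> and \<open>G\<close> between
  \<open>H\<close> and the term algebra in both directions. Their composite on \<open>H\<close>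
  fixes \<open>U\<close>, as the identity does, so uniqueness makes it the identity.\<close>

lemma classifier_retract:
  fixes H :: "('c, 'p, 'u) term_alg"
  assumes H: "classifier S H U" and T: "trivial_automorphisms (Pi1 term_cat)"
  shows "trivial_automorphisms (Pi1 (total H))"
proof -
  have cH: "categorical_algebra (opd S) H" and iH: "internal_algebra S H U"
    and uT: "universal_for S H U term_alg" and uH: "universal_for S H U H"
    using H categorical_algebra_T unfolding classifier_def by blast+
  interpret H: categorical_algebra "opd S" H by fact
  obtain F F' where F: "algebra_morphism (opd S) H term_alg F F'" "int_eq S (int_image F F' U) term_int_alg"
    using universal_for_morphism[OF uT internal_algebra_T] by metis
  obtain G G' where G: "algebra_morphism (opd S) term_alg H G G'" "int_eq S (int_image G G' term_int_alg) U"
    using universal_for_morphism[OF term_alg_universal[OF cH] iH] by metis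
  interpret F: algebra_morphism "opd S" H term_alg F F' by (rule F)
  interpret G: algebra_morphism "opd S" term_alg H G G' by (rule G)
  obtain E E' where E: "\<And>D D'. algebra_morphism (opd S) H H D D' \<Longrightarrow> int_eq S (int_image D D' U) U
      \<Longrightarrow> (\<forall>x \<in> Ob (total H). D x = E x) \<and> (\<forall>f \<in> Ar (total H). D' f = E' f)"
    using universal_for_morphism[OF uH iH] by metis
  have 1: "(\<forall>x \<in> Ob (total H). G (F x) = E x) \<and> (\<forall>f \<in> Ar (total H). G' (F' f) = E' f)"
    by (rule E[OF algebra_morphism_comp[OF H.category_axioms F(1) G(1)] int_eq_comp[OF F(2) G(2)]])
  have 2: "(\<forall>x \<in> Ob (total H). x = E x) \<and> (\<forall>f \<in> Ar (total H). f = E' f)"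
    by (rule E[OF algebra_morphism_id]) (simp add: int_eq_def int_image_def)
  show ?thesis
  proof (rule trivial_automorphisms_retract[OF H.category_axioms category_T, of F F' G G'])
    show "\<And>x. x \<in> Ob (total H) \<Longrightarrow> G (F x) = x" "\<And>f. f \<in> Ar (total H) \<Longrightarrow> G' (F' f) = f"
      using 1 2 by metis+
  qed (use F.ob_in F.ar_in F.Dom_ar F.Cod_ar G.ob_in G.ar_in G.Dom_ar G.Cod_ar G.ar_Ide G.ar_Cmp T in simp_all)
qed

end

text \<open>Intended for the components \<open>a\<close> and \<open>b\<close> of a natural
  transformation at the two ends of \<open>f\<close>: the square moves the step \<open>f\<close>
  past the backward steps and turns it into \<open>f'\<close>.\<close>

lemma (in category) homotopic_square:
  assumes f: "f \<in> Ar C" "a \<in> Ar C" "b \<in> Ar C" "f' \<in> Ar C" "c \<in> Ar C"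
    and e: "Dom C f = Cod C a" "Dom C f' = Dom C a" "Cod C f' = Dom C b" "Cod C b = Cod C f" "Dom C c = Cod C f'"
    and sq: "Cmp C f a = Cmp C b f'"
  shows "homotopic C (Dom C f) (Cod C c) [Fwd f, Bwd b, Fwd c] [Bwd a, Fwd (Cmp C c f')]"
proof -
  let ?h = "homotopic C (Dom C f) (Cod C c)"
  have F: "zigzag C (Dom C g) (Fwd g # zs) y" if "g \<in> Ar C" "zigzag C (Cod C g) zs y" for g zs y
    using that by (rule zigzag.Fwd)
  have B: "zigzag C (Cod C g) (Bwd g # zs) y" if "g \<in> Ar C" "zigzag C (Dom C g) zs y" for g zs y
    using that by (rule zigzag.Bwd)
  have c: "zigzag C (Dom C c) [Fwd c] (Cod C c)" by (rule zigzag_single(1)[OF f(5)])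
  have bc: "zigzag C (Cod C b) [Bwd b, Fwd c] (Cod C c)" using B[OF f(3)] c e by simp
  have fbc: "zigzag C (Dom C f) [Fwd f, Bwd b, Fwd c] (Cod C c)" using F[OF f(1)] bc e by simp
  have afbc: "zigzag C (Dom C f) [Bwd a, Fwd a, Fwd f, Bwd b, Fwd c] (Cod C c)"
    using B[OF f(2) F[OF f(2)]] fbc e by simp
  have fa: "Cmp C f a \<in> Ar C" "Dom C (Cmp C f a) = Dom C a" "Cod C (Cmp C f a) = Cod C f"
    using Cmp_in Dom_Cmp Cod_Cmp f e by simp_all
  have cf: "Cmp C c f' \<in> Ar C" "Dom C (Cmp C c f') = Dom C a" "Cod C (Cmp C c f') = Cod C c"
    using Cmp_in Dom_Cmp Cod_Cmp f e by simp_all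
  \<comment> \<open>The chain of homotopies: insert \<open>a\<close> and its inverse, compose
    \<open>a\<close> with \<open>f\<close>, use the square, split it into \<open>f'\<close> and
    \<open>b\<close>, cancel \<open>b\<close>, compose \<open>f'\<close> with
    \<open>c\<close>.\<close>
  have 1: "?h [Bwd a, Fwd a, Fwd f, Bwd b, Fwd c] [Fwd f, Bwd b, Fwd c]"
    using afbc fbc zigzag_reduce.intros(4)[OF f(2), of "[]" "[Fwd f, Bwd b, Fwd c]"] by (intro homotopicI) simp_all
  have z2: "zigzag C (Dom C f) [Bwd a, Fwd (Cmp C f a), Bwd b, Fwd c] (Cod C c)"
    using B[OF f(2)] F[OF fa(1)] bc e fa by simp
  have 2: "?h [Bwd a, Fwd a, Fwd f, Bwd b, Fwd c] [Bwd a, Fwd (Cmp C f a), Bwd b, Fwd c]"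
    using afbc z2 zigzag_reduce.intros(2)[OF f(2) f(1), of "[Bwd a]" "[Bwd b, Fwd c]"] e by (intro homotopicI) simp_all
  have z3: "zigzag C (Dom C f) [Bwd a, Fwd f', Fwd b, Bwd b, Fwd c] (Cod C c)"
    using B[OF f(2)] F[OF f(4)] F[OF f(3)] bc e by simp
  have 3: "?h [Bwd a, Fwd f', Fwd b, Bwd b, Fwd c] [Bwd a, Fwd (Cmp C f a), Bwd b, Fwd c]"
    using z2 z3 zigzag_reduce.intros(2)[OF f(4) f(3), of "[Bwd a]" "[Bwd b, Fwd c]"] e sq by (intro homotopicI) simp_all
  have z4: "zigzag C (Dom C f) [Bwd a, Fwd f', Fwd c] (Cod C c)"
    using B[OF f(2)] F[OF f(4)] c e by simp
  have 4: "?h [Bwd a, Fwd f', Fwd b, Bwd b, Fwd c] [Bwd a, Fwd f', Fwd c]"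
    using z3 z4 zigzag_reduce.intros(3)[OF f(3), of "[Bwd a, Fwd f']" "[Fwd c]"] by (intro homotopicI) simp_all
  have z5: "zigzag C (Dom C f) [Bwd a, Fwd (Cmp C c f')] (Cod C c)"
    using B[OF f(2)] F[OF cf(1)] zigzag.Nil[OF Cod_in[OF f(5)]] e cf by simp
  have 5: "?h [Bwd a, Fwd f', Fwd c] [Bwd a, Fwd (Cmp C c f')]"
    using z4 z5 zigzag_reduce.intros(2)[OF f(4) f(5), of "[Bwd a]" "[]"] e by (intro homotopicI) simp_all
  show ?thesis using 1 2 3 4 5 by (meson homotopic_trans homotopic_sym)
qed

section \<open>The normal form of an object of the classifier\<close>

text \<open>The tree that represents the image of a term under the splitting endofunctor. Only the
  tree \<open>snd (snd p)\<close> of an operation is used, since the colours are kept in the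
  labels.\<close>

primrec pt_of :: "('i pair_colour, 'i pair_op) oterm \<Rightarrow> ('i vert, nat) ptree" where
  "pt_of (TX c) = X_pt c"
| "pt_of (TK c) = K_pt c"
| "pt_of (TOp p ts) = plug (\<lambda>v. map pt_of ts ! v) (snd (snd p))"

context
  fixes I :: "'i set"
begin

interpretation S: substitude "pair_substitude I" by (rule substitude_pair)

interpretation T: pair_int I S.term_alg S.term_int_alg
  using S.categorical_algebra_T S.internal_algebra_T by (intro pair_int.intro pair_cat.intro) simp_all

lemma term_int_sel: "X_ob S.term_int_alg a = S.oc (TX a)" "K_ob S.term_int_alg a = S.oc (TK a)"
  "X_ar S.term_int_alg p = S.ac (AX p)" "K_ar S.term_int_alg u = S.ac (AK u)"
  by (simp_all add: S.term_int_alg_def)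

lemma typed_pt_of: "S.owf t \<Longrightarrow> typed I vcol (S.tcol t) (pt_of t)"
proof (induction rule: S.owf.induct)
  case (3 p ts)
  obtain cs c t where p: "p = (cs, c, t)" by (cases p)
  have cs: "map S.tcol ts = cs" using "3.hyps"(3) p by simp
  have "typed I vcol c (plug (\<lambda>v. map pt_of ts ! v) t)"
  proof (rule typed_plug)
    show "(cs, c, t) \<in> ops (pair_operad I)" using "3.hyps"(1) p by simp
    fix v assume "v < length cs"
    then have v: "v < length ts" using cs by auto
    show "typed I vcol (cs ! v) (map pt_of ts ! v)" using "3.IH"[OF nth_mem[OF v]] v by (simp flip: cs)
  qed
  then show ?case using p by simp
qed (auto intro: typed_X_pt typed_K_pt)

text \<open>The defining relations between object terms are the unit, composition and symmetry laws,
  and insertion of trees satisfies them by \<open>plug_unit\<close>, \<open>plug_comp\<close> and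
  \<open>plug_perm\<close>.\<close>

lemma pt_of_cong: "S.oeq t t' \<Longrightarrow> pt_of t = pt_of t'"
proof (induction rule: S.oeq.induct)
  case (oeq_Op p ts ts')
  have "map pt_of ts = map pt_of ts'" using oeq_Op.IH by (induction rule: list_all2_induct) auto
  then show ?case by simp
next
  case (oeq_unit t)
  then show ?case using plug_unit[of "pt_of t" "val (S.tcol t)" "\<lambda>v. [pt_of t] ! v"] typed_pt_of[OF oeq_unit]
    by (simp add: typed_def)
next
  case (oeq_comp p qs tss)
  obtain cs c t where p: "p = (cs, c, t)" by (cases p)
  have co: "composable (pair_operad I) (cs, c, t) qs" using oeq_comp(1) p by simp
  note q = pair_composable[OF co]
  have len: "length tss = length cs" using oeq_comp(2) q(2) by (simp add: list_all2_lengthD)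
  have w: "S.owf (TOp (qs ! v) (tss ! v))" if "v < length cs" for v
    using list_all2_nthD[OF oeq_comp(2)] that q(2) by simp
  have ts: "map S.tcol (tss ! v) = fst (qs ! v)" "\<forall>t \<in> set (tss ! v). S.owf t" if "v < length cs" for v
    using w[OF that] by (simp_all add: S.owf_TOp)
  have ls: "map length (map fst qs) = map length tss"
  proof (rule nth_equalityI)
    fix v assume "v < length (map length (map fst qs))"
    then have v: "v < length cs" using q(2) by simp
    then show "map length (map fst qs) ! v = map length tss ! v" using ts(1)[OF v] q(2) len by (simp flip: ts(1))
  qed (use len q(2) in simp)
  have ns: "map (length \<circ> fst) qs = map length (map (map pt_of) tss)" using ls by (simp add: comp_def)
  have ct: "map S.tcol (concat tss) = concat (map fst qs)"
  proof -
    have "map (map S.tcol) tss = map fst qs" using ts(1) len q(2) by (auto intro!: nth_equalityI)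
    then show ?thesis by (simp add: map_concat)
  qed
  have "\<forall>ts \<in> set tss. \<forall>t \<in> set ts. S.owf t" using ts(2) len by (metis in_set_conv_nth)
  then have ow: "\<forall>t \<in> set (concat tss). S.owf t" by auto
  have "plug (\<lambda>w. map pt_of (concat tss) ! w) (snd (snd (comp_op (pair_operad I) (cs, c, t) qs)))
    = plug (\<lambda>v. plug (\<lambda>w. map pt_of (concat tss) ! (blocks 0 (map (length \<circ> fst) qs) ! v ! w)) (snd (snd (qs ! v)))) t"
  proof (rule plug_comp[OF co])
    fix w assume "w < length (concat (map fst qs))"
    then have w: "w < length (concat tss)" using ct by (metis length_map)
    then have "S.owf (concat tss ! w)" using ow nth_mem by blast
    from typed_pt_of[OF this] show "typed I vcol (concat (map fst qs) ! w) (map pt_of (concat tss) ! w)"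
      using w by (simp flip: ct)
  qed
  also have "\<dots> = plug (\<lambda>v. map pt_of (map2 TOp qs tss) ! v) t"
  proof (rule plug_cong)
    fix v assume "v \<in> set (vertices t)"
    then have v: "v < length cs" using pair_opD(6)[OF q(1)] by simp
    have vs: "set (vertices (snd (snd (qs ! v)))) = {..<length (fst (qs ! v))}" using pair_opD(6) q(3)[OF v] by blast
    have lv: "length (fst (qs ! v)) = length (tss ! v)" using arg_cong[OF ts(1)[OF v], of length] by simp
    have "plug (\<lambda>w. map pt_of (concat tss) ! (blocks 0 (map (length \<circ> fst) qs) ! v ! w)) (snd (snd (qs ! v)))
        = plug (\<lambda>w. map pt_of (tss ! v) ! w) (snd (snd (qs ! v)))"
    proof (rule plug_cong)
      fix w assume "w \<in> set (vertices (snd (snd (qs ! v))))"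
      then have "w < length (tss ! v)" using vs lv by simp
      then show "map pt_of (concat tss) ! (blocks 0 (map (length \<circ> fst) qs) ! v ! w) = map pt_of (tss ! v) ! w"
        unfolding ns map_concat using nth_concat_blocks(1)[of v "map (map pt_of) tss" w] v len by simp
    qed
    then show "plug (\<lambda>w. map pt_of (concat tss) ! (blocks 0 (map (length \<circ> fst) qs) ! v ! w)) (snd (snd (qs ! v)))
        = map pt_of (map2 TOp qs tss) ! v" using v len q(2) by simp
  qed
  finally show ?case using p by simp
next
  case (oeq_perm p ts s)
  obtain cs c t where p: "p = (cs, c, t)" by (cases p)
  have p': "(cs, c, t) \<in> ops (pair_operad I)" and l: "length ts = length cs"
    using oeq_perm(1) p S.length_args[of p ts] by (simp_all add: S.owf_TOp)
  have s: "s \<in> perms (length cs)" using oeq_perm(2) p by simp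
  have "plug (\<lambda>v. map pt_of (permuted s ts) ! v) (relabel (inv_perm s) t) = plug (\<lambda>v. map pt_of ts ! v) t"
    by (rule plug_perm[OF p' s]) (use perms_length[OF s] perms_less[OF s] l in simp)
  then show ?case using p by simp
qed auto

abbreviation contr_at :: "'i pair_colour \<Rightarrow> ('i vert, nat) ptree \<Rightarrow> _" where
  "contr_at c d \<equiv> T.arr_at c (contract d)"

text \<open>The endofunctor comes from the universal property and is given on generators only.
  Induction over terms makes it explicit on all objects.\<close>

lemma split_ob:
  assumes F: "algebra_morphism (pair_operad I) S.term_alg S.term_alg F F'"
    and e: "int_eq (pair_substitude I) (int_image F F' S.term_int_alg) T.split_alg"
  shows "S.owf t \<Longrightarrow> F (S.oc t) = T.obj_at (S.tcol t) (pt_of t)"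
proof (induction rule: S.owf.induct)
  interpret F: algebra_morphism "pair_operad I" S.term_alg S.term_alg F F' by fact
  {
    case (1 a)
    then show ?case using e by (auto simp: int_eq_def int_image_def term_int_sel)
  next
    case (2 a)
    then have a: "a \<in> PBq I <+> PBq I" by simp
    let ?K = "K_ob S.term_int_alg a"
    have K: "?K \<in> Ob S.term_cat" "colour S.term_alg ?K = a" using T.K_ob_in[of a] T.colour_K_ob[of a] a by simp_all
    have "map (inp a) [0..<val a] = fst (boundary a)" by (simp add: map_nth)
    then have "T.ob.eval (inp a) (\<not> isl a) (Nd ?K (map Lf [0..<val a])) = ?K"
      using T.ob.eval_unit[of ?K "inp a" "[0..<val a]"] K by simp
    then have "T.obj_at a (K_pt a) = ?K" by (simp add: T.obj_def K_pt_def comp_def)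
    then show ?case using e 2 by (auto simp: int_eq_def int_image_def term_int_sel)
  next
    case (3 p ts)
    obtain cs c t where p: "p = (cs, c, t)" by (cases p)
    have cs: "map S.tcol ts = cs" using "3.hyps"(3) p by simp
    then have len: "length ts = length cs" by auto
    have w: "S.owf (TOp p ts)" using "3.hyps" by (simp add: S.owf_TOp)
    have p': "(cs, c, t) \<in> ops (pair_operad I)" using "3.hyps"(1) p by simp
    have "F (S.oc (TOp p ts)) = F (act_ob S.term_alg p (map S.oc ts))" using S.act_ob_T[OF w] by simp
    also have "\<dots> = act_ob S.term_alg p (map F (map S.oc ts))"
      using F.ob_act[of p "map S.oc ts"] S.ob_args_T[of p "map S.oc ts"] "3.hyps"(1) w by auto
    also have "map F (map S.oc ts) = map (\<lambda>v. T.obj_at (cs ! v) (map pt_of ts ! v)) [0..<length cs]"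
    proof (rule nth_equalityI)
      fix v assume "v < length (map F (map S.oc ts))"
      then have v: "v < length ts" by simp
      have "F (S.oc (ts ! v)) = T.obj_at (S.tcol (ts ! v)) (pt_of (ts ! v))" by (rule "3.IH"[OF nth_mem[OF v]])
      then show "map F (map S.oc ts) ! v = map (\<lambda>v. T.obj_at (cs ! v) (map pt_of ts ! v)) [0..<length cs] ! v"
        using v by (simp flip: cs)
    qed (simp add: len)
    also have "act_ob S.term_alg p \<dots> = T.obj_at c (plug (\<lambda>v. map pt_of ts ! v) t)"
      unfolding p
    proof (rule T.obj_plug[OF p'])
      fix v assume "v < length cs"
      then have v: "v < length ts" using len by simp
      show "typed I vcol (cs ! v) (map pt_of ts ! v)" using typed_pt_of[OF "3.hyps"(2)[OF nth_mem[OF v]]] v by (simp flip: cs)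
    qed
    finally show ?case using p by simp
  }
qed

text \<open>Induction over arrow terms. At \<open>AX p\<close> the image is itself the contraction
  of \<open>X_plug p\<close>, after which only an identity is left. At \<open>AOp\<close> the
  operands are contracted first, and functoriality of the action combines their naturality
  squares.\<close>

lemma contr_at_natural:
  assumes F: "algebra_morphism (pair_operad I) S.term_alg S.term_alg F F'"
    and e: "int_eq (pair_substitude I) (int_image F F' S.term_int_alg) T.split_alg"
  shows "S.awf f \<Longrightarrow> nform (inp (S.tcol (S.adom f))) (pt_of (S.adom f)) = nform (inp (S.tcol (S.adom f))) (pt_of (S.acod f)) \<and>
    Cmp S.term_cat (contr_at (S.tcol (S.adom f)) (pt_of (S.acod f))) (F' (S.ac f)) = contr_at (S.tcol (S.adom f)) (pt_of (S.adom f))"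
proof (induction rule: S.awf.induct)
  interpret F: algebra_morphism "pair_operad I" S.term_alg S.term_alg F F' by fact
  note Fo = split_ob[OF F e]
  note C = T.contract_in[OF typed_pt_of, simplified]
  have F': "F' (S.ac f) \<in> Ar S.term_cat" "Dom S.term_cat (F' (S.ac f)) = T.obj_at (S.tcol (S.adom f)) (pt_of (S.adom f))"
    "Cod S.term_cat (F' (S.ac f)) = T.obj_at (S.tcol (S.adom f)) (pt_of (S.acod f))" if "S.awf f" for f
    using F.ar_in[of "S.ac f"] F.Dom_ar[of "S.ac f"] F.Cod_ar[of "S.ac f"] Fo S.awf_dom_cod[OF that] that by simp_all
  {
    case (1 t)
    have "F' (S.ac (AId t)) = Ide S.term_cat (T.obj_at (S.tcol t) (pt_of t))"
      using F.ar_Ide[of "S.oc t"] Fo[OF 1] 1 by simp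
    then show ?case using T.Cmp_Ide[of "contr_at (S.tcol t) (pt_of t)"] C[OF 1] by simp
  next
    case (2 f g)
    have t: "S.tcol (S.adom g) = S.tcol (S.adom f)" using S.oeq_wf[OF "2.hyps"(3)] S.awf_dom_cod[OF "2.hyps"(1)] by simp
    have e': "pt_of (S.acod f) = pt_of (S.adom g)" by (rule pt_of_cong[OF "2.hyps"(3)])
    have "F' (S.ac (ACmp g f)) = Cmp S.term_cat (F' (S.ac g)) (F' (S.ac f))"
      using F.ar_Cmp[of "S.ac f" "S.ac g"] "2.hyps" S.oc_eq[OF "2.hyps"(3)] by simp
    then show ?case
      using "2.IH" T.Cmp_assoc[of "F' (S.ac f)" "F' (S.ac g)" "contr_at (S.tcol (S.adom g)) (pt_of (S.acod g))"]
        F'[OF "2.hyps"(1)] F'[OF "2.hyps"(2)] C[of "S.acod g"] S.awf_dom_cod[OF "2.hyps"(2)] t e' by simp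
  next
    case (3 p fs)
    obtain cs c t where p: "p = (cs, c, t)" by (cases p)
    have p': "(cs, c, t) \<in> ops (pair_operad I)" using "3.hyps"(1) p by simp
    have w: "S.awf (AOp p fs)" using "3.hyps" by (simp add: S.awf_AOp)
    have cs: "map (\<lambda>f. S.tcol (S.adom f)) fs = cs" using "3.hyps"(3) p by simp
    then have len: "length fs = length cs" by auto
    have csv: "S.tcol (S.adom (fs ! v)) = cs ! v" "S.awf (fs ! v)" if "v < length cs" for v
      using that len nth_map[of v fs "\<lambda>f. S.tcol (S.adom f)"] "3.hyps"(2)[OF nth_mem] unfolding cs by simp_all
    define d where "d v = pt_of (S.adom (fs ! v))" for v
    define d' where "d' v = pt_of (S.acod (fs ! v))" for v
    have d: "typed I vcol (cs ! v) (d v)" "typed I vcol (cs ! v) (d' v)" if "v < length cs" for v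
      using typed_pt_of[of "S.adom (fs ! v)"] typed_pt_of[of "S.acod (fs ! v)"] S.awf_dom_cod[OF csv(2)[OF that]] csv(1)[OF that]
      by (simp_all add: d_def d'_def)
    let ?s = "plug_ctr (\<lambda>v. contract (d v)) t" and ?s' = "plug_ctr (\<lambda>v. contract (d' v)) t"
    have da: "\<forall>v < length cs. typed I vcol (cs ! v) (d v)" "\<forall>v < length cs. typed I vcol (cs ! v) (d' v)" using d by blast+
    note i = T.plug_contract[OF p' da(1)] and i' = T.plug_contract[OF p' da(2)]
    have IH: "nform (inp (cs ! v)) (d v) = nform (inp (cs ! v)) (d' v)"
      "Cmp S.term_cat (contr_at (cs ! v) (d' v)) (F' (S.ac (fs ! v))) = contr_at (cs ! v) (d v)" if v: "v < length cs" for v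
      using "3.IH"[of "fs ! v"] csv(1)[OF v] v len by (simp_all add: d_def d'_def)
    \<comment> \<open>Once the operands are contracted, both ends of the arrow have become the same
      tree, and one common contraction finishes.\<close>
    have t: "tgt (inp c) ?s = tgt (inp c) ?s'"
      unfolding i(3) i'(3) by (rule plug_cong) (use IH(1) pair_opD(6)[OF p'] in simp)
    let ?g = "map F' (map S.ac fs)" and ?c = "map (\<lambda>v. contr_at (cs ! v) (d' v)) [0..<length cs]"
    have g: "map2 (Cmp S.term_cat) ?c ?g = map (\<lambda>v. contr_at (cs ! v) (d v)) [0..<length cs]"
      using IH(2) len by (auto intro!: nth_equalityI)
    have cd: "contr_at (cs ! v) (d' v) \<in> Ar S.term_cat" "Dom S.term_cat (contr_at (cs ! v) (d' v)) = T.obj_at (cs ! v) (d' v)" if "v < length cs" for v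
      using T.contract_in[OF d(2)[OF that]] by simp_all
    have gv: "F' (S.ac (fs ! v)) \<in> Ar S.term_cat" "Dom S.term_cat (F' (S.ac (fs ! v))) = T.obj_at (cs ! v) (d v)"
      "Cod S.term_cat (F' (S.ac (fs ! v))) = T.obj_at (cs ! v) (d' v)" if "v < length cs" for v
      using F'[OF csv(2)[OF that]] csv(1)[OF that] by (simp_all add: d_def d'_def)
    have F'p: "F' (S.ac (AOp p fs)) = act_ar S.term_alg p ?g"
      using F.ar_act[of p "map S.ac fs"] S.ar_args_T[of p "map S.ac fs"] S.act_ar_T[OF w] "3.hyps"(1) w by auto
    have "T.arr_at c ?s = act_ar S.term_alg p (map2 (Cmp S.term_cat) ?c ?g)" unfolding i(4) g p ..
    also have "\<dots> = Cmp S.term_cat (act_ar S.term_alg p ?c) (act_ar S.term_alg p ?g)"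
    proof (rule T.act_ar_Cmp[simplified])
      show "p \<in> ops (pair_operad I)" using p p' by simp
      show "ar_args (pair_operad I) S.term_alg p ?g"
        using gv T.obj_at_in[OF d(1)] len p by (auto simp: ar_args_def in_set_conv_nth intro!: nth_equalityI)
      show "ar_args (pair_operad I) S.term_alg p ?c"
        using cd T.obj_at_in[OF d(2)] len p by (auto simp: ar_args_def in_set_conv_nth intro!: nth_equalityI)
      show "map (Cod S.term_cat) ?g = map (Dom S.term_cat) ?c"
        using gv cd len by (auto intro!: nth_equalityI)
    qed
    also have "act_ar S.term_alg p ?c = T.arr_at c ?s'" unfolding i'(4) p ..
    finally have s: "T.arr_at c ?s = Cmp S.term_cat (T.arr_at c ?s') (F' (S.ac (AOp p fs)))" unfolding F'p .
    have ed: "pt_of (S.adom (AOp p fs)) = plug d t" "pt_of (S.acod (AOp p fs)) = plug d' t"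
      unfolding S.adom.simps S.acod.simps pt_of.simps p snd_conv
      by (rule plug_cong; use pair_opD(6)[OF p'] len in \<open>simp add: d_def d'_def\<close>)+
    have td: "typed I vcol c (plug d' t)" "typed I vcol c (plug d t)"
      using typed_plug[OF p', of vcol d'] typed_plug[OF p', of vcol d] d by simp_all
    have tt: "typed I vcol c (tgt (inp c) ?s')" by (rule ctyped_tgt[OF i'(1)])
    have tc: "S.tcol (S.adom (AOp p fs)) = c" by (simp add: p)
    have "Cmp S.term_cat (contr_at c (plug d' t)) (F' (S.ac (AOp p fs)))
      = Cmp S.term_cat (Cmp S.term_cat (contr_at c (tgt (inp c) ?s')) (T.arr_at c ?s')) (F' (S.ac (AOp p fs)))"
      using i'(5) by simp
    also have "\<dots> = Cmp S.term_cat (contr_at c (tgt (inp c) ?s')) (T.arr_at c ?s)"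
      unfolding s using T.Cmp_assoc[of "F' (S.ac (AOp p fs))" "T.arr_at c ?s'" "contr_at c (tgt (inp c) ?s')"]
        F'[OF w] T.arr_at_in[OF i'(1)] T.contract_in[OF tt] i'(2) ed tc by simp
    also have "\<dots> = contr_at c (plug d t)" using i(5) t by simp
    finally show ?case using ed tc i(6) i'(6) t by simp
  next
    case (4 p)
    obtain cs c t where p: "p = (cs, c, t)" by (cases p)
    have p': "(cs, c, t) \<in> ops (pair_operad I)" using 4 p by simp
    have ed: "pt_of (S.adom (AX p)) = X_plug (cs, c, t)"
      unfolding p X_plug_simp S.adom.simps pt_of.simps snd_conv
      by (rule plug_cong) (use pair_opD(6)[OF p'] in simp)
    have X: "F' (S.ac (AX p)) = contr_at c (X_plug (cs, c, t))"
      using e 4 p by (auto simp: int_eq_def int_image_def term_int_sel simp del: X_plug_simp)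
    have c: "c \<in> PBq I <+> PBq I" by (rule op_colours(2)[OF p'])
    have "nform (inp c) (X_pt c) = X_pt c"
      using nform_X_plug[OF pair_unit_in[OF c, unfolded pair_sel]] X_plug_unit[OF c] by simp
    moreover have "Cmp S.term_cat (contr_at c (X_pt c)) (contr_at c (X_plug (cs, c, t))) = contr_at c (X_plug (cs, c, t))"
      using T.contract_X_pt[OF c] T.Ide_Cmp[of "contr_at c (X_plug (cs, c, t))"] T.contract_in[OF typed_X_plug[OF p']] nform_X_plug[OF p']
      by (simp del: X_plug_simp)
    ultimately show ?case using ed X nform_X_plug[OF p'] p by (simp del: X_plug_simp)
  next
    case (5 u)
    then have u: "u \<in> PBq I <+> PBq I" by (simp add: discrete_cat_def)
    have "pt_of (TOp (unit_op (pair_operad I) u) [TK u]) = K_pt u"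
      using plug_unit[of "K_pt u" "val u" "\<lambda>v. [K_pt u] ! v"] typed_K_pt[OF u] by (simp add: typed_def)
    moreover have "F' (S.ac (AK u)) = Ide S.term_cat (T.obj_at u (K_pt u))"
    proof -
      \<comment> \<open>The endofunctor fixes \<open>K\<close>, and the structure arrow of
        \<open>K\<close> at \<open>u\<close> is an identity as the base category is
        discrete.\<close>
      have "F' (S.ac (AK u)) = S.ac (AK u)"
        using e 5 by (auto simp: int_eq_def int_image_def term_int_sel)
      also have "\<dots> = Ide S.term_cat (S.oc (TK u))"
        using T.K_ar_Ide[of u] u by (simp add: term_int_sel discrete_cat_def)
      also have "S.oc (TK u) = F (S.oc (TK u))"
        using e u by (auto simp: int_eq_def int_image_def term_int_sel)
      finally show ?thesis using Fo[of "TK u"] u by simp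
    qed
    ultimately show ?case using T.Cmp_Ide[of "contr_at u (K_pt u)"] T.contract_in[OF typed_K_pt[OF u]]
      by (simp add: discrete_cat_def)
  }
qed

theorem trivial_automorphisms_term: "trivial_automorphisms (Pi1 S.term_cat)"
proof -
  have T: "categorical_algebra (pair_operad I) S.term_alg" using S.categorical_algebra_T by simp
  have univ: "universal_for (pair_substitude I) S.term_alg S.term_int_alg S.term_alg"
    using S.term_alg_universal[of S.term_alg] T by simp
  obtain F F' where F: "algebra_morphism (pair_operad I) S.term_alg S.term_alg F F'"
    and e: "int_eq (pair_substitude I) (int_image F F' S.term_int_alg) T.split_alg"
    using universal_for_morphism[OF univ T.internal_split] by (metis pair_substitude_simps(1))
  interpret F: algebra_morphism "pair_operad I" S.term_alg S.term_alg F F' by (rule F)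
  \<comment> \<open>The internal algebra of the term classifier is its own image under the identity
    morphism, so \<open>merge\<close> lifts to a 2-cell from the endofunctor to the
    identity.\<close>
  have m: "internal_morphism (pair_substitude I) S.term_alg (int_image F F' S.term_int_alg)
      (int_image (\<lambda>x. x) (\<lambda>f. f) S.term_int_alg) T.merge (\<lambda>c. Ide S.term_cat (K_ob S.term_int_alg c))"
    by (rule internal_morphism_cong[OF _ _ T.internal_merge[simplified] substitude_pair])
      (use e in \<open>simp_all add: int_eq_def int_image_def\<close>)
  obtain b where "algebra_2cell (pair_operad I) S.term_alg S.term_alg F F' (\<lambda>x. x) (\<lambda>f. f) b"
    using universal_for_2cell[OF univ _ _ m] F algebra_morphism_id[of "pair_operad I" S.term_alg]
    by (metis pair_substitude_simps(1))
  then interpret b: algebra_2cell "pair_operad I" S.term_alg S.term_alg F F' "\<lambda>x. x" "\<lambda>f. f" b .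
  \<comment> \<open>The choice of a representative is harmless because \<open>pt_of\<close> respects
    the congruence on object terms.\<close>
  define k where "k x = contr_at (S.tcol (rep x)) (pt_of (rep x))" for x
  have k: "k (S.oc t) = contr_at (S.tcol t) (pt_of t)" if "S.owf t" for t
    using S.oeq_rep[OF that] pt_of_cong S.oeq_wf by (fastforce simp: k_def)
  have C: "k (S.oc t) \<in> Ar S.term_cat \<and> Dom S.term_cat (k (S.oc t)) = F (S.oc t) \<and>
      Cod S.term_cat (k (S.oc t)) = T.obj_at (S.tcol t) (nform (inp (S.tcol t)) (pt_of t))" if "S.owf t" for t
    using T.contract_in[OF typed_pt_of[OF that]] split_ob[OF F e that] k[OF that] by simp
  show ?thesis
  proof (rule T.trivial_automorphismsI[simplified, where h = "\<lambda>x. [Bwd (b x), Fwd (k x)]" and n = "\<lambda>x. Cod S.term_cat (k x)"])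
    fix x assume x: "x \<in> Ob S.term_cat"
    then obtain t where t: "x = S.oc t" "S.owf t" by (auto simp: S.Ob_T)
    have "zigzag S.term_cat (Dom S.term_cat (b x)) [Fwd (k x)] (Cod S.term_cat (k x))"
      using T.zigzag_single(1)[of "k x"] C[OF t(2)] t(1) b.Dom_component[of x] x by simp
    then show "zigzag S.term_cat x [Bwd (b x), Fwd (k x)] (Cod S.term_cat (k x))"
      using zigzag.Bwd[of "b x" S.term_cat] b.component_in[of x] b.Cod_component[of x] x by simp
  next
    fix g assume g: "g \<in> Ar S.term_cat"
    then obtain f where f: "g = S.ac f" "S.awf f" by (auto simp: S.Ar_T)
    note w = S.awf_dom_cod[OF f(2)]
    have D: "Dom S.term_cat g = S.oc (S.adom f)" "Cod S.term_cat g = S.oc (S.acod f)" using f by simp_all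
    note nat = contr_at_natural[OF F e f(2)]
    show n: "Cod S.term_cat (k (Dom S.term_cat g)) = Cod S.term_cat (k (Cod S.term_cat g))"
      using C[of "S.adom f"] C[of "S.acod f"] w nat D by simp
    have kc: "Cmp S.term_cat (k (Cod S.term_cat g)) (F' g) = k (Dom S.term_cat g)"
      using nat k[of "S.adom f"] k[of "S.acod f"] w D f(1) by simp
    \<comment> \<open>Naturality of \<open>b\<close> turns the step \<open>g\<close> into its image
      under the endofunctor, and there \<open>kc\<close> absorbs it into the contraction.\<close>
    have "homotopic S.term_cat (Dom S.term_cat g) (Cod S.term_cat (k (Cod S.term_cat g)))
        [Fwd g, Bwd (b (Cod S.term_cat g)), Fwd (k (Cod S.term_cat g))]
        [Bwd (b (Dom S.term_cat g)), Fwd (Cmp S.term_cat (k (Cod S.term_cat g)) (F' g))]"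
    proof (rule T.homotopic_square[simplified])
      have o: "Dom S.term_cat g \<in> Ob S.term_cat" "Cod S.term_cat g \<in> Ob S.term_cat" using w D by simp_all
      show "g \<in> Ar S.term_cat" by fact
      show "b (Dom S.term_cat g) \<in> Ar S.term_cat" "b (Cod S.term_cat g) \<in> Ar S.term_cat" using b.component_in o by simp_all
      show "F' g \<in> Ar S.term_cat" using F.ar_in g by simp
      show "k (Cod S.term_cat g) \<in> Ar S.term_cat" using C[of "S.acod f"] w D by simp
      show "Dom S.term_cat g = Cod S.term_cat (b (Dom S.term_cat g))" using b.Cod_component o by simp
      show "Dom S.term_cat (F' g) = Dom S.term_cat (b (Dom S.term_cat g))" using F.Dom_ar b.Dom_component o g by simp
      show "Cod S.term_cat (F' g) = Dom S.term_cat (b (Cod S.term_cat g))" using F.Cod_ar b.Dom_component o g by simp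
      show "Cod S.term_cat (b (Cod S.term_cat g)) = Cod S.term_cat g" using b.Cod_component o by simp
      show "Dom S.term_cat (k (Cod S.term_cat g)) = Cod S.term_cat (F' g)" using C[of "S.acod f"] w D F.Cod_ar g by simp
      show "Cmp S.term_cat g (b (Dom S.term_cat g)) = Cmp S.term_cat (b (Cod S.term_cat g)) (F' g)"
        using b.natural g by simp
    qed
    then show "homotopic S.term_cat (Dom S.term_cat g) (Cod S.term_cat (k (Dom S.term_cat g)))
        (Fwd g # [Bwd (b (Cod S.term_cat g)), Fwd (k (Cod S.term_cat g))]) [Bwd (b (Dom S.term_cat g)), Fwd (k (Dom S.term_cat g))]"
      unfolding kc n by simp
  qed
qed

end

theorem proposition4p24:
  fixes I :: "'i set"
  shows "quasi_tame (pair_substitude I)"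
proof -
  interpret S: substitude "pair_substitude I" by (rule substitude_pair)
  show ?thesis unfolding quasi_tame_def
    using S.term_alg_classifier S.classifier_retract[OF _ trivial_automorphisms_term] by blast
qed

end
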